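(* Let $K$ be a field, $A=KQ/I$ a finite-dimensional $K$-algebra given by a finite quiver $Q$ and an admissible ideal $I$, and let $k$ be a vertex of $Q$ without loops. Let $L_k$, $R_k$, $T^-_k$, $T^+_k$ be the complexes of projective $A$-modules attached to $k$ (defined in the context). Then: (a) $T^-_k$ is a tilting complex if and only if $\operatorname{Hom}_{\mathcal{D}^b(A)}(P_i, L_k[-1])=0$ for all vertices $i\neq k$. (b) $T^-_k$ is isomorphic in $\mathcal{D}^b(A)$ to a tilting module if and only if $\operatorname{Hom}_{\mathcal{D}^b(A)}(P_i, L_k[-1])=0$ for all vertices $i$ (including $i=k$). (c) $T^+_k$ is a tilting complex if and only if $\operatorname{Hom}_{\mathcal{D}^b(A)}(R_k[1], P_i)=0$ for all vertices $i\neq k$. (d) $T^+_k$ is never isomorphic in $\mathcal{D}^b(A)$ to a tilting module.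
   Context: For an arrow $\alpha$ of $Q$, $s(\alpha)$ and $t(\alpha)$ denote its start and end vertices; paths compose left to right, i.e. $\alpha\beta$ is defined if $t(\alpha)=s(\beta)$. Modules are finite-dimensional right $A$-modules, and $\mathcal{D}^b(A)$ is the bounded derived category of $\operatorname{mod} A$. For a vertex $i$, $S_i$ is the simple module at $i$ and $P_i$ its projective cover, spanned by the (non-zero) paths starting at $i$. An arrow $\alpha$ induces a map $P_{t(\alpha)}\xrightarrow{\alpha}P_{s(\alpha)}$ (left multiplication by $\alpha$). For a vertex $k$ without loops, let $f=(\alpha)_\alpha\colon P_k\to\bigoplus_{\alpha:\,t(\alpha)=k}P_{s(\alpha)}$ be induced by the arrows ending at $k$, and $g=(\beta)_\beta\colon\bigoplus_{\beta:\,s(\beta)=k}P_{t(\beta)}\to P_k$ be induced by the arrows starting at $k$. Then $L_k$ is the two-term complex $P_k\xrightarrow{f}\bigoplus_{\alpha:\,t(\alpha)=k}P_{s(\alpha)}$ with $P_k$ in degree $-1$, and $R_k$ is the two-term complex $\bigoplus_{\beta:\,s(\beta)=k}P_{t(\beta)}\xrightarrow{g}P_k$ with $P_k$ in degree $1$. Set $$T^-_k=L_k\oplus\bigoplus_{i\neq k}P_i,\qquad T^+_k=R_k\oplus\bigoplus_{i\neq k}P_i .$$ A tilting complex is a bounded complex $T$ of finitely generated projective modules with $\operatorname{Hom}_{\mathcal{D}^b(A)}(T,T[r])=0$ for all $r\neq 0$ whose direct summands generate the category $\operatorname{per}A$ of perfect complexes as a triangulated category. A tilting module is a module which, viewed as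 a complex concentrated in degree $0$, is isomorphic in $\mathcal{D}^b(A)$ to a tilting complex. *)

theory Defs
  imports "HOL-Algebra.QuotRing" "HOL-Algebra.Module" "Graph_Theory.Arc_Walk"
begin

section \<open>Bound quiver algebras\<close>

text \<open>
  A finite quiver is a \<^locale>\<open>fin_digraph\<close>, with \<^term>\<open>tail Q \<alpha>\<close> in the role of
  $s(\alpha)$ and \<^term>\<open>head Q \<alpha>\<close> in that of $t(\alpha)$. A path is its start vertex together
  with its list of arrows, read from left to right; \<^term>\<open>(v, [])\<close> is the trivial path at
  \<^term>\<open>v\<close>. The base field is a type of class \<^class>\<open>field\<close>.
\<close>

type_synonym ('v, 'a) qpath = "'v \<times> 'a list"

definition qpaths :: "('v, 'a) pre_digraph \<Rightarrow> ('v, 'a) qpath set" where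
  "qpaths Q = {(u, p). \<exists>v. pre_digraph.awalk Q u p v}"

definition path_fun :: "('v, 'a) qpath \<Rightarrow> ('v, 'a) qpath \<Rightarrow> 'k::field" where
  "path_fun p = (\<lambda>q. if q = p then 1 else 0)"

text \<open>
  The path algebra $KQ$ consists of the finitely supported functions on paths. In the product the
  sum runs over all ways to cut a path in two. A $K$-algebra is a \<^typ>\<open>('k, 'r) module\<close> record,
  \<^const>\<open>smult\<close> being the action of $K$.
\<close>

definition path_algebra ::
    "('v, 'a) pre_digraph \<Rightarrow> ('k::field, ('v, 'a) qpath \<Rightarrow> 'k) module" where
  "path_algebra Q =
    \<lparr> carrier = {f. finite {p. f p \<noteq> 0} \<and> {p. f p \<noteq> 0} \<subseteq> qpaths Q},
      mult = (\<lambda>f g (v, p). \<Sum>n\<le>length p.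
                f (v, take n p) * g (pre_digraph.awlast Q v (take n p), drop n p)),
      one = (\<lambda>p. if p \<in> verts Q \<times> {[]} then 1 else 0),
      zero = (\<lambda>p. 0),
      add = (\<lambda>f g p. f p + g p),
      smult = (\<lambda>c f p. c * f p) \<rparr>"

text \<open>
  The \<open>m\<close>-th power of the arrow ideal is spanned by the paths of length at least \<open>m\<close>.
\<close>

definition arrow_ideal_power ::
    "('v, 'a) pre_digraph \<Rightarrow> nat \<Rightarrow> (('v, 'a) qpath \<Rightarrow> 'k::field) set" where
  "arrow_ideal_power Q m =
    {f \<in> carrier (path_algebra Q). \<forall>p. f p \<noteq> 0 \<longrightarrow> m \<le> length (snd p)}"

definition admissible_ideal ::
    "('v, 'a) pre_digraph \<Rightarrow> (('v, 'a) qpath \<Rightarrow> 'k::field) set \<Rightarrow> bool" where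
  "admissible_ideal Q I \<longleftrightarrow> ideal I (path_algebra Q) \<and>
     (\<exists>m\<ge>2. arrow_ideal_power Q m \<subseteq> I) \<and> I \<subseteq> arrow_ideal_power Q 2"

text \<open>
  $KQ/I$. The scalar \<open>c\<close> sends the coset of \<open>x\<close> to the coset of \<open>c x\<close>; adding \<open>I\<close> is needed for
  \<open>c = 0\<close>.
\<close>

definition quiver_algebra ::
    "('v, 'a) pre_digraph \<Rightarrow> (('v, 'a) qpath \<Rightarrow> 'k::field) set
      \<Rightarrow> ('k, (('v, 'a) qpath \<Rightarrow> 'k) set) module" where
  "quiver_algebra Q I = ring.extend (path_algebra Q Quot I)
     (module.fields (\<lambda>c X. I <+>\<^bsub>path_algebra Q\<^esub> ((\<lambda>f. c \<odot>\<^bsub>path_algebra Q\<^esub> f) ` X)))"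

definition path_class ::
    "('v, 'a) pre_digraph \<Rightarrow> (('v, 'a) qpath \<Rightarrow> 'k::field) set \<Rightarrow> ('v, 'a) qpath
      \<Rightarrow> (('v, 'a) qpath \<Rightarrow> 'k) set" where
  "path_class Q I p = I +>\<^bsub>path_algebra Q\<^esub> path_fun p"

section \<open>Finite-dimensional right modules\<close>

text \<open>
  Modules are \<^typ>\<open>('r, 'm) module\<close> records, of which \<^const>\<open>mult\<close> and \<^const>\<open>one\<close> are ignored.
  The term \<open>a \<odot>\<^bsub>M\<^esub> x\<close> stands for the right action $x \cdot a$, whence the order of the factors in
  \<open>act_mult\<close>.
\<close>

locale right_module = A?: ring A + M?: abelian_group M
  for A (structure) and M :: "('r, 'm) module" (structure) +
  assumes act_closed: "\<lbrakk>a \<in> carrier A; x \<in> carrier M\<rbrakk> \<Longrightarrow> a \<odot>\<^bsub>M\<^esub> x \<in> carrier M"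
    and act_add_left: "\<lbrakk>a \<in> carrier A; b \<in> carrier A; x \<in> carrier M\<rbrakk>
      \<Longrightarrow> (a \<oplus>\<^bsub>A\<^esub> b) \<odot>\<^bsub>M\<^esub> x = a \<odot>\<^bsub>M\<^esub> x \<oplus>\<^bsub>M\<^esub> b \<odot>\<^bsub>M\<^esub> x"
    and act_add_right: "\<lbrakk>a \<in> carrier A; x \<in> carrier M; y \<in> carrier M\<rbrakk>
      \<Longrightarrow> a \<odot>\<^bsub>M\<^esub> (x \<oplus>\<^bsub>M\<^esub> y) = a \<odot>\<^bsub>M\<^esub> x \<oplus>\<^bsub>M\<^esub> a \<odot>\<^bsub>M\<^esub> y"
    and act_mult: "\<lbrakk>a \<in> carrier A; b \<in> carrier A; x \<in> carrier M\<rbrakk>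
      \<Longrightarrow> (a \<otimes>\<^bsub>A\<^esub> b) \<odot>\<^bsub>M\<^esub> x = b \<odot>\<^bsub>M\<^esub> (a \<odot>\<^bsub>M\<^esub> x)"
    and act_one: "x \<in> carrier M \<Longrightarrow> \<one>\<^bsub>A\<^esub> \<odot>\<^bsub>M\<^esub> x = x"

definition fd_module :: "('k, 'r) module \<Rightarrow> ('r, 'm) module \<Rightarrow> bool" where
  "fd_module A M \<longleftrightarrow> right_module A M \<and>
     (\<exists>B. finite B \<and> B \<subseteq> carrier M \<and>
       (\<forall>x\<in>carrier M. \<exists>c. x = (\<Oplus>\<^bsub>M\<^esub>b\<in>B. (c b \<odot>\<^bsub>A\<^esub> \<one>\<^bsub>A\<^esub>) \<odot>\<^bsub>M\<^esub> b)))"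

definition mod_hom ::
    "('k, 'r) module \<Rightarrow> ('r, 'm) module \<Rightarrow> ('r, 'n) module \<Rightarrow> ('m \<Rightarrow> 'n) set" where
  "mod_hom A M N = {h \<in> carrier M \<rightarrow> carrier N.
     (\<forall>x\<in>carrier M. \<forall>y\<in>carrier M. h (x \<oplus>\<^bsub>M\<^esub> y) = h x \<oplus>\<^bsub>N\<^esub> h y) \<and>
     (\<forall>a\<in>carrier A. \<forall>x\<in>carrier M. h (a \<odot>\<^bsub>M\<^esub> x) = a \<odot>\<^bsub>N\<^esub> h x)}"

definition zero_sub :: "('r, 'm) module \<Rightarrow> ('r, 'm) module" where
  "zero_sub M = M\<lparr>carrier := {\<zero>\<^bsub>M\<^esub>}\<rparr>"

definition pair_mod ::
    "('r, 'm) module \<Rightarrow> ('r, 'n) module \<Rightarrow> ('r, 'm \<times> 'n) module" where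
  "pair_mod M N =
    \<lparr> carrier = carrier M \<times> carrier N,
      mult = undefined, one = undefined,
      zero = (\<zero>\<^bsub>M\<^esub>, \<zero>\<^bsub>N\<^esub>),
      add = (\<lambda>(x, y) (x', y'). (x \<oplus>\<^bsub>M\<^esub> x', y \<oplus>\<^bsub>N\<^esub> y')),
      smult = (\<lambda>a (x, y). (a \<odot>\<^bsub>M\<^esub> x, a \<odot>\<^bsub>N\<^esub> y)) \<rparr>"

text \<open>Direct sum of a family; only used for finite \<open>J\<close>.\<close>

definition dsum_mod :: "'j set \<Rightarrow> ('j \<Rightarrow> ('r, 'm) module) \<Rightarrow> ('r, 'j \<Rightarrow> 'm) module" where
  "dsum_mod J M =
    \<lparr> carrier = (\<Pi>\<^sub>E j\<in>J. carrier (M j)),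
      mult = undefined, one = undefined,
      zero = (\<lambda>j\<in>J. \<zero>\<^bsub>M j\<^esub>),
      add = (\<lambda>x y. \<lambda>j\<in>J. x j \<oplus>\<^bsub>M j\<^esub> y j),
      smult = (\<lambda>a x. \<lambda>j\<in>J. a \<odot>\<^bsub>M j\<^esub> x j) \<rparr>"

text \<open>The right ideal $eA$.\<close>

definition right_ideal_mod :: "('k, 'r) module \<Rightarrow> 'r \<Rightarrow> ('r, 'r) module" where
  "right_ideal_mod A e =
    \<lparr> carrier = (\<lambda>x. e \<otimes>\<^bsub>A\<^esub> x) ` carrier A,
      mult = undefined, one = undefined,
      zero = \<zero>\<^bsub>A\<^esub>, add = add A, smult = (\<lambda>a x. x \<otimes>\<^bsub>A\<^esub> a) \<rparr>"

text \<open>Finitely generated projective: a direct summand of some $A^n$.\<close>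

definition fg_projective :: "('k, 'r) module \<Rightarrow> ('r, 'm) module \<Rightarrow> bool" where
  "fg_projective A M \<longleftrightarrow> right_module A M \<and>
     (\<exists>n::nat. let F = dsum_mod {..<n} (\<lambda>_. right_ideal_mod A \<one>\<^bsub>A\<^esub>) in
        \<exists>i\<in>mod_hom A M F. \<exists>p\<in>mod_hom A F M. \<forall>x\<in>carrier M. p (i x) = x)"

section \<open>Complexes\<close>

text \<open>Cohomologically graded; \<open>diff X n\<close> goes from degree \<open>n\<close> to degree \<open>n + 1\<close>.\<close>

record ('r, 'm) cpx =
  obj :: "int \<Rightarrow> ('r, 'm) module"
  diff :: "int \<Rightarrow> 'm \<Rightarrow> 'm"

definition bounded_complex :: "('k, 'r) module \<Rightarrow> ('r, 'm) cpx \<Rightarrow> bool" where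
  "bounded_complex A X \<longleftrightarrow>
     (\<forall>n. fd_module A (obj X n)) \<and>
     (\<forall>n. diff X n \<in> mod_hom A (obj X n) (obj X (n + 1))) \<and>
     (\<forall>n. \<forall>x\<in>carrier (obj X n). diff X (n + 1) (diff X n x) = \<zero>\<^bsub>obj X (n + 1 + 1)\<^esub>) \<and>
     (\<exists>N. \<forall>n. \<bar>n\<bar> > N \<longrightarrow> carrier (obj X n) = {\<zero>\<^bsub>obj X n\<^esub>})"

definition chain_map ::
    "('k, 'r) module \<Rightarrow> ('r, 'm) cpx \<Rightarrow> ('r, 'n) cpx \<Rightarrow> (int \<Rightarrow> 'm \<Rightarrow> 'n) \<Rightarrow> bool" where
  "chain_map A X Y f \<longleftrightarrow>
     (\<forall>n. f n \<in> mod_hom A (obj X n) (obj Y n)) \<and>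
     (\<forall>n. \<forall>x\<in>carrier (obj X n). f (n + 1) (diff X n x) = diff Y n (f n x))"

definition homotopic ::
    "('k, 'r) module \<Rightarrow> ('r, 'm) cpx \<Rightarrow> ('r, 'n) cpx
      \<Rightarrow> (int \<Rightarrow> 'm \<Rightarrow> 'n) \<Rightarrow> (int \<Rightarrow> 'm \<Rightarrow> 'n) \<Rightarrow> bool" where
  "homotopic A X Y f g \<longleftrightarrow>
     (\<exists>h. (\<forall>n. h n \<in> mod_hom A (obj X n) (obj Y (n - 1))) \<and>
       (\<forall>n. \<forall>x\<in>carrier (obj X n).
          f n x = g n x \<oplus>\<^bsub>obj Y n\<^esub> (diff Y (n - 1) (h n x) \<oplus>\<^bsub>obj Y n\<^esub> h (n + 1) (diff X n x))))"

definition cocycles :: "('r, 'm) cpx \<Rightarrow> int \<Rightarrow> 'm set" where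
  "cocycles X n = {x \<in> carrier (obj X n). diff X n x = \<zero>\<^bsub>obj X (n + 1)\<^esub>}"

definition coboundaries :: "('r, 'm) cpx \<Rightarrow> int \<Rightarrow> 'm set" where
  "coboundaries X n = diff X (n - 1) ` carrier (obj X (n - 1))"

definition cohomology :: "('r, 'm) cpx \<Rightarrow> int \<Rightarrow> 'm set set" where
  "cohomology X n = (\<lambda>z. coboundaries X n +>\<^bsub>obj X n\<^esub> z) ` cocycles X n"

text \<open>
  A chain map \<open>f\<close> sends the class \<open>C\<close> of \<open>z\<close> to the class of \<open>f z\<close>, which is \<open>f C\<close> plus the
  coboundaries.
\<close>

definition quasi_iso ::
    "('k, 'r) module \<Rightarrow> ('r, 'm) cpx \<Rightarrow> ('r, 'n) cpx \<Rightarrow> (int \<Rightarrow> 'm \<Rightarrow> 'n) \<Rightarrow> bool" where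
  "quasi_iso A X Y f \<longleftrightarrow> chain_map A X Y f \<and>
     (\<forall>n. bij_betw (\<lambda>C. coboundaries Y n <+>\<^bsub>obj Y n\<^esub> (f n ` C))
            (cohomology X n) (cohomology Y n))"

definition shift :: "int \<Rightarrow> ('r, 'm) cpx \<Rightarrow> ('r, 'm) cpx" where
  "shift r X =
    \<lparr> obj = (\<lambda>n. obj X (n + r)),
      diff = (\<lambda>n x. if even r then diff X (n + r) x
                    else \<ominus>\<^bsub>obj X (n + 1 + r)\<^esub> diff X (n + r) x) \<rparr>"

definition mapping_cone ::
    "('r, 'm) cpx \<Rightarrow> ('r, 'n) cpx \<Rightarrow> (int \<Rightarrow> 'm \<Rightarrow> 'n) \<Rightarrow> ('r, 'm \<times> 'n) cpx" where
  "mapping_cone X Y f =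
    \<lparr> obj = (\<lambda>n. pair_mod (obj X (n + 1)) (obj Y n)),
      diff = (\<lambda>n (x, y). (\<ominus>\<^bsub>obj X (n + 1 + 1)\<^esub> diff X (n + 1) x,
                          f (n + 1) x \<oplus>\<^bsub>obj Y (n + 1)\<^esub> diff Y n y)) \<rparr>"

definition pair_cpx :: "('r, 'm) cpx \<Rightarrow> ('r, 'n) cpx \<Rightarrow> ('r, 'm \<times> 'n) cpx" where
  "pair_cpx X Y =
    \<lparr> obj = (\<lambda>n. pair_mod (obj X n) (obj Y n)),
      diff = (\<lambda>n (x, y). (diff X n x, diff Y n y)) \<rparr>"

definition dsum_cpx :: "'j set \<Rightarrow> ('j \<Rightarrow> ('r, 'm) cpx) \<Rightarrow> ('r, 'j \<Rightarrow> 'm) cpx" where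
  "dsum_cpx J X =
    \<lparr> obj = (\<lambda>n. dsum_mod J (\<lambda>j. obj (X j) n)),
      diff = (\<lambda>n x. \<lambda>j\<in>J. diff (X j) n (x j)) \<rparr>"

text \<open>A module as a complex concentrated in degree 0.\<close>

definition stalk :: "('r, 'm) module \<Rightarrow> ('r, 'm) cpx" where
  "stalk M =
    \<lparr> obj = (\<lambda>n. if n = 0 then M else zero_sub M), diff = (\<lambda>n x. \<zero>\<^bsub>M\<^esub>) \<rparr>"

text \<open>The complex \<open>f : M \<rightarrow> N\<close> with \<open>M\<close> in degree \<open>d\<close> and \<open>N\<close> in degree \<open>d + 1\<close>.\<close>

definition two_term ::
    "int \<Rightarrow> ('r, 'm) module \<Rightarrow> ('r, 'm) module \<Rightarrow> ('m \<Rightarrow> 'm) \<Rightarrow> ('r, 'm) cpx" where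
  "two_term d M N f =
    (let ob = (\<lambda>n. if n = d then M else if n = d + 1 then N else zero_sub N)
     in \<lparr> obj = ob, diff = (\<lambda>n x. if n = d then f x else \<zero>\<^bsub>ob (n + 1)\<^esub>) \<rparr>)"

section \<open>The bounded derived category\<close>

text \<open>
  $\mathcal{D}^b(A)$ is the localization of the homotopy category of bounded complexes of
  finite-dimensional modules at the quasi-isomorphisms, described by left fractions:
  a morphism from \<open>X\<close> to \<open>Y\<close> is a class of roofs \<open>(Z, s, f)\<close> given by a quasi-isomorphism
  \<open>s : Z \<rightarrow> X\<close> and a chain map \<open>f : Z \<rightarrow> Y\<close>.

  HOL cannot quantify over all carrier types inside a definition. Every finite-dimensional module
  over a \<open>'k\<close>-algebra is isomorphic to one whose carrier is a set of elements of
  \<^typ>\<open>nat \<Rightarrow> 'k\<close> (the operations need not be the pointwise ones), so nothing is lost by taking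
  bound complexes and modules, such as the apex of a roof, over this type.
\<close>

type_synonym ('k, 'r) small_module = "('r, nat \<Rightarrow> 'k) module"

type_synonym ('k, 'r) small_cpx = "('r, nat \<Rightarrow> 'k) cpx"

type_synonym ('k, 'r, 'm, 'n) roof =
  "('k, 'r) small_cpx \<times> (int \<Rightarrow> (nat \<Rightarrow> 'k) \<Rightarrow> 'm) \<times> (int \<Rightarrow> (nat \<Rightarrow> 'k) \<Rightarrow> 'n)"

definition comp_maps :: "(int \<Rightarrow> 'n \<Rightarrow> 'p) \<Rightarrow> (int \<Rightarrow> 'm \<Rightarrow> 'n) \<Rightarrow> int \<Rightarrow> 'm \<Rightarrow> 'p" where
  "comp_maps g f = (\<lambda>n. g n \<circ> f n)"

definition roofs ::
    "('k, 'r) module \<Rightarrow> ('r, 'm) cpx \<Rightarrow> ('r, 'n) cpx \<Rightarrow> ('k, 'r, 'm, 'n) roof set" where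
  "roofs A X Y = {(Z, s, f). bounded_complex A Z \<and> quasi_iso A Z X s \<and> chain_map A Z Y f}"

definition roof_rel ::
    "('k, 'r) module \<Rightarrow> ('r, 'm) cpx \<Rightarrow> ('r, 'n) cpx \<Rightarrow> ('k, 'r, 'm, 'n) roof rel" where
  "roof_rel A X Y =
    {((Z, s, f), (Z', s', f')).
       (Z, s, f) \<in> roofs A X Y \<and> (Z', s', f') \<in> roofs A X Y \<and>
       (\<exists>(W :: ('k, 'r) small_cpx) u v. bounded_complex A W \<and>
          chain_map A W Z u \<and> chain_map A W Z' v \<and>
          quasi_iso A W X (comp_maps s u) \<and>
          homotopic A W X (comp_maps s u) (comp_maps s' v) \<and>
          homotopic A W Y (comp_maps f u) (comp_maps f' v))}"

definition Db_hom ::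
    "('k, 'r) module \<Rightarrow> ('r, 'm) cpx \<Rightarrow> ('r, 'n) cpx \<Rightarrow> ('k, 'r, 'm, 'n) roof set set" where
  "Db_hom A X Y = roofs A X Y // roof_rel A X Y"

definition Db_zero ::
    "('k, 'r) module \<Rightarrow> ('r, 'm) cpx \<Rightarrow> ('r, 'n) cpx \<Rightarrow> ('k, 'r, 'm, 'n) roof set" where
  "Db_zero A X Y = roof_rel A X Y `` {(Z, s, f) | Z s f. f = (\<lambda>n x. \<zero>\<^bsub>obj Y n\<^esub>)}"

text \<open>The identity of \<open>X\<close> is the common class of all roofs \<open>(Z, s, s)\<close>.\<close>

definition Db_id ::
    "('k, 'r) module \<Rightarrow> ('r, 'm) cpx \<Rightarrow> ('k, 'r, 'm, 'm) roof set" where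
  "Db_id A X = roof_rel A X X `` {(Z, s, s) | Z s. True}"

text \<open>
  The composite of \<open>F\<close> from \<open>X\<close> to \<open>Y\<close> and \<open>G\<close> from \<open>Y\<close> to \<open>V\<close>: representatives \<open>(Z, s, f)\<close> and
  \<open>(Z', t, g)\<close> are completed by a quasi-isomorphism \<open>u : W \<rightarrow> Z\<close> and a chain map \<open>w : W \<rightarrow> Z'\<close> to a
  square that commutes up to homotopy.
\<close>

definition Db_comp ::
    "('k, 'r) module \<Rightarrow> ('r, 'm) cpx \<Rightarrow> ('r, 'n) cpx \<Rightarrow> ('r, 'p) cpx
      \<Rightarrow> ('k, 'r, 'm, 'n) roof set \<Rightarrow> ('k, 'r, 'n, 'p) roof set \<Rightarrow> ('k, 'r, 'm, 'p) roof set" where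
  "Db_comp A X Y V F G = roof_rel A X V ``
    {(W, comp_maps s u, comp_maps g w) | W s u g w.
       \<exists>Z Z' f t. (Z, s, f) \<in> F \<and> (Z', t, g) \<in> G \<and> bounded_complex A W \<and>
         quasi_iso A W Z u \<and> chain_map A W Z' w \<and>
         homotopic A W Y (comp_maps f u) (comp_maps t w)}"

definition Db_isomorphic ::
    "('k, 'r) module \<Rightarrow> ('r, 'm) cpx \<Rightarrow> ('r, 'n) cpx \<Rightarrow> bool" where
  "Db_isomorphic A X Y \<longleftrightarrow>
     (\<exists>F\<in>Db_hom A X Y. \<exists>G\<in>Db_hom A Y X.
        Db_comp A X Y X F G = Db_id A X \<and> Db_comp A Y X Y G F = Db_id A Y)"

definition Db_hom_vanishes ::
    "('k, 'r) module \<Rightarrow> ('r, 'm) cpx \<Rightarrow> ('r, 'n) cpx \<Rightarrow> bool" where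
  "Db_hom_vanishes A X Y \<longleftrightarrow> Db_hom A X Y = {Db_zero A X Y}"

section \<open>Tilting complexes\<close>

definition projective_complex :: "('k, 'r) module \<Rightarrow> ('r, 'm) cpx \<Rightarrow> bool" where
  "projective_complex A X \<longleftrightarrow> bounded_complex A X \<and> (\<forall>n. fg_projective A (obj X n))"

definition perfect_complex :: "('k, 'r) module \<Rightarrow> ('k, 'r) small_cpx \<Rightarrow> bool" where
  "perfect_complex A X \<longleftrightarrow> bounded_complex A X \<and>
     (\<exists>P :: ('k, 'r) small_cpx. projective_complex A P \<and> Db_isomorphic A X P)"

text \<open>
  The smallest triangulated subcategory of $\mathcal{D}^b(A)$, closed under isomorphism, that
  contains the direct summands of \<open>T\<close>. A cone of an arbitrary morphism of $\mathcal{D}^b(A)$ is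
  isomorphic to the cone of a chain map out of the apex of a roof, so chain maps suffice in
  \<open>triangle\<close>.
\<close>

inductive generated :: "('k, 'r) module \<Rightarrow> ('r, 'm) cpx \<Rightarrow> ('k, 'r) small_cpx \<Rightarrow> bool"
  for A :: "('k, 'r) module" and T :: "('r, 'm) cpx" where
  summand: "\<lbrakk>bounded_complex A X; bounded_complex A (X' :: ('k, 'r) small_cpx);
      Db_isomorphic A (pair_cpx X X') T\<rbrakk> \<Longrightarrow> generated A T X"
| iso: "\<lbrakk>generated A T X; bounded_complex A Y; Db_isomorphic A X Y\<rbrakk> \<Longrightarrow> generated A T Y"
| shift: "generated A T X \<Longrightarrow> generated A T (shift r X)"
| triangle: "\<lbrakk>generated A T X; generated A T Y; chain_map A X Y f;
      bounded_complex A Z; Db_isomorphic A Z (mapping_cone X Y f)\<rbrakk> \<Longrightarrow> generated A T Z"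

text \<open>
  The terms of \<open>T\<close> being projective and per \<open>A\<close> being closed under direct summands, everything
  generated by \<open>T\<close> is perfect, so that generating per \<open>A\<close> amounts to the inclusion stated last.
\<close>

definition tilting_complex :: "('k, 'r) module \<Rightarrow> ('r, 'm) cpx \<Rightarrow> bool" where
  "tilting_complex A T \<longleftrightarrow> projective_complex A T \<and>
     (\<forall>r. r \<noteq> 0 \<longrightarrow> Db_hom_vanishes A T (shift r T)) \<and>
     (\<forall>X. perfect_complex A X \<longrightarrow> generated A T X)"

definition tilting_module :: "('k, 'r) module \<Rightarrow> ('r, 'm) module \<Rightarrow> bool" where
  "tilting_module A M \<longleftrightarrow> fd_module A M \<and>
     (\<exists>T :: ('k, 'r) small_cpx. tilting_complex A T \<and> Db_isomorphic A (stalk M) T)"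

definition iso_to_tilting_module :: "('k, 'r) module \<Rightarrow> ('r, 'm) cpx \<Rightarrow> bool" where
  "iso_to_tilting_module A T \<longleftrightarrow>
     (\<exists>M :: ('k, 'r) small_module. tilting_module A M \<and> Db_isomorphic A T (stalk M))"

section \<open>The complexes attached to a vertex\<close>

context
  fixes Q :: "('v, 'a) pre_digraph" and I :: "(('v, 'a) qpath \<Rightarrow> 'k::field) set"
begin

definition proj_at :: "'v \<Rightarrow> ((('v, 'a) qpath \<Rightarrow> 'k) set, (('v, 'a) qpath \<Rightarrow> 'k) set) module" where
  "proj_at i = right_ideal_mod (quiver_algebra Q I) (path_class Q I (i, []))"

definition arrow_class :: "'a \<Rightarrow> (('v, 'a) qpath \<Rightarrow> 'k) set" where
  "arrow_class \<alpha> = path_class Q I (tail Q \<alpha>, [\<alpha>])"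

text \<open>
  Both terms of a complex need the same carrier type. The summand belonging to an arrow \<open>\<alpha>\<close> is
  indexed by \<open>Some \<alpha>\<close>, and $P_k$ is taken as the direct sum over the one-element set \<open>{None}\<close>.
\<close>

definition L_complex ::
    "'v \<Rightarrow> ((('v, 'a) qpath \<Rightarrow> 'k) set, 'a option \<Rightarrow> (('v, 'a) qpath \<Rightarrow> 'k) set) cpx" where
  "L_complex k =
    (let S = Some ` {\<alpha> \<in> arcs Q. head Q \<alpha> = k} in
     two_term (- 1)
       (dsum_mod {None} (\<lambda>_. proj_at k))
       (dsum_mod S (\<lambda>j. proj_at (tail Q (the j))))
       (\<lambda>x. \<lambda>j\<in>S. arrow_class (the j) \<otimes>\<^bsub>quiver_algebra Q I\<^esub> x None))"

definition R_complex ::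
    "'v \<Rightarrow> ((('v, 'a) qpath \<Rightarrow> 'k) set, 'a option \<Rightarrow> (('v, 'a) qpath \<Rightarrow> 'k) set) cpx" where
  "R_complex k =
    (let S = Some ` {\<beta> \<in> arcs Q. tail Q \<beta> = k} in
     two_term 0
       (dsum_mod S (\<lambda>j. proj_at (head Q (the j))))
       (dsum_mod {None} (\<lambda>_. proj_at k))
       (\<lambda>x. \<lambda>_\<in>{None}. \<Oplus>\<^bsub>quiver_algebra Q I\<^esub>j\<in>S.
          arrow_class (the j) \<otimes>\<^bsub>quiver_algebra Q I\<^esub> x j))"

definition T_minus where
  "T_minus k = pair_cpx (L_complex k) (dsum_cpx (verts Q - {k}) (\<lambda>i. stalk (proj_at i)))"

definition T_plus where
  "T_plus k = pair_cpx (R_complex k) (dsum_cpx (verts Q - {k}) (\<lambda>i. stalk (proj_at i)))"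

end

end

theory Submission imports Defs
begin

text \<open>
  A complex of projectives computes morphisms of $\mathcal{D}^b(A)$ by chain maps up to homotopy, so
  every Hom space below is a question about maps between projective modules. Let $T$ be $T^-_k$ or
  $T^+_k$. In one direction a map $T \to T[1]$ is null-homotopic because $f$ and $g$ are
  approximations: an element of $e_i A e_k$ or $e_k A e_i$ with $i \neq k$ lies in the radical and
  hence factors through the arrows at $k$. In the other direction a map $T \to T[-1]$ is a map into
  the kernel of $f$, or out of the cokernel of $g$, and decomposes along the summands $P_i$ with
  $i \neq k$; that no such map exists is the condition of (a), or (c). That $T$ generates per $A$
  follows from the triangle relating $P_k$ to the two-term complex and the $P_i$ with $i \neq k$.

  If the condition of (a) also holds for $i = k$ then $f$ is injective, and $T^-_k$ is isomorphic to
  the module $H^0(T^-_k)$; conversely $H^{-1}(T^-_k) = 0$ forces the condition. On the other hand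
  $H^1(T^+_k)$ never vanishes, as the image of $g$ lies in the radical of $P_k$.
\<close>

text \<open>Carrier types shape the proof. Roofs have apexes over the small carrier type and
  \<open>generated\<close> speaks of small complexes only, while T, its summands and their cones
  live on other types; so results are proved for arbitrary carriers and reach the definitions
  through small copies. Classes of roofs are not composed by hand: once a projective resolution of
  the source is fixed, a class is a homotopy class of chain maps, and lifting along
  quasi-isomorphisms comes from contracting maps into an acyclic cone. As T lives in two adjacent
  degrees, only the shifts of T by 1, 0 and -1 can receive nonzero maps from it, and for -1 there
  are no homotopies, so Hom is a set of honest module maps.

  Generation has to reach every perfect complex, whose terms are arbitrary summands of A^n. They are
  cut into the P_v one generator at a time: modulo a nilpotent ideal e_i A e_i is K e_i, so a
  functional with a value outside the radical can be normalized to split off some P_v.\<close>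

section \<open>Right modules\<close>

subsection \<open>Abelian groups\<close>

context
  fixes M (structure)
  assumes M: "abelian_group M"
begin

interpretation abelian_group M by (fact M)

lemma ag_closed:
  "\<lbrakk>x \<in> carrier M; y \<in> carrier M\<rbrakk> \<Longrightarrow> x \<oplus> y \<in> carrier M"
  "\<zero> \<in> carrier M"
  "x \<in> carrier M \<Longrightarrow> \<ominus> x \<in> carrier M"
  by auto

lemma ag_zero:
  "x \<in> carrier M \<Longrightarrow> \<zero> \<oplus> x = x"
  "x \<in> carrier M \<Longrightarrow> x \<oplus> \<zero> = x"
  by auto

lemma ag_ac:
  "\<lbrakk>x \<in> carrier M; y \<in> carrier M; z \<in> carrier M\<rbrakk> \<Longrightarrow> (x \<oplus> y) \<oplus> z = x \<oplus> (y \<oplus> z)"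
  "\<lbrakk>x \<in> carrier M; y \<in> carrier M\<rbrakk> \<Longrightarrow> x \<oplus> y = y \<oplus> x"
  "\<lbrakk>x \<in> carrier M; y \<in> carrier M; z \<in> carrier M\<rbrakk> \<Longrightarrow> x \<oplus> (y \<oplus> z) = y \<oplus> (x \<oplus> z)"
  by (auto simp: a_ac)

lemma ag_neg:
  "x \<in> carrier M \<Longrightarrow> \<ominus> x \<oplus> x = \<zero>"
  "x \<in> carrier M \<Longrightarrow> x \<oplus> \<ominus> x = \<zero>"
  "\<lbrakk>x \<in> carrier M; y \<in> carrier M\<rbrakk> \<Longrightarrow> x \<oplus> (\<ominus> x \<oplus> y) = y"
  "\<lbrakk>x \<in> carrier M; y \<in> carrier M\<rbrakk> \<Longrightarrow> \<ominus> x \<oplus> (x \<oplus> y) = y"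
  "\<lbrakk>x \<in> carrier M; y \<in> carrier M\<rbrakk> \<Longrightarrow> \<ominus> (x \<oplus> y) = \<ominus> x \<oplus> \<ominus> y"
  "x \<in> carrier M \<Longrightarrow> \<ominus> (\<ominus> x) = x"
  "\<ominus> \<zero> = \<zero>"
  by (auto simp: l_neg r_neg r_neg1 r_neg2 minus_add)

lemma ag_diff_zero:
  "\<lbrakk>x \<in> carrier M; y \<in> carrier M; x \<oplus> \<ominus> y = \<zero>\<rbrakk> \<Longrightarrow> x = y"
  by (metis a_assoc a_inv_closed l_neg l_zero r_zero)

lemma ag_cancel:
  "\<lbrakk>x \<in> carrier M; y \<in> carrier M; z \<in> carrier M\<rbrakk> \<Longrightarrow> x \<oplus> y = x \<oplus> z \<longleftrightarrow> y = z"
  "\<lbrakk>x \<in> carrier M; x \<oplus> x = x\<rbrakk> \<Longrightarrow> x = \<zero>"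
  by (metis a_assoc a_inv_closed l_neg l_zero)+

lemma ag_move:
  "\<lbrakk>x \<in> carrier M; y \<in> carrier M; z \<in> carrier M\<rbrakk> \<Longrightarrow> x = y \<oplus> z \<longleftrightarrow> y = x \<oplus> \<ominus> z"
  using ag_neg ag_ac ag_zero ag_closed by auto

end

lemmas ag_simps = ag_closed ag_zero ag_neg

lemma right_module_ag: "right_module A M \<Longrightarrow> abelian_group M"
  by (simp add: right_module_def)

lemma right_module_ring: "right_module A M \<Longrightarrow> ring A"
  by (simp add: right_module_def)

lemma right_moduleI:
  assumes "ring A" "abelian_group M"
    and "\<And>a x. \<lbrakk>a \<in> carrier A; x \<in> carrier M\<rbrakk> \<Longrightarrow> a \<odot>\<^bsub>M\<^esub> x \<in> carrier M"
    and "\<And>a b x. \<lbrakk>a \<in> carrier A; b \<in> carrier A; x \<in> carrier M\<rbrakk>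
      \<Longrightarrow> (a \<oplus>\<^bsub>A\<^esub> b) \<odot>\<^bsub>M\<^esub> x = a \<odot>\<^bsub>M\<^esub> x \<oplus>\<^bsub>M\<^esub> b \<odot>\<^bsub>M\<^esub> x"
    and "\<And>a x y. \<lbrakk>a \<in> carrier A; x \<in> carrier M; y \<in> carrier M\<rbrakk>
      \<Longrightarrow> a \<odot>\<^bsub>M\<^esub> (x \<oplus>\<^bsub>M\<^esub> y) = a \<odot>\<^bsub>M\<^esub> x \<oplus>\<^bsub>M\<^esub> a \<odot>\<^bsub>M\<^esub> y"
    and "\<And>a b x. \<lbrakk>a \<in> carrier A; b \<in> carrier A; x \<in> carrier M\<rbrakk>
      \<Longrightarrow> (a \<otimes>\<^bsub>A\<^esub> b) \<odot>\<^bsub>M\<^esub> x = b \<odot>\<^bsub>M\<^esub> (a \<odot>\<^bsub>M\<^esub> x)"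
    and "\<And>x. x \<in> carrier M \<Longrightarrow> \<one>\<^bsub>A\<^esub> \<odot>\<^bsub>M\<^esub> x = x"
  shows "right_module A M"
  using assms by (simp add: right_module_def right_module_axioms_def)

lemma right_module_act_zero:
  assumes "right_module A M" "a \<in> carrier A"
  shows "a \<odot>\<^bsub>M\<^esub> \<zero>\<^bsub>M\<^esub> = \<zero>\<^bsub>M\<^esub>"
proof -
  interpret right_module A M by fact
  have "a \<odot>\<^bsub>M\<^esub> \<zero>\<^bsub>M\<^esub> \<oplus>\<^bsub>M\<^esub> a \<odot>\<^bsub>M\<^esub> \<zero>\<^bsub>M\<^esub> = a \<odot>\<^bsub>M\<^esub> \<zero>\<^bsub>M\<^esub>"
    using assms by (simp flip: act_add_right)
  then show ?thesis
    using assms by (intro ag_cancel(2)[OF right_module_ag[OF assms(1)]] act_closed) auto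
qed

lemma right_module_zero_act:
  assumes "right_module A M" "x \<in> carrier M"
  shows "\<zero>\<^bsub>A\<^esub> \<odot>\<^bsub>M\<^esub> x = \<zero>\<^bsub>M\<^esub>"
proof -
  interpret right_module A M by fact
  have "\<zero>\<^bsub>A\<^esub> \<odot>\<^bsub>M\<^esub> x \<oplus>\<^bsub>M\<^esub> \<zero>\<^bsub>A\<^esub> \<odot>\<^bsub>M\<^esub> x = \<zero>\<^bsub>A\<^esub> \<odot>\<^bsub>M\<^esub> x"
    using assms by (simp flip: act_add_left)
  then show ?thesis
    using assms by (intro ag_cancel(2)[OF right_module_ag[OF assms(1)]] act_closed) auto
qed

lemma right_module_act_neg:
  assumes "right_module A M" "a \<in> carrier A" "x \<in> carrier M"
  shows "a \<odot>\<^bsub>M\<^esub> (\<ominus>\<^bsub>M\<^esub> x) = \<ominus>\<^bsub>M\<^esub> (a \<odot>\<^bsub>M\<^esub> x)"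
proof -
  interpret right_module A M by fact
  have "a \<odot>\<^bsub>M\<^esub> (\<ominus>\<^bsub>M\<^esub> x) \<oplus>\<^bsub>M\<^esub> a \<odot>\<^bsub>M\<^esub> x = \<zero>\<^bsub>M\<^esub>"
    using assms right_module_act_zero[OF assms(1)]
    by (simp add: M.l_neg flip: act_add_right)
  then show ?thesis
    using assms act_closed by (simp add: M.minus_equality)
qed

lemmas right_module_act = right_module.act_closed right_module.act_add_left
  right_module.act_add_right right_module.act_mult right_module.act_one
  right_module_act_zero right_module_zero_act right_module_act_neg

text \<open>The module axioms are equations, apart from the existence of negatives, and pass along
  any surjection that respects the operations; N is at first a bare record. Zero submodules, right
  ideals, complements and transported structures become modules this way.\<close>

lemma right_module_surj:
  assumes M: "right_module A M"
    and surj: "h ` carrier M = carrier N"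
    and zero: "h \<zero>\<^bsub>M\<^esub> = \<zero>\<^bsub>N\<^esub>"
    and add: "\<And>x y. \<lbrakk>x \<in> carrier M; y \<in> carrier M\<rbrakk> \<Longrightarrow> h (x \<oplus>\<^bsub>M\<^esub> y) = h x \<oplus>\<^bsub>N\<^esub> h y"
    and act: "\<And>a x. \<lbrakk>a \<in> carrier A; x \<in> carrier M\<rbrakk> \<Longrightarrow> h (a \<odot>\<^bsub>M\<^esub> x) = a \<odot>\<^bsub>N\<^esub> h x"
  shows "right_module A N"
proof -
  interpret right_module A M by fact
  have el: "\<exists>x\<in>carrier M. y = h x" if "y \<in> carrier N" for y
    using that surj by auto
  have cl: "h x \<in> carrier N" if "x \<in> carrier M" for x
    using that surj by auto
  show ?thesis
  proof (rule right_moduleI)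
    show "ring A" ..
    show "abelian_group N"
    proof (rule abelian_groupI)
      fix x y assume "x \<in> carrier N" "y \<in> carrier N"
      with el obtain x' y' where "x' \<in> carrier M" "y' \<in> carrier M" "x = h x'" "y = h y'"
        by blast
      then show "x \<oplus>\<^bsub>N\<^esub> y \<in> carrier N" "x \<oplus>\<^bsub>N\<^esub> y = y \<oplus>\<^bsub>N\<^esub> x"
        by (simp_all add: cl M.a_comm flip: add)
    next
      show "\<zero>\<^bsub>N\<^esub> \<in> carrier N" using cl[of "\<zero>\<^bsub>M\<^esub>"] zero by simp
    next
      fix x y z assume "x \<in> carrier N" "y \<in> carrier N" "z \<in> carrier N"
      with el obtain x' y' z' where "x' \<in> carrier M" "y' \<in> carrier M" "z' \<in> carrier M"
        "x = h x'" "y = h y'" "z = h z'"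
        by metis
      then show "x \<oplus>\<^bsub>N\<^esub> y \<oplus>\<^bsub>N\<^esub> z = x \<oplus>\<^bsub>N\<^esub> (y \<oplus>\<^bsub>N\<^esub> z)"
        by (simp add: cl M.a_assoc flip: add)
    next
      fix x assume "x \<in> carrier N"
      then obtain x' where x': "x' \<in> carrier M" "x = h x'" using el by blast
      then show "\<zero>\<^bsub>N\<^esub> \<oplus>\<^bsub>N\<^esub> x = x"
        by (simp flip: add zero)
      have "h (\<ominus>\<^bsub>M\<^esub> x') \<oplus>\<^bsub>N\<^esub> x = \<zero>\<^bsub>N\<^esub>"
        using x' by (simp add: M.l_neg flip: add zero)
      then show "\<exists>y\<in>carrier N. y \<oplus>\<^bsub>N\<^esub> x = \<zero>\<^bsub>N\<^esub>" using x' cl by blast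
    qed
  next
    fix a x assume "a \<in> carrier A" "x \<in> carrier N"
    moreover obtain x' where "x' \<in> carrier M" "x = h x'" using el[OF \<open>x \<in> carrier N\<close>] by blast
    ultimately show "a \<odot>\<^bsub>N\<^esub> x \<in> carrier N"
      by (simp add: cl act_closed flip: act)
  next
    fix a b x assume "a \<in> carrier A" "b \<in> carrier A" "x \<in> carrier N"
    moreover obtain x' where "x' \<in> carrier M" "x = h x'" using el[OF \<open>x \<in> carrier N\<close>] by blast
    ultimately show "(a \<oplus>\<^bsub>A\<^esub> b) \<odot>\<^bsub>N\<^esub> x = a \<odot>\<^bsub>N\<^esub> x \<oplus>\<^bsub>N\<^esub> b \<odot>\<^bsub>N\<^esub> x"
      "(a \<otimes>\<^bsub>A\<^esub> b) \<odot>\<^bsub>N\<^esub> x = b \<odot>\<^bsub>N\<^esub> (a \<odot>\<^bsub>N\<^esub> x)"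
      by (simp_all add: act_closed act_add_left act_mult flip: act add)
  next
    fix a x y assume "a \<in> carrier A" "x \<in> carrier N" "y \<in> carrier N"
    moreover obtain x' y' where "x' \<in> carrier M" "x = h x'" "y' \<in> carrier M" "y = h y'"
      using el[OF \<open>x \<in> carrier N\<close>] el[OF \<open>y \<in> carrier N\<close>] by blast
    ultimately show "a \<odot>\<^bsub>N\<^esub> (x \<oplus>\<^bsub>N\<^esub> y) = a \<odot>\<^bsub>N\<^esub> x \<oplus>\<^bsub>N\<^esub> a \<odot>\<^bsub>N\<^esub> y"
      by (simp add: act_closed act_add_right flip: act add)
  next
    fix x assume "x \<in> carrier N"
    then obtain x' where "x' \<in> carrier M" "x = h x'" using el by blast
    then show "\<one>\<^bsub>A\<^esub> \<odot>\<^bsub>N\<^esub> x = x" by (simp add: act_one flip: act)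
  qed
qed

subsection \<open>Homomorphisms\<close>

lemma mod_homI:
  assumes "\<And>x. x \<in> carrier M \<Longrightarrow> h x \<in> carrier N"
    and "\<And>x y. \<lbrakk>x \<in> carrier M; y \<in> carrier M\<rbrakk> \<Longrightarrow> h (x \<oplus>\<^bsub>M\<^esub> y) = h x \<oplus>\<^bsub>N\<^esub> h y"
    and "\<And>a x. \<lbrakk>a \<in> carrier A; x \<in> carrier M\<rbrakk> \<Longrightarrow> h (a \<odot>\<^bsub>M\<^esub> x) = a \<odot>\<^bsub>N\<^esub> h x"
  shows "h \<in> mod_hom A M N"
  using assms by (auto simp: mod_hom_def)

lemma mod_hom_closed: "\<lbrakk>h \<in> mod_hom A M N; x \<in> carrier M\<rbrakk> \<Longrightarrow> h x \<in> carrier N"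
  by (auto simp: mod_hom_def)

lemma mod_hom_add:
  "\<lbrakk>h \<in> mod_hom A M N; x \<in> carrier M; y \<in> carrier M\<rbrakk> \<Longrightarrow> h (x \<oplus>\<^bsub>M\<^esub> y) = h x \<oplus>\<^bsub>N\<^esub> h y"
  by (auto simp: mod_hom_def)

lemma mod_hom_act:
  "\<lbrakk>h \<in> mod_hom A M N; a \<in> carrier A; x \<in> carrier M\<rbrakk> \<Longrightarrow> h (a \<odot>\<^bsub>M\<^esub> x) = a \<odot>\<^bsub>N\<^esub> h x"
  by (auto simp: mod_hom_def)

lemma mod_hom_zero:
  assumes "h \<in> mod_hom A M N" "abelian_group M" "abelian_group N"
  shows "h \<zero>\<^bsub>M\<^esub> = \<zero>\<^bsub>N\<^esub>"
proof -
  interpret M: abelian_group M by fact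
  have "h \<zero>\<^bsub>M\<^esub> \<oplus>\<^bsub>N\<^esub> h \<zero>\<^bsub>M\<^esub> = h \<zero>\<^bsub>M\<^esub>"
    by (simp flip: mod_hom_add[OF assms(1)])
  then show ?thesis
    by (intro ag_cancel(2)[OF assms(3)] mod_hom_closed[OF assms(1)]) auto
qed

lemma mod_hom_neg:
  assumes "h \<in> mod_hom A M N" "abelian_group M" "abelian_group N" "x \<in> carrier M"
  shows "h (\<ominus>\<^bsub>M\<^esub> x) = \<ominus>\<^bsub>N\<^esub> h x"
proof -
  interpret M: abelian_group M by fact
  interpret N: abelian_group N by fact
  have "h (\<ominus>\<^bsub>M\<^esub> x) \<oplus>\<^bsub>N\<^esub> h x = \<zero>\<^bsub>N\<^esub>"
    using mod_hom_add[OF assms(1), of "\<ominus>\<^bsub>M\<^esub> x" x] assms mod_hom_zero[OF assms(1-3)]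
    by (simp add: M.l_neg)
  then show ?thesis
    using assms(1,4) mod_hom_closed[OF assms(1)] N.minus_equality by simp
qed

lemmas mod_hom_simps = mod_hom_closed mod_hom_add mod_hom_act mod_hom_zero mod_hom_neg

lemma mod_hom_id: "(\<lambda>x. x) \<in> mod_hom A M M"
  by (rule mod_homI) auto

lemma mod_hom_comp:
  "\<lbrakk>g \<in> mod_hom A N L; f \<in> mod_hom A M N\<rbrakk> \<Longrightarrow> (\<lambda>x. g (f x)) \<in> mod_hom A M L"
  by (rule mod_homI) (auto simp: mod_hom_def Pi_iff)

text \<open>\<open>mod_hom\<close> constrains a map on the carrier only. M is taken to be a module
  so that the sums and multiples at which the maps are compared stay in the carrier.\<close>

lemma mod_hom_cong:
  assumes "f \<in> mod_hom A M N" "right_module A M" "\<And>x. x \<in> carrier M \<Longrightarrow> g x = f x"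
  shows "g \<in> mod_hom A M N"
  by (rule mod_homI)
    (use assms in \<open>auto simp: mod_hom_simps ag_closed right_module_ag right_module_act\<close>)

lemma mod_hom_zero_map: "right_module A N \<Longrightarrow> (\<lambda>x. \<zero>\<^bsub>N\<^esub>) \<in> mod_hom A M N"
  by (rule mod_homI) (auto simp: ag_simps right_module_ag right_module_act)

lemma mod_hom_plus:
  assumes "f \<in> mod_hom A M N" "g \<in> mod_hom A M N" "right_module A N"
  shows "(\<lambda>x. f x \<oplus>\<^bsub>N\<^esub> g x) \<in> mod_hom A M N"
  by (rule mod_homI)
    (use assms in \<open>auto simp: mod_hom_simps ag_simps ag_ac right_module_ag right_module_act\<close>)

lemma mod_hom_uminus:
  assumes "f \<in> mod_hom A M N" "right_module A N"
  shows "(\<lambda>x. \<ominus>\<^bsub>N\<^esub> f x) \<in> mod_hom A M N"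
  by (rule mod_homI)
    (use assms in \<open>auto simp: mod_hom_simps ag_simps right_module_ag right_module_act\<close>)

lemma mod_hom_inv:
  assumes f: "f \<in> mod_hom A M N" and M: "right_module A M"
    and g: "\<And>y. y \<in> carrier N \<Longrightarrow> g y \<in> carrier M \<and> f (g y) = y"
    and gf: "\<And>x. x \<in> carrier M \<Longrightarrow> g (f x) = x"
  shows "g \<in> mod_hom A N M"
proof (rule mod_homI)
  fix x y assume xy: "x \<in> carrier N" "y \<in> carrier N"
  have "g (x \<oplus>\<^bsub>N\<^esub> y) = g (f (g x \<oplus>\<^bsub>M\<^esub> g y))" using f xy g by (simp add: mod_hom_simps)
  then show "g (x \<oplus>\<^bsub>N\<^esub> y) = g x \<oplus>\<^bsub>M\<^esub> g y"
    using gf g xy by (simp add: ag_closed right_module_ag[OF M])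
next
  fix a y assume xy: "a \<in> carrier A" "y \<in> carrier N"
  have "g (a \<odot>\<^bsub>N\<^esub> y) = g (f (a \<odot>\<^bsub>M\<^esub> g y))" using f xy g by (simp add: mod_hom_simps)
  then show "g (a \<odot>\<^bsub>N\<^esub> y) = a \<odot>\<^bsub>M\<^esub> g y"
    using gf g xy by (simp add: right_module_act[OF M])
qed (use g in auto)

subsection \<open>Zero modules, pairs and direct sums\<close>

lemma zero_sub_simps [simp]:
  "carrier (zero_sub M) = {\<zero>\<^bsub>M\<^esub>}" "\<zero>\<^bsub>zero_sub M\<^esub> = \<zero>\<^bsub>M\<^esub>"
  "x \<oplus>\<^bsub>zero_sub M\<^esub> y = x \<oplus>\<^bsub>M\<^esub> y" "a \<odot>\<^bsub>zero_sub M\<^esub> x = a \<odot>\<^bsub>M\<^esub> x"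
  by (simp_all add: zero_sub_def)

lemma right_module_zero_sub:
  assumes "right_module A M"
  shows "right_module A (zero_sub M)"
  by (rule right_module_surj[OF assms, of "\<lambda>_. \<zero>\<^bsub>M\<^esub>"])
    (use right_module_ag[OF assms] in \<open>auto simp: ag_simps right_module_act[OF assms] image_iff intro: ag_closed\<close>)

lemma pair_mod_simps [simp]:
  "carrier (pair_mod M N) = carrier M \<times> carrier N"
  "\<zero>\<^bsub>pair_mod M N\<^esub> = (\<zero>\<^bsub>M\<^esub>, \<zero>\<^bsub>N\<^esub>)"
  "(x, y) \<oplus>\<^bsub>pair_mod M N\<^esub> (x', y') = (x \<oplus>\<^bsub>M\<^esub> x', y \<oplus>\<^bsub>N\<^esub> y')"
  "a \<odot>\<^bsub>pair_mod M N\<^esub> (x, y) = (a \<odot>\<^bsub>M\<^esub> x, a \<odot>\<^bsub>N\<^esub> y)"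
  by (simp_all add: pair_mod_def)

lemma right_module_pair:
  assumes M: "right_module A M" and N: "right_module A N"
  shows "right_module A (pair_mod M N)"
proof (rule right_moduleI)
  note s = right_module_ag[OF M] right_module_ag[OF N] ag_simps ag_ac
  show "ring A" using M by (rule right_module_ring)
  show "abelian_group (pair_mod M N)"
  proof (rule abelian_groupI)
    fix x assume "x \<in> carrier (pair_mod M N)"
    then show "\<exists>y\<in>carrier (pair_mod M N). y \<oplus>\<^bsub>pair_mod M N\<^esub> x = \<zero>\<^bsub>pair_mod M N\<^esub>"
      by (intro bexI[of _ "(\<ominus>\<^bsub>M\<^esub> fst x, \<ominus>\<^bsub>N\<^esub> snd x)"]) (auto simp: s)
  qed (auto simp: s)
qed (use M N in \<open>auto simp: right_module_act\<close>)

lemma mod_hom_fst: "fst \<in> mod_hom A (pair_mod M N) M"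
  and mod_hom_snd: "snd \<in> mod_hom A (pair_mod M N) N"
  by (auto intro!: mod_homI)

lemma mod_hom_into_pair:
  "\<lbrakk>f \<in> mod_hom A L M; g \<in> mod_hom A L N\<rbrakk> \<Longrightarrow> (\<lambda>x. (f x, g x)) \<in> mod_hom A L (pair_mod M N)"
  by (rule mod_homI) (auto simp: mod_hom_simps)

lemma mod_hom_from_pair:
  assumes "f \<in> mod_hom A M L" "g \<in> mod_hom A N L" "right_module A L"
  shows "(\<lambda>x. f (fst x) \<oplus>\<^bsub>L\<^esub> g (snd x)) \<in> mod_hom A (pair_mod M N) L"
  by (intro mod_hom_plus mod_hom_comp[OF _ mod_hom_fst] mod_hom_comp[OF _ mod_hom_snd] assms)

lemma dsum_mod_simps [simp]:
  "carrier (dsum_mod J M) = (\<Pi>\<^sub>E j\<in>J. carrier (M j))"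
  "\<zero>\<^bsub>dsum_mod J M\<^esub> = (\<lambda>j\<in>J. \<zero>\<^bsub>M j\<^esub>)"
  "x \<oplus>\<^bsub>dsum_mod J M\<^esub> y = (\<lambda>j\<in>J. x j \<oplus>\<^bsub>M j\<^esub> y j)"
  "a \<odot>\<^bsub>dsum_mod J M\<^esub> x = (\<lambda>j\<in>J. a \<odot>\<^bsub>M j\<^esub> x j)"
  by (simp_all add: dsum_mod_def)

lemma right_module_dsum:
  assumes A: "ring A" and M: "\<And>j. j \<in> J \<Longrightarrow> right_module A (M j)"
  shows "right_module A (dsum_mod J M)"
proof (rule right_moduleI)
  note s = right_module_ag[OF M] ag_simps ag_ac
  show "abelian_group (dsum_mod J M)"
  proof (rule abelian_groupI)
    fix x assume "x \<in> carrier (dsum_mod J M)"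
    then show "\<exists>y\<in>carrier (dsum_mod J M). y \<oplus>\<^bsub>dsum_mod J M\<^esub> x = \<zero>\<^bsub>dsum_mod J M\<^esub>"
      by (intro bexI[of _ "\<lambda>j\<in>J. \<ominus>\<^bsub>M j\<^esub> x j"]) (auto simp: s PiE_iff fun_eq_iff)
  next
    fix x assume "x \<in> carrier (dsum_mod J M)"
    then show "\<zero>\<^bsub>dsum_mod J M\<^esub> \<oplus>\<^bsub>dsum_mod J M\<^esub> x = x"
      by (auto simp: s PiE_iff fun_eq_iff restrict_def extensional_def)
  qed (auto simp: s PiE_iff fun_eq_iff)
next
  fix x assume "x \<in> carrier (dsum_mod J M)"
  then show "\<one>\<^bsub>A\<^esub> \<odot>\<^bsub>dsum_mod J M\<^esub> x = x"
    by (auto simp: right_module_act[OF M] PiE_iff fun_eq_iff restrict_def extensional_def)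
qed (use A in \<open>auto simp: right_module_act[OF M] PiE_iff fun_eq_iff\<close>)

lemma mod_hom_proj: "j \<in> J \<Longrightarrow> (\<lambda>x. x j) \<in> mod_hom A (dsum_mod J M) (M j)"
  by (rule mod_homI) auto

lemma mod_hom_into_dsum:
  assumes "\<And>j. j \<in> J \<Longrightarrow> h j \<in> mod_hom A L (M j)"
  shows "(\<lambda>x. \<lambda>j\<in>J. h j x) \<in> mod_hom A L (dsum_mod J M)"
  by (rule mod_homI) (auto simp: mod_hom_simps[OF assms] fun_eq_iff)

definition dsum_inj :: "'j set \<Rightarrow> ('j \<Rightarrow> ('r, 'm) module) \<Rightarrow> 'j \<Rightarrow> 'm \<Rightarrow> 'j \<Rightarrow> 'm" where
  "dsum_inj J M j y = (\<lambda>i\<in>J. if i = j then y else \<zero>\<^bsub>M i\<^esub>)"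

lemma mod_hom_dsum_inj:
  assumes "\<And>j. j \<in> J \<Longrightarrow> right_module A (M j)" "j \<in> J"
  shows "dsum_inj J M j \<in> mod_hom A (M j) (dsum_mod J M)"
  unfolding dsum_inj_def
  by (rule mod_homI)
    (use assms(2) in \<open>auto simp: fun_eq_iff right_module_act[OF assms(1)] ag_simps
      right_module_ag[OF assms(1)]\<close>)

subsection \<open>Spans\<close>

inductive_set mspan :: "'r set \<Rightarrow> ('r, 'm) module \<Rightarrow> 'm set \<Rightarrow> 'm set" for C M G where
  zero: "\<zero>\<^bsub>M\<^esub> \<in> mspan C M G"
| base: "g \<in> G \<Longrightarrow> g \<in> mspan C M G"
| add: "\<lbrakk>x \<in> mspan C M G; y \<in> mspan C M G\<rbrakk> \<Longrightarrow> x \<oplus>\<^bsub>M\<^esub> y \<in> mspan C M G"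
| act: "\<lbrakk>a \<in> C; x \<in> mspan C M G\<rbrakk> \<Longrightarrow> a \<odot>\<^bsub>M\<^esub> x \<in> mspan C M G"

lemma mspan_closed:
  assumes "right_module A M" "C \<subseteq> carrier A" "G \<subseteq> carrier M" "x \<in> mspan C M G"
  shows "x \<in> carrier M"
  using assms(4)
  by induction (use assms(1-3) in \<open>auto simp: ag_simps right_module_ag right_module_act\<close>)

lemma mspan_trans:
  assumes "x \<in> mspan C M G" "C \<subseteq> C'" "G \<subseteq> mspan C' M G'"
  shows "x \<in> mspan C' M G'"
  using assms(1) by induction (use assms(2,3) in \<open>auto intro: mspan.intros\<close>)

lemma mspan_hom:
  assumes "x \<in> mspan C M G" "h \<in> mod_hom A M N" "right_module A M" "right_module A N"
    "C \<subseteq> carrier A" "G \<subseteq> carrier M" "h ` G \<subseteq> mspan C N G'"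
  shows "h x \<in> mspan C N G'"
  using assms(1)
proof induction
  case zero
  then show ?case using assms by (simp add: mod_hom_simps right_module_ag mspan.zero)
next
  case (add x y)
  moreover have "x \<in> carrier M" "y \<in> carrier M" using add mspan_closed[OF assms(3,5,6)] by auto
  ultimately show ?case using assms(2) by (simp add: mod_hom_simps mspan.add)
next
  case (act a x)
  moreover have "x \<in> carrier M" using act mspan_closed[OF assms(3,5,6)] by auto
  moreover have "a \<in> carrier A" using act assms by auto
  ultimately show ?case using assms(2) by (simp add: mod_hom_simps mspan.act)
qed (use assms(7) in auto)

lemma mod_hom_eq_on_span:
  assumes "x \<in> mspan C M G" "f \<in> mod_hom A M N" "g \<in> mod_hom A M N"
    "right_module A M" "right_module A N" "C \<subseteq> carrier A" "G \<subseteq> carrier M"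
    "\<And>y. y \<in> G \<Longrightarrow> f y = g y"
  shows "f x = g x"
  using assms(1)
proof induction
  case zero
  then show ?case using assms by (simp add: mod_hom_simps right_module_ag)
next
  case (add x y)
  moreover have "x \<in> carrier M" "y \<in> carrier M" using add mspan_closed[OF assms(4,6,7)] by auto
  ultimately show ?case using assms(2,3) by (simp add: mod_hom_simps)
next
  case (act a x)
  moreover have "x \<in> carrier M" using act mspan_closed[OF assms(4,6,7)] by auto
  moreover have "a \<in> carrier A" using act assms by auto
  ultimately show ?case using assms(2,3) by (simp add: mod_hom_simps)
qed (use assms(8) in auto)

lemma pair_span:
  fixes A :: "('k, 'r) module"
  assumes "right_module A M" "right_module A N" "C \<subseteq> carrier A"
    and "carrier M \<subseteq> mspan C M G" "carrier N \<subseteq> mspan C N H" "G \<subseteq> carrier M" "H \<subseteq> carrier N"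
  shows "carrier (pair_mod M N)
    \<subseteq> mspan C (pair_mod M N) ((\<lambda>x. (x, \<zero>\<^bsub>N\<^esub>)) ` G \<union> (\<lambda>y. (\<zero>\<^bsub>M\<^esub>, y)) ` H)" (is "_ \<subseteq> ?S")
proof
  fix z assume z: "z \<in> carrier (pair_mod M N)"
  note p = right_module_pair[OF assms(1,2)]
  have z': "fst z \<in> mspan C M G" "snd z \<in> mspan C N H" using z assms(4,5) by auto
  have "(fst z, \<zero>\<^bsub>N\<^esub>) \<in> ?S"
    by (rule mspan_hom[OF _ mod_hom_into_pair[OF mod_hom_id mod_hom_zero_map], where A = A and G = G])
      (use assms z' p in \<open>auto intro: mspan.base\<close>)
  moreover have "(\<zero>\<^bsub>M\<^esub>, snd z) \<in> ?S"
    by (rule mspan_hom[OF _ mod_hom_into_pair[OF mod_hom_zero_map mod_hom_id], where A = A and G = H])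
      (use assms z' p in \<open>auto intro: mspan.base\<close>)
  ultimately have "(fst z, \<zero>\<^bsub>N\<^esub>) \<oplus>\<^bsub>pair_mod M N\<^esub> (\<zero>\<^bsub>M\<^esub>, snd z) \<in> ?S"
    by (rule mspan.add)
  then show "z \<in> ?S"
    using z assms(1,2) by (auto simp: ag_simps right_module_ag)
qed

text \<open>Induction on a finite set S of indices outside of which x vanishes: one coordinate is
  set to zero and added back as its image under \<open>dsum_inj\<close>.\<close>

lemma dsum_span:
  fixes A :: "('k, 'r) module"
  assumes "finite J" and A: "ring A" and M: "\<And>j. j \<in> J \<Longrightarrow> right_module A (M j)"
    and C: "C \<subseteq> carrier A"
    and G: "\<And>j. j \<in> J \<Longrightarrow> carrier (M j) \<subseteq> mspan C (M j) (G j)"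
      "\<And>j. j \<in> J \<Longrightarrow> G j \<subseteq> carrier (M j)"
  shows "carrier (dsum_mod J M) \<subseteq> mspan C (dsum_mod J M) (\<Union>j\<in>J. dsum_inj J M j ` G j)"
    (is "_ \<subseteq> ?S")
proof -
  have "x \<in> ?S" if "x \<in> carrier (dsum_mod J M)" "\<forall>j\<in>J - S. x j = \<zero>\<^bsub>M j\<^esub>" "finite S" "S \<subseteq> J"
    for S x
    using that(3,4,1,2)
  proof (induction S arbitrary: x rule: finite_induct)
    case empty
    then have "x = \<zero>\<^bsub>dsum_mod J M\<^esub>" by (auto simp: fun_eq_iff PiE_iff extensional_def)
    then show ?case using mspan.zero by metis
  next
    case (insert s S)
    then have s: "s \<in> J" by auto
    let ?y = "x(s := \<zero>\<^bsub>M s\<^esub>)"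
    have y: "?y \<in> ?S"
      using insert.prems insert.hyps s right_module_ag[OF M[OF s]]
      by (intro insert.IH) (auto simp: PiE_iff extensional_def ag_simps)
    have z: "dsum_inj J M s (x s) \<in> ?S"
    proof (rule mspan_hom)
      show "x s \<in> mspan C (M s) (G s)"
        using insert.prems s by (intro subsetD[OF G(1)]) (auto simp: PiE_iff)
      show "dsum_inj J M s \<in> mod_hom A (M s) (dsum_mod J M)"
        by (rule mod_hom_dsum_inj) (use M s in auto)
      show "right_module A (dsum_mod J M)" by (rule right_module_dsum[OF A M])
      show "dsum_inj J M s ` G s \<subseteq> ?S" using s by (auto intro!: mspan.base)
    qed (use s G C M in auto)
    have "x = ?y \<oplus>\<^bsub>dsum_mod J M\<^esub> dsum_inj J M s (x s)"
      using insert.prems right_module_ag[OF M]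
      by (auto simp: fun_eq_iff PiE_iff extensional_def dsum_inj_def ag_simps restrict_def)
    then show ?case using mspan.add[OF y z] by metis
  qed
  from this[of _ J] show ?thesis using assms(1) by blast
qed

lemma dsum_span_self:
  fixes A :: "('k, 'r) module"
  assumes "finite J" and A: "ring A" and M: "\<And>j. j \<in> J \<Longrightarrow> right_module A (M j)"
    and C: "C \<subseteq> carrier A"
  shows "carrier (dsum_mod J M) \<subseteq> mspan C (dsum_mod J M) (\<Union>j\<in>J. dsum_inj J M j ` carrier (M j))"
  by (rule dsum_span[OF assms]) (auto intro: mspan.base)

text \<open>The universal property of a finite direct sum, stated as existence. The map is built by
  adding one summand at a time, which avoids a formula with a finite sum of homomorphisms.\<close>

lemma dsum_copair:
  assumes "finite J" and A: "ring A" and M: "\<And>j. j \<in> J \<Longrightarrow> right_module A (M j)"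
    and N: "right_module A N" and h: "\<And>j. j \<in> J \<Longrightarrow> h j \<in> mod_hom A (M j) N"
  shows "\<exists>\<phi>\<in>mod_hom A (dsum_mod J M) N. \<forall>j\<in>J. \<forall>y\<in>carrier (M j). \<phi> (dsum_inj J M j y) = h j y"
proof -
  \<comment> \<open>The value zero on the summands outside S is part of the induction, so that
    adding the next component leaves the earlier ones unchanged.\<close>
  have "\<exists>\<phi>\<in>mod_hom A (dsum_mod J M) N. \<forall>j\<in>J. \<forall>y\<in>carrier (M j).
      \<phi> (dsum_inj J M j y) = (if j \<in> S then h j y else \<zero>\<^bsub>N\<^esub>)"
    if "finite S" "S \<subseteq> J" for S
    using that
  proof (induction S rule: finite_induct)
    case empty
    show ?case by (rule bexI[OF _ mod_hom_zero_map[OF N]]) auto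
  next
    case (insert s S)
    then obtain \<phi> where \<phi>: "\<phi> \<in> mod_hom A (dsum_mod J M) N"
      "\<forall>j\<in>J. \<forall>y\<in>carrier (M j). \<phi> (dsum_inj J M j y) = (if j \<in> S then h j y else \<zero>\<^bsub>N\<^esub>)"
      by auto
    have s: "s \<in> J" using insert by auto
    have "(\<lambda>x. h s (x s)) \<in> mod_hom A (dsum_mod J M) N"
      using mod_hom_comp[OF h[OF s], of "\<lambda>x. x s"] mod_hom_proj[OF s] by blast
    then have "(\<lambda>x. \<phi> x \<oplus>\<^bsub>N\<^esub> h s (x s)) \<in> mod_hom A (dsum_mod J M) N"
      by (intro mod_hom_plus \<phi> N)
    moreover have "h s (dsum_inj J M j y s) = (if j = s then h s y else \<zero>\<^bsub>N\<^esub>)" for j y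
      using s mod_hom_zero[OF h[OF s] right_module_ag[OF M[OF s]] right_module_ag[OF N]]
      by (auto simp: dsum_inj_def)
    ultimately show ?case
      using \<phi>(2) insert.hyps mod_hom_closed[OF h] N
      by (intro bexI[of _ "\<lambda>x. \<phi> x \<oplus>\<^bsub>N\<^esub> h s (x s)"]) (auto simp: ag_simps right_module_ag)
  qed
  from this[OF assms(1)] show ?thesis by simp
qed

subsection \<open>Finite-dimensional modules\<close>

text \<open>The field acts on modules only through the elements c . 1, as in
  \<open>fd_module\<close>; the assumptions say that c |-> c . 1 is a ring homomorphism from K to
  A.\<close>

locale kalgebra = ring A for A :: "('k::field, 'r) module" (structure) +
  assumes scalar_closed: "c \<odot> \<one> \<in> carrier A"
    and scalar_add: "(c + d) \<odot> \<one> = c \<odot> \<one> \<oplus> d \<odot> \<one>"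
    and scalar_mult: "(c * d) \<odot> \<one> = (c \<odot> \<one>) \<otimes> (d \<odot> \<one>)"
    and scalar_one: "1 \<odot> \<one> = \<one>"
begin

abbreviation "scalars \<equiv> range (\<lambda>c. c \<odot> \<one>)"

lemma scalars_carrier: "scalars \<subseteq> carrier A"
  using scalar_closed by auto

lemma scalar_zero: "0 \<odot> \<one> = \<zero>"
  by (rule ag_cancel(2)[OF is_abelian_group scalar_closed]) (simp flip: scalar_add)

lemma ring_A: "ring A" ..

lemma scalar_combination_in_span:
  assumes "right_module A M" "finite B" "B \<subseteq> carrier M"
  shows "(\<Oplus>\<^bsub>M\<^esub>b\<in>B. (c b \<odot> \<one>) \<odot>\<^bsub>M\<^esub> b) \<in> mspan scalars M B"
proof -
  interpret right_module A M by fact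
  have "(\<Oplus>\<^bsub>M\<^esub>b\<in>S. (c b \<odot> \<one>) \<odot>\<^bsub>M\<^esub> b) \<in> mspan scalars M B" if "finite S" "S \<subseteq> B" for S
    using that
  proof (induction S rule: finite_induct)
    case empty
    then show ?case by (simp add: mspan.zero)
  next
    case (insert s S)
    then have "(\<Oplus>\<^bsub>M\<^esub>b\<in>insert s S. (c b \<odot> \<one>) \<odot>\<^bsub>M\<^esub> b)
      = (c s \<odot> \<one>) \<odot>\<^bsub>M\<^esub> s \<oplus>\<^bsub>M\<^esub> (\<Oplus>\<^bsub>M\<^esub>b\<in>S. (c b \<odot> \<one>) \<odot>\<^bsub>M\<^esub> b)"
      using assms(3) by (intro M.finsum_insert) (auto simp: act_closed scalar_closed)
    moreover have "(c s \<odot> \<one>) \<odot>\<^bsub>M\<^esub> s \<in> mspan scalars M B"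
      using insert.prems by (intro mspan.act mspan.base) auto
    ultimately show ?case using insert by (simp add: mspan.add)
  qed
  then show ?thesis using assms(2) by simp
qed

text \<open>The combinations of B with scalar coefficients contain B and are closed under the
  operations that generate the span.\<close>

lemma span_scalar_combination:
  assumes M: "right_module A M" and B: "finite B" "B \<subseteq> carrier M" and x: "x \<in> mspan scalars M B"
  shows "\<exists>c. x = (\<Oplus>\<^bsub>M\<^esub>b\<in>B. (c b \<odot> \<one>) \<odot>\<^bsub>M\<^esub> b)"
  using x
proof induction
  interpret right_module A M by fact
  note s = act_closed act_add_left act_add_right act_one scalar_closed scalar_zero scalar_one
    right_module_zero_act[OF M] right_module_act_zero[OF M]
  have cl: "(\<lambda>b. (c b \<odot> \<one>) \<odot>\<^bsub>M\<^esub> b) \<in> B \<rightarrow> carrier M" for c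
    using B by (auto simp: s)
  {
    case zero
    have "(\<Oplus>\<^bsub>M\<^esub>b\<in>B. (0 \<odot> \<one>) \<odot>\<^bsub>M\<^esub> b) = (\<Oplus>\<^bsub>M\<^esub>b\<in>B. \<zero>\<^bsub>M\<^esub>)"
      using B by (intro M.finsum_cong) (auto simp: s simp_implies_def)
    then show ?case by (intro exI[of _ "\<lambda>_. 0"]) (simp)
  next
    case (base g)
    have "(\<Oplus>\<^bsub>M\<^esub>b\<in>B. ((if b = g then 1 else 0) \<odot> \<one>) \<odot>\<^bsub>M\<^esub> b) = (\<Oplus>\<^bsub>M\<^esub>b\<in>B. if g = b then b else \<zero>\<^bsub>M\<^esub>)"
      using B by (intro M.finsum_cong) (auto simp: s simp_implies_def)
    also have "\<dots> = g"
      using M.finsum_singleton[of g B "\<lambda>b. b"] base B by auto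
    finally show ?case by metis
  next
    case (add x y)
    then obtain c d where cd: "x = (\<Oplus>\<^bsub>M\<^esub>b\<in>B. (c b \<odot> \<one>) \<odot>\<^bsub>M\<^esub> b)" "y = (\<Oplus>\<^bsub>M\<^esub>b\<in>B. (d b \<odot> \<one>) \<odot>\<^bsub>M\<^esub> b)"
      by blast
    have "(\<Oplus>\<^bsub>M\<^esub>b\<in>B. ((c b + d b) \<odot> \<one>) \<odot>\<^bsub>M\<^esub> b)
      = (\<Oplus>\<^bsub>M\<^esub>b\<in>B. (c b \<odot> \<one>) \<odot>\<^bsub>M\<^esub> b \<oplus>\<^bsub>M\<^esub> (d b \<odot> \<one>) \<odot>\<^bsub>M\<^esub> b)"
      using B by (intro M.finsum_cong) (auto simp: s scalar_add simp_implies_def)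
    also have "\<dots> = x \<oplus>\<^bsub>M\<^esub> y"
      using M.finsum_addf[OF cl cl] cd by simp
    finally show ?case by (intro exI[of _ "\<lambda>b. c b + d b"]) simp
  next
    case (act a x)
    then obtain c e where cd: "x = (\<Oplus>\<^bsub>M\<^esub>b\<in>B. (c b \<odot> \<one>) \<odot>\<^bsub>M\<^esub> b)" and e: "a = e \<odot> \<one>"
      by blast
    \<comment> \<open>The new coefficient is c b * e, in this order, because in a right module a
      product of A acts by its left factor first.\<close>
    have "a \<odot>\<^bsub>M\<^esub> (\<Oplus>\<^bsub>M\<^esub>b\<in>S. (c b \<odot> \<one>) \<odot>\<^bsub>M\<^esub> b) = (\<Oplus>\<^bsub>M\<^esub>b\<in>S. ((c b * e) \<odot> \<one>) \<odot>\<^bsub>M\<^esub> b)"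
      if "finite S" "S \<subseteq> B" for S
      using that
    proof (induction S rule: finite_induct)
      case empty
      then show ?case by (simp add: e s)
    next
      case (insert b S)
      have cl': "(\<lambda>b. (c b \<odot> \<one>) \<odot>\<^bsub>M\<^esub> b) \<in> S \<rightarrow> carrier M" for c
        using cl[of c] insert.prems by (auto simp: Pi_iff)
      have "b \<in> carrier M" using insert.prems B by auto
      moreover have "(\<Oplus>\<^bsub>M\<^esub>b\<in>S. (c b \<odot> \<one>) \<odot>\<^bsub>M\<^esub> b) \<in> carrier M"
        using cl'[of c] by simp
      moreover have "((c b * e) \<odot> \<one>) \<odot>\<^bsub>M\<^esub> b = a \<odot>\<^bsub>M\<^esub> ((c b \<odot> \<one>) \<odot>\<^bsub>M\<^esub> b)"
        using \<open>b \<in> carrier M\<close> act_mult[of "c b \<odot> \<one>" a b] by (simp add: e s scalar_mult)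
      ultimately show ?case
        using insert cl' by (subst (1 2) M.finsum_insert) (auto simp: s e)
    qed
    from this[OF B(1) order_refl] show ?case using cd by (intro exI[of _ "\<lambda>b. c b * e"]) simp
  }
qed

text \<open>Trades the coordinate form of finite-dimensionality for a span, which images, pairs and
  direct sums inherit by induction.\<close>

lemma fd_module_iff:
  "fd_module A M \<longleftrightarrow>
    right_module A M \<and> (\<exists>B. finite B \<and> B \<subseteq> carrier M \<and> carrier M \<subseteq> mspan scalars M B)"
proof (intro iffI conjI; (elim conjE)?)
  assume fd: "fd_module A M"
  then show "right_module A M" by (simp add: fd_module_def)
  obtain B where B: "finite B" "B \<subseteq> carrier M"
    "\<forall>x\<in>carrier M. \<exists>c. x = (\<Oplus>\<^bsub>M\<^esub>b\<in>B. (c b \<odot> \<one>) \<odot>\<^bsub>M\<^esub> b)"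
    using fd by (auto simp: fd_module_def)
  then show "\<exists>B. finite B \<and> B \<subseteq> carrier M \<and> carrier M \<subseteq> mspan scalars M B"
    using scalar_combination_in_span[OF \<open>right_module A M\<close> B(1,2)]
    by (intro exI[of _ B] conjI B subsetI) force
next
  assume "right_module A M" "\<exists>B. finite B \<and> B \<subseteq> carrier M \<and> carrier M \<subseteq> mspan scalars M B"
  then obtain B where "right_module A M" "finite B" "B \<subseteq> carrier M" "carrier M \<subseteq> mspan scalars M B"
    by blast
  then show "fd_module A M"
    unfolding fd_module_def using span_scalar_combination[of M B] by blast
qed

lemma fd_moduleI:
  "\<lbrakk>right_module A M; finite B; B \<subseteq> carrier M; carrier M \<subseteq> mspan scalars M B\<rbrakk> \<Longrightarrow> fd_module A M"
  by (auto simp: fd_module_iff)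

lemma fd_surj:
  assumes "fd_module A M" "right_module A N" "h \<in> mod_hom A M N" "carrier N \<subseteq> h ` carrier M"
  shows "fd_module A N"
proof -
  obtain B where B: "right_module A M" "finite B" "B \<subseteq> carrier M" "carrier M \<subseteq> mspan scalars M B"
    using assms by (auto simp: fd_module_iff)
  have "h x \<in> mspan scalars N (h ` B)" if "x \<in> carrier M" for x
    by (rule mspan_hom[OF _ assms(3)])
      (use that B assms(2) scalars_carrier in \<open>auto intro: mspan.base\<close>)
  then show ?thesis
    using assms B by (intro fd_moduleI[of _ "h ` B"]) (auto simp: mod_hom_simps)
qed

lemma fd_trivial:
  assumes "right_module A M" "carrier M = {\<zero>\<^bsub>M\<^esub>}"
  shows "fd_module A M"
  by (rule fd_moduleI[OF assms(1), of "{}"]) (use assms in \<open>auto intro: mspan.zero\<close>)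

lemma fd_pair:
  assumes "fd_module A M" "fd_module A N"
  shows "fd_module A (pair_mod M N)"
proof -
  obtain B where B: "right_module A M" "finite B" "B \<subseteq> carrier M" "carrier M \<subseteq> mspan scalars M B"
    using assms by (auto simp: fd_module_iff)
  obtain C where C: "right_module A N" "finite C" "C \<subseteq> carrier N" "carrier N \<subseteq> mspan scalars N C"
    using assms by (auto simp: fd_module_iff)
  show ?thesis
    by (rule fd_moduleI[OF _ _ _ pair_span[OF B(1) C(1) scalars_carrier B(4) C(4) B(3) C(3)]])
      (use B C in \<open>auto simp: ag_simps right_module_ag right_module_pair\<close>)
qed

lemma fd_dsum:
  assumes "finite J" "\<And>j. j \<in> J \<Longrightarrow> fd_module A (M j)"
  shows "fd_module A (dsum_mod J M)"
proof -
  have "\<forall>j\<in>J. \<exists>B. right_module A (M j) \<and> finite B \<and> B \<subseteq> carrier (M j) \<and>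
      carrier (M j) \<subseteq> mspan scalars (M j) B"
    using assms by (simp add: fd_module_iff)
  then obtain B where B: "\<And>j. j \<in> J \<Longrightarrow> right_module A (M j)" "\<And>j. j \<in> J \<Longrightarrow> finite (B j)"
    "\<And>j. j \<in> J \<Longrightarrow> B j \<subseteq> carrier (M j)" "\<And>j. j \<in> J \<Longrightarrow> carrier (M j) \<subseteq> mspan scalars (M j) (B j)"
    by metis
  show ?thesis
  proof (rule fd_moduleI)
    show "right_module A (dsum_mod J M)" by (rule right_module_dsum[OF ring_A B(1)])
    show "carrier (dsum_mod J M) \<subseteq> mspan scalars (dsum_mod J M) (\<Union>j\<in>J. dsum_inj J M j ` B j)"
      by (rule dsum_span) (use assms(1) B ring_A scalars_carrier in auto)
    have "dsum_inj J M j b \<in> carrier (dsum_mod J M)" if "j \<in> J" "b \<in> B j" for j b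
    proof (rule mod_hom_closed[OF mod_hom_dsum_inj])
      show "b \<in> carrier (M j)" using B(3) that by blast
    qed (use B that in auto)
    then show "(\<Union>j\<in>J. dsum_inj J M j ` B j) \<subseteq> carrier (dsum_mod J M)" by blast
  qed (use B assms(1) in auto)
qed

end

subsection \<open>Projective modules\<close>

text \<open>The lifting property is asked for maps whose image lies in the image of p, rather than
  for surjective p, because p will be a differential. M, N and p are parameters, since a definition
  cannot quantify over carrier types.\<close>

definition lifts ::
  "('k, 'r) module \<Rightarrow> ('r, 'p) module \<Rightarrow> ('r, 'm) module \<Rightarrow> ('r, 'n) module \<Rightarrow> ('m \<Rightarrow> 'n) \<Rightarrow> bool" where
  "lifts A P M N p \<longleftrightarrow> (\<forall>\<phi>\<in>mod_hom A P N. \<phi> ` carrier P \<subseteq> p ` carrier M \<longrightarrow>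
     (\<exists>\<psi>\<in>mod_hom A P M. \<forall>x\<in>carrier P. p (\<psi> x) = \<phi> x))"

lemma liftsD:
  assumes "lifts A P M N p" "\<phi> \<in> mod_hom A P N" "\<And>x. x \<in> carrier P \<Longrightarrow> \<phi> x \<in> p ` carrier M"
  obtains \<psi> where "\<psi> \<in> mod_hom A P M" "\<And>x. x \<in> carrier P \<Longrightarrow> p (\<psi> x) = \<phi> x"
proof -
  have "\<phi> ` carrier P \<subseteq> p ` carrier M" using assms(3) by blast
  then show ?thesis using assms(1,2) that by (metis lifts_def)
qed

lemma lifts_retract:
  assumes "lifts A F M N p" "i \<in> mod_hom A P F" "q \<in> mod_hom A F P"
    "\<And>x. x \<in> carrier P \<Longrightarrow> q (i x) = x"
  shows "lifts A P M N p"
  unfolding lifts_def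
proof (intro ballI impI)
  fix \<phi> assume \<phi>: "\<phi> \<in> mod_hom A P N" "\<phi> ` carrier P \<subseteq> p ` carrier M"
  obtain \<psi> where \<psi>: "\<psi> \<in> mod_hom A F M" "\<And>x. x \<in> carrier F \<Longrightarrow> p (\<psi> x) = \<phi> (q x)"
    by (rule liftsD[OF assms(1) mod_hom_comp[OF \<phi>(1) assms(3)]])
      (use \<phi>(2) mod_hom_closed[OF assms(3)] in auto)
  show "\<exists>\<psi>\<in>mod_hom A P M. \<forall>x\<in>carrier P. p (\<psi> x) = \<phi> x"
    using assms \<psi> mod_hom_comp[OF \<psi>(1) assms(2)] mod_hom_closed[OF assms(2)]
    by (intro bexI[of _ "\<lambda>x. \<psi> (i x)"]) auto
qed

lemma lifts_trivial:
  assumes "right_module A P" "carrier P = {\<zero>\<^bsub>P\<^esub>}" "p \<in> mod_hom A M N"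
    "right_module A M" "right_module A N"
  shows "lifts A P M N p"
  unfolding lifts_def
  using assms
  by (auto intro!: bexI[of _ "\<lambda>_. \<zero>\<^bsub>M\<^esub>"] mod_hom_zero_map simp: mod_hom_zero right_module_ag)

text \<open>The lifts on the summands are assembled by \<open>dsum_copair\<close>; the result agrees
  with \<phi> after p on the images of the summands, and these span.\<close>

lemma lifts_dsum:
  assumes J: "finite J" and P: "\<And>j. j \<in> J \<Longrightarrow> right_module A (P j)"
    and l: "\<And>j. j \<in> J \<Longrightarrow> lifts A (P j) M N p" and p: "p \<in> mod_hom A M N"
    and M: "right_module A M" and N: "right_module A N"
  shows "lifts A (dsum_mod J P) M N p"
  unfolding lifts_def
proof (intro ballI impI)
  fix \<phi> assume \<phi>: "\<phi> \<in> mod_hom A (dsum_mod J P) N" "\<phi> ` carrier (dsum_mod J P) \<subseteq> p ` carrier M"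
  note A = right_module_ring[OF M]
  have inj: "dsum_inj J P j \<in> mod_hom A (P j) (dsum_mod J P)" if "j \<in> J" for j
    by (rule mod_hom_dsum_inj) (use P that in auto)
  have "\<exists>\<psi>\<in>mod_hom A (P j) M. \<forall>x\<in>carrier (P j). p (\<psi> x) = \<phi> (dsum_inj J P j x)" if j: "j \<in> J" for j
    by (rule liftsD[OF l[OF j] mod_hom_comp[OF \<phi>(1) inj[OF j]]])
      (use \<phi>(2) mod_hom_closed[OF inj[OF j]] in \<open>blast\<close>)+
  then obtain \<psi> where \<psi>: "\<And>j. j \<in> J \<Longrightarrow> \<psi> j \<in> mod_hom A (P j) M"
    "\<And>j x. j \<in> J \<Longrightarrow> x \<in> carrier (P j) \<Longrightarrow> p (\<psi> j x) = \<phi> (dsum_inj J P j x)"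
    by metis
  obtain \<chi> where \<chi>: "\<chi> \<in> mod_hom A (dsum_mod J P) M"
    "\<forall>j\<in>J. \<forall>y\<in>carrier (P j). \<chi> (dsum_inj J P j y) = \<psi> j y"
    using dsum_copair[of J A P M \<psi>] J A P M \<psi>(1) by blast
  have "p (\<chi> x) = \<phi> x" if x: "x \<in> carrier (dsum_mod J P)" for x
  proof (rule mod_hom_eq_on_span[OF _ mod_hom_comp[OF p \<chi>(1)] \<phi>(1)])
    show "x \<in> mspan {} (dsum_mod J P) (\<Union>j\<in>J. dsum_inj J P j ` carrier (P j))"
      by (rule subsetD[OF dsum_span_self x]) (use J A P in auto)
    show "right_module A (dsum_mod J P)" by (rule right_module_dsum[OF A P])
    show "(\<Union>j\<in>J. dsum_inj J P j ` carrier (P j)) \<subseteq> carrier (dsum_mod J P)"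
      using mod_hom_closed[OF inj] by blast
  qed (use N \<chi> \<psi> in auto)
  then show "\<exists>\<psi>\<in>mod_hom A (dsum_mod J P) M. \<forall>x\<in>carrier (dsum_mod J P). p (\<psi> x) = \<phi> x"
    by (intro bexI[OF _ \<chi>(1)] ballI)
qed

lemma lifts_pair:
  assumes P: "right_module A P" "right_module A P'"
    and l: "lifts A P M N p" "lifts A P' M N p" and p: "p \<in> mod_hom A M N"
    and M: "right_module A M" and N: "right_module A N"
  shows "lifts A (pair_mod P P') M N p"
  unfolding lifts_def
proof (intro ballI impI)
  fix \<phi> assume \<phi>: "\<phi> \<in> mod_hom A (pair_mod P P') N" "\<phi> ` carrier (pair_mod P P') \<subseteq> p ` carrier M"
  note z = ag_closed(2)[OF right_module_ag[OF P(1)]] ag_closed(2)[OF right_module_ag[OF P(2)]]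
  have i: "(\<lambda>x. (x, \<zero>\<^bsub>P'\<^esub>)) \<in> mod_hom A P (pair_mod P P')"
    "(\<lambda>x. (\<zero>\<^bsub>P\<^esub>, x)) \<in> mod_hom A P' (pair_mod P P')"
    by (intro mod_hom_into_pair mod_hom_id mod_hom_zero_map P)+
  obtain f where f: "f \<in> mod_hom A P M" "\<And>x. x \<in> carrier P \<Longrightarrow> p (f x) = \<phi> (x, \<zero>\<^bsub>P'\<^esub>)"
    by (rule liftsD[OF l(1) mod_hom_comp[OF \<phi>(1) i(1)]]) (use \<phi>(2) z in auto)
  obtain g where g: "g \<in> mod_hom A P' M" "\<And>x. x \<in> carrier P' \<Longrightarrow> p (g x) = \<phi> (\<zero>\<^bsub>P\<^esub>, x)"
    by (rule liftsD[OF l(2) mod_hom_comp[OF \<phi>(1) i(2)]]) (use \<phi>(2) z in auto)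
  have "p (f x \<oplus>\<^bsub>M\<^esub> g y) = \<phi> (x, y)" if xy: "x \<in> carrier P" "y \<in> carrier P'" for x y
  proof -
    have "p (f x \<oplus>\<^bsub>M\<^esub> g y) = \<phi> ((x, \<zero>\<^bsub>P'\<^esub>) \<oplus>\<^bsub>pair_mod P P'\<^esub> (\<zero>\<^bsub>P\<^esub>, y))"
      using xy f g p z \<phi>(1) by (subst mod_hom_add[OF \<phi>(1)]) (auto simp: mod_hom_simps)
    then show ?thesis using xy P by (simp add: ag_simps right_module_ag)
  qed
  then show "\<exists>\<psi>\<in>mod_hom A (pair_mod P P') M. \<forall>x\<in>carrier (pair_mod P P'). p (\<psi> x) = \<phi> x"
    by (intro bexI[OF _ mod_hom_from_pair[OF f(1) g(1) M]]) auto
qed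

lemma right_ideal_mod_simps [simp]:
  "carrier (right_ideal_mod A e) = (\<lambda>x. e \<otimes>\<^bsub>A\<^esub> x) ` carrier A"
  "\<zero>\<^bsub>right_ideal_mod A e\<^esub> = \<zero>\<^bsub>A\<^esub>"
  "x \<oplus>\<^bsub>right_ideal_mod A e\<^esub> y = x \<oplus>\<^bsub>A\<^esub> y"
  "a \<odot>\<^bsub>right_ideal_mod A e\<^esub> x = x \<otimes>\<^bsub>A\<^esub> a"
  by (simp_all add: right_ideal_mod_def)

lemma right_module_regular:
  assumes "ring A"
  shows "right_module A (right_ideal_mod A \<one>\<^bsub>A\<^esub>)"
proof -
  interpret ring A by fact
  have c: "carrier (right_ideal_mod A \<one>\<^bsub>A\<^esub>) = carrier A" by auto
  show ?thesis
  proof (rule right_moduleI)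
    show "abelian_group (right_ideal_mod A \<one>\<^bsub>A\<^esub>)"
    proof (rule abelian_groupI)
      fix x assume "x \<in> carrier (right_ideal_mod A \<one>\<^bsub>A\<^esub>)"
      then show "\<exists>y\<in>carrier (right_ideal_mod A \<one>\<^bsub>A\<^esub>). y \<oplus>\<^bsub>right_ideal_mod A \<one>\<^bsub>A\<^esub>\<^esub> x
          = \<zero>\<^bsub>right_ideal_mod A \<one>\<^bsub>A\<^esub>\<^esub>"
        unfolding c by (intro bexI[of _ "\<ominus>\<^bsub>A\<^esub> x"]) (auto simp: l_neg)
    qed (unfold c, auto simp: a_ac)
  qed (unfold c, auto simp: l_distr r_distr m_assoc assms)
qed

lemma right_module_right_ideal:
  assumes "ring A" "e \<in> carrier A"
  shows "right_module A (right_ideal_mod A e)"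
proof -
  interpret ring A by fact
  show ?thesis
    by (rule right_module_surj[OF right_module_regular[OF assms(1)], of "\<lambda>x. e \<otimes>\<^bsub>A\<^esub> x"])
      (use assms(2) in \<open>auto simp: r_distr m_assoc\<close>)
qed

text \<open>A homomorphism \<phi> out of eA is determined by \<phi>(e). If p maps m to \<phi>(e),
  then x |-> m x is a lift, because \<phi>(e) x = \<phi>(e x) = \<phi>(x).\<close>

lemma lifts_right_ideal:
  assumes A: "ring A" and e: "e \<in> carrier A" "e \<otimes>\<^bsub>A\<^esub> e = e"
    and M: "right_module A M" and p: "p \<in> mod_hom A M N"
  shows "lifts A (right_ideal_mod A e) M N p"
  unfolding lifts_def
proof (intro ballI impI)
  let ?P = "right_ideal_mod A e"
  interpret ring A by fact
  fix \<phi> assume \<phi>: "\<phi> \<in> mod_hom A ?P N" "\<phi> ` carrier ?P \<subseteq> p ` carrier M"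
  have eP: "e \<in> carrier ?P" using imageI[OF e(1), of "\<lambda>x. e \<otimes>\<^bsub>A\<^esub> x"] e(2) by simp
  then obtain m where m: "m \<in> carrier M" "\<phi> e = p m" using \<phi>(2) by blast
  have "(\<lambda>x. x \<odot>\<^bsub>M\<^esub> m) \<in> mod_hom A ?P M"
    by (rule mod_homI) (use e m in \<open>auto simp: right_module_act[OF M] m_assoc\<close>)
  moreover have "p (x \<odot>\<^bsub>M\<^esub> m) = \<phi> x" if x: "x \<in> carrier ?P" for x
  proof -
    have xA: "x \<in> carrier A" and ex: "e \<otimes>\<^bsub>A\<^esub> x = x"
      using x e by (auto simp: e simp flip: m_assoc)
    have "p (x \<odot>\<^bsub>M\<^esub> m) = x \<odot>\<^bsub>N\<^esub> \<phi> e" using xA m p by (simp add: mod_hom_simps)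
    also have "\<dots> = \<phi> (x \<odot>\<^bsub>?P\<^esub> e)" using mod_hom_act[OF \<phi>(1) xA eP] by simp
    finally show ?thesis using ex by simp
  qed
  ultimately show "\<exists>\<psi>\<in>mod_hom A ?P M. \<forall>x\<in>carrier ?P. p (\<psi> x) = \<phi> x"
    by (intro bexI[of _ "\<lambda>x. x \<odot>\<^bsub>M\<^esub> m"] ballI)
qed

lemma fg_projective_lifts:
  assumes "fg_projective A P" "right_module A M" "right_module A N" "p \<in> mod_hom A M N"
  shows "lifts A P M N p"
proof -
  note A = right_module_ring[OF assms(2)]
  interpret ring A by fact
  obtain n i q where "i \<in> mod_hom A P (dsum_mod {..<n::nat} (\<lambda>_. right_ideal_mod A \<one>\<^bsub>A\<^esub>))"
    "q \<in> mod_hom A (dsum_mod {..<n} (\<lambda>_. right_ideal_mod A \<one>\<^bsub>A\<^esub>)) P" "\<forall>x\<in>carrier P. q (i x) = x"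
    using assms(1) unfolding fg_projective_def Let_def by blast
  moreover have "lifts A (dsum_mod {..<n} (\<lambda>_. right_ideal_mod A \<one>\<^bsub>A\<^esub>)) M N p"
    by (intro lifts_dsum lifts_right_ideal right_module_right_ideal A assms) auto
  ultimately show ?thesis by (blast intro: lifts_retract)
qed

text \<open>The converse of \<open>fg_projective_lifts\<close>: a finite spanning set gives a
  surjection p from some A^n onto P, and a lift of the identity along p exhibits P as a
  summand.\<close>

lemma (in kalgebra) fg_projectiveI:
  assumes fd: "fd_module A P"
    and l: "\<And>n p. p \<in> mod_hom A (dsum_mod {..<n::nat} (\<lambda>_. right_ideal_mod A \<one>)) P \<Longrightarrow>
      lifts A P (dsum_mod {..<n} (\<lambda>_. right_ideal_mod A \<one>)) P p"
  shows "fg_projective A P"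
proof -
  obtain B where P: "right_module A P" and B: "finite B" "B \<subseteq> carrier P" "carrier P \<subseteq> mspan scalars P B"
    using fd by (auto simp: fd_module_iff)
  obtain b n where b: "B = b ` {..<n::nat}"
    using B(1) finite_imp_nat_seg_image_inj_on by (metis lessThan_def)
  let ?R = "right_ideal_mod A \<one>"
  let ?F = "dsum_mod {..<n} (\<lambda>_. ?R)"
  note R = right_module_regular[OF ring_A]
  have F: "right_module A ?F" by (intro right_module_dsum R ring_A)
  have h: "(\<lambda>x. x \<odot>\<^bsub>P\<^esub> b j) \<in> mod_hom A ?R P" if "j \<in> {..<n}" for j
  proof -
    have "b j \<in> carrier P" using that B b by auto
    then show ?thesis by (intro mod_homI) (auto simp: right_module_act[OF P])
  qed
  have "\<exists>p\<in>mod_hom A ?F P. \<forall>j\<in>{..<n}. \<forall>y\<in>carrier ?R.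
      p (dsum_inj {..<n} (\<lambda>_. ?R) j y) = y \<odot>\<^bsub>P\<^esub> b j"
    by (rule dsum_copair) (use h P R ring_A in auto)
  then obtain p where p: "p \<in> mod_hom A ?F P"
    "\<forall>j\<in>{..<n}. \<forall>y\<in>carrier ?R. p (dsum_inj {..<n} (\<lambda>_. ?R) j y) = y \<odot>\<^bsub>P\<^esub> b j"
    by blast
  have "x \<in> p ` carrier ?F" if "x \<in> mspan scalars P B" for x
    using that
  proof induction
    case zero
    have "p \<zero>\<^bsub>?F\<^esub> = \<zero>\<^bsub>P\<^esub>" by (rule mod_hom_zero[OF p(1) right_module_ag[OF F] right_module_ag[OF P]])
    then show ?case using ag_closed(2)[OF right_module_ag[OF F]] by (metis imageI)
  next
    case (base g)
    then obtain j where j: "j \<in> {..<n}" "g = b j" using b by auto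
    have 1: "\<one> \<in> carrier ?R" using imageI[OF one_closed, of "\<lambda>x. \<one> \<otimes> x"] by simp
    have "dsum_inj {..<n} (\<lambda>_. ?R) j \<one> \<in> carrier ?F"
      by (rule mod_hom_closed[OF mod_hom_dsum_inj]) (use 1 j R in auto)
    moreover have "p (dsum_inj {..<n} (\<lambda>_. ?R) j \<one>) = g"
      using p(2) j 1 right_module_act(5)[OF P] base B by auto
    ultimately show ?case by (metis imageI)
  next
    case (add x y)
    then obtain u v where "u \<in> carrier ?F" "x = p u" "v \<in> carrier ?F" "y = p v" by blast
    then have "x \<oplus>\<^bsub>P\<^esub> y = p (u \<oplus>\<^bsub>?F\<^esub> v)" "u \<oplus>\<^bsub>?F\<^esub> v \<in> carrier ?F"
      by (simp_all only: mod_hom_add[OF p(1)] ag_closed(1)[OF right_module_ag[OF F]])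
    then show ?case by blast
  next
    case (act a x)
    then obtain u where "u \<in> carrier ?F" "x = p u" by blast
    moreover have "a \<in> carrier A" using act scalars_carrier by auto
    ultimately have "a \<odot>\<^bsub>P\<^esub> x = p (a \<odot>\<^bsub>?F\<^esub> u)" "a \<odot>\<^bsub>?F\<^esub> u \<in> carrier ?F"
      by (simp_all only: mod_hom_act[OF p(1)] right_module_act(1)[OF F])
    then show ?case by blast
  qed
  then have "x \<in> p ` carrier ?F" if "x \<in> carrier P" for x
    using that B(3) by blast
  then obtain i where i: "i \<in> mod_hom A P ?F" "\<And>x. x \<in> carrier P \<Longrightarrow> p (i x) = x"
    using liftsD[OF l[OF p(1)] mod_hom_id, of thesis] by blast
  then show ?thesis unfolding fg_projective_def Let_def using P p(1) i by blast
qed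

context kalgebra
begin

lemma fg_projective_retract:
  assumes "fg_projective A F" "fd_module A F" "right_module A P"
    "i \<in> mod_hom A P F" "q \<in> mod_hom A F P" "\<And>x. x \<in> carrier P \<Longrightarrow> q (i x) = x"
  shows "fg_projective A P"
proof (rule fg_projectiveI)
  show "fd_module A P"
    by (rule fd_surj[OF assms(2,3,5)]) (use assms(4,6) in \<open>force dest: mod_hom_closed\<close>)
  show "lifts A P (dsum_mod {..<n::nat} (\<lambda>_. right_ideal_mod A \<one>)) P p"
    if "p \<in> mod_hom A (dsum_mod {..<n} (\<lambda>_. right_ideal_mod A \<one>)) P" for n p
    by (rule lifts_retract[OF fg_projective_lifts[OF assms(1)] assms(4-6)])
      (use that assms(3) in \<open>auto intro!: right_module_dsum right_module_regular ring_A simp del: dsum_mod_simps\<close>)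
qed

lemma fg_projective_trivial:
  assumes "right_module A P" "carrier P = {\<zero>\<^bsub>P\<^esub>}"
  shows "fg_projective A P"
  by (intro fg_projectiveI fd_trivial lifts_trivial assms right_module_dsum right_module_regular ring_A)

text \<open>The detour through lifting spares the reindexing of A^n + A^m as A^(n+m) that the
  definition would call for.\<close>

lemma fg_projective_pair:
  assumes "fg_projective A P" "fg_projective A P'" "fd_module A P" "fd_module A P'"
  shows "fg_projective A (pair_mod P P')"
proof -
  have "right_module A P" "right_module A P'" using assms by (auto simp: fd_module_iff)
  then show ?thesis
    by (intro fg_projectiveI[OF fd_pair] lifts_pair fg_projective_lifts[of A P]
        fg_projective_lifts[of A P'] right_module_pair assms
        right_module_dsum right_module_regular ring_A)
qed

lemma fg_projective_dsum:
  assumes "finite J" "\<And>j. j \<in> J \<Longrightarrow> fg_projective A (P j)" "\<And>j. j \<in> J \<Longrightarrow> fd_module A (P j)"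
  shows "fg_projective A (dsum_mod J P)"
proof -
  have P: "right_module A (P j)" if "j \<in> J" for j using assms that by (auto simp: fd_module_iff)
  show ?thesis
  proof (rule fg_projectiveI[OF fd_dsum[OF assms(1,3)]])
    fix n :: nat and p
    let ?F = "dsum_mod {..<n} (\<lambda>_. right_ideal_mod A \<one>)"
    assume p: "p \<in> mod_hom A ?F (dsum_mod J P)"
    have F: "right_module A ?F" "right_module A (dsum_mod J P)"
      using P by (auto intro!: right_module_dsum right_module_regular ring_A)
    show "lifts A (dsum_mod J P) ?F (dsum_mod J P) p"
      by (rule lifts_dsum[OF assms(1) P fg_projective_lifts[OF assms(2) F p] p F])
  qed
qed

lemma fd_right_ideal:
  assumes "fd_module A (right_ideal_mod A \<one>)" "e \<in> carrier A"
  shows "fd_module A (right_ideal_mod A e)"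
  by (rule fd_surj[OF assms(1), of _ "\<lambda>x. e \<otimes> x"])
    (use assms(2) in \<open>auto intro!: right_module_right_ideal ring_A mod_homI simp: r_distr m_assoc\<close>)

lemma fg_projective_right_ideal:
  assumes "fd_module A (right_ideal_mod A \<one>)" "e \<in> carrier A" "e \<otimes> e = e"
  shows "fg_projective A (right_ideal_mod A e)"
  by (rule fg_projectiveI[OF fd_right_ideal[OF assms(1,2)]])
    (intro lifts_right_ideal right_module_dsum right_module_regular ring_A assms)

end

subsection \<open>Transport of structure\<close>

text \<open>This is a module only if the kernel relation of \<open>h\<close> is a congruence of \<open>M\<close>.\<close>

definition image_mod :: "('m \<Rightarrow> 'n) \<Rightarrow> ('r, 'm) module \<Rightarrow> ('r, 'n) module" where
  "image_mod h M = (let g = inv_into (carrier M) h in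
    \<lparr> carrier = h ` carrier M, mult = undefined, one = undefined, zero = h \<zero>\<^bsub>M\<^esub>,
      add = (\<lambda>u v. h (g u \<oplus>\<^bsub>M\<^esub> g v)), smult = (\<lambda>a u. h (a \<odot>\<^bsub>M\<^esub> g u)) \<rparr>)"

lemma carrier_image_mod [simp]: "carrier (image_mod h M) = h ` carrier M"
  by (simp add: image_mod_def Let_def)

text \<open>Compatibility of h with sums and multiples makes the operations independent of the
  representatives that \<open>inv_into\<close> picks.\<close>

lemma
  assumes M: "right_module A M"
    and add: "\<And>x x' y y'. \<lbrakk>x \<in> carrier M; x' \<in> carrier M; y \<in> carrier M; y' \<in> carrier M;
      h x = h x'; h y = h y'\<rbrakk> \<Longrightarrow> h (x \<oplus>\<^bsub>M\<^esub> y) = h (x' \<oplus>\<^bsub>M\<^esub> y')"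
    and act: "\<And>a x x'. \<lbrakk>a \<in> carrier A; x \<in> carrier M; x' \<in> carrier M; h x = h x'\<rbrakk>
      \<Longrightarrow> h (a \<odot>\<^bsub>M\<^esub> x) = h (a \<odot>\<^bsub>M\<^esub> x')"
  shows right_module_image_mod: "right_module A (image_mod h M)"
    and mod_hom_image_mod: "h \<in> mod_hom A M (image_mod h M)"
proof -
  have inv: "inv_into (carrier M) h (h x) \<in> carrier M" "h (inv_into (carrier M) h (h x)) = h x"
    if "x \<in> carrier M" for x
    using that by (auto intro: inv_into_into f_inv_into_f)
  have a: "h (x \<oplus>\<^bsub>M\<^esub> y) = h x \<oplus>\<^bsub>image_mod h M\<^esub> h y" if "x \<in> carrier M" "y \<in> carrier M" for x y
    using that by (auto simp: image_mod_def Let_def inv intro!: add)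
  have b: "h (c \<odot>\<^bsub>M\<^esub> x) = c \<odot>\<^bsub>image_mod h M\<^esub> h x" if "c \<in> carrier A" "x \<in> carrier M" for c x
    using that by (auto simp: image_mod_def Let_def inv intro!: act)
  show "right_module A (image_mod h M)"
    by (rule right_module_surj[OF M, of h]) (auto simp: a b, simp add: image_mod_def Let_def)
  show "h \<in> mod_hom A M (image_mod h M)"
    by (rule mod_homI) (auto simp: a b)
qed

section \<open>Complexes\<close>

definition module_complex :: "('k, 'r) module \<Rightarrow> ('r, 'm) cpx \<Rightarrow> bool" where
  "module_complex A X \<longleftrightarrow>
     (\<forall>n. right_module A (obj X n)) \<and>
     (\<forall>n. diff X n \<in> mod_hom A (obj X n) (obj X (n + 1))) \<and>
     (\<forall>n. \<forall>x\<in>carrier (obj X n). diff X (n + 1) (diff X n x) = \<zero>\<^bsub>obj X (n + 1 + 1)\<^esub>)"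

text \<open>Chain maps (e = 0), differentials (e = 1) and homotopies (e = -1) are instances, so that
  closure under sums and composites is proved once.\<close>

definition graded_hom ::
    "('k, 'r) module \<Rightarrow> ('r, 'm) cpx \<Rightarrow> ('r, 'n) cpx \<Rightarrow> int \<Rightarrow> (int \<Rightarrow> 'm \<Rightarrow> 'n) \<Rightarrow> bool" where
  "graded_hom A X Y e f \<longleftrightarrow> (\<forall>n. f n \<in> mod_hom A (obj X n) (obj Y (n + e)))"

lemma bounded_complex_module_complex: "bounded_complex A X \<Longrightarrow> module_complex A X"
  by (auto simp: bounded_complex_def module_complex_def fd_module_def)

lemma projective_complex_bounded: "projective_complex A X \<Longrightarrow> bounded_complex A X"
  by (simp add: projective_complex_def)

context kalgebra
begin

lemma module_complex_rm: "module_complex A X \<Longrightarrow> right_module A (obj X n)"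
  by (simp add: module_complex_def)

lemma module_complex_ag: "module_complex A X \<Longrightarrow> abelian_group (obj X n)"
  using module_complex_rm right_module_ag by blast

lemma graded_hom_diff: "module_complex A X \<Longrightarrow> graded_hom A X X 1 (diff X)"
  by (simp add: module_complex_def graded_hom_def)

lemma diff_hom: "module_complex A X \<Longrightarrow> k = n + 1 \<Longrightarrow> diff X n \<in> mod_hom A (obj X n) (obj X k)"
  by (simp add: module_complex_def)

lemma diff_diff:
  "\<lbrakk>module_complex A X; x \<in> carrier (obj X m); k = m + 1\<rbrakk>
    \<Longrightarrow> diff X k (diff X m x) = \<zero>\<^bsub>obj X (k + 1)\<^esub>"
  by (simp add: module_complex_def)

text \<open>In the membership rule the target degree is a variable k with k = m + e, so that
  rewriting also applies where degrees agree only up to arithmetic.\<close>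

lemma graded_hom_simps:
  assumes "graded_hom A X Y e f" "module_complex A X" "module_complex A Y"
  shows "\<lbrakk>x \<in> carrier (obj X m); k = m + e\<rbrakk> \<Longrightarrow> f m x \<in> carrier (obj Y k)"
    and "\<lbrakk>x \<in> carrier (obj X m); y \<in> carrier (obj X m)\<rbrakk>
      \<Longrightarrow> f m (x \<oplus>\<^bsub>obj X m\<^esub> y) = f m x \<oplus>\<^bsub>obj Y (m + e)\<^esub> f m y"
    and "f m \<zero>\<^bsub>obj X m\<^esub> = \<zero>\<^bsub>obj Y (m + e)\<^esub>"
    and "x \<in> carrier (obj X m) \<Longrightarrow> f m (\<ominus>\<^bsub>obj X m\<^esub> x) = \<ominus>\<^bsub>obj Y (m + e)\<^esub> f m x"
proof -
  have h: "f m \<in> mod_hom A (obj X m) (obj Y (m + e))"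
    using assms(1) by (simp add: graded_hom_def)
  note ag = module_complex_ag[OF assms(2), of m] module_complex_ag[OF assms(3), of "m + e"]
  show "\<lbrakk>x \<in> carrier (obj X m); k = m + e\<rbrakk> \<Longrightarrow> f m x \<in> carrier (obj Y k)"
    "\<lbrakk>x \<in> carrier (obj X m); y \<in> carrier (obj X m)\<rbrakk>
      \<Longrightarrow> f m (x \<oplus>\<^bsub>obj X m\<^esub> y) = f m x \<oplus>\<^bsub>obj Y (m + e)\<^esub> f m y"
    "f m \<zero>\<^bsub>obj X m\<^esub> = \<zero>\<^bsub>obj Y (m + e)\<^esub>"
    "x \<in> carrier (obj X m) \<Longrightarrow> f m (\<ominus>\<^bsub>obj X m\<^esub> x) = \<ominus>\<^bsub>obj Y (m + e)\<^esub> f m x"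
    using mod_hom_simps[OF h] ag by simp_all
qed

lemma diff_simps:
  assumes "module_complex A X"
  shows "\<lbrakk>x \<in> carrier (obj X m); k = m + 1\<rbrakk> \<Longrightarrow> diff X m x \<in> carrier (obj X k)"
    and "\<lbrakk>x \<in> carrier (obj X m); y \<in> carrier (obj X m)\<rbrakk>
      \<Longrightarrow> diff X m (x \<oplus>\<^bsub>obj X m\<^esub> y) = diff X m x \<oplus>\<^bsub>obj X (m + 1)\<^esub> diff X m y"
    and "diff X m \<zero>\<^bsub>obj X m\<^esub> = \<zero>\<^bsub>obj X (m + 1)\<^esub>"
    and "x \<in> carrier (obj X m) \<Longrightarrow> diff X m (\<ominus>\<^bsub>obj X m\<^esub> x) = \<ominus>\<^bsub>obj X (m + 1)\<^esub> diff X m x"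
    and "\<lbrakk>x \<in> carrier (obj X m); k = m + 1\<rbrakk>
      \<Longrightarrow> diff X k (diff X m x) = \<zero>\<^bsub>obj X (k + 1)\<^esub>"
  by (fact graded_hom_simps[OF graded_hom_diff[OF assms] assms assms] diff_diff[OF assms])+

lemma graded_hom_comp:
  assumes "graded_hom A X Y e f" "graded_hom A Y Z e' g"
  shows "graded_hom A X Z (e + e') (\<lambda>n x. g (n + e) (f n x))"
  unfolding graded_hom_def
proof
  fix n
  have "f n \<in> mod_hom A (obj X n) (obj Y (n + e))" using assms(1) by (simp add: graded_hom_def)
  moreover have "g (n + e) \<in> mod_hom A (obj Y (n + e)) (obj Z (n + (e + e')))"
    using assms(2) unfolding graded_hom_def add.assoc[symmetric] by blast
  ultimately show "(\<lambda>x. g (n + e) (f n x)) \<in> mod_hom A (obj X n) (obj Z (n + (e + e')))"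
    by (rule mod_hom_comp[rotated])
qed

lemma graded_hom_plus:
  assumes "graded_hom A X Y e f" "graded_hom A X Y e g" "module_complex A Y"
  shows "graded_hom A X Y e (\<lambda>n x. f n x \<oplus>\<^bsub>obj Y (n + e)\<^esub> g n x)"
  using assms by (auto simp: graded_hom_def intro!: mod_hom_plus module_complex_rm)

lemma graded_hom_uminus:
  assumes "graded_hom A X Y e f" "module_complex A Y"
  shows "graded_hom A X Y e (\<lambda>n x. \<ominus>\<^bsub>obj Y (n + e)\<^esub> f n x)"
  using assms by (auto simp: graded_hom_def intro!: mod_hom_uminus module_complex_rm)

lemma graded_hom_zero: "module_complex A Y \<Longrightarrow> graded_hom A X Y e (\<lambda>n x. \<zero>\<^bsub>obj Y (n + e)\<^esub>)"
  by (auto simp: graded_hom_def intro!: mod_hom_zero_map module_complex_rm)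

subsection \<open>Chain maps and homotopies\<close>

lemma chain_map_graded: "chain_map A X Y f \<Longrightarrow> graded_hom A X Y 0 f"
  by (simp add: chain_map_def graded_hom_def)

lemma chain_mapI:
  assumes "graded_hom A X Y 0 f"
    and "\<And>n x. x \<in> carrier (obj X n) \<Longrightarrow> f (n + 1) (diff X n x) = diff Y n (f n x)"
  shows "chain_map A X Y f"
  using assms by (simp add: chain_map_def graded_hom_def)

lemma chain_map_simps:
  assumes "chain_map A X Y f" "module_complex A X" "module_complex A Y"
  shows "x \<in> carrier (obj X m) \<Longrightarrow> f m x \<in> carrier (obj Y m)"
    and "\<lbrakk>x \<in> carrier (obj X m); y \<in> carrier (obj X m)\<rbrakk>
      \<Longrightarrow> f m (x \<oplus>\<^bsub>obj X m\<^esub> y) = f m x \<oplus>\<^bsub>obj Y m\<^esub> f m y"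
    and "f m \<zero>\<^bsub>obj X m\<^esub> = \<zero>\<^bsub>obj Y m\<^esub>"
    and "x \<in> carrier (obj X m) \<Longrightarrow> f m (\<ominus>\<^bsub>obj X m\<^esub> x) = \<ominus>\<^bsub>obj Y m\<^esub> f m x"
    and "\<lbrakk>x \<in> carrier (obj X m); k = m + 1\<rbrakk> \<Longrightarrow> f k (diff X m x) = diff Y m (f m x)"
  using graded_hom_simps[OF chain_map_graded[OF assms(1)] assms(2,3)] assms(1)
  by (simp_all add: chain_map_def)

lemma chain_map_hom: "chain_map A X Y f \<Longrightarrow> f n \<in> mod_hom A (obj X n) (obj Y n)"
  by (simp add: chain_map_def)

lemma chain_map_id: "chain_map A X X (\<lambda>n x. x)"
  by (simp add: chain_map_def mod_hom_id)

lemma chain_map_comp: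
  assumes g: "chain_map A Y Z g" and f: "chain_map A X Y f"
  shows "chain_map A X Z (comp_maps g f)"
proof (rule chain_mapI)
  show "graded_hom A X Z 0 (comp_maps g f)"
    using graded_hom_comp[OF chain_map_graded[OF f] chain_map_graded[OF g]]
    by (simp add: comp_maps_def o_def)
qed (use f g mod_hom_closed[OF chain_map_hom[OF f]] in \<open>simp add: chain_map_def comp_maps_def\<close>)

lemma chain_map_zero:
  assumes "module_complex A X" "module_complex A Y"
  shows "chain_map A X Y (\<lambda>n x. \<zero>\<^bsub>obj Y n\<^esub>)"
  using graded_hom_zero[OF assms(2), of X 0] diff_simps(3)[OF assms(2)]
  by (intro chain_mapI) auto

lemma chain_map_plus:
  assumes "chain_map A X Y f" "chain_map A X Y g" "module_complex A X" "module_complex A Y"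
  shows "chain_map A X Y (\<lambda>n x. f n x \<oplus>\<^bsub>obj Y n\<^esub> g n x)"
  using graded_hom_plus[OF chain_map_graded[OF assms(1)] chain_map_graded[OF assms(2)] assms(4)]
  by (intro chain_mapI)
    (simp_all add: chain_map_simps[OF assms(1,3,4)] chain_map_simps[OF assms(2-4)] diff_simps[OF assms(4)])

lemma chain_map_uminus:
  assumes "chain_map A X Y f" "module_complex A X" "module_complex A Y"
  shows "chain_map A X Y (\<lambda>n x. \<ominus>\<^bsub>obj Y n\<^esub> f n x)"
  using graded_hom_uminus[OF chain_map_graded[OF assms(1)] assms(3)]
  by (intro chain_mapI) (simp_all add: chain_map_simps[OF assms(1-3)] diff_simps[OF assms(3)])

lemma homotopicI:
  assumes "graded_hom A X Y (- 1) h"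
    and "\<And>n x. x \<in> carrier (obj X n) \<Longrightarrow>
      f n x = g n x \<oplus>\<^bsub>obj Y n\<^esub> (diff Y (n - 1) (h n x) \<oplus>\<^bsub>obj Y n\<^esub> h (n + 1) (diff X n x))"
  shows "homotopic A X Y f g"
  using assms by (auto simp: homotopic_def graded_hom_def)

lemma homotopicE:
  assumes "homotopic A X Y f g"
  obtains h where "graded_hom A X Y (- 1) h"
    "\<And>n x. x \<in> carrier (obj X n) \<Longrightarrow>
      f n x = g n x \<oplus>\<^bsub>obj Y n\<^esub> (diff Y (n - 1) (h n x) \<oplus>\<^bsub>obj Y n\<^esub> h (n + 1) (diff X n x))"
  using assms by (auto simp: homotopic_def graded_hom_def)

lemma homotopic_eq:
  assumes "chain_map A X Y g" "module_complex A X" "module_complex A Y"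
    and "\<And>n x. x \<in> carrier (obj X n) \<Longrightarrow> f n x = g n x"
  shows "homotopic A X Y f g"
proof (rule homotopicI)
  show "graded_hom A X Y (- 1) (\<lambda>n x. \<zero>\<^bsub>obj Y (n + - 1)\<^esub>)" by (rule graded_hom_zero[OF assms(3)])
  fix n x assume x: "x \<in> carrier (obj X n)"
  note s = module_complex_ag[OF assms(3)] ag_simps diff_simps[OF assms(3)]
    chain_map_simps[OF assms(1-3)]
  show "f n x = g n x \<oplus>\<^bsub>obj Y n\<^esub> (diff Y (n - 1) \<zero>\<^bsub>obj Y (n + - 1)\<^esub> \<oplus>\<^bsub>obj Y n\<^esub> \<zero>\<^bsub>obj Y (n + 1 + - 1)\<^esub>)"
    using x assms(4)[OF x] by (simp add: s)
qed

lemmas homotopic_refl = homotopic_eq[OF _ _ _ refl]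

lemma homotopic_sym:
  assumes f: "chain_map A X Y f" and g: "chain_map A X Y g"
    and X: "module_complex A X" and Y: "module_complex A Y" and fg: "homotopic A X Y f g"
  shows "homotopic A X Y g f"
proof -
  obtain h where h: "graded_hom A X Y (- 1) h" and
    eq: "\<And>n x. x \<in> carrier (obj X n) \<Longrightarrow>
      f n x = g n x \<oplus>\<^bsub>obj Y n\<^esub> (diff Y (n - 1) (h n x) \<oplus>\<^bsub>obj Y n\<^esub> h (n + 1) (diff X n x))"
    using homotopicE[OF fg] by metis
  note s = module_complex_ag[OF Y] ag_simps diff_simps[OF Y] diff_simps[OF X]
    chain_map_simps[OF g X Y] graded_hom_simps[OF h X Y]
  show ?thesis
    by (rule homotopicI[OF graded_hom_uminus[OF h Y]]) (simp add: s eq ag_ac)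
qed

lemma homotopic_trans:
  assumes X: "module_complex A X" and Y: "module_complex A Y" and k: "chain_map A X Y k"
    and fg: "homotopic A X Y f g" and gk: "homotopic A X Y g k"
  shows "homotopic A X Y f k"
proof -
  obtain h where h: "graded_hom A X Y (- 1) h" and
    eq: "\<And>n x. x \<in> carrier (obj X n) \<Longrightarrow>
      f n x = g n x \<oplus>\<^bsub>obj Y n\<^esub> (diff Y (n - 1) (h n x) \<oplus>\<^bsub>obj Y n\<^esub> h (n + 1) (diff X n x))"
    using homotopicE[OF fg] by metis
  obtain h' where h': "graded_hom A X Y (- 1) h'" and
    eq': "\<And>n x. x \<in> carrier (obj X n) \<Longrightarrow>
      g n x = k n x \<oplus>\<^bsub>obj Y n\<^esub> (diff Y (n - 1) (h' n x) \<oplus>\<^bsub>obj Y n\<^esub> h' (n + 1) (diff X n x))"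
    using homotopicE[OF gk] by metis
  note s = module_complex_ag[OF Y] ag_simps diff_simps[OF Y] diff_simps[OF X]
    chain_map_simps[OF k X Y] graded_hom_simps[OF h X Y] graded_hom_simps[OF h' X Y]
  show ?thesis
    by (rule homotopicI[OF graded_hom_plus[OF h h' Y]]) (simp add: s eq eq' ag_ac)
qed

lemma homotopic_comp_left:
  assumes X: "module_complex A X" and Y: "module_complex A Y" and Z: "module_complex A Z"
    and g: "chain_map A Y Z g" and f': "chain_map A X Y f'" and ff': "homotopic A X Y f f'"
  shows "homotopic A X Z (comp_maps g f) (comp_maps g f')"
proof -
  obtain h where h: "graded_hom A X Y (- 1) h" and
    eq: "\<And>n x. x \<in> carrier (obj X n) \<Longrightarrow>
      f n x = f' n x \<oplus>\<^bsub>obj Y n\<^esub> (diff Y (n - 1) (h n x) \<oplus>\<^bsub>obj Y n\<^esub> h (n + 1) (diff X n x))"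
    using homotopicE[OF ff'] by metis
  note s = module_complex_ag[OF Y] ag_simps diff_simps[OF Y] diff_simps[OF X]
    chain_map_simps[OF g Y Z] chain_map_simps[OF f' X Y] graded_hom_simps[OF h X Y]
  show ?thesis
  proof (rule homotopicI)
    show "graded_hom A X Z (- 1) (\<lambda>n x. g (n + - 1) (h n x))"
      using graded_hom_comp[OF h chain_map_graded[OF g]] by simp
  qed (simp add: s eq comp_maps_def)
qed

lemma homotopic_comp_right:
  assumes X: "module_complex A X" and Y: "module_complex A Y" and Z: "module_complex A Z"
    and g: "chain_map A X Y g" and f': "chain_map A Y Z f'" and ff': "homotopic A Y Z f f'"
  shows "homotopic A X Z (comp_maps f g) (comp_maps f' g)"
proof -
  obtain h where h: "graded_hom A Y Z (- 1) h" and
    eq: "\<And>n x. x \<in> carrier (obj Y n) \<Longrightarrow>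
      f n x = f' n x \<oplus>\<^bsub>obj Z n\<^esub> (diff Z (n - 1) (h n x) \<oplus>\<^bsub>obj Z n\<^esub> h (n + 1) (diff Y n x))"
    using homotopicE[OF ff'] by metis
  note s = chain_map_simps[OF g X Y]
  show ?thesis
  proof (rule homotopicI)
    show "graded_hom A X Z (- 1) (\<lambda>n x. h n (g n x))"
      using graded_hom_comp[OF chain_map_graded[OF g] h] by simp
  qed (simp add: s eq comp_maps_def)
qed

lemma homotopic_congs:
  assumes "\<And>n x. x \<in> carrier (obj X n) \<Longrightarrow> f n x = f' n x"
    and "\<And>n x. x \<in> carrier (obj X n) \<Longrightarrow> g n x = g' n x"
  shows "homotopic A X Y f g \<longleftrightarrow> homotopic A X Y f' g'"
  using assms by (auto simp: homotopic_def)

subsection \<open>Quasi-isomorphisms\<close>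

lemma coset_eq_iff:
  assumes G: "abelian_group G" and H: "additive_subgroup H G" and x: "x \<in> carrier G" "y \<in> carrier G"
  shows "H +>\<^bsub>G\<^esub> x = H +>\<^bsub>G\<^esub> y \<longleftrightarrow> x \<oplus>\<^bsub>G\<^esub> \<ominus>\<^bsub>G\<^esub> y \<in> H"
proof -
  interpret abelian_group G by fact
  interpret abelian_subgroup H G by (rule abelian_subgroupI3[OF H G])
  show ?thesis
    using a_rcos_module[OF x(2,1)] a_repr_independence'[of x y] a_rcos_self[of x] x by blast
qed

lemma additive_subgroup_coboundaries:
  assumes X: "module_complex A X"
  shows "additive_subgroup (coboundaries X n) (obj X n)"
proof -
  interpret abelian_group "obj X n" by (rule module_complex_ag[OF X])
  interpret p: abelian_group "obj X (n - 1)" by (rule module_complex_ag[OF X])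
  note s = diff_simps[OF X]
  show ?thesis
  proof (rule additive_subgroupI, rule subgroup.intro)
    have "diff X (n - 1) \<zero>\<^bsub>obj X (n - 1)\<^esub> \<in> coboundaries X n"
      unfolding coboundaries_def by blast
    then show "\<one>\<^bsub>add_monoid (obj X n)\<^esub> \<in> coboundaries X n" by (simp add: s)
  next
    fix a assume "a \<in> coboundaries X n"
    then obtain x where x: "x \<in> carrier (obj X (n - 1))" "a = diff X (n - 1) x"
      by (auto simp: coboundaries_def)
    then have "\<ominus>\<^bsub>obj X n\<^esub> a = diff X (n - 1) (\<ominus>\<^bsub>obj X (n - 1)\<^esub> x)" by (simp add: s)
    then show "inv\<^bsub>add_monoid (obj X n)\<^esub> a \<in> coboundaries X n"
      using x by (auto simp: coboundaries_def a_inv_def[symmetric])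
    fix b assume "b \<in> coboundaries X n"
    then obtain y where y: "y \<in> carrier (obj X (n - 1))" "b = diff X (n - 1) y"
      by (auto simp: coboundaries_def)
    with x have "a \<oplus>\<^bsub>obj X n\<^esub> b = diff X (n - 1) (x \<oplus>\<^bsub>obj X (n - 1)\<^esub> y)" by (simp add: s)
    then show "a \<otimes>\<^bsub>add_monoid (obj X n)\<^esub> b \<in> coboundaries X n"
      using x y by (auto simp: coboundaries_def)
  qed (auto simp: coboundaries_def s)
qed

lemma chain_map_cocycles:
  assumes "chain_map A X Y f" "module_complex A X" "module_complex A Y" "z \<in> cocycles X n"
  shows "f n z \<in> cocycles Y n"
  using assms(4) chain_map_simps(1,5)[OF assms(1-3), of z n] chain_map_simps(3)[OF assms(1-3), of "n + 1"]
  by (auto simp: cocycles_def)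

lemma chain_map_coboundaries:
  assumes "chain_map A X Y f" "module_complex A X" "module_complex A Y" "z \<in> coboundaries X n"
  shows "f n z \<in> coboundaries Y n"
proof -
  obtain x where "x \<in> carrier (obj X (n - 1))" "z = diff X (n - 1) x"
    using assms(4) by (auto simp: coboundaries_def)
  then show ?thesis
    using chain_map_simps(1,5)[OF assms(1-3), of x "n - 1"] by (auto simp: coboundaries_def)
qed

text \<open>Since f maps coboundaries to coboundaries, the set that \<open>quasi_iso\<close> forms
  from a coset is again a single coset.\<close>

lemma coset_image:
  assumes f: "chain_map A X Y f" and X: "module_complex A X" and Y: "module_complex A Y"
    and z: "z \<in> carrier (obj X n)"
  shows "coboundaries Y n <+>\<^bsub>obj Y n\<^esub> f n ` (coboundaries X n +>\<^bsub>obj X n\<^esub> z)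
    = coboundaries Y n +>\<^bsub>obj Y n\<^esub> f n z"
proof -
  interpret BX: additive_subgroup "coboundaries X n" "obj X n"
    by (rule additive_subgroup_coboundaries[OF X])
  interpret BY: additive_subgroup "coboundaries Y n" "obj Y n"
    by (rule additive_subgroup_coboundaries[OF Y])
  note s = module_complex_ag[OF X] module_complex_ag[OF Y] ag_simps chain_map_simps[OF f X Y] z
  have "\<exists>b''\<in>coboundaries Y n. b \<oplus>\<^bsub>obj Y n\<^esub> f n (b' \<oplus>\<^bsub>obj X n\<^esub> z) = b'' \<oplus>\<^bsub>obj Y n\<^esub> f n z"
    if "b \<in> coboundaries Y n" "b' \<in> coboundaries X n" for b b'
    using that chain_map_coboundaries[OF f X Y that(2)] BX.a_Hcarr[OF that(2)] BY.a_Hcarr[OF that(1)]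
    by (intro bexI[of _ "b \<oplus>\<^bsub>obj Y n\<^esub> f n b'"]) (auto simp: s ag_ac)
  moreover have "\<exists>b\<in>coboundaries Y n. \<exists>b'\<in>coboundaries X n.
      b'' \<oplus>\<^bsub>obj Y n\<^esub> f n z = b \<oplus>\<^bsub>obj Y n\<^esub> f n (b' \<oplus>\<^bsub>obj X n\<^esub> z)" if "b'' \<in> coboundaries Y n" for b''
    using that BX.zero_closed by (intro bexI[of _ b''] bexI[of _ "\<zero>\<^bsub>obj X n\<^esub>"]) (auto simp: s)
  ultimately show ?thesis
    by (auto simp: set_add_def' a_r_coset_def')
qed

text \<open>Bijectivity on cosets becomes two statements on cocycles: only coboundaries go to
  coboundaries, and every cocycle is hit up to a coboundary. Quasi-isomorphisms are handled by
  element chases in this form.\<close>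

lemma quasi_iso_iff:
  fixes X :: "('r, 'b) cpx" and Y :: "('r, 'c) cpx"
  assumes X: "module_complex A X" and Y: "module_complex A Y"
  shows "quasi_iso A X Y f \<longleftrightarrow> chain_map A X Y f \<and>
    (\<forall>n. \<forall>z\<in>cocycles X n. f n z \<in> coboundaries Y n \<longrightarrow> z \<in> coboundaries X n) \<and>
    (\<forall>n. \<forall>y\<in>cocycles Y n. \<exists>z\<in>cocycles X n. \<exists>b\<in>coboundaries Y n. y = b \<oplus>\<^bsub>obj Y n\<^esub> f n z)"
proof (cases "chain_map A X Y f")
  case f: True
  have "bij_betw (\<lambda>C. coboundaries Y n <+>\<^bsub>obj Y n\<^esub> (f n ` C)) (cohomology X n) (cohomology Y n) \<longleftrightarrow>
    (\<forall>z\<in>cocycles X n. f n z \<in> coboundaries Y n \<longrightarrow> z \<in> coboundaries X n) \<and>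
    (\<forall>y\<in>cocycles Y n. \<exists>z\<in>cocycles X n. \<exists>b\<in>coboundaries Y n. y = b \<oplus>\<^bsub>obj Y n\<^esub> f n z)" for n
  proof -
    let ?B = "coboundaries X n" and ?B' = "coboundaries Y n"
    note aX = module_complex_ag[OF X, of n] and aY = module_complex_ag[OF Y, of n]
    note BX = additive_subgroup_coboundaries[OF X, of n]
    note BY = additive_subgroup_coboundaries[OF Y, of n]
    note s = ag_simps chain_map_simps[OF f X Y] aX aY
    have car: "z \<in> carrier (obj X n)" if "z \<in> cocycles X n" for z
      using that by (simp add: cocycles_def)
    have car': "z \<in> carrier (obj Y n)" if "z \<in> cocycles Y n" for z
      using that by (simp add: cocycles_def)
    have sub: "z \<oplus>\<^bsub>obj X n\<^esub> \<ominus>\<^bsub>obj X n\<^esub> z' \<in> cocycles X n" if "z \<in> cocycles X n" "z' \<in> cocycles X n" for z z'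
      using that by (simp add: cocycles_def s diff_simps[OF X] module_complex_ag[OF X])
    have zc: "\<zero>\<^bsub>obj X n\<^esub> \<in> cocycles X n"
      by (simp add: cocycles_def s diff_simps[OF X])
    \<comment> \<open>Two classes agree iff the difference of their cocycles is a coboundary, so
      injectivity need only be tested at the zero class.\<close>
    have inj: "inj_on (\<lambda>C. ?B' <+>\<^bsub>obj Y n\<^esub> (f n ` C)) (cohomology X n) \<longleftrightarrow>
      (\<forall>z\<in>cocycles X n. f n z \<in> ?B' \<longrightarrow> z \<in> ?B)"
    proof -
      have "inj_on (\<lambda>C. ?B' <+>\<^bsub>obj Y n\<^esub> (f n ` C)) (cohomology X n) \<longleftrightarrow>
        (\<forall>z\<in>cocycles X n. \<forall>z'\<in>cocycles X n.
          ?B' +>\<^bsub>obj Y n\<^esub> f n z = ?B' +>\<^bsub>obj Y n\<^esub> f n z' \<longrightarrow> ?B +>\<^bsub>obj X n\<^esub> z = ?B +>\<^bsub>obj X n\<^esub> z')"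
        by (simp add: inj_on_def cohomology_def coset_image[OF f X Y] car)
      also have "\<dots> \<longleftrightarrow> (\<forall>z\<in>cocycles X n. \<forall>z'\<in>cocycles X n.
          f n (z \<oplus>\<^bsub>obj X n\<^esub> \<ominus>\<^bsub>obj X n\<^esub> z') \<in> ?B' \<longrightarrow> z \<oplus>\<^bsub>obj X n\<^esub> \<ominus>\<^bsub>obj X n\<^esub> z' \<in> ?B)"
        by (simp add: coset_eq_iff[OF aX BX] coset_eq_iff[OF aY BY] car s)
      also have "\<dots> \<longleftrightarrow> (\<forall>z\<in>cocycles X n. f n z \<in> ?B' \<longrightarrow> z \<in> ?B)"
      proof (intro iffI ballI impI)
        fix z assume a: "\<forall>z\<in>cocycles X n. \<forall>z'\<in>cocycles X n.
          f n (z \<oplus>\<^bsub>obj X n\<^esub> \<ominus>\<^bsub>obj X n\<^esub> z') \<in> ?B' \<longrightarrow> z \<oplus>\<^bsub>obj X n\<^esub> \<ominus>\<^bsub>obj X n\<^esub> z' \<in> ?B"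
          and z: "z \<in> cocycles X n" "f n z \<in> ?B'"
        have "z \<oplus>\<^bsub>obj X n\<^esub> \<ominus>\<^bsub>obj X n\<^esub> \<zero>\<^bsub>obj X n\<^esub> = z" using car[OF z(1)] by (simp add: s)
        then show "z \<in> ?B" using a z zc by metis
      qed (use sub in blast)
      finally show ?thesis .
    qed
    have "(\<lambda>C. ?B' <+>\<^bsub>obj Y n\<^esub> (f n ` C)) ` cohomology X n = (\<lambda>z. ?B' +>\<^bsub>obj Y n\<^esub> f n z) ` cocycles X n"
      unfolding cohomology_def image_image
      by (rule image_cong) (simp_all add: coset_image[OF f X Y] car)
    also have "\<dots> = cohomology Y n \<longleftrightarrow>
      (\<forall>y\<in>cocycles Y n. \<exists>z\<in>cocycles X n. ?B' +>\<^bsub>obj Y n\<^esub> y = ?B' +>\<^bsub>obj Y n\<^esub> f n z)"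
    proof -
      have "(\<lambda>z. G (h z)) ` S = G ` T \<longleftrightarrow> (\<forall>y\<in>T. \<exists>z\<in>S. G y = G (h z))"
        if "\<And>z. z \<in> S \<Longrightarrow> h z \<in> T" for G :: "'c \<Rightarrow> 'c set" and h :: "'b \<Rightarrow> 'c" and S T
        using that by (auto simp: image_iff set_eq_iff)
      from this[of "cocycles X n" "f n" "cocycles Y n" "\<lambda>y. ?B' +>\<^bsub>obj Y n\<^esub> y"]
      show ?thesis using chain_map_cocycles[OF f X Y] unfolding cohomology_def by blast
    qed
    also have "\<dots> \<longleftrightarrow> (\<forall>y\<in>cocycles Y n. \<exists>z\<in>cocycles X n. \<exists>b\<in>?B'. y = b \<oplus>\<^bsub>obj Y n\<^esub> f n z)"
    proof -
      have "?B' +>\<^bsub>obj Y n\<^esub> y = ?B' +>\<^bsub>obj Y n\<^esub> f n z \<longleftrightarrow> (\<exists>b\<in>?B'. y = b \<oplus>\<^bsub>obj Y n\<^esub> f n z)"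
        if yz: "y \<in> cocycles Y n" "z \<in> cocycles X n" for y z
      proof -
        have c: "y \<in> carrier (obj Y n)" "f n z \<in> carrier (obj Y n)"
          using car'[OF yz(1)] car[OF yz(2)] by (auto simp: s)
        have "y = b \<oplus>\<^bsub>obj Y n\<^esub> f n z \<longleftrightarrow> b = y \<oplus>\<^bsub>obj Y n\<^esub> \<ominus>\<^bsub>obj Y n\<^esub> f n z" if "b \<in> ?B'" for b
          using ag_move[OF aY c(1) additive_subgroup.a_Hcarr[OF BY that] c(2)] .
        then have "(\<exists>b\<in>?B'. y = b \<oplus>\<^bsub>obj Y n\<^esub> f n z)
            \<longleftrightarrow> (\<exists>b\<in>?B'. b = y \<oplus>\<^bsub>obj Y n\<^esub> \<ominus>\<^bsub>obj Y n\<^esub> f n z)"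
          by (rule bex_cong[OF refl])
        then show ?thesis unfolding coset_eq_iff[OF aY BY c] by simp
      qed
      then show ?thesis by (intro ball_cong bex_cong refl)
    qed
    finally show ?thesis unfolding bij_betw_def inj by blast
  qed
  then show ?thesis using f by (simp add: quasi_iso_def all_conj_distrib)
qed (simp add: quasi_iso_def)

lemma quasi_isoI:
  assumes "module_complex A X" "module_complex A Y" "chain_map A X Y f"
    and "\<And>n z. \<lbrakk>z \<in> cocycles X n; f n z \<in> coboundaries Y n\<rbrakk> \<Longrightarrow> z \<in> coboundaries X n"
    and "\<And>n y. y \<in> cocycles Y n \<Longrightarrow> \<exists>z\<in>cocycles X n. \<exists>b\<in>coboundaries Y n. y = b \<oplus>\<^bsub>obj Y n\<^esub> f n z"
  shows "quasi_iso A X Y f"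
  using assms by (simp add: quasi_iso_iff)

lemma quasi_iso_chain_map: "quasi_iso A X Y f \<Longrightarrow> chain_map A X Y f"
  by (simp add: quasi_iso_def)

lemma quasi_iso_comp:
  assumes X: "module_complex A X" and Y: "module_complex A Y" and Z: "module_complex A Z"
    and f: "quasi_iso A X Y f" and g: "quasi_iso A Y Z g"
  shows "quasi_iso A X Z (comp_maps g f)"
proof -
  note cf = quasi_iso_chain_map[OF f] and cg = quasi_iso_chain_map[OF g]
  note f' = f[unfolded quasi_iso_iff[OF X Y]] and g' = g[unfolded quasi_iso_iff[OF Y Z]]
  show ?thesis
  proof (rule quasi_isoI[OF X Z chain_map_comp[OF cg cf]])
    fix n z assume z: "z \<in> cocycles X n" "comp_maps g f n z \<in> coboundaries Z n"
    then show "z \<in> coboundaries X n"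
      using f' g' chain_map_cocycles[OF cf X Y z(1)] by (auto simp: comp_maps_def)
  next
    fix n y assume "y \<in> cocycles Z n"
    then obtain u b where u: "u \<in> cocycles Y n" "b \<in> coboundaries Z n" "y = b \<oplus>\<^bsub>obj Z n\<^esub> g n u"
      using g' by blast
    obtain z c where z: "z \<in> cocycles X n" "c \<in> coboundaries Y n" "u = c \<oplus>\<^bsub>obj Y n\<^esub> f n z"
      using f' u(1) by blast
    note BY = additive_subgroup_coboundaries[OF Y, of n] and BZ = additive_subgroup_coboundaries[OF Z, of n]
    have car: "c \<in> carrier (obj Y n)" "b \<in> carrier (obj Z n)" "z \<in> carrier (obj X n)"
      using additive_subgroup.a_Hcarr[OF BY z(2)] additive_subgroup.a_Hcarr[OF BZ u(2)] z(1)
      by (auto simp: cocycles_def)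
    have "y = (b \<oplus>\<^bsub>obj Z n\<^esub> g n c) \<oplus>\<^bsub>obj Z n\<^esub> comp_maps g f n z"
      using car by (simp add: u z comp_maps_def chain_map_simps[OF cg Y Z] chain_map_simps[OF cf X Y]
          ag_simps ag_ac module_complex_ag[OF Z])
    moreover have "b \<oplus>\<^bsub>obj Z n\<^esub> g n c \<in> coboundaries Z n"
      using additive_subgroup.a_closed[OF BZ u(2)] chain_map_coboundaries[OF cg Y Z z(2)] by blast
    ultimately show "\<exists>z\<in>cocycles X n. \<exists>b\<in>coboundaries Z n. y = b \<oplus>\<^bsub>obj Z n\<^esub> comp_maps g f n z"
      using z(1) by blast
  qed
qed

text \<open>On a cocycle z the term h d of the homotopy vanishes, so f z and g z differ by the
  coboundary d h z.\<close>

lemma quasi_iso_homotopic: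
  assumes X: "module_complex A X" and Y: "module_complex A Y"
    and f: "quasi_iso A X Y f" and g: "chain_map A X Y g" and gf: "homotopic A X Y f g"
  shows "quasi_iso A X Y g"
proof -
  note f' = f[unfolded quasi_iso_iff[OF X Y]]
  have eq: "\<exists>b\<in>coboundaries Y n. f n z = b \<oplus>\<^bsub>obj Y n\<^esub> g n z" if "z \<in> cocycles X n" for n z
  proof -
    obtain h where h: "graded_hom A X Y (- 1) h" and
      eq: "\<And>n x. x \<in> carrier (obj X n) \<Longrightarrow>
        f n x = g n x \<oplus>\<^bsub>obj Y n\<^esub> (diff Y (n - 1) (h n x) \<oplus>\<^bsub>obj Y n\<^esub> h (n + 1) (diff X n x))"
      using homotopicE[OF gf] by metis
    note s = module_complex_ag[OF Y] ag_simps diff_simps[OF Y] diff_simps[OF X]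
      chain_map_simps[OF g X Y] graded_hom_simps[OF h X Y]
    have "f n z = diff Y (n - 1) (h n z) \<oplus>\<^bsub>obj Y n\<^esub> g n z"
      using that eq[of z n] graded_hom_simps(3)[OF h X Y, of "n + 1"]
      by (simp add: cocycles_def s ag_ac)
    moreover have "diff Y (n - 1) (h n z) \<in> coboundaries Y n"
      using that by (auto simp: cocycles_def coboundaries_def s)
    ultimately show ?thesis by blast
  qed
  note BY = additive_subgroup_coboundaries[OF Y]
  show ?thesis
  proof (rule quasi_isoI[OF X Y g])
    fix n z assume z: "z \<in> cocycles X n" "g n z \<in> coboundaries Y n"
    then have "f n z \<in> coboundaries Y n" using eq[OF z(1)] additive_subgroup.a_closed[OF BY] by metis
    then show "z \<in> coboundaries X n" using f' z by blast
  next
    fix n y assume "y \<in> cocycles Y n"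
    then obtain z b where z: "z \<in> cocycles X n" "b \<in> coboundaries Y n" "y = b \<oplus>\<^bsub>obj Y n\<^esub> f n z"
      using f' by blast
    obtain c where c: "c \<in> coboundaries Y n" "f n z = c \<oplus>\<^bsub>obj Y n\<^esub> g n z" using eq[OF z(1)] by blast
    have car: "c \<in> carrier (obj Y n)" "b \<in> carrier (obj Y n)" "z \<in> carrier (obj X n)"
      using additive_subgroup.a_Hcarr[OF BY c(1)] additive_subgroup.a_Hcarr[OF BY z(2)] z(1)
      by (auto simp: cocycles_def)
    have "y = (b \<oplus>\<^bsub>obj Y n\<^esub> c) \<oplus>\<^bsub>obj Y n\<^esub> g n z"
      using car by (simp add: z c chain_map_simps[OF g X Y] ag_simps ag_ac module_complex_ag[OF Y])
    then show "\<exists>z\<in>cocycles X n. \<exists>b\<in>coboundaries Y n. y = b \<oplus>\<^bsub>obj Y n\<^esub> g n z"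
      using z(1) additive_subgroup.a_closed[OF BY z(2) c(1)] by blast
  qed
qed

end

lemma ag_cancel_mid:
  assumes "abelian_group M"
  shows "\<lbrakk>x \<in> carrier M; y \<in> carrier M\<rbrakk> \<Longrightarrow> x \<oplus>\<^bsub>M\<^esub> (y \<oplus>\<^bsub>M\<^esub> \<ominus>\<^bsub>M\<^esub> x) = y"
    and "\<lbrakk>x \<in> carrier M; y \<in> carrier M\<rbrakk> \<Longrightarrow> \<ominus>\<^bsub>M\<^esub> x \<oplus>\<^bsub>M\<^esub> (y \<oplus>\<^bsub>M\<^esub> x) = y"
  using ag_ac[OF assms] ag_simps[OF assms] by auto

context kalgebra
begin

lemma bounded_complex_iff:
  "bounded_complex A X \<longleftrightarrow> module_complex A X \<and> (\<forall>n. fd_module A (obj X n)) \<and>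
     (\<exists>N. \<forall>n. \<bar>n\<bar> > N \<longrightarrow> carrier (obj X n) = {\<zero>\<^bsub>obj X n\<^esub>})"
  by (auto simp: bounded_complex_def module_complex_def fd_module_def)

subsection \<open>Shifts and mapping cones\<close>

lemma shift_simps [simp]:
  "obj (shift r X) n = obj X (n + r)"
  "diff (shift r X) n x = (if even r then diff X (n + r) x
     else \<ominus>\<^bsub>obj X (n + 1 + r)\<^esub> diff X (n + r) x)"
  by (simp_all add: shift_def)

lemma module_complex_shift:
  assumes X: "module_complex A X"
  shows "module_complex A (shift r X)"
  unfolding module_complex_def
proof (intro conjI allI ballI)
  fix n
  have d: "diff X (n + r) \<in> mod_hom A (obj X (n + r)) (obj X (n + 1 + r))"
    by (rule diff_hom[OF X]) simp
  show "diff (shift r X) n \<in> mod_hom A (obj (shift r X) n) (obj (shift r X) (n + 1))"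
  proof (cases "even r")
    case True
    then have "diff (shift r X) n = diff X (n + r)" by (simp add: fun_eq_iff)
    then show ?thesis using d by simp
  next
    case False
    then have "diff (shift r X) n = (\<lambda>x. \<ominus>\<^bsub>obj X (n + 1 + r)\<^esub> diff X (n + r) x)" by (simp add: fun_eq_iff)
    then show ?thesis using mod_hom_uminus[OF d module_complex_rm[OF X]] by simp
  qed
  fix x assume "x \<in> carrier (obj (shift r X) n)"
  then have x: "x \<in> carrier (obj X (n + r))" by simp
  have e: "n + 1 + r = n + r + 1" "n + 1 + 1 + r = n + r + 1 + 1" by simp_all
  show "diff (shift r X) (n + 1) (diff (shift r X) n x) = \<zero>\<^bsub>obj (shift r X) (n + 1 + 1)\<^esub>"
    using x unfolding shift_simps e
    by (simp add: diff_simps[OF X] module_complex_ag[OF X] ag_simps)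
qed (simp add: module_complex_rm[OF X])

lemma bounded_complex_shift:
  assumes "bounded_complex A X"
  shows "bounded_complex A (shift r X)"
proof -
  obtain N where "\<And>n. \<bar>n\<bar> > N \<Longrightarrow> carrier (obj X n) = {\<zero>\<^bsub>obj X n\<^esub>}"
    using assms by (auto simp: bounded_complex_iff)
  then have "\<forall>n. \<bar>n\<bar> > N + \<bar>r\<bar> \<longrightarrow> carrier (obj (shift r X) n) = {\<zero>\<^bsub>obj (shift r X) n\<^esub>}"
    by simp
  then show ?thesis using assms module_complex_shift unfolding bounded_complex_iff by auto
qed

lemma projective_complex_shift:
  "projective_complex A X \<Longrightarrow> projective_complex A (shift r X)"
  by (simp add: projective_complex_def bounded_complex_shift)

lemma chain_map_shift:
  assumes "chain_map A X Y f" "module_complex A X" "module_complex A Y"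
  shows "chain_map A (shift r X) (shift r Y) (\<lambda>n. f (n + r))"
proof (rule chain_mapI)
  show "graded_hom A (shift r X) (shift r Y) 0 (\<lambda>n. f (n + r))"
    using assms(1) by (simp add: graded_hom_def chain_map_def)
  fix n x assume "x \<in> carrier (obj (shift r X) n)"
  then have x: "x \<in> carrier (obj X (n + r))" by simp
  have e: "n + 1 + r = n + r + 1" by simp
  show "f (n + 1 + r) (diff (shift r X) n x) = diff (shift r Y) n (f (n + r) x)"
    using x unfolding shift_simps e
    by (simp add: chain_map_simps[OF assms] diff_simps[OF assms(2)])
qed

lemma mapping_cone_simps [simp]:
  "obj (mapping_cone X Y f) n = pair_mod (obj X (n + 1)) (obj Y n)"
  "diff (mapping_cone X Y f) n (x, y) =
    (\<ominus>\<^bsub>obj X (n + 1 + 1)\<^esub> diff X (n + 1) x, f (n + 1) x \<oplus>\<^bsub>obj Y (n + 1)\<^esub> diff Y n y)"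
  by (simp_all add: mapping_cone_def)

lemma module_complex_cone:
  assumes X: "module_complex A X" and Y: "module_complex A Y" and f: "chain_map A X Y f"
  shows "module_complex A (mapping_cone X Y f)"
  unfolding module_complex_def
proof (intro conjI allI ballI)
  fix n
  show "right_module A (obj (mapping_cone X Y f) n)"
    by (simp add: right_module_pair module_complex_rm[OF X] module_complex_rm[OF Y])
  have "diff (mapping_cone X Y f) n = (\<lambda>p. (\<ominus>\<^bsub>obj X (n + 1 + 1)\<^esub> diff X (n + 1) (fst p),
      f (n + 1) (fst p) \<oplus>\<^bsub>obj Y (n + 1)\<^esub> diff Y n (snd p)))"
    by (auto simp: fun_eq_iff)
  moreover have "\<dots> \<in> mod_hom A (pair_mod (obj X (n + 1)) (obj Y n))
      (pair_mod (obj X (n + 1 + 1)) (obj Y (n + 1)))"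
    by (intro mod_hom_into_pair mod_hom_uminus mod_hom_from_pair chain_map_hom[OF f]
        mod_hom_comp[OF diff_hom[OF X refl] mod_hom_fst] diff_hom[OF Y refl]
        module_complex_rm[OF X] module_complex_rm[OF Y])
  ultimately show "diff (mapping_cone X Y f) n
      \<in> mod_hom A (obj (mapping_cone X Y f) n) (obj (mapping_cone X Y f) (n + 1))"
    by simp
  fix z assume "z \<in> carrier (obj (mapping_cone X Y f) n)"
  then show "diff (mapping_cone X Y f) (n + 1) (diff (mapping_cone X Y f) n z)
      = \<zero>\<^bsub>obj (mapping_cone X Y f) (n + 1 + 1)\<^esub>"
    by (auto simp: diff_simps[OF X] diff_simps[OF Y] chain_map_simps[OF f X Y] ag_simps
        module_complex_ag[OF X] module_complex_ag[OF Y])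
qed

lemma bounded_complex_cone:
  assumes X: "bounded_complex A X" and Y: "bounded_complex A Y" and f: "chain_map A X Y f"
  shows "bounded_complex A (mapping_cone X Y f)"
proof -
  obtain N where N: "\<And>n. \<bar>n\<bar> > N \<Longrightarrow> carrier (obj X n) = {\<zero>\<^bsub>obj X n\<^esub>}"
    using X by (auto simp: bounded_complex_iff)
  obtain N' where N': "\<And>n. \<bar>n\<bar> > N' \<Longrightarrow> carrier (obj Y n) = {\<zero>\<^bsub>obj Y n\<^esub>}"
    using Y by (auto simp: bounded_complex_iff)
  have "\<forall>n. \<bar>n\<bar> > max (N + 1) N' \<longrightarrow>
      carrier (obj (mapping_cone X Y f) n) = {\<zero>\<^bsub>obj (mapping_cone X Y f) n\<^esub>}"
    using N N' by auto
  moreover have "\<forall>n. fd_module A (obj (mapping_cone X Y f) n)"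
    using X Y by (auto simp: bounded_complex_iff intro!: fd_pair)
  moreover have "module_complex A (mapping_cone X Y f)"
    using X Y f by (auto simp: bounded_complex_iff intro!: module_complex_cone)
  ultimately show ?thesis unfolding bounded_complex_iff by blast
qed

lemma projective_complex_cone:
  assumes "projective_complex A X" "projective_complex A Y" "chain_map A X Y f"
  shows "projective_complex A (mapping_cone X Y f)"
  using assms bounded_complex_cone[OF assms(1,2)[THEN projective_complex_bounded] assms(3)]
  by (auto simp: projective_complex_def bounded_complex_iff intro!: fg_projective_pair)

text \<open>An element chase that combines both halves of \<open>quasi_iso_iff\<close>. A cocycle
  (z, y) of the cone has d z = 0 and s z = - d y. Injectivity gives z = d z', and then s z' + y is a
  cocycle, to which surjectivity applies.\<close>

lemma cone_acyclic:
  assumes Z: "module_complex A Z" and Y: "module_complex A Y" and s: "quasi_iso A Z Y s"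
    and c: "c \<in> cocycles (mapping_cone Z Y s) n"
  shows "c \<in> coboundaries (mapping_cone Z Y s) n"
proof -
  note cs = quasi_iso_chain_map[OF s]
  note s' = s[unfolded quasi_iso_iff[OF Z Y]]
  note r = diff_simps[OF Z] diff_simps[OF Y] chain_map_simps[OF cs Z Y]
    module_complex_ag[OF Z] module_complex_ag[OF Y] ag_simps
  obtain z y where c': "c = (z, y)" by (cases c)
  have z: "z \<in> carrier (obj Z (n + 1))" and y: "y \<in> carrier (obj Y n)"
    and dz: "\<ominus>\<^bsub>obj Z (n + 1 + 1)\<^esub> diff Z (n + 1) z = \<zero>\<^bsub>obj Z (n + 1 + 1)\<^esub>"
    and sz: "s (n + 1) z \<oplus>\<^bsub>obj Y (n + 1)\<^esub> diff Y n y = \<zero>\<^bsub>obj Y (n + 1)\<^esub>"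
    using c by (auto simp: c' cocycles_def)
  have "diff Z (n + 1) z = \<ominus>\<^bsub>obj Z (n + 1 + 1)\<^esub> (\<ominus>\<^bsub>obj Z (n + 1 + 1)\<^esub> diff Z (n + 1) z)"
    using z by (simp add: r)
  also have "\<dots> = \<zero>\<^bsub>obj Z (n + 1 + 1)\<^esub>" unfolding dz by (simp add: r)
  finally have zc: "z \<in> cocycles Z (n + 1)" using z by (simp add: cocycles_def)
  have "s (n + 1) z = diff Y n (\<ominus>\<^bsub>obj Y n\<^esub> y)"
    by (rule ag_diff_zero[OF module_complex_ag[OF Y, of "n + 1"]]) (use z y sz in \<open>simp_all add: r\<close>)
  then have "s (n + 1) z \<in> coboundaries Y (n + 1)"
    using imageI[OF ag_closed(3)[OF module_complex_ag[OF Y] y], of "diff Y n"]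
    by (simp add: coboundaries_def)
  then have "z \<in> coboundaries Z (n + 1)" using s' zc by blast
  then obtain z' where z': "z' \<in> carrier (obj Z n)" "z = diff Z n z'"
    by (auto simp: coboundaries_def)
  have "s n z' \<oplus>\<^bsub>obj Y n\<^esub> y \<in> cocycles Y n"
    using z' y sz by (simp add: cocycles_def r)
  then obtain w b where w: "w \<in> cocycles Z n" "b \<in> coboundaries Y n"
    "s n z' \<oplus>\<^bsub>obj Y n\<^esub> y = b \<oplus>\<^bsub>obj Y n\<^esub> s n w"
    using s' by blast
  obtain b' where b': "b' \<in> carrier (obj Y (n - 1))" "b = diff Y (n - 1) b'"
    using w(2) by (auto simp: coboundaries_def)
  have wc: "w \<in> carrier (obj Z n)" "diff Z n w = \<zero>\<^bsub>obj Z (n + 1)\<^esub>" using w(1) by (auto simp: cocycles_def)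
  have bc: "b \<in> carrier (obj Y n)" using b' by (simp add: r)
  have "y = \<ominus>\<^bsub>obj Y n\<^esub> s n z' \<oplus>\<^bsub>obj Y n\<^esub> (s n z' \<oplus>\<^bsub>obj Y n\<^esub> y)" using z' y by (simp add: r)
  also have "\<dots> = s n (w \<oplus>\<^bsub>obj Z n\<^esub> \<ominus>\<^bsub>obj Z n\<^esub> z') \<oplus>\<^bsub>obj Y n\<^esub> b"
    unfolding w(3) using wc z' bc by (simp add: r ag_ac)
  \<comment> \<open>The cone differential negates its first component, whence w - z' and not z' -
    w.\<close>
  finally have "diff (mapping_cone Z Y s) (n - 1) (w \<oplus>\<^bsub>obj Z n\<^esub> \<ominus>\<^bsub>obj Z n\<^esub> z', b') = (z, y)"
    using wc z' b' by (simp add: r)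
  moreover have "(w \<oplus>\<^bsub>obj Z n\<^esub> \<ominus>\<^bsub>obj Z n\<^esub> z', b') \<in> carrier (obj (mapping_cone Z Y s) (n - 1))"
    using wc z' b' by (simp add: r)
  ultimately show ?thesis unfolding coboundaries_def c' by (metis image_eqI)
qed

lemma homotopicD:
  assumes "homotopic A X Y f g"
  shows "\<exists>h. graded_hom A X Y (- 1) h \<and> (\<forall>n. \<forall>x\<in>carrier (obj X n).
    f n x = g n x \<oplus>\<^bsub>obj Y n\<^esub> (diff Y (n - 1) (h n x) \<oplus>\<^bsub>obj Y n\<^esub> h (n + 1) (diff X n x)))"
  using assms by (auto simp: homotopic_def graded_hom_def)

subsection \<open>Lifting along quasi-isomorphisms\<close>

text \<open>The homotopy is built downwards from the top degree. Once it is known above degree k,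
  the map f - h d in degree k takes values in the cocycles, which are coboundaries, and projectivity
  of the term of X lifts it through the differential of C.\<close>

lemma acyclic_null_homotopic:
  assumes P: "projective_complex A X" and C: "module_complex A C"
    and ac: "\<And>n c. c \<in> cocycles C n \<Longrightarrow> c \<in> coboundaries C n"
    and f: "chain_map A X C f"
  shows "homotopic A X C f (\<lambda>n x. \<zero>\<^bsub>obj C n\<^esub>)"
proof -
  have X: "module_complex A X"
    using P projective_complex_bounded bounded_complex_module_complex by blast
  obtain N where N: "\<And>n. \<bar>n\<bar> > N \<Longrightarrow> carrier (obj X n) = {\<zero>\<^bsub>obj X n\<^esub>}"
    using P by (auto simp: projective_complex_def bounded_complex_def)
  note s = diff_simps[OF X] diff_simps[OF C] chain_map_simps[OF f X C]
    module_complex_ag[OF X] module_complex_ag[OF C] ag_simps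
  \<comment> \<open>Beyond the bound N every homotopy works, as X is zero there.\<close>
  have triv: "f n x = diff C (n - 1) (h n x) \<oplus>\<^bsub>obj C n\<^esub> h (n + 1) (diff X n x)"
    if "\<bar>n\<bar> > N" "x \<in> carrier (obj X n)" "graded_hom A X C (- 1) h" for n x h
  proof -
    have "x = \<zero>\<^bsub>obj X n\<^esub>" using N that by blast
    moreover have "h (n + 1) \<zero>\<^bsub>obj X (n + 1)\<^esub> = \<zero>\<^bsub>obj C n\<^esub>"
      using graded_hom_simps(3)[OF that(3) X C, of "n + 1"] by simp
    ultimately show ?thesis by (simp add: s graded_hom_simps[OF that(3) X C])
  qed
  have step: "\<exists>h. graded_hom A X C (- 1) h \<and> (\<forall>n \<ge> N + 1 - int m. \<forall>x\<in>carrier (obj X n).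
      f n x = diff C (n - 1) (h n x) \<oplus>\<^bsub>obj C n\<^esub> h (n + 1) (diff X n x))" for m
  proof (induction m)
    case 0
    show ?case
      using triv[OF _ _ graded_hom_zero[OF C, of X "- 1"]]
      by (intro exI[of _ "\<lambda>n x. \<zero>\<^bsub>obj C (n + - 1)\<^esub>"] conjI graded_hom_zero[OF C]) auto
  next
    case (Suc m)
    then obtain h where h: "graded_hom A X C (- 1) h" and
      eq: "\<And>n x. n \<ge> N + 1 - int m \<Longrightarrow> x \<in> carrier (obj X n) \<Longrightarrow>
        f n x = diff C (n - 1) (h n x) \<oplus>\<^bsub>obj C n\<^esub> h (n + 1) (diff X n x)"
      by blast
    note hs = graded_hom_simps[OF h X C]
    define k where "k = N + 1 - int (Suc m)"
    let ?g = "\<lambda>x. f k x \<oplus>\<^bsub>obj C k\<^esub> \<ominus>\<^bsub>obj C k\<^esub> h (k + 1) (diff X k x)"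
    have "h (k + 1) \<in> mod_hom A (obj X (k + 1)) (obj C k)"
      using h unfolding graded_hom_def by (metis add_uminus_conv_diff add_diff_cancel_right')
    then have g: "?g \<in> mod_hom A (obj X k) (obj C k)"
      by (intro mod_hom_plus mod_hom_uminus chain_map_hom[OF f] mod_hom_comp[OF _ diff_hom[OF X refl]]
          module_complex_rm[OF C])
    have "?g x \<in> diff C (k - 1) ` carrier (obj C (k - 1))" if x: "x \<in> carrier (obj X k)" for x
    proof -
      have "f (k + 1) (diff X k x) = diff C k (h (k + 1) (diff X k x))"
        using eq[of "k + 1" "diff X k x"] x hs(3)[of "k + 2"]
        by (simp add: s hs k_def add.commute[of "1::int"])
      then have "diff C k (?g x) = \<zero>\<^bsub>obj C (k + 1)\<^esub>"
        using x by (simp add: s hs)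
      then have "?g x \<in> cocycles C k" using x by (simp add: cocycles_def s hs)
      then show ?thesis using ac by (auto simp: coboundaries_def)
    qed
    moreover have "lifts A (obj X k) (obj C (k - 1)) (obj C k) (diff C (k - 1))"
      using P by (intro fg_projective_lifts module_complex_rm[OF C] diff_hom[OF C])
        (auto simp: projective_complex_def)
    ultimately obtain l where l: "l \<in> mod_hom A (obj X k) (obj C (k - 1))"
      "\<And>x. x \<in> carrier (obj X k) \<Longrightarrow> diff C (k - 1) (l x) = ?g x"
      using liftsD[OF _ g, of "obj C (k - 1)" "diff C (k - 1)" thesis] by blast
    have "graded_hom A X C (- 1) (h(k := l))"
      using h l(1) by (simp add: graded_hom_def)
    moreover have "f n x = diff C (n - 1) ((h(k := l)) n x) \<oplus>\<^bsub>obj C n\<^esub> (h(k := l)) (n + 1) (diff X n x)"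
      if n: "n \<ge> k" and x: "x \<in> carrier (obj X n)" for n x
    proof (cases "n = k")
      case True
      then show ?thesis using x l(2)[of x] by (simp add: s hs ag_ac)
    next
      case False
      then have "n \<ge> N + 1 - int m" using n by (simp add: k_def)
      then show ?thesis using False n eq x by simp
    qed
    ultimately show ?case unfolding k_def by blast
  qed
  \<comment> \<open>After 2|N| + 2 steps the treated range starts below -|N|, so all degrees with
    |n| <= N are covered; \<open>triv\<close> does the others.\<close>
  obtain h where h: "graded_hom A X C (- 1) h" and
    eq: "\<And>n x. n \<ge> N + 1 - int (nat (2 * \<bar>N\<bar> + 2)) \<Longrightarrow> x \<in> carrier (obj X n) \<Longrightarrow>
      f n x = diff C (n - 1) (h n x) \<oplus>\<^bsub>obj C n\<^esub> h (n + 1) (diff X n x)"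
    using step[of "nat (2 * \<bar>N\<bar> + 2)"] by blast
  have "f n x = diff C (n - 1) (h n x) \<oplus>\<^bsub>obj C n\<^esub> h (n + 1) (diff X n x)"
    if x: "x \<in> carrier (obj X n)" for n x
  proof (cases "\<bar>n\<bar> > N")
    case True
    then show ?thesis by (rule triv[OF _ x h])
  next
    case False
    then show ?thesis by (intro eq x) linarith
  qed
  then show ?thesis
    by (intro homotopicI[OF h]) (simp add: s graded_hom_simps[OF h X C])
qed

text \<open>The map (0, g) into the cone of s is null-homotopic because the cone is acyclic. A
  null-homotopy has two components: the one in Z is the lift t, the one in Y a homotopy between s t
  and g.\<close>

lemma lift_exists:
  assumes P: "projective_complex A X" and Z: "module_complex A Z" and Y: "module_complex A Y"
    and s: "quasi_iso A Z Y s" and g: "chain_map A X Y g"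
  shows "\<exists>t. chain_map A X Z t \<and> homotopic A X Y (comp_maps s t) g"
proof -
  have X: "module_complex A X"
    using P projective_complex_bounded bounded_complex_module_complex by blast
  note cs = quasi_iso_chain_map[OF s]
  let ?C = "mapping_cone Z Y s"
  note C = module_complex_cone[OF Z Y cs]
  note r = diff_simps[OF X] diff_simps[OF Y] diff_simps[OF Z] chain_map_simps[OF cs Z Y]
    chain_map_simps[OF g X Y]
    module_complex_ag[OF X] module_complex_ag[OF Y] module_complex_ag[OF Z] ag_simps
  have cm: "chain_map A X ?C (\<lambda>n x. (\<zero>\<^bsub>obj Z (n + 1)\<^esub>, g n x))"
  proof (rule chain_mapI)
    show "graded_hom A X ?C 0 (\<lambda>n x. (\<zero>\<^bsub>obj Z (n + 1)\<^esub>, g n x))"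
      by (simp add: graded_hom_def mod_hom_into_pair mod_hom_zero_map module_complex_rm[OF Z] chain_map_hom[OF g])
  qed (simp add: r)
  have "homotopic A X ?C (\<lambda>n x. (\<zero>\<^bsub>obj Z (n + 1)\<^esub>, g n x)) (\<lambda>n x. \<zero>\<^bsub>obj ?C n\<^esub>)"
    by (rule acyclic_null_homotopic[OF P C cone_acyclic[OF Z Y s] cm])
  then obtain h where h: "graded_hom A X ?C (- 1) h" and
    "\<forall>n. \<forall>x\<in>carrier (obj X n). (\<zero>\<^bsub>obj Z (n + 1)\<^esub>, g n x) =
      \<zero>\<^bsub>obj ?C n\<^esub> \<oplus>\<^bsub>obj ?C n\<^esub> (diff ?C (n - 1) (h n x) \<oplus>\<^bsub>obj ?C n\<^esub> h (n + 1) (diff X n x))"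
    by (blast dest: homotopicD)
  note eq = this(2)[rule_format]
  have hh: "h n \<in> mod_hom A (obj X n) (pair_mod (obj Z n) (obj Y (n - 1)))" for n
    using h by (simp add: graded_hom_def)
  define t where "t n x = fst (h n x)" for n x
  define k where "k n x = snd (h n x)" for n x
  have t: "t n \<in> mod_hom A (obj X n) (obj Z n)" for n
    using mod_hom_comp[OF mod_hom_fst hh[of n]] by (simp add: t_def[abs_def])
  have k: "k n \<in> mod_hom A (obj X n) (obj Y (n - 1))" for n
    using mod_hom_comp[OF mod_hom_snd hh[of n]] by (simp add: k_def[abs_def])
  have gt: "graded_hom A X Z 0 t" and gk: "graded_hom A X Y (- 1) k"
    using t k by (simp_all add: graded_hom_def)
  note q = r graded_hom_simps[OF gt X Z] graded_hom_simps[OF gk X Y]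
  have e1: "\<ominus>\<^bsub>obj Z (n + 1)\<^esub> diff Z n (t n x) \<oplus>\<^bsub>obj Z (n + 1)\<^esub> t (n + 1) (diff X n x)
      = \<zero>\<^bsub>obj Z (n + 1)\<^esub>"
    and e2: "g n x = (s n (t n x) \<oplus>\<^bsub>obj Y n\<^esub> diff Y (n - 1) (k n x)) \<oplus>\<^bsub>obj Y n\<^esub> k (n + 1) (diff X n x)"
    if x: "x \<in> carrier (obj X n)" for n x
  proof -
    have p: "h m y = (t m y, k m y)" for m y by (simp add: t_def k_def)
    note E = eq[OF x, symmetric, unfolded p]
    show "\<ominus>\<^bsub>obj Z (n + 1)\<^esub> diff Z n (t n x) \<oplus>\<^bsub>obj Z (n + 1)\<^esub> t (n + 1) (diff X n x)
      = \<zero>\<^bsub>obj Z (n + 1)\<^esub>"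
      "g n x = (s n (t n x) \<oplus>\<^bsub>obj Y n\<^esub> diff Y (n - 1) (k n x)) \<oplus>\<^bsub>obj Y n\<^esub> k (n + 1) (diff X n x)"
      using E x by (simp_all add: q)
  qed
  have ct: "chain_map A X Z t"
  proof (rule chain_mapI[OF gt])
    fix n x assume x: "x \<in> carrier (obj X n)"
    show "t (n + 1) (diff X n x) = diff Z n (t n x)"
      by (rule ag_diff_zero[OF module_complex_ag[OF Z, of "n + 1"]])
        (use x e1[OF x] in \<open>simp_all add: q ag_ac\<close>)
  qed
  have "homotopic A X Y g (comp_maps s t)"
    by (rule homotopicI[OF gk]) (use e2 in \<open>simp add: comp_maps_def q ag_ac\<close>)
  from homotopic_sym[OF g chain_map_comp[OF cs ct] X Y this] show ?thesis using ct by blast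
qed

text \<open>A null-homotopy k of s a turns a into a chain map (a, - k) from X[1] to the cone of s.
  That map is null-homotopic, and the Z-component of its null-homotopy, with the sign changed,
  contracts a.\<close>

lemma lift_null:
  assumes P: "projective_complex A X" and Z: "module_complex A Z" and Y: "module_complex A Y"
    and s: "quasi_iso A Z Y s" and a: "chain_map A X Z a"
    and sa: "homotopic A X Y (comp_maps s a) (\<lambda>n x. \<zero>\<^bsub>obj Y n\<^esub>)"
  shows "homotopic A X Z a (\<lambda>n x. \<zero>\<^bsub>obj Z n\<^esub>)"
proof -
  have X: "module_complex A X"
    using P projective_complex_bounded bounded_complex_module_complex by blast
  note cs = quasi_iso_chain_map[OF s]
  let ?C = "mapping_cone Z Y s" and ?X = "shift 1 X"
  note C = module_complex_cone[OF Z Y cs]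
  obtain k where k: "graded_hom A X Y (- 1) k" and
    eq: "\<And>n x. x \<in> carrier (obj X n) \<Longrightarrow> s n (a n x) =
      \<zero>\<^bsub>obj Y n\<^esub> \<oplus>\<^bsub>obj Y n\<^esub> (diff Y (n - 1) (k n x) \<oplus>\<^bsub>obj Y n\<^esub> k (n + 1) (diff X n x))"
    using homotopicE[OF sa] unfolding comp_maps_def o_def by metis
  note r = diff_simps[OF X] diff_simps[OF Y] diff_simps[OF Z] chain_map_simps[OF cs Z Y]
    chain_map_simps[OF a X Z] graded_hom_simps[OF k X Y]
    module_complex_ag[OF X] module_complex_ag[OF Y] module_complex_ag[OF Z] ag_simps
  have kh: "k (n + 1) \<in> mod_hom A (obj X (n + 1)) (obj Y n)" for n
    using k unfolding graded_hom_def by (metis add_uminus_conv_diff add_diff_cancel_right')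
  have cm: "chain_map A ?X ?C (\<lambda>n x. (a (n + 1) x, \<ominus>\<^bsub>obj Y n\<^esub> k (n + 1) x))"
  proof (rule chain_mapI)
    show "graded_hom A ?X ?C 0 (\<lambda>n x. (a (n + 1) x, \<ominus>\<^bsub>obj Y n\<^esub> k (n + 1) x))"
      by (simp add: graded_hom_def mod_hom_into_pair mod_hom_uminus kh module_complex_rm[OF Y] chain_map_hom[OF a])
    fix n x assume "x \<in> carrier (obj ?X n)"
    then have x: "x \<in> carrier (obj X (n + 1))" by simp
    show "(a (n + 1 + 1) (diff ?X n x), \<ominus>\<^bsub>obj Y (n + 1)\<^esub> k (n + 1 + 1) (diff ?X n x)) =
        diff ?C n (a (n + 1) x, \<ominus>\<^bsub>obj Y n\<^esub> k (n + 1) x)"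
      using x eq[OF x] graded_hom_simps(4)[OF k X Y, of "diff X (n + 1) x" "n + 2"]
      by (simp add: r ag_ac ag_cancel_mid add.commute[of "1::int"])
  qed
  have "homotopic A ?X ?C (\<lambda>n x. (a (n + 1) x, \<ominus>\<^bsub>obj Y n\<^esub> k (n + 1) x)) (\<lambda>n x. \<zero>\<^bsub>obj ?C n\<^esub>)"
    by (rule acyclic_null_homotopic[OF projective_complex_shift[OF P] C cone_acyclic[OF Z Y s] cm])
  then obtain h where h: "graded_hom A ?X ?C (- 1) h" and
    "\<forall>n. \<forall>x\<in>carrier (obj ?X n). (a (n + 1) x, \<ominus>\<^bsub>obj Y n\<^esub> k (n + 1) x) =
      \<zero>\<^bsub>obj ?C n\<^esub> \<oplus>\<^bsub>obj ?C n\<^esub> (diff ?C (n - 1) (h n x) \<oplus>\<^bsub>obj ?C n\<^esub> h (n + 1) (diff ?X n x))"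
    by (blast dest: homotopicD)
  note heq = this(2)[rule_format]
  \<comment> \<open>The homotopy h is indexed by the degrees of X[1]; re-indexing by n - 1 makes its
    first component a map of degree -1 on X.\<close>
  define l where "l n x = fst (h (n - 1) x)" for n x
  define w where "w n x = snd (h n x)" for n x
  have hh: "h (n - 1) \<in> mod_hom A (obj X n) (pair_mod (obj Z (n - 1)) (obj Y (n - 2)))" for n
    using h[unfolded graded_hom_def, rule_format, of "n - 1"] by simp
  have gl: "graded_hom A X Z (- 1) l"
    using mod_hom_comp[OF mod_hom_fst hh] by (simp add: graded_hom_def l_def[abs_def])
  note q = r graded_hom_simps[OF gl X Z]
  have hs: "w n x \<in> carrier (obj Y (n - 1))" if "x \<in> carrier (obj X (n + 1))" for n x
    using mod_hom_closed[OF mod_hom_comp[OF mod_hom_snd hh[of "n + 1"]]] that by (simp add: w_def)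
  have "a n x = \<ominus>\<^bsub>obj Z n\<^esub> diff Z (n - 1) (l n x) \<oplus>\<^bsub>obj Z n\<^esub> \<ominus>\<^bsub>obj Z n\<^esub> l (n + 1) (diff X n x)"
    if x: "x \<in> carrier (obj X n)" for n x
  proof -
    have p: "h m y = (l (m + 1) y, w m y)" for m y by (simp add: l_def w_def)
    have x': "x \<in> carrier (obj ?X (n - 1))" using x by simp
    have dx: "\<ominus>\<^bsub>obj X (n + 1)\<^esub> diff X n x \<in> carrier (obj X (n + 1))" using x by (simp add: r)
    show ?thesis
      using heq[OF x', symmetric, unfolded p] x hs[of x "n - 1"] hs[OF dx]
        graded_hom_simps(4)[OF gl X Z, of "diff X n x" "n + 1"]
      by (simp add: q)
  qed
  then show ?thesis
    by (intro homotopicI[OF graded_hom_uminus[OF gl Z]]) (simp add: q)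
qed

text \<open>The same h serves both statements; only the term g n x changes sides.\<close>

lemma homotopic_diff_null:
  assumes X: "module_complex A X" and Y: "module_complex A Y"
    and f: "chain_map A X Y f" and g: "chain_map A X Y g"
  shows "homotopic A X Y (\<lambda>n x. f n x \<oplus>\<^bsub>obj Y n\<^esub> \<ominus>\<^bsub>obj Y n\<^esub> g n x) (\<lambda>n x. \<zero>\<^bsub>obj Y n\<^esub>)
    \<longleftrightarrow> homotopic A X Y f g"
proof -
  note s = chain_map_simps[OF f X Y] chain_map_simps[OF g X Y] diff_simps[OF X] diff_simps[OF Y]
    module_complex_ag[OF X] module_complex_ag[OF Y] ag_simps
  have key: "f n x \<oplus>\<^bsub>obj Y n\<^esub> \<ominus>\<^bsub>obj Y n\<^esub> g n x = \<zero>\<^bsub>obj Y n\<^esub> \<oplus>\<^bsub>obj Y n\<^esub> (diff Y (n - 1) (h n x) \<oplus>\<^bsub>obj Y n\<^esub> h (n + 1) (diff X n x))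
    \<longleftrightarrow> f n x = g n x \<oplus>\<^bsub>obj Y n\<^esub> (diff Y (n - 1) (h n x) \<oplus>\<^bsub>obj Y n\<^esub> h (n + 1) (diff X n x))"
    if "graded_hom A X Y (- 1) h" "x \<in> carrier (obj X n)" for h n x
  proof -
    have c: "diff Y (n - 1) (h n x) \<oplus>\<^bsub>obj Y n\<^esub> h (n + 1) (diff X n x) \<in> carrier (obj Y n)" (is "?c \<in> _")
      using that by (simp add: s graded_hom_simps[OF that(1) X Y])
    have "f n x = ?c \<oplus>\<^bsub>obj Y n\<^esub> g n x \<longleftrightarrow> ?c = f n x \<oplus>\<^bsub>obj Y n\<^esub> \<ominus>\<^bsub>obj Y n\<^esub> g n x"
      using that c by (intro ag_move[OF module_complex_ag[OF Y]]) (auto simp: s)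
    moreover have "?c \<oplus>\<^bsub>obj Y n\<^esub> g n x = g n x \<oplus>\<^bsub>obj Y n\<^esub> ?c"
      by (rule ag_ac(2)[OF module_complex_ag[OF Y] c]) (use that in \<open>simp add: s\<close>)
    ultimately show ?thesis
      unfolding ag_zero(1)[OF module_complex_ag[OF Y] c] by metis
  qed
  show ?thesis
  proof
    assume "homotopic A X Y (\<lambda>n x. f n x \<oplus>\<^bsub>obj Y n\<^esub> \<ominus>\<^bsub>obj Y n\<^esub> g n x) (\<lambda>n x. \<zero>\<^bsub>obj Y n\<^esub>)"
    then obtain h where h: "graded_hom A X Y (- 1) h" and
      "\<forall>n. \<forall>x\<in>carrier (obj X n). f n x \<oplus>\<^bsub>obj Y n\<^esub> \<ominus>\<^bsub>obj Y n\<^esub> g n x =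
        \<zero>\<^bsub>obj Y n\<^esub> \<oplus>\<^bsub>obj Y n\<^esub> (diff Y (n - 1) (h n x) \<oplus>\<^bsub>obj Y n\<^esub> h (n + 1) (diff X n x))"
      by (blast dest: homotopicD)
    note eq = this(2)[rule_format]
    show "homotopic A X Y f g"
      by (rule homotopicI[OF h]) (rule iffD1[OF key[OF h] eq])
  next
    assume "homotopic A X Y f g"
    then obtain h where h: "graded_hom A X Y (- 1) h" and
      "\<forall>n. \<forall>x\<in>carrier (obj X n).
        f n x = g n x \<oplus>\<^bsub>obj Y n\<^esub> (diff Y (n - 1) (h n x) \<oplus>\<^bsub>obj Y n\<^esub> h (n + 1) (diff X n x))"
      by (blast dest: homotopicD)
    note eq = this(2)[rule_format]
    show "homotopic A X Y (\<lambda>n x. f n x \<oplus>\<^bsub>obj Y n\<^esub> \<ominus>\<^bsub>obj Y n\<^esub> g n x) (\<lambda>n x. \<zero>\<^bsub>obj Y n\<^esub>)"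
      by (rule homotopicI[OF h]) (rule iffD2[OF key[OF h] eq])
  qed
qed

lemma lift_unique:
  assumes P: "projective_complex A X" and Z: "module_complex A Z" and Y: "module_complex A Y"
    and s: "quasi_iso A Z Y s" and a: "chain_map A X Z a" and b: "chain_map A X Z b"
    and ab: "homotopic A X Y (comp_maps s a) (comp_maps s b)"
  shows "homotopic A X Z a b"
proof -
  have X: "module_complex A X"
    using P projective_complex_bounded bounded_complex_module_complex by blast
  note cs = quasi_iso_chain_map[OF s]
  let ?c = "\<lambda>n x. a n x \<oplus>\<^bsub>obj Z n\<^esub> \<ominus>\<^bsub>obj Z n\<^esub> b n x"
  have c: "chain_map A X Z ?c"
    by (intro chain_map_plus chain_map_uminus a b X Z)
  have "homotopic A X Y (comp_maps s ?c) (\<lambda>n x. \<zero>\<^bsub>obj Y n\<^esub>) \<longleftrightarrow>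
    homotopic A X Y (\<lambda>n x. comp_maps s a n x \<oplus>\<^bsub>obj Y n\<^esub> \<ominus>\<^bsub>obj Y n\<^esub> comp_maps s b n x) (\<lambda>n x. \<zero>\<^bsub>obj Y n\<^esub>)"
    by (rule homotopic_congs) (simp_all add: comp_maps_def chain_map_simps[OF cs Z Y]
        chain_map_simps[OF a X Z] chain_map_simps[OF b X Z] module_complex_ag[OF Z] ag_simps)
  also have "\<dots>" using ab homotopic_diff_null[OF X Y chain_map_comp[OF cs a] chain_map_comp[OF cs b]] by simp
  finally show ?thesis
    using lift_null[OF P Z Y s c] homotopic_diff_null[OF X Z a b] by simp
qed

end

subsection \<open>Isomorphisms of complexes\<close>

definition cpx_iso ::
    "('k, 'r) module \<Rightarrow> ('r, 'm) cpx \<Rightarrow> ('r, 'n) cpx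
      \<Rightarrow> (int \<Rightarrow> 'm \<Rightarrow> 'n) \<Rightarrow> (int \<Rightarrow> 'n \<Rightarrow> 'm) \<Rightarrow> bool" where
  "cpx_iso A X Y f g \<longleftrightarrow> chain_map A X Y f \<and> chain_map A Y X g \<and>
     (\<forall>n. \<forall>x\<in>carrier (obj X n). g n (f n x) = x) \<and>
     (\<forall>n. \<forall>y\<in>carrier (obj Y n). f n (g n y) = y)"

lemma cpx_iso_sym: "cpx_iso A X Y f g \<Longrightarrow> cpx_iso A Y X g f"
  by (auto simp: cpx_iso_def)

lemma comp_maps_assoc: "comp_maps h (comp_maps g f) = comp_maps (comp_maps h g) f"
  by (simp add: comp_maps_def fun_eq_iff)

context kalgebra
begin

lemma cpx_iso_trans:
  assumes "cpx_iso A X Y f g" "cpx_iso A Y Z f' g'"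
  shows "cpx_iso A X Z (comp_maps f' f) (comp_maps g g')"
proof -
  have "f n x \<in> carrier (obj Y n)" if "x \<in> carrier (obj X n)" for n x
    using that assms mod_hom_closed[OF chain_map_hom] by (metis cpx_iso_def)
  moreover have "g' n x \<in> carrier (obj Y n)" if "x \<in> carrier (obj Z n)" for n x
    using that assms mod_hom_closed[OF chain_map_hom] by (metis cpx_iso_def)
  ultimately show ?thesis
    using assms chain_map_comp[of Y Z f' X f] chain_map_comp[of Y X g Z g']
    unfolding cpx_iso_def by (simp add: comp_maps_def)
qed

lemma cpx_isoI:
  assumes X: "module_complex A X" and f: "chain_map A X Y f"
    and g: "\<And>n y. y \<in> carrier (obj Y n) \<Longrightarrow> g n y \<in> carrier (obj X n) \<and> f n (g n y) = y"
    and gf: "\<And>n x. x \<in> carrier (obj X n) \<Longrightarrow> g n (f n x) = x"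
  shows "cpx_iso A X Y f g"
proof -
  have "chain_map A Y X g"
  proof (rule chain_mapI)
    show "graded_hom A Y X 0 g"
      unfolding graded_hom_def
      using mod_hom_inv[OF chain_map_hom[OF f] module_complex_rm[OF X] g gf] by simp
    fix n y assume y: "y \<in> carrier (obj Y n)"
    have "diff Y n y = diff Y n (f n (g n y))" using g[OF y] by simp
    also have "\<dots> = f (n + 1) (diff X n (g n y))" using f g[OF y] by (simp add: chain_map_def)
    finally show "g (n + 1) (diff Y n y) = diff X n (g n y)"
      using g[OF y] gf diff_simps(1)[OF X] by simp
  qed
  then show ?thesis using f g gf by (simp add: cpx_iso_def)
qed

lemma cpx_iso_quasi_iso:
  assumes X: "module_complex A X" and Y: "module_complex A Y" and i: "cpx_iso A X Y f g"
  shows "quasi_iso A X Y f"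
proof -
  have f: "chain_map A X Y f" and g: "chain_map A Y X g"
    and gf: "\<And>n x. x \<in> carrier (obj X n) \<Longrightarrow> g n (f n x) = x"
    and fg: "\<And>n y. y \<in> carrier (obj Y n) \<Longrightarrow> f n (g n y) = y"
    using i by (auto simp: cpx_iso_def)
  show ?thesis
  proof (rule quasi_isoI[OF X Y f])
    fix n z assume z: "z \<in> cocycles X n" "f n z \<in> coboundaries Y n"
    then have "g n (f n z) \<in> coboundaries X n" by (intro chain_map_coboundaries[OF g Y X])
    then show "z \<in> coboundaries X n" using z gf by (simp add: cocycles_def)
  next
    fix n y assume y: "y \<in> cocycles Y n"
    then have "g n y \<in> cocycles X n" by (rule chain_map_cocycles[OF g Y X])
    moreover have "\<zero>\<^bsub>obj Y n\<^esub> \<in> coboundaries Y n"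
      using additive_subgroup.zero_closed[OF additive_subgroup_coboundaries[OF Y]] .
    moreover have "y = \<zero>\<^bsub>obj Y n\<^esub> \<oplus>\<^bsub>obj Y n\<^esub> f n (g n y)"
      using y fg by (simp add: cocycles_def ag_simps module_complex_ag[OF Y])
    ultimately show "\<exists>z\<in>cocycles X n. \<exists>b\<in>coboundaries Y n. y = b \<oplus>\<^bsub>obj Y n\<^esub> f n z" by blast
  qed
qed

lemma projective_complex_iso:
  assumes X: "projective_complex A X" and Y: "bounded_complex A Y" and i: "cpx_iso A X Y f g"
  shows "projective_complex A Y"
  unfolding projective_complex_def
proof (intro conjI allI Y)
  fix n
  show "fg_projective A (obj Y n)"
  proof (rule fg_projective_retract)
    show "fg_projective A (obj X n)" "fd_module A (obj X n)"
      using X by (auto simp: projective_complex_def bounded_complex_def)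
    show "right_module A (obj Y n)" using Y by (simp add: bounded_complex_def fd_module_def)
    show "g n \<in> mod_hom A (obj Y n) (obj X n)" "f n \<in> mod_hom A (obj X n) (obj Y n)"
      using i by (auto simp: cpx_iso_def chain_map_def)
    show "f n (g n x) = x" if "x \<in> carrier (obj Y n)" for x
      using i that by (auto simp: cpx_iso_def)
  qed
qed

text \<open>The injection takes coordinates with respect to a finite spanning set, chosen
  arbitrarily for each element: equal coordinates give equal combinations, hence equal
  elements.\<close>

lemma fd_module_inj:
  assumes "fd_module A (M :: ('r, 'm) module)"
  shows "\<exists>\<iota> :: 'm \<Rightarrow> nat \<Rightarrow> 'k. inj_on \<iota> (carrier M)"
proof -
  obtain B where M: "right_module A M" and B: "finite B" "B \<subseteq> carrier M"
    "\<forall>x\<in>carrier M. \<exists>c. x = (\<Oplus>\<^bsub>M\<^esub>b\<in>B. (c b \<odot> \<one>) \<odot>\<^bsub>M\<^esub> b)"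
    using assms unfolding fd_module_def by blast
  obtain b n where b: "B = b ` {..<n::nat}"
    using B(1) finite_imp_nat_seg_image_inj_on by (metis lessThan_def)
  obtain c where c: "\<And>x. x \<in> carrier M \<Longrightarrow> x = (\<Oplus>\<^bsub>M\<^esub>b\<in>B. (c x b \<odot> \<one>) \<odot>\<^bsub>M\<^esub> b)"
    using B(3) by metis
  interpret abelian_group M by (rule right_module_ag[OF M])
  have "inj_on (\<lambda>x i. c x (b i)) (carrier M)"
  proof (rule inj_onI)
    fix x y assume xy: "x \<in> carrier M" "y \<in> carrier M" "(\<lambda>i. c x (b i)) = (\<lambda>i. c y (b i))"
    then have e: "c x u = c y u" if "u \<in> B" for u
      using that b by (auto dest: fun_cong)
    have "(\<Oplus>\<^bsub>M\<^esub>b\<in>B. (c x b \<odot> \<one>) \<odot>\<^bsub>M\<^esub> b) = (\<Oplus>\<^bsub>M\<^esub>b\<in>B. (c y b \<odot> \<one>) \<odot>\<^bsub>M\<^esub> b)"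
      by (rule finsum_cong')
        (use e B(2) in \<open>auto intro!: right_module_act(1)[OF M] scalar_closed\<close>)
    from trans[OF c[OF xy(1)] trans[OF this c[OF xy(2), symmetric]]] show "x = y" .
  qed
  then show ?thesis by blast
qed

text \<open>Structure is transported degree by degree along injections into
  \<open>nat => 'k\<close>. This supplies apexes of roofs and inputs of \<open>generated\<close> for
  complexes on any carrier.\<close>

lemma small_copy:
  fixes X :: "('r, 'm) cpx"
  assumes X: "bounded_complex A X"
  shows "\<exists>(P :: ('k, 'r) small_cpx) \<phi> \<psi>. bounded_complex A P \<and> cpx_iso A P X \<phi> \<psi>"
proof -
  have mX: "module_complex A X" and fd: "\<And>n. fd_module A (obj X n)"
    using X by (auto simp: bounded_complex_iff)
  note rm = module_complex_rm[OF mX]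
  obtain N where N: "\<And>n. \<bar>n\<bar> > N \<Longrightarrow> carrier (obj X n) = {\<zero>\<^bsub>obj X n\<^esub>}"
    using X by (auto simp: bounded_complex_iff)
  have "\<forall>n. \<exists>i :: 'm \<Rightarrow> nat \<Rightarrow> 'k. inj_on i (carrier (obj X n))"
    by (intro allI fd_module_inj fd)
  from choice[OF this] obtain \<iota> :: "int \<Rightarrow> 'm \<Rightarrow> nat \<Rightarrow> 'k"
    where "\<forall>n. inj_on (\<iota> n) (carrier (obj X n))"
    by blast
  then have \<iota>: "inj_on (\<iota> n) (carrier (obj X n))" for n by blast
  define \<phi> where "\<phi> n = inv_into (carrier (obj X n)) (\<iota> n)" for n
  define P where "P = \<lparr>obj = \<lambda>n. image_mod (\<iota> n) (obj X n),
    diff = \<lambda>n u. \<iota> (n + 1) (diff X n (\<phi> n u))\<rparr>"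
  have P_obj: "obj P n = image_mod (\<iota> n) (obj X n)" for n by (simp add: P_def)
  have \<phi>\<iota>: "\<phi> n (\<iota> n x) = x" if "x \<in> carrier (obj X n)" for n x
    using that \<iota> by (simp add: \<phi>_def inv_into_f_f)
  have rmP: "right_module A (obj P n)" and hom: "\<iota> n \<in> mod_hom A (obj X n) (obj P n)" for n
    unfolding P_obj
    by (rule right_module_image_mod[OF rm] mod_hom_image_mod[OF rm];
        simp add: inj_on_eq_iff[OF \<iota>])+
  have \<phi>: "\<phi> n \<in> mod_hom A (obj P n) (obj X n)" for n
    by (rule mod_hom_inv[OF hom rm]) (auto simp: P_obj \<phi>\<iota>)
  have d: "diff P n \<in> mod_hom A (obj P n) (obj P (n + 1))" for n
    using mod_hom_comp[OF hom mod_hom_comp[OF diff_hom[OF mX refl] \<phi>]] by (simp add: P_def)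
  have P: "module_complex A P"
    unfolding module_complex_def
  proof (intro conjI allI ballI rmP d)
    fix n u assume "u \<in> carrier (obj P n)"
    then obtain x where "x \<in> carrier (obj X n)" "u = \<iota> n x" by (auto simp: P_obj)
    then show "diff P (n + 1) (diff P n u) = \<zero>\<^bsub>obj P (n + 1 + 1)\<^esub>"
      using mod_hom_zero[OF hom right_module_ag[OF rm] right_module_ag[OF rmP]]
      by (simp add: P_def \<phi>\<iota> diff_simps[OF mX])
  qed
  have "fd_module A (obj P n)" for n
    by (rule fd_surj[OF fd rmP hom]) (simp add: P_obj)
  moreover have "carrier (obj P n) = {\<zero>\<^bsub>obj P n\<^esub>}" if "\<bar>n\<bar> > N" for n
    using mod_hom_zero[OF hom right_module_ag[OF rm] right_module_ag[OF rmP], of n] N[OF that]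
    by (simp add: P_obj)
  ultimately have "bounded_complex A P" using P unfolding bounded_complex_iff by blast
  moreover have "cpx_iso A P X \<phi> \<iota>"
  proof (rule cpx_isoI[OF P])
    show "chain_map A P X \<phi>"
      unfolding chain_map_def using \<phi>
      by (auto simp: P_obj) (auto simp: P_def \<phi>\<iota> diff_simps[OF mX])
  qed (auto simp: P_obj \<phi>\<iota>)
  ultimately show ?thesis by blast
qed

section \<open>The derived category\<close>

subsection \<open>Roofs and projective resolutions\<close>

text \<open>Homotopy is bundled with its side conditions, which makes it symmetric and transitive
  outright and allows chains of \<open>also\<close>.\<close>

definition htp :: "('r, 'm) cpx \<Rightarrow> ('r, 'n) cpx \<Rightarrow> (int \<Rightarrow> 'm \<Rightarrow> 'n) \<Rightarrow> (int \<Rightarrow> 'm \<Rightarrow> 'n) \<Rightarrow> bool" where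
  "htp X Y f g \<longleftrightarrow> module_complex A X \<and> module_complex A Y \<and>
     chain_map A X Y f \<and> chain_map A X Y g \<and> homotopic A X Y f g"

lemma htp_refl: "\<lbrakk>module_complex A X; module_complex A Y; chain_map A X Y f\<rbrakk> \<Longrightarrow> htp X Y f f"
  by (simp add: htp_def homotopic_refl)

lemma htp_sym: "htp X Y f g \<Longrightarrow> htp X Y g f"
  by (auto simp: htp_def intro: homotopic_sym)

lemma htp_trans [trans]: "\<lbrakk>htp X Y f g; htp X Y g h\<rbrakk> \<Longrightarrow> htp X Y f h"
  by (auto simp: htp_def intro: homotopic_trans)

lemma htp_left:
  "\<lbrakk>htp X Y f f'; chain_map A Y Z g; module_complex A Z\<rbrakk> \<Longrightarrow> htp X Z (comp_maps g f) (comp_maps g f')"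
  by (auto simp: htp_def intro: homotopic_comp_left chain_map_comp)

lemma htp_right:
  "\<lbrakk>htp Y Z f f'; chain_map A X Y g; module_complex A X\<rbrakk> \<Longrightarrow> htp X Z (comp_maps f g) (comp_maps f' g)"
  by (auto simp: htp_def intro: homotopic_comp_right chain_map_comp)

lemma htp_eq:
  assumes "module_complex A X" "module_complex A Y" "chain_map A X Y g" "chain_map A X Y f"
    "\<And>n x. x \<in> carrier (obj X n) \<Longrightarrow> f n x = g n x"
  shows "htp X Y f g"
  using assms homotopic_eq[of X Y g f] by (simp add: htp_def)

lemma lift_htp:
  assumes "projective_complex A X" "module_complex A Z" "module_complex A Y"
    "quasi_iso A Z Y s" "chain_map A X Y g"
  shows "\<exists>t. chain_map A X Z t \<and> htp X Y (comp_maps s t) g"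
  using lift_exists[OF assms] assms projective_complex_bounded[of A X]
    bounded_complex_module_complex[of A X] chain_map_comp[OF quasi_iso_chain_map[OF assms(4)]]
  by (auto simp: htp_def)

lemma lift_htp_unique:
  assumes "projective_complex A X" "module_complex A Z" "quasi_iso A Z Y s"
    "chain_map A X Z a" "chain_map A X Z b" "htp X Y (comp_maps s a) (comp_maps s b)"
  shows "htp X Z a b"
  using assms lift_unique[of X Z Y s a b] by (auto simp: htp_def)

text \<open>
  Given a projective resolution $q : X \to Y$, the roofs from \<open>Y\<close> to \<open>V\<close> of one class are those that
  represent a fixed homotopy class of chain maps $g : X \to V$.
\<close>

definition represents ::
    "('r, 'p) cpx \<Rightarrow> (int \<Rightarrow> 'p \<Rightarrow> 'm) \<Rightarrow> ('r, 'm) cpx \<Rightarrow> ('r, 'n) cpx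
      \<Rightarrow> ('k, 'r, 'm, 'n) roof \<Rightarrow> (int \<Rightarrow> 'p \<Rightarrow> 'n) \<Rightarrow> bool" where
  "represents X q Y V \<rho> g \<longleftrightarrow> (case \<rho> of (Z, s, f) \<Rightarrow>
     \<exists>t. chain_map A X Z t \<and> htp X Y (comp_maps s t) q \<and> htp X V (comp_maps f t) g)"

definition roof_class ::
    "('r, 'p) cpx \<Rightarrow> (int \<Rightarrow> 'p \<Rightarrow> 'm) \<Rightarrow> ('r, 'm) cpx \<Rightarrow> ('r, 'n) cpx
      \<Rightarrow> (int \<Rightarrow> 'p \<Rightarrow> 'n) \<Rightarrow> ('k, 'r, 'm, 'n) roof set" where
  "roof_class X q Y V g = {\<rho> \<in> roofs A Y V. represents X q Y V \<rho> g}"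

definition resolution :: "('r, 'p) cpx \<Rightarrow> ('r, 'm) cpx \<Rightarrow> (int \<Rightarrow> 'p \<Rightarrow> 'm) \<Rightarrow> bool" where
  "resolution X Y q \<longleftrightarrow> projective_complex A X \<and> bounded_complex A Y \<and> quasi_iso A X Y q"

lemma resolutionD:
  assumes "resolution X Y q"
  shows "projective_complex A X" "bounded_complex A X" "module_complex A X"
    "bounded_complex A Y" "module_complex A Y" "quasi_iso A X Y q" "chain_map A X Y q"
  using assms projective_complex_bounded bounded_complex_module_complex quasi_iso_chain_map
  unfolding resolution_def by blast+

lemma roofsD:
  assumes "(Z, s, f) \<in> roofs A Y V"
  shows "bounded_complex A Z" "module_complex A Z" "quasi_iso A Z Y s" "chain_map A Z Y s"
    "chain_map A Z V f"
  using assms bounded_complex_module_complex quasi_iso_chain_map unfolding roofs_def by auto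

lemma represents_htp:
  "\<lbrakk>represents X q Y V \<rho> g; htp X V g g'\<rbrakk> \<Longrightarrow> represents X q Y V \<rho> g'"
  unfolding represents_def by (auto split: prod.splits) (metis htp_trans)

lemma roof_represents:
  assumes r: "resolution X Y q" and V: "module_complex A V" and \<rho>: "\<rho> \<in> roofs A Y V"
  shows "\<exists>g. chain_map A X V g \<and> represents X q Y V \<rho> g"
proof -
  obtain Z s f where \<rho>': "\<rho> = (Z, s, f)" by (cases \<rho>)
  note d = roofsD[OF \<rho>[unfolded \<rho>']] and rd = resolutionD[OF r]
  obtain t where t: "chain_map A X Z t" "htp X Y (comp_maps s t) q"
    using lift_htp[OF rd(1) d(2) rd(5) d(3) rd(7)] by blast
  note c = chain_map_comp[OF d(5) t(1)]
  then have "represents X q Y V \<rho> (comp_maps f t)"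
    using t htp_refl[OF rd(3) V c] by (auto simp: represents_def \<rho>')
  then show ?thesis using c by blast
qed

text \<open>The link between roofs and chain maps. For related roofs, q is lifted to the common
  refinement W, and uniqueness of lifts identifies the composites into Z and Z' with t and t'.
  Conversely a small copy of X serves as W, with legs given by t and t'. Transitivity of the
  relation on roofs is thereby inherited from homotopy.\<close>

lemma roof_rel_iff:
  assumes r: "resolution X Y q" and V: "module_complex A V"
    and \<rho>: "\<rho> \<in> roofs A Y V" and \<rho>': "\<rho>' \<in> roofs A Y V"
    and g: "represents X q Y V \<rho> g" and g': "represents X q Y V \<rho>' g'"
  shows "(\<rho>, \<rho>') \<in> roof_rel A Y V \<longleftrightarrow> htp X V g g'"
proof -
  obtain Z s f where e: "\<rho> = (Z, s, f)" by (cases \<rho>)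
  obtain Z' s' f' where e': "\<rho>' = (Z', s', f')" by (cases \<rho>')
  note d = roofsD[OF \<rho>[unfolded e]] and d' = roofsD[OF \<rho>'[unfolded e']] and rd = resolutionD[OF r]
  obtain t where t: "chain_map A X Z t" "htp X Y (comp_maps s t) q" "htp X V (comp_maps f t) g"
    using g by (auto simp: represents_def e)
  obtain t' where t': "chain_map A X Z' t'" "htp X Y (comp_maps s' t') q" "htp X V (comp_maps f' t') g'"
    using g' by (auto simp: represents_def e')
  show ?thesis
  proof
    assume "(\<rho>, \<rho>') \<in> roof_rel A Y V"
    then obtain W :: "('k, 'r) small_cpx" and u v where W: "bounded_complex A W"
      and u: "chain_map A W Z u" and v: "chain_map A W Z' v"
      and qi: "quasi_iso A W Y (comp_maps s u)"
      and h1: "homotopic A W Y (comp_maps s u) (comp_maps s' v)"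
      and h2: "homotopic A W V (comp_maps f u) (comp_maps f' v)"
      unfolding roof_rel_def e e' by blast
    note mW = bounded_complex_module_complex[OF W]
    have H1: "htp W Y (comp_maps s u) (comp_maps s' v)" and H2: "htp W V (comp_maps f u) (comp_maps f' v)"
      unfolding htp_def using h1 h2 mW rd(5) V chain_map_comp u v d d' by blast+
    obtain x where x: "chain_map A X W x" "htp X Y (comp_maps (comp_maps s u) x) q"
      using lift_htp[OF rd(1) mW rd(5) qi rd(7)] by blast
    have "htp X Y (comp_maps s (comp_maps u x)) (comp_maps s t)"
      using x(2) htp_sym[OF t(2)] htp_trans by (metis comp_maps_assoc)
    then have 1: "htp X Z (comp_maps u x) t"
      by (rule lift_htp_unique[OF rd(1) d(2,3) chain_map_comp[OF u x(1)] t(1)])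
    have "htp X Y (comp_maps s' (comp_maps v x)) (comp_maps s' t')"
      using htp_sym[OF htp_right[OF H1 x(1) rd(3)]] x(2) htp_sym[OF t'(2)] htp_trans
      by (metis comp_maps_assoc)
    then have 2: "htp X Z' (comp_maps v x) t'"
      by (rule lift_htp_unique[OF rd(1) d'(2,3) chain_map_comp[OF v x(1)] t'(1)])
    have "htp X V g (comp_maps f t)" by (rule htp_sym[OF t(3)])
    also have "htp X V (comp_maps f t) (comp_maps f (comp_maps u x))"
      by (rule htp_sym[OF htp_left[OF 1 d(5) V]])
    also have "htp X V (comp_maps f (comp_maps u x)) (comp_maps f' (comp_maps v x))"
      using htp_right[OF H2 x(1) rd(3)] by (simp add: comp_maps_assoc)
    also have "htp X V (comp_maps f' (comp_maps v x)) (comp_maps f' t')"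
      by (rule htp_left[OF 2 d'(5) V])
    also have "htp X V (comp_maps f' t') g'" by (rule t'(3))
    finally show "htp X V g g'" .
  next
    assume gg: "htp X V g g'"
    obtain P :: "('k, 'r) small_cpx" and \<phi> \<psi> where P: "bounded_complex A P" "cpx_iso A P X \<phi> \<psi>"
      using small_copy[OF rd(2)] by blast
    note mP = bounded_complex_module_complex[OF P(1)]
    have \<phi>: "chain_map A P X \<phi>" using P(2) by (simp add: cpx_iso_def)
    have qq: "quasi_iso A P Y (comp_maps q \<phi>)"
      by (rule quasi_iso_comp[OF mP rd(3,5) cpx_iso_quasi_iso[OF mP rd(3) P(2)] rd(6)])
    have 1: "htp P Y (comp_maps s (comp_maps t \<phi>)) (comp_maps q \<phi>)"
      using htp_right[OF t(2) \<phi> mP] by (simp add: comp_maps_assoc)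
    have 2: "htp P Y (comp_maps s' (comp_maps t' \<phi>)) (comp_maps q \<phi>)"
      using htp_right[OF t'(2) \<phi> mP] by (simp add: comp_maps_assoc)
    have 3: "htp P V (comp_maps f (comp_maps t \<phi>)) (comp_maps f' (comp_maps t' \<phi>))"
      using htp_right[OF htp_trans[OF htp_trans[OF t(3) gg] htp_sym[OF t'(3)]] \<phi> mP]
      by (simp add: comp_maps_assoc)
    have "quasi_iso A P Y (comp_maps s (comp_maps t \<phi>))"
      using quasi_iso_homotopic[OF mP rd(5) qq] htp_sym[OF 1] by (auto simp: htp_def)
    then show "(\<rho>, \<rho>') \<in> roof_rel A Y V"
      using \<rho> \<rho>' P(1) chain_map_comp[OF t(1) \<phi>] chain_map_comp[OF t'(1) \<phi>]
        htp_trans[OF 1 htp_sym[OF 2]] 3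
      unfolding roof_rel_def e e' htp_def by blast
  qed
qed

text \<open>\<open>Db_hom\<close> takes images of single roofs, but zero, identities and composites
  are images of larger sets. If all roofs of a set represent the same g, its image is still one
  class.\<close>

lemma roof_rel_Image:
  assumes r: "resolution X Y q" and V: "module_complex A V"
    and S: "\<And>\<rho>. \<rho> \<in> S \<Longrightarrow> \<rho> \<in> roofs A Y V \<Longrightarrow> represents X q Y V \<rho> g"
    and ne: "\<rho>\<^sub>0 \<in> S" "\<rho>\<^sub>0 \<in> roofs A Y V"
  shows "roof_rel A Y V `` S = roof_class X q Y V g"
proof -
  have sub: "\<rho> \<in> roofs A Y V \<and> \<rho>' \<in> roofs A Y V" if "(\<rho>, \<rho>') \<in> roof_rel A Y V" for \<rho> \<rho>'
    using that by (auto simp: roof_rel_def)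
  have g0: "represents X q Y V \<rho>\<^sub>0 g" using S ne by blast
  then have gg: "htp X V g g"
    unfolding represents_def by (auto split: prod.splits) (metis htp_sym htp_trans)
  show ?thesis
  proof (intro subset_antisym subsetI)
    fix \<rho>' assume "\<rho>' \<in> roof_rel A Y V `` S"
    then obtain \<rho> where \<rho>: "\<rho> \<in> S" "(\<rho>, \<rho>') \<in> roof_rel A Y V" by blast
    obtain g' where g': "represents X q Y V \<rho>' g'"
      using roof_represents[OF r V] sub[OF \<rho>(2)] by blast
    have "htp X V g g'"
      using roof_rel_iff[OF r V _ _ _ g', of \<rho> g] sub[OF \<rho>(2)] S \<rho> by blast
    then show "\<rho>' \<in> roof_class X q Y V g"
      using represents_htp[OF g' htp_sym] sub[OF \<rho>(2)] by (simp add: roof_class_def)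
  next
    fix \<rho>' assume "\<rho>' \<in> roof_class X q Y V g"
    then have "(\<rho>\<^sub>0, \<rho>') \<in> roof_rel A Y V"
      using roof_rel_iff[OF r V ne(2) _ g0, of \<rho>' g] gg by (simp add: roof_class_def)
    then show "\<rho>' \<in> roof_rel A Y V `` S" using ne by blast
  qed
qed

text \<open>X has the wrong carrier type for an apex, so its small copy P takes its place.\<close>

lemma standard_roof:
  assumes r: "resolution X Y q" and V: "module_complex A V" and g: "chain_map A X V g"
    and P: "bounded_complex A P" "cpx_iso A P X \<phi> \<psi>"
  shows "(P, comp_maps q \<phi>, comp_maps g \<phi>) \<in> roof_class X q Y V g"
proof -
  note rd = resolutionD[OF r] and mP = bounded_complex_module_complex[OF P(1)]
  have i: "chain_map A P X \<phi>" "chain_map A X P \<psi>"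
    "\<And>n y. y \<in> carrier (obj X n) \<Longrightarrow> \<phi> n (\<psi> n y) = y"
    using P(2) by (auto simp: cpx_iso_def)
  have "quasi_iso A P Y (comp_maps q \<phi>)"
    by (rule quasi_iso_comp[OF mP rd(3,5) cpx_iso_quasi_iso[OF mP rd(3) P(2)] rd(6)])
  moreover have "htp X Y (comp_maps (comp_maps q \<phi>) \<psi>) q"
    by (rule htp_eq[OF rd(3,5,7) chain_map_comp[OF chain_map_comp[OF rd(7) i(1)] i(2)]])
      (simp add: comp_maps_def i(3))
  moreover have "htp X V (comp_maps (comp_maps g \<phi>) \<psi>) g"
    by (rule htp_eq[OF rd(3) V g chain_map_comp[OF chain_map_comp[OF g i(1)] i(2)]])
      (simp add: comp_maps_def i(3))
  ultimately show ?thesis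
    using i(2) P(1) chain_map_comp[OF g i(1)]
    by (auto simp: roof_class_def represents_def roofs_def)
qed

lemma roof_class_nonempty:
  assumes r: "resolution X Y q" and V: "module_complex A V" and g: "chain_map A X V g"
  shows "\<exists>\<rho>. \<rho> \<in> roof_class X q Y V g"
  using small_copy[OF resolutionD(2)[OF r]] standard_roof[OF r V g] by blast

lemma roof_class_in_Db_hom:
  assumes r: "resolution X Y q" and V: "module_complex A V" and g: "chain_map A X V g"
  shows "roof_class X q Y V g \<in> Db_hom A Y V"
proof -
  obtain \<rho> where \<rho>: "\<rho> \<in> roof_class X q Y V g" using roof_class_nonempty[OF assms] by blast
  then have "roof_rel A Y V `` {\<rho>} = roof_class X q Y V g"
    by (intro roof_rel_Image[OF r V]) (auto simp: roof_class_def)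
  then show ?thesis using \<rho> unfolding Db_hom_def quotient_def roof_class_def by blast
qed

lemma Db_hom_roof_class:
  assumes r: "resolution X Y q" and V: "module_complex A V" and F: "F \<in> Db_hom A Y V"
  shows "\<exists>g. chain_map A X V g \<and> F = roof_class X q Y V g"
proof -
  obtain \<rho> where \<rho>: "\<rho> \<in> roofs A Y V" "F = roof_rel A Y V `` {\<rho>}"
    using F unfolding Db_hom_def quotient_def by blast
  obtain g where g: "chain_map A X V g" "represents X q Y V \<rho> g"
    using roof_represents[OF r V \<rho>(1)] by blast
  then have "F = roof_class X q Y V g"
    unfolding \<rho>(2) by (intro roof_rel_Image[OF r V]) (use \<rho>(1) in auto)
  then show ?thesis using g by blast
qed

lemma roof_class_eq_iff:
  assumes r: "resolution X Y q" and V: "module_complex A V"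
    and g: "chain_map A X V g" and g': "chain_map A X V g'"
  shows "roof_class X q Y V g = roof_class X q Y V g' \<longleftrightarrow> htp X V g g'"
proof
  assume e: "roof_class X q Y V g = roof_class X q Y V g'"
  obtain \<rho> where \<rho>: "\<rho> \<in> roof_class X q Y V g" using roof_class_nonempty[OF r V g] by blast
  have a: "\<rho> \<in> roofs A Y V" "represents X q Y V \<rho> g" "represents X q Y V \<rho> g'"
    using \<rho> \<rho>[unfolded e] by (auto simp: roof_class_def)
  have "(\<rho>, \<rho>) \<in> roof_rel A Y V"
    using roof_rel_iff[OF r V a(1,1,2,2)] htp_refl[OF resolutionD(3)[OF r] V g] by simp
  then show "htp X V g g'" using roof_rel_iff[OF r V a(1,1,2,3)] by simp
next
  assume "htp X V g g'"
  then show "roof_class X q Y V g = roof_class X q Y V g'"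
    unfolding roof_class_def using represents_htp htp_sym by blast
qed

lemma Db_zero_roof_class:
  assumes r: "resolution X Y q" and V: "module_complex A V"
  shows "Db_zero A Y V = roof_class X q Y V (\<lambda>n x. \<zero>\<^bsub>obj V n\<^esub>)"
  unfolding Db_zero_def
proof -
  note rd = resolutionD[OF r]
  let ?z = "\<lambda>n x. \<zero>\<^bsub>obj V n\<^esub>"
  have rep: "represents X q Y V (Z, s, ?z) ?z" if "(Z, s, ?z) \<in> roofs A Y V" for Z s
  proof -
    note d = roofsD[OF that]
    obtain t where t: "chain_map A X Z t" "htp X Y (comp_maps s t) q"
      using lift_htp[OF rd(1) d(2) rd(5) d(3) rd(7)] by blast
    have "comp_maps ?z t = ?z" by (simp add: comp_maps_def o_def)
    then have "htp X V (comp_maps ?z t) ?z"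
      using htp_refl[OF rd(3) V chain_map_zero[OF rd(3) V]] by simp
    then show ?thesis using t by (auto simp: represents_def)
  qed
  obtain P :: "('k, 'r) small_cpx" and \<phi> \<psi> where P: "bounded_complex A P" "cpx_iso A P X \<phi> \<psi>"
    using small_copy[OF rd(2)] by blast
  have "comp_maps ?z \<phi> = ?z" by (simp add: comp_maps_def o_def)
  then have "(P, comp_maps q \<phi>, ?z) \<in> roofs A Y V"
    using standard_roof[OF r V chain_map_zero[OF rd(3) V] P] by (simp add: roof_class_def)
  then show "roof_rel A Y V `` {(Z, s, f) |Z s f. f = ?z} = roof_class X q Y V ?z"
    by (intro roof_rel_Image[OF r V, where \<rho>\<^sub>0 = "(P, comp_maps q \<phi>, ?z)"]) (auto intro: rep)
qed

lemma Db_id_roof_class: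
  assumes r: "resolution X Y q"
  shows "Db_id A Y = roof_class X q Y Y q"
  unfolding Db_id_def
proof -
  note rd = resolutionD[OF r]
  have rep: "represents X q Y Y (Z, s, s) q" if "(Z, s, s) \<in> roofs A Y Y" for Z s
  proof -
    note d = roofsD[OF that]
    obtain t where t: "chain_map A X Z t" "htp X Y (comp_maps s t) q"
      using lift_htp[OF rd(1) d(2) rd(5) d(3) rd(7)] by blast
    then show ?thesis by (auto simp: represents_def)
  qed
  obtain P :: "('k, 'r) small_cpx" and \<phi> \<psi> where P: "bounded_complex A P" "cpx_iso A P X \<phi> \<psi>"
    using small_copy[OF rd(2)] by blast
  have "(P, comp_maps q \<phi>, comp_maps q \<phi>) \<in> roofs A Y Y"
    using standard_roof[OF r rd(5,7) P] by (simp add: roof_class_def)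
  then show "roof_rel A Y Y `` {(Z, s, s) |Z s. True} = roof_class X q Y Y q"
    by (intro roof_rel_Image[OF r rd(5), where \<rho>\<^sub>0 = "(P, comp_maps q \<phi>, comp_maps q \<phi>)"])
      (auto intro: rep)
qed

text \<open>To compose, g is lifted up to homotopy to a map l between the resolutions; every
  completed square then represents h l, by uniqueness of lifts. One square must also be exhibited,
  because an empty set of squares has an empty image.\<close>

lemma Db_comp_roof_class:
  assumes r: "resolution X Y q" and r': "resolution X' Y' q'" and V: "module_complex A V"
    and h: "chain_map A X' V h" and l: "chain_map A X X' l"
    and ql: "htp X Y' (comp_maps q' l) g"
  shows "Db_comp A Y Y' V (roof_class X q Y Y' g) (roof_class X' q' Y' V h)
    = roof_class X q Y V (comp_maps h l)"
  unfolding Db_comp_def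
proof -
  note rd = resolutionD[OF r] and rd' = resolutionD[OF r']
  let ?F = "roof_class X q Y Y' g" and ?G = "roof_class X' q' Y' V h"
  let ?S = "{(W :: ('k, 'r) small_cpx, comp_maps s u, comp_maps k w) | W s u k w.
       \<exists>Z Z' f t. (Z, s, f) \<in> ?F \<and> (Z', t, k) \<in> ?G \<and> bounded_complex A W \<and>
         quasi_iso A W Z u \<and> chain_map A W Z' w \<and>
         homotopic A W Y' (comp_maps f u) (comp_maps t w)}"
  have rep: "represents X q Y V \<rho> (comp_maps h l)" if "\<rho> \<in> ?S" for \<rho>
    using that unfolding mem_Collect_eq
  proof (elim exE conjE)
    fix W :: "('k, 'r) small_cpx" and s u k w Z Z' f t
    assume \<rho>: "\<rho> = (W, comp_maps s u, comp_maps k w)"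
      and F: "(Z, s, f) \<in> ?F" and G: "(Z', t, k) \<in> ?G" and W: "bounded_complex A W"
      and u: "quasi_iso A W Z u" and w: "chain_map A W Z' w"
      and hh: "homotopic A W Y' (comp_maps f u) (comp_maps t w)"
    have F': "(Z, s, f) \<in> roofs A Y Y'" and G': "(Z', t, k) \<in> roofs A Y' V"
      using F G by (auto simp: roof_class_def)
    note d = roofsD[OF F'] and d' = roofsD[OF G'] and mW = bounded_complex_module_complex[OF W]
    note cu = quasi_iso_chain_map[OF u]
    have HH: "htp W Y' (comp_maps f u) (comp_maps t w)"
      using hh mW rd'(5) chain_map_comp[OF d(5) cu] chain_map_comp[OF d'(4) w] by (simp add: htp_def)
    obtain a where a: "chain_map A X Z a" "htp X Y (comp_maps s a) q" "htp X Y' (comp_maps f a) g"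
      using F by (auto simp: roof_class_def represents_def)
    obtain b where b: "chain_map A X' Z' b" "htp X' Y' (comp_maps t b) q'" "htp X' V (comp_maps k b) h"
      using G by (auto simp: roof_class_def represents_def)
    obtain x where x: "chain_map A X W x" "htp X Y (comp_maps (comp_maps s u) x) q"
      using lift_htp[OF rd(1) mW rd(5) quasi_iso_comp[OF mW d(2) rd(5) u d(3)] rd(7)] by blast
    have "htp X Y (comp_maps s (comp_maps u x)) (comp_maps s a)"
      using x(2) htp_sym[OF a(2)] htp_trans by (metis comp_maps_assoc)
    then have ux: "htp X Z (comp_maps u x) a"
      by (rule lift_htp_unique[OF rd(1) d(2,3) chain_map_comp[OF cu x(1)] a(1)])
    have "htp X Y' (comp_maps t (comp_maps w x)) (comp_maps f (comp_maps u x))"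
      using htp_sym[OF htp_right[OF HH x(1) rd(3)]] by (simp add: comp_maps_assoc)
    also have "htp X Y' (comp_maps f (comp_maps u x)) (comp_maps f a)"
      by (rule htp_left[OF ux d(5) rd'(5)])
    also have "htp X Y' (comp_maps f a) g" by (rule a(3))
    also have "htp X Y' g (comp_maps q' l)" by (rule htp_sym[OF ql])
    also have "htp X Y' (comp_maps q' l) (comp_maps t (comp_maps b l))"
      using htp_right[OF htp_sym[OF b(2)] l rd(3)] by (simp add: comp_maps_assoc)
    finally have wx: "htp X Z' (comp_maps w x) (comp_maps b l)"
      by (rule lift_htp_unique[OF rd(1) d'(2,3) chain_map_comp[OF w x(1)] chain_map_comp[OF b(1) l]])
    have "htp X V (comp_maps (comp_maps k w) x) (comp_maps k (comp_maps b l))"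
      using htp_left[OF wx d'(5) V] by (simp add: comp_maps_assoc)
    also have "htp X V (comp_maps k (comp_maps b l)) (comp_maps h l)"
      using htp_right[OF b(3) l rd(3)] by (simp add: comp_maps_assoc)
    finally show "represents X q Y V \<rho> (comp_maps h l)" using x by (auto simp: represents_def \<rho>)
  qed
  obtain P :: "('k, 'r) small_cpx" and \<phi> \<psi> where P: "bounded_complex A P" "cpx_iso A P X \<phi> \<psi>"
    using small_copy[OF rd(2)] by blast
  obtain P' :: "('k, 'r) small_cpx" and \<phi>' \<psi>' where P': "bounded_complex A P'" "cpx_iso A P' X' \<phi>' \<psi>'"
    using small_copy[OF rd'(2)] by blast
  have g: "chain_map A X Y' g" using ql by (simp add: htp_def)
  note F = standard_roof[OF r rd'(5) g P] and G = standard_roof[OF r' V h P']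
  note mP = bounded_complex_module_complex[OF P(1)]
  have i: "chain_map A P X \<phi>" and i': "chain_map A P' X' \<phi>'" "chain_map A X' P' \<psi>'"
    "\<And>n y. y \<in> carrier (obj X' n) \<Longrightarrow> \<phi>' n (\<psi>' n y) = y"
    using P(2) P'(2) by (auto simp: cpx_iso_def)
  \<comment> \<open>A completed square on the small copies: u is the identity of P, and w is l
    carried over to a map P -> P'.\<close>
  let ?w = "comp_maps \<psi>' (comp_maps l \<phi>)" and ?id = "\<lambda>n x. x"
  have w: "chain_map A P P' ?w" by (rule chain_map_comp[OF i'(2) chain_map_comp[OF l i]])
  have "cpx_iso A P P ?id ?id" by (simp add: cpx_iso_def chain_map_id)
  then have u: "quasi_iso A P P ?id" by (rule cpx_iso_quasi_iso[OF mP mP])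
  have cl: "l n (\<phi> n x) \<in> carrier (obj X' n)" if "x \<in> carrier (obj P n)" for n x
    using that chain_map_simps(1)[OF i mP rd(3)] chain_map_simps(1)[OF l rd(3) rd'(3)] by simp
  have "htp P Y' (comp_maps g \<phi>) (comp_maps (comp_maps q' l) \<phi>)"
    by (rule htp_right[OF htp_sym[OF ql] i mP])
  also have "htp P Y' (comp_maps (comp_maps q' l) \<phi>) (comp_maps (comp_maps q' \<phi>') ?w)"
    by (rule htp_eq[OF mP rd'(5) chain_map_comp[OF chain_map_comp[OF rd'(7) i'(1)] w]
          chain_map_comp[OF chain_map_comp[OF rd'(7) l] i]])
      (simp add: comp_maps_def i'(3) cl)
  finally have H: "homotopic A P Y' (comp_maps (comp_maps g \<phi>) ?id) (comp_maps (comp_maps q' \<phi>') ?w)"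
    by (simp add: htp_def comp_maps_def o_def)
  have S: "(P, comp_maps (comp_maps q \<phi>) ?id, comp_maps (comp_maps h \<phi>') ?w) \<in> ?S"
    unfolding mem_Collect_eq
    by (intro exI conjI, rule refl, rule F, rule G, rule P(1), rule u, rule w, rule H)
  have "chain_map A P V (comp_maps (comp_maps h \<phi>') ?w)"
    by (rule chain_map_comp[OF chain_map_comp[OF h i'(1)] w])
  then have R: "(P, comp_maps (comp_maps q \<phi>) ?id, comp_maps (comp_maps h \<phi>') ?w) \<in> roofs A Y V"
    using F P(1) by (simp add: roof_class_def roofs_def comp_maps_def o_def)
  show "roof_rel A Y V `` ?S = roof_class X q Y V (comp_maps h l)"
    by (rule roof_rel_Image[OF r V _ S R]) (rule rep)
qed

subsection \<open>Vanishing and isomorphism\<close>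

lemma resolution_id:
  assumes "projective_complex A X"
  shows "resolution X X (\<lambda>n x. x)"
proof -
  have X: "bounded_complex A X" "module_complex A X"
    using assms projective_complex_bounded bounded_complex_module_complex by blast+
  have "cpx_iso A X X (\<lambda>n x. x) (\<lambda>n x. x)" by (simp add: cpx_iso_def chain_map_id)
  then show ?thesis using cpx_iso_quasi_iso[OF X(2,2)] assms X by (simp add: resolution_def)
qed

text \<open>A complex of projectives resolves itself, so \<open>Db_hom\<close> is the set of
  homotopy classes of chain maps out of X, and \<open>Db_zero\<close> is the class of the zero
  map.\<close>

lemma Db_hom_vanishes_iff:
  assumes P: "projective_complex A X" and V: "bounded_complex A V"
  shows "Db_hom_vanishes A X V \<longleftrightarrow>
    (\<forall>g. chain_map A X V g \<longrightarrow> homotopic A X V g (\<lambda>n x. \<zero>\<^bsub>obj V n\<^esub>))"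
proof -
  note r = resolution_id[OF P]
  note rd = resolutionD[OF r]
  have mV: "module_complex A V" using V by (rule bounded_complex_module_complex)
  note z = chain_map_zero[OF rd(3) mV]
  have "Db_hom A X V = {roof_class X (\<lambda>n x. x) X V g | g. chain_map A X V g}"
    using roof_class_in_Db_hom[OF r mV] Db_hom_roof_class[OF r mV] by blast
  then have "Db_hom_vanishes A X V \<longleftrightarrow> {roof_class X (\<lambda>n x. x) X V g | g. chain_map A X V g}
    = {roof_class X (\<lambda>n x. x) X V (\<lambda>n x. \<zero>\<^bsub>obj V n\<^esub>)}"
    by (simp add: Db_hom_vanishes_def Db_zero_roof_class[OF r mV])
  also have "\<dots> \<longleftrightarrow> (\<forall>g. chain_map A X V g \<longrightarrow>
      roof_class X (\<lambda>n x. x) X V g = roof_class X (\<lambda>n x. x) X V (\<lambda>n x. \<zero>\<^bsub>obj V n\<^esub>))"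
    using z by blast
  also have "\<dots> \<longleftrightarrow> (\<forall>g. chain_map A X V g \<longrightarrow> homotopic A X V g (\<lambda>n x. \<zero>\<^bsub>obj V n\<^esub>))"
    using roof_class_eq_iff[OF r mV _ z] z rd(3) mV by (auto simp: htp_def)
  finally show ?thesis .
qed

text \<open>Over the common resolution X the class of q' goes from Y to Y' and the class of q goes
  back. Both lift to the identity of X, so the composites are the classes of q and q', which are the
  identities.\<close>

lemma Db_isomorphicI:
  assumes r: "resolution X Y q" and r': "resolution X Y' q'"
  shows "Db_isomorphic A Y Y'"
proof -
  note rd = resolutionD[OF r] and rd' = resolutionD[OF r']
  let ?id = "\<lambda>n x. x"
  have e: "comp_maps f ?id = f" for f :: "int \<Rightarrow> 'd \<Rightarrow> 'e" by (simp add: comp_maps_def o_def)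
  have "Db_comp A Y Y' Y (roof_class X q Y Y' q') (roof_class X q' Y' Y q) = roof_class X q Y Y q"
    using Db_comp_roof_class[OF r r' rd(5) rd(7) chain_map_id, of q'] htp_refl[OF rd(3) rd'(5) rd'(7)]
    by (simp add: e)
  moreover have "Db_comp A Y' Y Y' (roof_class X q' Y' Y q) (roof_class X q Y Y' q') = roof_class X q' Y' Y' q'"
    using Db_comp_roof_class[OF r' r rd'(5) rd'(7) chain_map_id, of q] htp_refl[OF rd(3) rd(5) rd(7)]
    by (simp add: e)
  ultimately show ?thesis
    unfolding Db_isomorphic_def Db_id_roof_class[OF r] Db_id_roof_class[OF r']
    using roof_class_in_Db_hom[OF r rd'(5,7)] roof_class_in_Db_hom[OF r' rd(5,7)] by blast
qed

lemma Db_isomorphic_sym: "Db_isomorphic A X Y \<Longrightarrow> Db_isomorphic A Y X"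
  by (auto simp: Db_isomorphic_def)

lemma Db_isomorphic_quasi_iso:
  assumes "projective_complex A X" "bounded_complex A Y" "quasi_iso A X Y q"
  shows "Db_isomorphic A X Y"
  by (rule Db_isomorphicI[OF resolution_id[OF assms(1)]]) (use assms in \<open>auto simp: resolution_def\<close>)

text \<open>Resolutions of X and Y are not at hand, so roofs are unpacked. Because the composite of
  F and G is the identity, some quasi-isomorphism W' -> X factors through the apex Z' of a roof of
  G; as Z' is quasi-isomorphic to Y, its cocycles of degree n are coboundaries.\<close>

lemma Db_isomorphic_acyclic:
  assumes X: "bounded_complex A X" and Y: "bounded_complex A Y" and i: "Db_isomorphic A X Y"
    and ac: "cocycles Y n \<subseteq> coboundaries Y n"
  shows "cocycles X n \<subseteq> coboundaries X n"
proof
  note mX = bounded_complex_module_complex[OF X] and mY = bounded_complex_module_complex[OF Y]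
  obtain F G where F: "F \<in> Db_hom A X Y" and G: "G \<in> Db_hom A Y X"
    and FG: "Db_comp A X Y X F G = Db_id A X"
    using i unfolding Db_isomorphic_def by blast
  obtain \<rho> where "\<rho> \<in> roofs A X Y" using F unfolding Db_hom_def quotient_def by blast
  then obtain Z s f where Zs: "(Z, s, f) \<in> roofs A X Y" by (cases \<rho>) auto
  note d = roofsD[OF Zs]
  have r: "(Z, s, s) \<in> roofs A X X" using d by (simp add: roofs_def)
  have "comp_maps s (\<lambda>n x. x) = s" by (simp add: comp_maps_def o_def)
  then have "((Z, s, s), (Z, s, s)) \<in> roof_rel A X X"
    unfolding roof_rel_def using r d(1,3) chain_map_id[of Z] homotopic_refl[OF d(4) d(2) mX]
    by (auto intro!: exI[of _ Z] exI[of _ "\<lambda>n x. x"])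
  then have "(Z, s, s) \<in> Db_id A X" unfolding Db_id_def by blast
  \<comment> \<open>Membership of an identity roof in the composite produces concrete
    representatives of F and G.\<close>
  then have "(Z, s, s) \<in> Db_comp A X Y X F G" using FG by simp
  then obtain W s1 u k w Z1 Z' f1 t where rel: "((W, comp_maps s1 u, comp_maps k w), (Z, s, s)) \<in> roof_rel A X X"
    and F1: "(Z1, s1, f1) \<in> F" and G1: "(Z', t, k) \<in> G" and W: "bounded_complex A W"
    and u: "quasi_iso A W Z1 u" and w: "chain_map A W Z' w"
    unfolding Db_comp_def by blast
  obtain W' :: "('k, 'r) small_cpx" and a b where W': "bounded_complex A W'" "chain_map A W' W a" "chain_map A W' Z b"
    "quasi_iso A W' X (comp_maps (comp_maps s1 u) a)"
    "homotopic A W' X (comp_maps (comp_maps s1 u) a) (comp_maps s b)"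
    "homotopic A W' X (comp_maps (comp_maps k w) a) (comp_maps s b)"
    using rel unfolding roof_rel_def by blast
  have G1': "(Z', t, k) \<in> roofs A Y X"
    using G1 G unfolding Db_hom_def quotient_def roof_rel_def by blast
  note d' = roofsD[OF G1'] and mW = bounded_complex_module_complex[OF W]
    and mW' = bounded_complex_module_complex[OF W'(1)]
  have kwa: "chain_map A W' X (comp_maps (comp_maps k w) a)"
    by (rule chain_map_comp[OF chain_map_comp[OF d'(5) w] W'(2)])
  note sb = chain_map_comp[OF d(4) W'(3)]
  have "homotopic A W' X (comp_maps (comp_maps s1 u) a) (comp_maps (comp_maps k w) a)"
    by (rule homotopic_trans[OF mW' mX kwa W'(5) homotopic_sym[OF kwa sb mW' mX W'(6)]])
  then have "quasi_iso A W' X (comp_maps (comp_maps k w) a)"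
    by (rule quasi_iso_homotopic[OF mW' mX W'(4) kwa])
  note q = this[unfolded quasi_iso_iff[OF mW' mX]]
  fix z assume "z \<in> cocycles X n"
  then obtain z' c where z': "z' \<in> cocycles W' n" "c \<in> coboundaries X n"
    "z = c \<oplus>\<^bsub>obj X n\<^esub> comp_maps (comp_maps k w) a n z'"
    using q by blast
  have "w n (a n z') \<in> cocycles Z' n"
    by (intro chain_map_cocycles[OF w mW d'(2)] chain_map_cocycles[OF W'(2) mW' mW] z')
  moreover from this have "t n (w n (a n z')) \<in> coboundaries Y n"
    using chain_map_cocycles[OF d'(4) d'(2) mY] ac by blast
  ultimately have "w n (a n z') \<in> coboundaries Z' n"
    using d'(3)[unfolded quasi_iso_iff[OF d'(2) mY]] by blast
  then have "k n (w n (a n z')) \<in> coboundaries X n"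
    by (rule chain_map_coboundaries[OF d'(5) d'(2) mX])
  then show "z \<in> coboundaries X n"
    using additive_subgroup.a_closed[OF additive_subgroup_coboundaries[OF mX] z'(2)]
    by (simp add: z'(3) comp_maps_def)
qed

end

section \<open>Generated complexes\<close>

lemma pair_cpx_simps [simp]:
  "obj (pair_cpx X Y) n = pair_mod (obj X n) (obj Y n)"
  "diff (pair_cpx X Y) n (x, y) = (diff X n x, diff Y n y)"
  by (simp_all add: pair_cpx_def)

context kalgebra
begin

section \<open>Direct sums of two complexes and complements of retracts\<close>

lemma bounded_complex_pair:
  assumes X: "bounded_complex A X" and Y: "bounded_complex A Y"
  shows "bounded_complex A (pair_cpx X Y)"
proof -
  have m: "module_complex A X" "module_complex A Y" using assms by (auto simp: bounded_complex_iff)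
  obtain N where N: "\<And>n. \<bar>n\<bar> > N \<Longrightarrow> carrier (obj X n) = {\<zero>\<^bsub>obj X n\<^esub>}"
    using X by (auto simp: bounded_complex_iff)
  obtain N' where N': "\<And>n. \<bar>n\<bar> > N' \<Longrightarrow> carrier (obj Y n) = {\<zero>\<^bsub>obj Y n\<^esub>}"
    using Y by (auto simp: bounded_complex_iff)
  have "\<forall>n. \<bar>n\<bar> > max N N' \<longrightarrow> carrier (obj (pair_cpx X Y) n) = {\<zero>\<^bsub>obj (pair_cpx X Y) n\<^esub>}"
    using N N' by auto
  moreover have "\<forall>n. fd_module A (obj (pair_cpx X Y) n)"
    using X Y by (auto simp: bounded_complex_iff intro!: fd_pair)
  moreover have "module_complex A (pair_cpx X Y)"
    unfolding module_complex_def
  proof (intro conjI allI ballI)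
    fix n
    show "right_module A (obj (pair_cpx X Y) n)"
      by (simp add: right_module_pair module_complex_rm m)
    have "diff (pair_cpx X Y) n = (\<lambda>p. (diff X n (fst p), diff Y n (snd p)))"
      by (auto simp: fun_eq_iff)
    then show "diff (pair_cpx X Y) n \<in> mod_hom A (obj (pair_cpx X Y) n) (obj (pair_cpx X Y) (n + 1))"
      using mod_hom_into_pair[OF mod_hom_comp[OF diff_hom[OF m(1) refl] mod_hom_fst]
          mod_hom_comp[OF diff_hom[OF m(2) refl] mod_hom_snd]] by simp
    fix z assume "z \<in> carrier (obj (pair_cpx X Y) n)"
    then show "diff (pair_cpx X Y) (n + 1) (diff (pair_cpx X Y) n z) = \<zero>\<^bsub>obj (pair_cpx X Y) (n + 1 + 1)\<^esub>"
      using diff_simps[OF m(1)] diff_simps[OF m(2)] by auto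
  qed
  ultimately show ?thesis unfolding bounded_complex_iff by blast
qed

lemma projective_complex_pair:
  assumes "projective_complex A X" "projective_complex A Y"
  shows "projective_complex A (pair_cpx X Y)"
  using assms bounded_complex_pair[OF assms[THEN projective_complex_bounded]]
  by (auto simp: projective_complex_def bounded_complex_iff intro!: fg_projective_pair)

text \<open>x |-> x - i (p x) is an idempotent endomorphism of M whose image is the kernel of p. So
  the kernel is a module by \<open>right_module_surj\<close>, and being a quotient of M it inherits
  finite-dimensionality.\<close>

lemma right_module_retract_kernel:
  assumes M: "right_module A M" and N: "right_module A N"
    and i: "i \<in> mod_hom A N M" and p: "p \<in> mod_hom A M N"
    and pi: "\<And>x. x \<in> carrier N \<Longrightarrow> p (i x) = x"
  defines "K \<equiv> M\<lparr>carrier := {x \<in> carrier M. p x = \<zero>\<^bsub>N\<^esub>}\<rparr>"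
  shows "right_module A K"
    and "(\<lambda>x. x \<oplus>\<^bsub>M\<^esub> \<ominus>\<^bsub>M\<^esub> i (p x)) \<in> mod_hom A M K"
    and "(\<lambda>x. x \<oplus>\<^bsub>M\<^esub> \<ominus>\<^bsub>M\<^esub> i (p x)) ` carrier M = carrier K"
proof -
  let ?e = "\<lambda>x. x \<oplus>\<^bsub>M\<^esub> \<ominus>\<^bsub>M\<^esub> i (p x)"
  note ag = right_module_ag[OF M] right_module_ag[OF N]
  note s = mod_hom_closed[OF i] mod_hom_closed[OF p] mod_hom_add[OF i] mod_hom_add[OF p]
    mod_hom_zero[OF i ag(2,1)] mod_hom_zero[OF p ag] mod_hom_neg[OF i ag(2,1)] mod_hom_neg[OF p ag]
    ag_simps[OF ag(1)] ag_simps[OF ag(2)] pi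
  have e: "?e \<in> mod_hom A M M"
    by (intro mod_hom_plus mod_hom_uminus mod_hom_id M mod_hom_comp[OF i p])
  have K: "carrier K = {x \<in> carrier M. p x = \<zero>\<^bsub>N\<^esub>}" "\<zero>\<^bsub>K\<^esub> = \<zero>\<^bsub>M\<^esub>"
    "\<And>x y. x \<oplus>\<^bsub>K\<^esub> y = x \<oplus>\<^bsub>M\<^esub> y" "\<And>a x. a \<odot>\<^bsub>K\<^esub> x = a \<odot>\<^bsub>M\<^esub> x"
    by (simp_all add: K_def)
  have fx: "?e x = x" if "x \<in> carrier K" for x using that by (simp add: K s)
  have cl: "?e x \<in> carrier K" if "x \<in> carrier M" for x using that by (simp add: K s)
  show im: "?e ` carrier M = carrier K"
  proof
    show "carrier K \<subseteq> ?e ` carrier M"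
    proof
      fix x assume x: "x \<in> carrier K"
      then have "x \<in> carrier M" by (simp add: K)
      with fx[OF x] show "x \<in> ?e ` carrier M" by (intro image_eqI[of x ?e x]) simp_all
    qed
  qed (use cl in auto)
  show "right_module A K"
    by (rule right_module_surj[OF M im])
      (use mod_hom_add[OF e] mod_hom_act[OF e] in \<open>simp_all add: K s\<close>)
  show "?e \<in> mod_hom A M K"
    by (rule mod_homI) (use cl mod_hom_add[OF e] mod_hom_act[OF e] in \<open>simp_all add: K(2-4)\<close>)
qed

text \<open>
  The predicate \<^const>\<open>generated\<close> lives on small complexes; \<open>Gen\<close> is its extension to complexes of
  projectives with arbitrary carriers.
\<close>

definition Gen :: "('r, 't) cpx \<Rightarrow> ('r, 'm) cpx \<Rightarrow> bool" where
  "Gen T Y \<longleftrightarrow> projective_complex A Y \<and>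
     (\<exists>P \<phi> \<psi>. bounded_complex A P \<and> cpx_iso A P Y \<phi> \<psi> \<and> generated A T P)"

text \<open>Independence of the chosen copy: two copies of one projective complex are isomorphic
  complexes, hence isomorphic in the derived category, and \<open>generated\<close> is closed under
  that.\<close>

lemma Gen_generated:
  assumes "Gen T Y" "bounded_complex A P'" "cpx_iso A P' Y \<phi>' \<psi>'"
  shows "generated A T P'"
proof -
  obtain P \<phi> \<psi> where P: "bounded_complex A P" "cpx_iso A P Y \<phi> \<psi>" "generated A T P"
    and Y: "projective_complex A Y"
    using assms by (auto simp: Gen_def)
  note i = cpx_iso_trans[OF P(2) cpx_iso_sym[OF assms(3)]]
  have "projective_complex A P" by (rule projective_complex_iso[OF Y P(1) cpx_iso_sym[OF P(2)]])
  then have "Db_isomorphic A P P'"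
    by (rule Db_isomorphic_quasi_iso[OF _ assms(2) cpx_iso_quasi_iso[OF _ _ i]])
      (use P(1) assms(2) bounded_complex_module_complex in auto)
  then show ?thesis by (rule generated.iso[OF P(3) assms(2)])
qed

lemma Gen_generated_self: "Gen T P \<Longrightarrow> generated A T P"
  by (rule Gen_generated[where \<phi>' = "\<lambda>n x. x" and \<psi>' = "\<lambda>n x. x"])
    (auto simp: Gen_def projective_complex_def cpx_iso_def chain_map_id)

lemma Gen_projective: "Gen T Y \<Longrightarrow> projective_complex A Y"
  by (simp add: Gen_def)

lemma proj_module_complex: "projective_complex A X \<Longrightarrow> module_complex A X"
  using projective_complex_bounded bounded_complex_module_complex by blast

text \<open>The small copies inherit projectivity, so the quasi-isomorphism between them is an
  isomorphism of the derived category and can be used in either direction.\<close>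

lemma
  assumes q: "quasi_iso A Y Y' q" and Y: "projective_complex A Y" and Y': "projective_complex A Y'"
  shows Gen_quasi_iso: "Gen T Y \<Longrightarrow> Gen T Y'"
    and Gen_quasi_iso_rev: "Gen T Y' \<Longrightarrow> Gen T Y"
proof -
  obtain P :: "('k, 'r) small_cpx" and \<phi> \<psi> where P: "bounded_complex A P" "cpx_iso A P Y \<phi> \<psi>"
    using small_copy[OF projective_complex_bounded[OF Y]] by blast
  obtain P' :: "('k, 'r) small_cpx" and \<phi>' \<psi>' where P': "bounded_complex A P'" "cpx_iso A P' Y' \<phi>' \<psi>'"
    using small_copy[OF projective_complex_bounded[OF Y']] by blast
  note m = bounded_complex_module_complex[OF P(1)] bounded_complex_module_complex[OF P'(1)]
    proj_module_complex[OF Y] proj_module_complex[OF Y']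
  have "quasi_iso A P P' (comp_maps \<psi>' (comp_maps q \<phi>))"
    by (rule quasi_iso_comp[OF m(1,4,2) quasi_iso_comp[OF m(1,3,4) cpx_iso_quasi_iso[OF m(1,3) P(2)] q]
          cpx_iso_quasi_iso[OF m(4,2) cpx_iso_sym[OF P'(2)]]])
  moreover have "projective_complex A P" by (rule projective_complex_iso[OF Y P(1) cpx_iso_sym[OF P(2)]])
  ultimately have i: "Db_isomorphic A P P'" using P'(1) by (intro Db_isomorphic_quasi_iso)
  show "Gen T Y \<Longrightarrow> Gen T Y'"
    unfolding Gen_def[of T Y']
    using Y' P' generated.iso[OF Gen_generated[OF _ P] P'(1) i] by blast
  show "Gen T Y' \<Longrightarrow> Gen T Y"
    unfolding Gen_def[of T Y]
    using Y P generated.iso[OF Gen_generated[OF _ P'] P(1) Db_isomorphic_sym[OF i]] by blast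
qed

lemma Gen_iso:
  assumes "Gen T Y" "bounded_complex A Y'" "cpx_iso A Y Y' f g"
  shows "Gen T Y'"
proof -
  note Y = Gen_projective[OF assms(1)]
  note Y' = projective_complex_iso[OF Y assms(2,3)]
  show ?thesis
    by (rule Gen_quasi_iso[OF cpx_iso_quasi_iso[OF _ _ assms(3)] Y Y' assms(1)])
      (intro proj_module_complex Y Y')+
qed

lemma Gen_shift:
  assumes "Gen T Y"
  shows "Gen T (shift r Y)"
proof -
  obtain P \<phi> \<psi> where P: "bounded_complex A P" "cpx_iso A P Y \<phi> \<psi>" "generated A T P"
    and Y: "projective_complex A Y"
    using assms by (auto simp: Gen_def)
  note m = bounded_complex_module_complex[OF P(1)] proj_module_complex[OF Y]
  have "cpx_iso A (shift r P) (shift r Y) (\<lambda>n. \<phi> (n + r)) (\<lambda>n. \<psi> (n + r))"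
    using P(2) chain_map_shift[OF _ m] chain_map_shift[OF _ m(2,1)] by (auto simp: cpx_iso_def)
  then show ?thesis
    using generated.shift[OF P(3), of r] bounded_complex_shift[OF P(1)] projective_complex_shift[OF Y]
    unfolding Gen_def by blast
qed

lemma cpx_iso_cone:
  assumes i: "cpx_iso A P X \<phi> \<psi>" and i': "cpx_iso A P' Y \<phi>' \<psi>'" and f: "chain_map A X Y f"
    and m: "module_complex A P" "module_complex A X" "module_complex A P'" "module_complex A Y"
  shows "cpx_iso A (mapping_cone P P' (comp_maps \<psi>' (comp_maps f \<phi>))) (mapping_cone X Y f)
    (\<lambda>n (x, y). (\<phi> (n + 1) x, \<phi>' n y)) (\<lambda>n (x, y). (\<psi> (n + 1) x, \<psi>' n y))"
proof -
  let ?f = "comp_maps \<psi>' (comp_maps f \<phi>)"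
  have c: "chain_map A P X \<phi>" "chain_map A X P \<psi>" "chain_map A P' Y \<phi>'" "chain_map A Y P' \<psi>'"
    and inv: "\<And>n x. x \<in> carrier (obj P n) \<Longrightarrow> \<psi> n (\<phi> n x) = x"
    "\<And>n x. x \<in> carrier (obj X n) \<Longrightarrow> \<phi> n (\<psi> n x) = x"
    "\<And>n x. x \<in> carrier (obj P' n) \<Longrightarrow> \<psi>' n (\<phi>' n x) = x"
    "\<And>n x. x \<in> carrier (obj Y n) \<Longrightarrow> \<phi>' n (\<psi>' n x) = x"
    using i i' by (auto simp: cpx_iso_def)
  have f': "chain_map A P P' ?f"
    by (rule chain_map_comp[OF c(4) chain_map_comp[OF f c(1)]])
  note s = chain_map_simps[OF c(1) m(1,2)] chain_map_simps[OF c(2) m(2,1)]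
    chain_map_simps[OF c(3) m(3,4)] chain_map_simps[OF c(4) m(4,3)] chain_map_simps[OF f m(2,4)]
    diff_simps[OF m(1)] diff_simps[OF m(2)] diff_simps[OF m(3)] diff_simps[OF m(4)] inv
  show ?thesis
  proof (rule cpx_isoI)
    show "module_complex A (mapping_cone P P' ?f)" by (rule module_complex_cone[OF m(1,3) f'])
    show "chain_map A (mapping_cone P P' ?f) (mapping_cone X Y f) (\<lambda>n (x, y). (\<phi> (n + 1) x, \<phi>' n y))"
    proof (rule chain_mapI)
      have "(\<lambda>p. (\<phi> (n + 1) (fst p), \<phi>' n (snd p)))
        \<in> mod_hom A (pair_mod (obj P (n + 1)) (obj P' n)) (pair_mod (obj X (n + 1)) (obj Y n))" for n
        by (intro mod_hom_into_pair mod_hom_comp[OF chain_map_hom[OF c(1)] mod_hom_fst]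
            mod_hom_comp[OF chain_map_hom[OF c(3)] mod_hom_snd])
      then show "graded_hom A (mapping_cone P P' ?f) (mapping_cone X Y f) 0 (\<lambda>n (x, y). (\<phi> (n + 1) x, \<phi>' n y))"
        by (simp add: graded_hom_def case_prod_unfold)
    qed (auto simp: s comp_maps_def)
  qed (auto simp: s)
qed

text \<open>\<open>generated\<close> has triangles on small complexes only; the cone is formed
  between the copies and compared with the wanted one by \<open>cpx_iso_cone\<close>.\<close>

lemma Gen_cone:
  assumes "Gen T X" "Gen T Y" and f: "chain_map A X Y f"
  shows "Gen T (mapping_cone X Y f)"
proof -
  obtain P \<phi> \<psi> where P: "bounded_complex A P" "cpx_iso A P X \<phi> \<psi>" "generated A T P"
    and X: "projective_complex A X"
    using assms by (auto simp: Gen_def)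
  obtain P' \<phi>' \<psi>' where P': "bounded_complex A P'" "cpx_iso A P' Y \<phi>' \<psi>'" "generated A T P'"
    and Y: "projective_complex A Y"
    using assms by (auto simp: Gen_def)
  note m = bounded_complex_module_complex[OF P(1)] proj_module_complex[OF X]
    bounded_complex_module_complex[OF P'(1)] proj_module_complex[OF Y]
  let ?f = "comp_maps \<psi>' (comp_maps f \<phi>)"
  have f': "chain_map A P P' ?f"
    using P(2) P'(2) chain_map_comp f unfolding cpx_iso_def by metis
  note C = bounded_complex_cone[OF P(1) P'(1) f']
  obtain Z :: "('k, 'r) small_cpx" and \<alpha> \<beta> where Z: "bounded_complex A Z" "cpx_iso A Z (mapping_cone P P' ?f) \<alpha> \<beta>"
    using small_copy[OF C] by blast
  note PC = projective_complex_cone[OF X Y f]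
  note i = cpx_iso_trans[OF Z(2) cpx_iso_cone[OF P(2) P'(2) f m]]
  note PZ = projective_complex_iso[OF PC Z(1) cpx_iso_sym[OF i]]
  have "Db_isomorphic A Z (mapping_cone P P' ?f)"
    by (rule Db_isomorphic_quasi_iso[OF PZ C cpx_iso_quasi_iso[OF _ _ Z(2)]])
      (intro bounded_complex_module_complex Z C)+
  then have "generated A T Z"
    by (rule generated.triangle[OF P(3) P'(3) f' Z(1)])
  then show ?thesis using PC Z(1) i unfolding Gen_def by blast
qed

text \<open>The rule \<open>summand\<close> asks for a complement of X as a complex. It is the
  kernel K of p, a subcomplex because p is a chain map, and T is isomorphic to X + K.\<close>

lemma Gen_retract:
  assumes T: "projective_complex A T" and X: "projective_complex A X"
    and i: "chain_map A X T i" and p: "chain_map A T X p"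
    and pi: "\<And>n x. x \<in> carrier (obj X n) \<Longrightarrow> p n (i n x) = x"
  shows "Gen T X"
proof -
  note mT = proj_module_complex[OF T] and mX = proj_module_complex[OF X]
  define K where "K = \<lparr>obj = \<lambda>n. (obj T n)\<lparr>carrier := {x \<in> carrier (obj T n). p n x = \<zero>\<^bsub>obj X n\<^esub>}\<rparr>,
    diff = diff T\<rparr>"
  have K: "carrier (obj K n) = {x \<in> carrier (obj T n). p n x = \<zero>\<^bsub>obj X n\<^esub>}" "\<zero>\<^bsub>obj K n\<^esub> = \<zero>\<^bsub>obj T n\<^esub>"
    "x \<oplus>\<^bsub>obj K n\<^esub> y = x \<oplus>\<^bsub>obj T n\<^esub> y" "a \<odot>\<^bsub>obj K n\<^esub> x = a \<odot>\<^bsub>obj T n\<^esub> x" "diff K = diff T" for n x y a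
    by (simp_all add: K_def)
  note ker = right_module_retract_kernel[OF module_complex_rm[OF mT] module_complex_rm[OF mX]
      chain_map_hom[OF i] chain_map_hom[OF p] pi]
  have rmK: "right_module A (obj K n)" for n using ker(1)[of n] by (simp add: K_def)
  have e: "(\<lambda>x. x \<oplus>\<^bsub>obj T n\<^esub> \<ominus>\<^bsub>obj T n\<^esub> i n (p n x)) \<in> mod_hom A (obj T n) (obj K n)"
    "(\<lambda>x. x \<oplus>\<^bsub>obj T n\<^esub> \<ominus>\<^bsub>obj T n\<^esub> i n (p n x)) ` carrier (obj T n) = carrier (obj K n)" for n
    using ker(2,3)[of n] by (simp_all add: K_def)
  note s = diff_simps[OF mT] diff_simps[OF mX] chain_map_simps[OF p mT mX] chain_map_simps[OF i mX mT]
    ag_simps module_complex_ag[OF mT] module_complex_ag[OF mX] pi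
  have mK: "module_complex A K"
    unfolding module_complex_def
  proof (intro conjI allI ballI rmK)
    fix n
    show "diff K n \<in> mod_hom A (obj K n) (obj K (n + 1))"
    proof (rule mod_homI)
      show "diff K n x \<in> carrier (obj K (n + 1))" if "x \<in> carrier (obj K n)" for x
        using that by (simp add: K s)
    qed (use mod_hom_add[OF diff_hom[OF mT refl]] mod_hom_act[OF diff_hom[OF mT refl]] in \<open>simp_all add: K\<close>)
  qed (simp add: K s)
  have bT: "bounded_complex A T" using T projective_complex_bounded by blast
  then obtain N where N: "\<And>n. \<bar>n\<bar> > N \<Longrightarrow> carrier (obj T n) = {\<zero>\<^bsub>obj T n\<^esub>}"
    by (auto simp: bounded_complex_iff)
  have "fd_module A (obj K n)" for n
    by (rule fd_surj[OF _ rmK e(1)]) (use bT e(2) in \<open>auto simp: bounded_complex_iff\<close>)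
  moreover have "carrier (obj K n) = {\<zero>\<^bsub>obj K n\<^esub>}" if "\<bar>n\<bar> > N" for n
    using N[OF that] by (auto simp: K s)
  ultimately have bK: "bounded_complex A K" unfolding bounded_complex_iff using mK by blast
  obtain P :: "('k, 'r) small_cpx" and \<phi> \<psi> where P: "bounded_complex A P" "cpx_iso A P X \<phi> \<psi>"
    using small_copy[OF projective_complex_bounded[OF X]] by blast
  obtain P' :: "('k, 'r) small_cpx" and \<phi>' \<psi>' where P': "bounded_complex A P'" "cpx_iso A P' K \<phi>' \<psi>'"
    using small_copy[OF bK] by blast
  note mP = bounded_complex_module_complex[OF P(1)] and mP' = bounded_complex_module_complex[OF P'(1)]
  have c: "chain_map A P X \<phi>" "chain_map A X P \<psi>" "chain_map A P' K \<phi>'" "chain_map A K P' \<psi>'"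
    and inv: "\<And>n x. x \<in> carrier (obj P n) \<Longrightarrow> \<psi> n (\<phi> n x) = x"
    "\<And>n x. x \<in> carrier (obj X n) \<Longrightarrow> \<phi> n (\<psi> n x) = x"
    "\<And>n x. x \<in> carrier (obj P' n) \<Longrightarrow> \<psi>' n (\<phi>' n x) = x"
    "\<And>n x. x \<in> carrier (obj K n) \<Longrightarrow> \<phi>' n (\<psi>' n x) = x"
    using P(2) P'(2) by (auto simp: cpx_iso_def)
  have kt: "chain_map A K T (\<lambda>n x. x)"
    by (simp add: chain_map_def K mod_hom_def)
  have c': "chain_map A P' T \<phi>'"
    using chain_map_comp[OF kt c(3)] by (simp add: comp_maps_def o_def)
  have c0: "chain_map A P T (comp_maps i \<phi>)" by (rule chain_map_comp[OF i c(1)])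
  have pc': "p n (\<phi>' n x) = \<zero>\<^bsub>obj X n\<^esub>" if "x \<in> carrier (obj P' n)" for n x
    using chain_map_simps(1)[OF c(3) mP' mK that] by (simp add: K)
  note q = s chain_map_simps[OF c' mP' mT] chain_map_simps[OF c(1) mP mX] chain_map_simps[OF c(2) mX mP] inv(1-3) pc'
  let ?PP = "pair_cpx P P'"
  have bPP: "bounded_complex A ?PP" by (rule bounded_complex_pair[OF P(1) P'(1)])
  let ?F = "\<lambda>n (x, y). i n (\<phi> n x) \<oplus>\<^bsub>obj T n\<^esub> \<phi>' n y"
  let ?e = "\<lambda>n z. z \<oplus>\<^bsub>obj T n\<^esub> \<ominus>\<^bsub>obj T n\<^esub> i n (p n z)"
  have eK: "?e n z \<in> carrier (obj K n)" if "z \<in> carrier (obj T n)" for n z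
    using mod_hom_closed[OF e(1)] that by blast
  have iso: "cpx_iso A ?PP T ?F (\<lambda>n z. (\<psi> n (p n z), \<psi>' n (?e n z)))"
  proof (rule cpx_isoI)
    show "module_complex A ?PP" by (rule bounded_complex_module_complex[OF bPP])
    show "chain_map A ?PP T ?F"
    proof (rule chain_mapI)
      have "(\<lambda>w. comp_maps i \<phi> n (fst w) \<oplus>\<^bsub>obj T n\<^esub> \<phi>' n (snd w)) \<in> mod_hom A (pair_mod (obj P n) (obj P' n)) (obj T n)" for n
        by (intro mod_hom_from_pair chain_map_hom[OF c0] chain_map_hom[OF c'] module_complex_rm[OF mT])
      then show "graded_hom A ?PP T 0 ?F"
        by (simp add: graded_hom_def case_prod_unfold comp_maps_def)
    qed (auto simp: q)
  next
    fix n z assume z: "z \<in> carrier (obj T n)"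
    have "\<psi> n (p n z) \<in> carrier (obj P n)" "\<psi>' n (?e n z) \<in> carrier (obj P' n)"
      using z chain_map_simps(1)[OF c(4) mK mP' eK[OF z]] by (simp_all add: q)
    moreover have "i n (p n z) \<oplus>\<^bsub>obj T n\<^esub> ?e n z = z"
      using z by (simp add: q ag_ac ag_cancel_mid)
    ultimately show "(\<psi> n (p n z), \<psi>' n (?e n z)) \<in> carrier (obj ?PP n) \<and> ?F n (\<psi> n (p n z), \<psi>' n (?e n z)) = z"
      using z inv(4)[OF eK[OF z]] by (simp add: q)
  next
    fix n w assume "w \<in> carrier (obj ?PP n)"
    then obtain x y where w: "w = (x, y)" "x \<in> carrier (obj P n)" "y \<in> carrier (obj P' n)" by auto
    have "p n (?F n w) = \<phi> n x" using w by (simp add: q)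
    moreover have "?F n w \<oplus>\<^bsub>obj T n\<^esub> \<ominus>\<^bsub>obj T n\<^esub> i n (\<phi> n x) = \<phi>' n y"
      using w by (simp add: q ag_ac ag_cancel_mid)
    ultimately show "(\<psi> n (p n (?F n w)), \<psi>' n (?e n (?F n w))) = w"
      using w by (simp add: q del: split_conv)
  qed
  have "Db_isomorphic A ?PP T"
    by (rule Db_isomorphic_quasi_iso[OF projective_complex_iso[OF T bPP cpx_iso_sym[OF iso]] bT
          cpx_iso_quasi_iso[OF bounded_complex_module_complex[OF bPP] mT iso]])
  then have "generated A T P" by (rule generated.summand[OF P(1) P'(1)])
  then show ?thesis using X P unfolding Gen_def by blast
qed

text \<open>A zero complex is a retract of T, with zero maps both ways.\<close>

lemma Gen_trivial:
  assumes T: "projective_complex A T" and X: "module_complex A X"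
    and X0: "\<And>n. carrier (obj X n) = {\<zero>\<^bsub>obj X n\<^esub>}"
  shows "Gen T X"
proof (rule Gen_retract[OF T])
  have "bounded_complex A X"
    unfolding bounded_complex_iff using X X0 fd_trivial module_complex_rm[OF X] by blast
  then show "projective_complex A X"
    using fg_projective_trivial[OF module_complex_rm[OF X] X0] by (simp add: projective_complex_def)
  show "chain_map A X T (\<lambda>n x. \<zero>\<^bsub>obj T n\<^esub>)" "chain_map A T X (\<lambda>n x. \<zero>\<^bsub>obj X n\<^esub>)"
    by (intro chain_map_zero X proj_module_complex T)+
qed (use X0 in auto)

text \<open>The direct sum is the cone of the zero map X[-1] -> Y.\<close>

lemma Gen_pair:
  assumes "Gen T X" "Gen T Y"
  shows "Gen T (pair_cpx X Y)"
proof -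
  note X = Gen_projective[OF assms(1)] and Y = Gen_projective[OF assms(2)]
  note mX = proj_module_complex[OF X] and mY = proj_module_complex[OF Y]
  let ?S = "shift (- 1) X" and ?z = "\<lambda>n x. \<zero>\<^bsub>obj Y n\<^esub>"
  note mS = module_complex_shift[OF mX, of "- 1"]
  have z: "chain_map A ?S Y ?z" by (rule chain_map_zero[OF mS mY])
  have G: "Gen T (mapping_cone ?S Y ?z)" by (rule Gen_cone[OF Gen_shift[OF assms(1)] assms(2) z])
  have B: "bounded_complex A (pair_cpx X Y)"
    by (intro bounded_complex_pair projective_complex_bounded X Y)
  show ?thesis
  proof (rule Gen_iso[OF G B])
    show "cpx_iso A (mapping_cone ?S Y ?z) (pair_cpx X Y) (\<lambda>n x. x) (\<lambda>n x. x)"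
    proof (rule cpx_isoI)
      show "module_complex A (mapping_cone ?S Y ?z)" by (rule module_complex_cone[OF mS mY z])
      show "chain_map A (mapping_cone ?S Y ?z) (pair_cpx X Y) (\<lambda>n x. x)"
      proof (rule chain_mapI)
        show "graded_hom A (mapping_cone ?S Y ?z) (pair_cpx X Y) 0 (\<lambda>n x. x)"
          by (simp add: graded_hom_def mod_hom_id)
      qed (auto simp: diff_simps[OF mX] diff_simps[OF mY] ag_simps module_complex_ag[OF mX] module_complex_ag[OF mY])
    qed auto
  qed
qed

subsection \<open>Short exact sequences\<close>

context
  fixes Y :: "('r, 'y) cpx" and E :: "('r, 'e) cpx" and Z :: "('r, 'z) cpx" and i p
  assumes Y: "projective_complex A Y" and E: "projective_complex A E" and Z: "projective_complex A Z"
    and i: "chain_map A Y E i" and p: "chain_map A E Z p"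
    and inj: "\<And>n y. \<lbrakk>y \<in> carrier (obj Y n); i n y = \<zero>\<^bsub>obj E n\<^esub>\<rbrakk> \<Longrightarrow> y = \<zero>\<^bsub>obj Y n\<^esub>"
    and surj: "\<And>n z. z \<in> carrier (obj Z n) \<Longrightarrow> \<exists>e\<in>carrier (obj E n). z = p n e"
    and exact: "\<And>n e. e \<in> carrier (obj E n) \<Longrightarrow> p n e = \<zero>\<^bsub>obj Z n\<^esub> \<longleftrightarrow> (\<exists>y\<in>carrier (obj Y n). e = i n y)"
begin

text \<open>The map (y, e) |-> p e from the cone of i to Z is a quasi-isomorphism between complexes
  of projectives, so Z inherits generation from the cone.\<close>

lemma Gen_ses_right:
  assumes "Gen T Y" "Gen T E"
  shows "Gen T Z"
proof -
  note mY = proj_module_complex[OF Y] and mE = proj_module_complex[OF E] and mZ = proj_module_complex[OF Z]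
  note s = diff_simps[OF mY] diff_simps[OF mE] diff_simps[OF mZ] chain_map_simps[OF i mY mE]
    chain_map_simps[OF p mE mZ] ag_simps module_complex_ag[OF mY] module_complex_ag[OF mE] module_complex_ag[OF mZ]
  have pi: "p n (i n y) = \<zero>\<^bsub>obj Z n\<^esub>" if "y \<in> carrier (obj Y n)" for n y
    using exact[of "i n y" n] that by (auto simp: s)
  let ?C = "mapping_cone Y E i"
  note mC = module_complex_cone[OF mY mE i]
  let ?q = "\<lambda>n (y, e). p n e"
  have "quasi_iso A ?C Z ?q"
  proof (rule quasi_isoI[OF mC mZ])
    show "chain_map A ?C Z ?q"
    proof (rule chain_mapI)
      have "(\<lambda>w. p n (snd w)) \<in> mod_hom A (pair_mod (obj Y (n + 1)) (obj E n)) (obj Z n)" for n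
        by (rule mod_hom_comp[OF chain_map_hom[OF p] mod_hom_snd])
      then show "graded_hom A ?C Z 0 ?q" by (simp add: graded_hom_def case_prod_unfold)
    qed (auto simp: s pi)
  next
    fix n w assume w: "w \<in> cocycles ?C n" "?q n w \<in> coboundaries Z n"
    obtain y e where we: "w = (y, e)" by (cases w)
    have y: "y \<in> carrier (obj Y (n + 1))" and e: "e \<in> carrier (obj E n)"
      and c: "i (n + 1) y \<oplus>\<^bsub>obj E (n + 1)\<^esub> diff E n e = \<zero>\<^bsub>obj E (n + 1)\<^esub>"
      using w(1) by (auto simp: we cocycles_def)
    obtain z where z: "z \<in> carrier (obj Z (n - 1))" "p n e = diff Z (n - 1) z"
      using w(2) by (auto simp: we coboundaries_def)
    obtain e' where e': "e' \<in> carrier (obj E (n - 1))" "z = p (n - 1) e'" using surj[OF z(1)] by blast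
    \<comment> \<open>Subtracting the boundary of a preimage of z moves e into the kernel of p,
      where exactness applies.\<close>
    let ?u = "e \<oplus>\<^bsub>obj E n\<^esub> \<ominus>\<^bsub>obj E n\<^esub> diff E (n - 1) e'"
    have uc: "?u \<in> carrier (obj E n)" using e e' by (simp add: s)
    have "p n ?u = \<zero>\<^bsub>obj Z n\<^esub>"
      using e e'(1) z(2) by (simp add: s e'(2))
    then obtain y' where y': "y' \<in> carrier (obj Y n)" "?u = i n y'" using exact[OF uc] by blast
    have eq: "i n y' \<oplus>\<^bsub>obj E n\<^esub> diff E (n - 1) e' = e"
      unfolding y'(2)[symmetric] using e e' by (simp add: s ag_ac ag_cancel_mid)
    have "diff E n e = i (n + 1) (diff Y n y')"
      unfolding eq[symmetric] using y' e' by (simp add: s)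
    then have "i (n + 1) (y \<oplus>\<^bsub>obj Y (n + 1)\<^esub> diff Y n y') = \<zero>\<^bsub>obj E (n + 1)\<^esub>"
      using y y' c by (simp add: s)
    then have yy: "y \<oplus>\<^bsub>obj Y (n + 1)\<^esub> diff Y n y' = \<zero>\<^bsub>obj Y (n + 1)\<^esub>"
      using y y' by (intro inj) (simp_all add: s)
    have "y = \<ominus>\<^bsub>obj Y (n + 1)\<^esub> diff Y n y'"
      by (rule ag_diff_zero[OF module_complex_ag[OF mY, of "n + 1"]]) (use y y' yy in \<open>simp_all add: s\<close>)
    then have "diff ?C (n - 1) (y', e') = w" using eq by (simp add: we)
    moreover have "(y', e') \<in> carrier (obj ?C (n - 1))" using y' e' by simp
    ultimately show "w \<in> coboundaries ?C n" unfolding coboundaries_def by (metis image_eqI)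
  next
    fix n z assume z: "z \<in> cocycles Z n"
    then have z': "z \<in> carrier (obj Z n)" "diff Z n z = \<zero>\<^bsub>obj Z (n + 1)\<^esub>" by (auto simp: cocycles_def)
    obtain e where e: "e \<in> carrier (obj E n)" "z = p n e" using surj[OF z'(1)] by blast
    have "p (n + 1) (diff E n e) = \<zero>\<^bsub>obj Z (n + 1)\<^esub>" using e z' by (simp add: s)
    then obtain y where y: "y \<in> carrier (obj Y (n + 1))" "diff E n e = i (n + 1) y"
      using exact[of "diff E n e" "n + 1"] e by (auto simp: s)
    have "i (n + 1 + 1) (diff Y (n + 1) y) = diff E (n + 1) (diff E n e)"
      unfolding y(2) using y(1) by (simp add: s)
    also have "\<dots> = \<zero>\<^bsub>obj E (n + 1 + 1)\<^esub>" using e by (simp add: s)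
    finally have dy: "diff Y (n + 1) y = \<zero>\<^bsub>obj Y (n + 1 + 1)\<^esub>"
      by (rule inj[rotated]) (use y in \<open>simp add: s\<close>)
    have "(\<ominus>\<^bsub>obj Y (n + 1)\<^esub> y, e) \<in> cocycles ?C n"
      using y e dy by (simp add: cocycles_def s)
    moreover have "z = \<zero>\<^bsub>obj Z n\<^esub> \<oplus>\<^bsub>obj Z n\<^esub> ?q n (\<ominus>\<^bsub>obj Y (n + 1)\<^esub> y, e)"
      using e by (simp add: s)
    moreover have "\<zero>\<^bsub>obj Z n\<^esub> \<in> coboundaries Z n"
      using additive_subgroup.zero_closed[OF additive_subgroup_coboundaries[OF mZ]] .
    ultimately show "\<exists>w\<in>cocycles ?C n. \<exists>b\<in>coboundaries Z n. z = b \<oplus>\<^bsub>obj Z n\<^esub> ?q n w" by blast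
  qed
  then show ?thesis
    by (rule Gen_quasi_iso[OF _ projective_complex_cone[OF Y E i] Z Gen_cone[OF assms i]])
qed

text \<open>Dually, y |-> (i y, 0) is a quasi-isomorphism from Y[1] to the cone of p. The shift
  stays in the conclusion and is undone where the lemma is applied.\<close>

lemma Gen_ses_left:
  assumes "Gen T E" "Gen T Z"
  shows "Gen T (shift 1 Y)"
proof -
  note mY = proj_module_complex[OF Y] and mE = proj_module_complex[OF E] and mZ = proj_module_complex[OF Z]
  note s = diff_simps[OF mY] diff_simps[OF mE] diff_simps[OF mZ] chain_map_simps[OF i mY mE]
    chain_map_simps[OF p mE mZ] ag_simps module_complex_ag[OF mY] module_complex_ag[OF mE] module_complex_ag[OF mZ]
  have pi: "p n (i n y) = \<zero>\<^bsub>obj Z n\<^esub>" if "y \<in> carrier (obj Y n)" for n y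
    using exact[of "i n y" n] that by (auto simp: s)
  let ?C = "mapping_cone E Z p" and ?Y = "shift 1 Y"
  note mC = module_complex_cone[OF mE mZ p] and mS = module_complex_shift[OF mY, of 1]
  let ?q = "\<lambda>n y. (i (n + 1) y, \<zero>\<^bsub>obj Z n\<^esub>)"
  have "quasi_iso A ?Y ?C ?q"
  proof (rule quasi_isoI[OF mS mC])
    show "chain_map A ?Y ?C ?q"
    proof (rule chain_mapI)
      show "graded_hom A ?Y ?C 0 ?q"
        by (simp add: graded_hom_def mod_hom_into_pair chain_map_hom[OF i] mod_hom_zero_map module_complex_rm[OF mZ])
    qed (simp add: s pi)
  next
    fix n y assume y: "y \<in> cocycles ?Y n" "?q n y \<in> coboundaries ?C n"
    have yc: "y \<in> carrier (obj Y (n + 1))" using y(1) by (simp add: cocycles_def)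
    obtain e z where ez: "e \<in> carrier (obj E n)" "z \<in> carrier (obj Z (n - 1))"
      "i (n + 1) y = \<ominus>\<^bsub>obj E (n + 1)\<^esub> diff E n e"
      "p n e \<oplus>\<^bsub>obj Z n\<^esub> diff Z (n - 1) z = \<zero>\<^bsub>obj Z n\<^esub>"
      using y(2) by (auto simp: coboundaries_def)
    obtain e' where e': "e' \<in> carrier (obj E (n - 1))" "z = p (n - 1) e'" using surj[OF ez(2)] by blast
    let ?u = "e \<oplus>\<^bsub>obj E n\<^esub> diff E (n - 1) e'"
    have uc: "?u \<in> carrier (obj E n)" using ez e' by (simp add: s)
    have "p n ?u = \<zero>\<^bsub>obj Z n\<^esub>" using ez e'(1) by (simp add: s e'(2))
    then obtain y' where y': "y' \<in> carrier (obj Y n)" "?u = i n y'" using exact[OF uc] by blast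
    have "diff E n ?u = diff E n e" using ez e' by (simp add: s)
    then have "diff E n e = i (n + 1) (diff Y n y')" using y' by (simp add: s)
    then have "i (n + 1) (y \<oplus>\<^bsub>obj Y (n + 1)\<^esub> diff Y n y') = \<zero>\<^bsub>obj E (n + 1)\<^esub>"
      using yc y'(1) ez(3) by (simp add: s)
    then have yy: "y \<oplus>\<^bsub>obj Y (n + 1)\<^esub> diff Y n y' = \<zero>\<^bsub>obj Y (n + 1)\<^esub>"
      using yc y' by (intro inj) (simp_all add: s)
    have "y = \<ominus>\<^bsub>obj Y (n + 1)\<^esub> diff Y n y'"
      by (rule ag_diff_zero[OF module_complex_ag[OF mY, of "n + 1"]]) (use yc y' yy in \<open>simp_all add: s\<close>)
    then have "diff ?Y (n - 1) y' = y" by simp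
    moreover have "y' \<in> carrier (obj ?Y (n - 1))" using y' by simp
    ultimately show "y \<in> coboundaries ?Y n" unfolding coboundaries_def by (metis image_eqI)
  next
    fix n w assume w: "w \<in> cocycles ?C n"
    obtain e z where we: "w = (e, z)" by (cases w)
    have e: "e \<in> carrier (obj E (n + 1))" and z: "z \<in> carrier (obj Z n)"
      and de: "\<ominus>\<^bsub>obj E (n + 1 + 1)\<^esub> diff E (n + 1) e = \<zero>\<^bsub>obj E (n + 1 + 1)\<^esub>"
      and pe: "p (n + 1) e \<oplus>\<^bsub>obj Z (n + 1)\<^esub> diff Z n z = \<zero>\<^bsub>obj Z (n + 1)\<^esub>"
      using w by (auto simp: we cocycles_def)
    have "diff E (n + 1) e = \<ominus>\<^bsub>obj E (n + 1 + 1)\<^esub> (\<ominus>\<^bsub>obj E (n + 1 + 1)\<^esub> diff E (n + 1) e)"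
      using e by (simp add: s)
    also have "\<dots> = \<zero>\<^bsub>obj E (n + 1 + 1)\<^esub>" unfolding de by (simp add: s)
    finally have de': "diff E (n + 1) e = \<zero>\<^bsub>obj E (n + 1 + 1)\<^esub>" .
    obtain e' where e': "e' \<in> carrier (obj E n)" "z = p n e'" using surj[OF z] by blast
    let ?u = "e \<oplus>\<^bsub>obj E (n + 1)\<^esub> diff E n e'"
    have uc: "?u \<in> carrier (obj E (n + 1))" using e e' by (simp add: s)
    have "p (n + 1) ?u = \<zero>\<^bsub>obj Z (n + 1)\<^esub>" using e e'(1) pe by (simp add: s e'(2))
    then obtain y where y: "y \<in> carrier (obj Y (n + 1))" "?u = i (n + 1) y" using exact[OF uc] by blast
    have "i (n + 1 + 1) (diff Y (n + 1) y) = diff E (n + 1) ?u"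
      unfolding y(2) using y(1) by (simp add: s)
    also have "\<dots> = \<zero>\<^bsub>obj E (n + 1 + 1)\<^esub>" using e e' de' by (simp add: s)
    finally have dy: "diff Y (n + 1) y = \<zero>\<^bsub>obj Y (n + 1 + 1)\<^esub>"
      by (rule inj[rotated]) (use y in \<open>simp add: s\<close>)
    have "y \<in> cocycles ?Y n" using y dy by (simp add: cocycles_def s)
    moreover have "diff ?C (n - 1) (e', \<zero>\<^bsub>obj Z (n - 1)\<^esub>) \<in> coboundaries ?C n"
      unfolding coboundaries_def using e' by (intro imageI) (simp add: s)
    moreover have "w = diff ?C (n - 1) (e', \<zero>\<^bsub>obj Z (n - 1)\<^esub>) \<oplus>\<^bsub>obj ?C n\<^esub> ?q n y"
      using e e' z unfolding y(2)[symmetric] by (simp add: we s ag_ac ag_cancel_mid)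
    ultimately show "\<exists>y\<in>cocycles ?Y n. \<exists>b\<in>coboundaries ?C n. w = b \<oplus>\<^bsub>obj ?C n\<^esub> ?q n y" by blast
  qed
  then show ?thesis
    by (rule Gen_quasi_iso_rev[OF _ projective_complex_shift[OF Y] projective_complex_cone[OF E Z p] Gen_cone[OF assms p]])
qed

end

end

text \<open>Sharper than \<open>dsum_span\<close>: x is the sum of its own components. This allows
  an estimate component by component, as the radical argument for projective modules needs.\<close>

lemma dsum_elem_span:
  fixes A :: "('k, 'r) module"
  assumes "finite J" and M: "\<And>j. j \<in> J \<Longrightarrow> right_module A (M j)"
    and x: "x \<in> carrier (dsum_mod J M)"
  shows "x \<in> mspan {} (dsum_mod J M) ((\<lambda>j. dsum_inj J M j (x j)) ` J)" (is "_ \<in> ?S")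
proof -
  have "restrict (\<lambda>j. if j \<in> S then x j else \<zero>\<^bsub>M j\<^esub>) J \<in> ?S" if "finite S" "S \<subseteq> J" for S
    using that
  proof (induction S rule: finite_induct)
    case empty
    then show ?case using mspan.zero[of "dsum_mod J M" "{}"] by (simp add: restrict_def)
  next
    case (insert s S)
    then have s: "s \<in> J" by auto
    let ?r = "\<lambda>S. restrict (\<lambda>j. if j \<in> S then x j else \<zero>\<^bsub>M j\<^esub>) J"
    have 1: "dsum_inj J M s (x s) \<in> ?S" using s by (auto intro: mspan.base)
    have 2: "?r S \<in> ?S" by (rule insert.IH) (use insert.prems in auto)
    have 3: "?r S \<oplus>\<^bsub>dsum_mod J M\<^esub> dsum_inj J M s (x s) = ?r (insert s S)"
      using x insert.hyps ag_simps[OF right_module_ag[OF M]]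
      by (auto simp: fun_eq_iff dsum_inj_def PiE_iff)
    show ?case using mspan.add[OF 2 1] unfolding 3 .
  qed
  note this[OF assms(1) order_refl]
  moreover have "restrict (\<lambda>j. if j \<in> J then x j else \<zero>\<^bsub>M j\<^esub>) J = x"
    using x by (auto simp: PiE_iff extensional_def fun_eq_iff)
  ultimately show ?thesis by simp
qed

lemma stalk_simps [simp]:
  "obj (stalk M) n = (if n = 0 then M else zero_sub M)"
  "diff (stalk M) n x = \<zero>\<^bsub>M\<^esub>"
  by (simp_all add: stalk_def)

context kalgebra
begin

subsection \<open>Stalk complexes and truncation\<close>

lemma module_complex_stalk:
  assumes M: "right_module A M"
  shows "module_complex A (stalk M)"
  unfolding module_complex_def
proof (intro conjI allI)
  fix n
  have *: "right_module A (obj (stalk M) n)" for n using M right_module_zero_sub[OF M] by simp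
  then show "right_module A (obj (stalk M) n)" .
  have "diff (stalk M) n = (\<lambda>x. \<zero>\<^bsub>obj (stalk M) (n + 1)\<^esub>)" by (auto simp: fun_eq_iff)
  then show "diff (stalk M) n \<in> mod_hom A (obj (stalk M) n) (obj (stalk M) (n + 1))"
    using mod_hom_zero_map[OF *] by metis
qed simp

lemma bounded_complex_stalk:
  assumes "fd_module A M"
  shows "bounded_complex A (stalk M)"
proof -
  have M: "right_module A M" using assms by (simp add: fd_module_def)
  have "fd_module A (zero_sub M)"
    by (rule fd_trivial[OF right_module_zero_sub[OF M]]) simp
  then show ?thesis
    unfolding bounded_complex_iff
    using module_complex_stalk[OF M] assms by (auto intro!: exI[of _ 0])
qed

lemma projective_complex_stalk:
  assumes "fd_module A M" "fg_projective A M"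
  shows "projective_complex A (stalk M)"
proof -
  have M: "right_module A M" using assms by (simp add: fd_module_def)
  have "fg_projective A (zero_sub M)"
    by (rule fg_projective_trivial[OF right_module_zero_sub[OF M]]) simp
  then show ?thesis using bounded_complex_stalk assms by (simp add: projective_complex_def)
qed

text \<open>Serves for a splitting of M into P_v and a complement that is a submodule of M and not
  literally a component of a \<open>pair_mod\<close>.\<close>

lemma Gen_stalk_sum:
  assumes G: "Gen T (stalk M1)" "Gen T (stalk M2)" and M: "fd_module A M"
    and M1: "right_module A M1" and M2: "right_module A M2"
    and p: "p1 \<in> mod_hom A M M1" "p2 \<in> mod_hom A M M2"
    and i: "i1 \<in> mod_hom A M1 M" "i2 \<in> mod_hom A M2 M"
    and ip: "\<And>x. x \<in> carrier M \<Longrightarrow> i1 (p1 x) \<oplus>\<^bsub>M\<^esub> i2 (p2 x) = x"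
    and pi: "\<And>x y. \<lbrakk>x \<in> carrier M1; y \<in> carrier M2\<rbrakk> \<Longrightarrow> p1 (i1 x \<oplus>\<^bsub>M\<^esub> i2 y) = x"
      "\<And>x y. \<lbrakk>x \<in> carrier M1; y \<in> carrier M2\<rbrakk> \<Longrightarrow> p2 (i1 x \<oplus>\<^bsub>M\<^esub> i2 y) = y"
  shows "Gen T (stalk M)"
proof (rule Gen_iso[OF Gen_pair[OF G] bounded_complex_stalk[OF M]])
  have rM: "right_module A M" using M by (simp add: fd_module_def)
  note ag = right_module_ag[OF rM] right_module_ag[OF M1] right_module_ag[OF M2]
  note s = ag_simps[OF ag(1)] ag_simps[OF ag(2)] ag_simps[OF ag(3)] mod_hom_closed[OF p(1)]
    mod_hom_closed[OF p(2)] mod_hom_closed[OF i(1)] mod_hom_closed[OF i(2)]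
    mod_hom_zero[OF i(1) ag(2,1)] mod_hom_zero[OF i(2) ag(3,1)] ip pi
  let ?P = "pair_cpx (stalk M1) (stalk M2)"
  let ?f = "\<lambda>n::int. \<lambda>w. i1 (fst w) \<oplus>\<^bsub>M\<^esub> i2 (snd w)"
  show "cpx_iso A ?P (stalk M) ?f (\<lambda>n x. if n = 0 then (p1 x, p2 x) else (\<zero>\<^bsub>M1\<^esub>, \<zero>\<^bsub>M2\<^esub>))"
  proof (rule cpx_isoI)
    show "module_complex A ?P" by (intro proj_module_complex Gen_projective[OF Gen_pair[OF G]])
    have h: "?f n \<in> mod_hom A (pair_mod M1 M2) M" for n by (rule mod_hom_from_pair[OF i rM])
    show "chain_map A ?P (stalk M) ?f"
    proof (rule chain_mapI)
      have "?f n \<in> mod_hom A (obj ?P n) (obj (stalk M) n)" for n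
      proof (cases "n = 0")
        case False
        \<comment> \<open>Outside degree 0 the terms are zero submodules, so linearity restricts
          from degree 0.\<close>
        have sub: "z \<in> carrier (pair_mod M1 M2)" if "z \<in> carrier (obj ?P n)" for z
          using that False by (auto simp: s)
        show ?thesis
        proof (rule mod_homI)
          fix z assume "z \<in> carrier (obj ?P n)"
          then show "?f n z \<in> carrier (obj (stalk M) n)" using False by (auto simp: s)
        next
          fix z w assume zw: "z \<in> carrier (obj ?P n)" "w \<in> carrier (obj ?P n)"
          obtain z1 z2 w1 w2 where e: "z = (z1, z2)" "w = (w1, w2)" by (cases z, cases w)
          show "?f n (z \<oplus>\<^bsub>obj ?P n\<^esub> w) = ?f n z \<oplus>\<^bsub>obj (stalk M) n\<^esub> ?f n w"
            using False mod_hom_add[OF h sub[OF zw(1)] sub[OF zw(2)]] unfolding e by simp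
        next
          fix a z assume az: "a \<in> carrier A" "z \<in> carrier (obj ?P n)"
          obtain z1 z2 where e: "z = (z1, z2)" by (cases z)
          show "?f n (a \<odot>\<^bsub>obj ?P n\<^esub> z) = a \<odot>\<^bsub>obj (stalk M) n\<^esub> ?f n z"
            using False mod_hom_act[OF h az(1) sub[OF az(2)]] unfolding e by simp
        qed
      qed (use h in simp)
      then show "graded_hom A ?P (stalk M) 0 ?f" by (simp add: graded_hom_def)
    qed (auto simp: s)
  qed (auto simp: s split: if_splits)
qed

text \<open>Induction on the number of degrees in which X may be nonzero. The lowest one, a, is
  stripped off: X is the cone of the differential X_a[-a-1] -> X', where X' is the brutal truncation
  of X above a.\<close>

lemma Gen_of_stalks:
  fixes X :: "('r, 'm) cpx"
  assumes T: "projective_complex A T"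
    and st: "\<And>M :: ('r, 'm) module. \<lbrakk>fg_projective A M; fd_module A M\<rbrakk> \<Longrightarrow> Gen T (stalk M)"
    and X: "projective_complex A X"
  shows "Gen T X"
proof -
  \<comment> \<open>The possibly nonzero degrees run from a to a + m - 1.\<close>
  have "Gen T X" if "projective_complex A X"
    "\<And>n. n < a \<or> a + int m \<le> n \<Longrightarrow> carrier (obj X n) = {\<zero>\<^bsub>obj X n\<^esub>}" for a m and X :: "('r, 'm) cpx"
    using that
  proof (induction m arbitrary: a X)
    case 0
    show ?case by (rule Gen_trivial[OF T proj_module_complex[OF "0.prems"(1)]]) (rule "0.prems"(2), auto)
  next
    case (Suc m)
    note X = Suc.prems(1)
    note mX = proj_module_complex[OF X] and rX = module_complex_rm[OF proj_module_complex[OF X]]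
    define X' where "X' = \<lparr>obj = \<lambda>n. if n \<le> a then zero_sub (obj X n) else obj X n,
      diff = \<lambda>n x. if n \<le> a then \<zero>\<^bsub>obj X (n + 1)\<^esub> else diff X n x\<rparr>"
    have oX': "obj X' n = (if n \<le> a then zero_sub (obj X n) else obj X n)"
      and dX': "diff X' n x = (if n \<le> a then \<zero>\<^bsub>obj X (n + 1)\<^esub> else diff X n x)" for n x
      by (simp_all add: X'_def)
    have rX': "right_module A (obj X' n)" for n using rX right_module_zero_sub[OF rX] by (simp add: oX')
    have zX': "\<zero>\<^bsub>obj X' n\<^esub> = \<zero>\<^bsub>obj X n\<^esub>" "x \<oplus>\<^bsub>obj X' n\<^esub> y = x \<oplus>\<^bsub>obj X n\<^esub> y" for n x y by (simp_all add: oX')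
    note s = diff_simps[OF mX] ag_simps module_complex_ag[OF mX] zX'
    have mX': "module_complex A X'"
      unfolding module_complex_def
    proof (intro conjI allI ballI rX')
      fix n
      show "diff X' n \<in> mod_hom A (obj X' n) (obj X' (n + 1))"
      proof (cases "n \<le> a")
        case True
        then have "diff X' n = (\<lambda>x. \<zero>\<^bsub>obj X' (n + 1)\<^esub>)" by (auto simp: fun_eq_iff dX' zX')
        then show ?thesis using mod_hom_zero_map[OF rX'] by metis
      next
        case False
        then have "diff X' n = diff X n" by (auto simp: fun_eq_iff dX')
        then show ?thesis using False diff_hom[OF mX refl, of n] by (simp add: oX')
      qed
    qed (auto simp: dX' s oX')
    have "bounded_complex A X" using X projective_complex_bounded by blast
    then obtain N where N: "\<And>n. \<bar>n\<bar> > N \<Longrightarrow> carrier (obj X n) = {\<zero>\<^bsub>obj X n\<^esub>}"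
      and fd: "\<And>n. fd_module A (obj X n)"
      by (auto simp: bounded_complex_iff)
    have "fd_module A (obj X' n)" for n
      using fd_trivial[OF right_module_zero_sub[OF rX]] fd by (simp add: oX')
    moreover have "carrier (obj X' n) = {\<zero>\<^bsub>obj X' n\<^esub>}" if "\<bar>n\<bar> > N" for n
      using N[OF that] by (simp add: oX')
    ultimately have "bounded_complex A X'" using mX' unfolding bounded_complex_iff by blast
    moreover have "fg_projective A (obj X' n)" for n
      using fg_projective_trivial[OF right_module_zero_sub[OF rX]] X by (simp add: oX' projective_complex_def)
    ultimately have X': "projective_complex A X'" by (simp add: projective_complex_def)
    have GX': "Gen T X'"
    proof (rule Suc.IH[OF X'])
      show "carrier (obj X' n) = {\<zero>\<^bsub>obj X' n\<^esub>}" if "n < a + 1 \<or> a + 1 + int m \<le> n" for n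
      proof (cases "n \<le> a")
        case False
        then show ?thesis using that Suc.prems(2)[of n] by (simp add: oX')
      qed (simp add: oX')
    qed
    have fgX: "fg_projective A (obj X a)" using X by (simp add: projective_complex_def)
    \<comment> \<open>X_a is put into degree a + 1, so that the cone returns it to degree a.\<close>
    let ?S = "shift (- a - 1) (stalk (obj X a))"
    have GS: "Gen T ?S" by (rule Gen_shift[OF st[OF fgX fd]])
    note mS = proj_module_complex[OF Gen_projective[OF GS]]
    have oS: "obj ?S n = (if n = a + 1 then obj X a else zero_sub (obj X a))" for n by simp
    have dS: "diff ?S n x = \<zero>\<^bsub>obj X a\<^esub>" for n x
      by (simp add: ag_simps module_complex_ag[OF mX] zero_sub_def)
        (metis ag_neg(7) module_complex_ag[OF mX] right_module_ag right_module_zero_sub rX zero_sub_def zero_sub_simps(2))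
    have zS: "\<zero>\<^bsub>obj ?S n\<^esub> = \<zero>\<^bsub>obj X a\<^esub>" for n by simp
    define f where "f n x = (if n = a + 1 then diff X a x else \<zero>\<^bsub>obj X' n\<^esub>)" for n x
    have f: "chain_map A ?S X' f"
    proof (rule chain_mapI)
      have "f n \<in> mod_hom A (obj ?S n) (obj X' n)" for n
      proof (cases "n = a + 1")
        case True
        then have "f n = diff X a" by (auto simp: f_def fun_eq_iff)
        then show ?thesis using True diff_hom[OF mX refl, of a] unfolding oS by (simp add: oX')
      next
        case False
        then have "f n = (\<lambda>x. \<zero>\<^bsub>obj X' n\<^esub>)" by (auto simp: f_def fun_eq_iff)
        then show ?thesis using mod_hom_zero_map[OF rX'] by metis
      qed
      then show "graded_hom A ?S X' 0 f" by (simp add: graded_hom_def)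
      fix n x assume x: "x \<in> carrier (obj ?S n)"
      show "f (n + 1) (diff ?S n x) = diff X' n (f n x)"
        using x unfolding dS oS by (auto simp: f_def s dX' split: if_splits)
    qed
    let ?C = "mapping_cone ?S X' f"
    have GC: "Gen T ?C" by (rule Gen_cone[OF GS GX' f])
    note mC = proj_module_complex[OF Gen_projective[OF GC]]
    have oC: "obj ?C n = pair_mod (obj ?S (n + 1)) (obj X' n)" for n by simp
    have mem: "x \<in> carrier (obj X a) \<and> (n \<noteq> a \<longrightarrow> x = \<zero>\<^bsub>obj X a\<^esub>)" "y \<in> carrier (obj X n) \<and> (n \<le> a \<longrightarrow> y = \<zero>\<^bsub>obj X n\<^esub>)"
      if "(x, y) \<in> carrier (obj ?C n)" for n x y
      using that unfolding oC oS oX' by (auto simp: s split: if_splits)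
    let ?F = "\<lambda>n (x, y). if n = a then x else y"
    show ?case
    proof (rule Gen_iso[OF GC \<open>bounded_complex A X\<close>])
      show "cpx_iso A ?C X ?F (\<lambda>n u. if n = a then (u, \<zero>\<^bsub>obj X n\<^esub>) else (\<zero>\<^bsub>obj X a\<^esub>, u))"
      proof (rule cpx_isoI[OF mC])
        show "chain_map A ?C X ?F"
        proof (rule chain_mapI)
          have "?F n \<in> mod_hom A (obj ?C n) (obj X n)" for n
          proof (rule mod_homI)
            fix w w' assume w: "w \<in> carrier (obj ?C n)" "w' \<in> carrier (obj ?C n)"
            obtain x y x' y' where ww: "w = (x, y)" "w' = (x', y')" by (cases w, cases w')
            show "?F n (w \<oplus>\<^bsub>obj ?C n\<^esub> w') = ?F n w \<oplus>\<^bsub>obj X n\<^esub> ?F n w'"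
              unfolding ww oC oS by (auto simp: zX')
          next
            fix w assume w: "w \<in> carrier (obj ?C n)"
            obtain x y where ww: "w = (x, y)" by (cases w)
            show "?F n w \<in> carrier (obj X n)" using mem[of x y n] w unfolding ww by auto
            fix c
            show "?F n (c \<odot>\<^bsub>obj ?C n\<^esub> w) = c \<odot>\<^bsub>obj X n\<^esub> ?F n w"
              unfolding ww oC oS by (auto simp: oX')
          qed
          then show "graded_hom A ?C X 0 ?F" by (simp add: graded_hom_def)
        next
          fix n w assume w: "w \<in> carrier (obj ?C n)"
          obtain x y where ww: "w = (x, y)" by (cases w)
          have "\<ominus>\<^bsub>obj ?S (n + 1 + 1)\<^esub> \<zero>\<^bsub>obj X a\<^esub> = \<zero>\<^bsub>obj X a\<^esub>" for n
            using ag_neg(7)[OF module_complex_ag[OF mS, of "n + 1 + 1"]] unfolding zS .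
          then have d: "diff ?C n (x, y) = (\<zero>\<^bsub>obj X a\<^esub>, f (n + 1) x \<oplus>\<^bsub>obj X (n + 1)\<^esub> diff X' n y)"
            unfolding mapping_cone_simps dS zX'(2) by simp
          show "?F (n + 1) (diff ?C n w) = diff X n (?F n w)"
            using mem[of x y n] w unfolding ww d by (auto simp: f_def dX' s)
        qed
      next
        fix n u assume u: "u \<in> carrier (obj X n)"
        have "n < a \<Longrightarrow> u = \<zero>\<^bsub>obj X n\<^esub>" using u Suc.prems(2)[of n] by auto
        then show "(if n = a then (u, \<zero>\<^bsub>obj X n\<^esub>) else (\<zero>\<^bsub>obj X a\<^esub>, u)) \<in> carrier (obj ?C n) \<and>
            ?F n (if n = a then (u, \<zero>\<^bsub>obj X n\<^esub>) else (\<zero>\<^bsub>obj X a\<^esub>, u)) = u"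
          using u unfolding oC oS oX' by (auto simp: s)
      next
        fix n w assume w: "w \<in> carrier (obj ?C n)"
        obtain x y where ww: "w = (x, y)" by (cases w)
        show "(if n = a then (?F n w, \<zero>\<^bsub>obj X n\<^esub>) else (\<zero>\<^bsub>obj X a\<^esub>, ?F n w)) = w"
          using mem[of x y n] w unfolding ww by auto
      qed
    qed
  qed
  note * = this
  obtain N where N: "\<And>n. \<bar>n\<bar> > N \<Longrightarrow> carrier (obj X n) = {\<zero>\<^bsub>obj X n\<^esub>}"
    using X by (auto simp: projective_complex_def bounded_complex_iff)
  show ?thesis
  proof (rule *[OF X])
    \<comment> \<open>Starting at -|N|, a width of 2|N| + 1 reaches |N|.\<close>
    show "carrier (obj X n) = {\<zero>\<^bsub>obj X n\<^esub>}"
      if "n < - \<bar>N\<bar> \<or> - \<bar>N\<bar> + int (nat (2 * \<bar>N\<bar> + 1)) \<le> n" for n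
      using that by (intro N) linarith
  qed
qed

end

section \<open>Projective modules over a split basic algebra\<close>

text \<open>The intended \<open>J r\<close> is the \<open>r\<close>-th power of the radical.\<close>

locale basic_algebra = kalgebra A for A :: "('k::field, 'r) module" (structure) +
  fixes V :: "'v set" and e :: "'v \<Rightarrow> 'r" and J :: "nat \<Rightarrow> 'r set"
  assumes V_finite: "finite V"
    and e_closed: "i \<in> V \<Longrightarrow> e i \<in> carrier A"
    and e_idem: "i \<in> V \<Longrightarrow> e i \<otimes> e i = e i"
    and e_sum: "(\<Oplus>i\<in>V. e i) = \<one>"
    and J_sub: "J r \<subseteq> carrier A"
    and J_zero: "\<zero> \<in> J r"
    and J_add: "\<lbrakk>x \<in> J r; y \<in> J r\<rbrakk> \<Longrightarrow> x \<oplus> y \<in> J r"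
    and J_right: "\<lbrakk>x \<in> J r; a \<in> carrier A\<rbrakk> \<Longrightarrow> x \<otimes> a \<in> J r"
    and J_left: "\<lbrakk>x \<in> J r; a \<in> carrier A\<rbrakk> \<Longrightarrow> a \<otimes> x \<in> J r"
    and J_mult: "\<lbrakk>x \<in> J r; y \<in> J 1\<rbrakk> \<Longrightarrow> x \<otimes> y \<in> J (Suc r)"
    and J_nil: "\<exists>m. J (Suc m) = {\<zero>}"
    and e_notin_J: "i \<in> V \<Longrightarrow> e i \<notin> J 1"
    and e_off_diag: "\<lbrakk>i \<in> V; j \<in> V; i \<noteq> j; a \<in> carrier A\<rbrakk> \<Longrightarrow> e i \<otimes> a \<otimes> e j \<in> J 1"
    and e_diag: "\<lbrakk>i \<in> V; a \<in> carrier A\<rbrakk> \<Longrightarrow> \<exists>c. \<exists>x\<in>J 1. e i \<otimes> a \<otimes> e i = (c \<odot> \<one>) \<otimes> e i \<oplus> x"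
    and fd_regular: "fd_module A (right_ideal_mod A \<one>)"
begin

abbreviation "P v \<equiv> right_ideal_mod A (e v)"

abbreviation "R \<equiv> right_ideal_mod A \<one>"

lemma J_carrier: "x \<in> J r \<Longrightarrow> x \<in> carrier A"
  using J_sub by blast

lemma J_neg: "x \<in> J r \<Longrightarrow> \<ominus> x \<in> J r"
  using J_right[of x r "\<ominus> \<one>"] J_carrier[of x r] by (simp add: r_minus)

lemma carrier_R: "carrier R = carrier A"
  by auto

lemma P_elem:
  assumes "v \<in> V"
  shows "x \<in> carrier (P v) \<longleftrightarrow> x \<in> carrier A \<and> e v \<otimes> x = x"
  using assms e_closed e_idem by (auto simp: m_assoc[symmetric]) (metis image_eqI)

lemma right_module_P: "v \<in> V \<Longrightarrow> right_module A (P v)"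
  by (simp add: right_module_right_ideal ring_A e_closed)

lemma right_module_R: "right_module A R"
  by (simp add: right_module_right_ideal ring_A)

text \<open>The corner e_i A e_i is local: modulo the radical it is K e_i by \<open>e_diag\<close>.
  An element outside the radical is a nonzero scalar times e_i + y with y in the radical, and
  nilpotency makes e_i + y invertible.\<close>

lemma left_inverse:
  assumes i: "i \<in> V" and a: "a \<in> carrier A" and u: "e i \<otimes> a \<otimes> e i \<notin> J 1"
  shows "\<exists>b\<in>carrier A. b \<otimes> (e i \<otimes> a \<otimes> e i) = e i \<and> e i \<otimes> b = b"
proof -
  note ei = e_closed[OF i] e_idem[OF i]
  let ?u = "e i \<otimes> a \<otimes> e i"
  have uc: "?u \<in> carrier A" using ei a by simp
  obtain c x where cx: "x \<in> J 1" "?u = (c \<odot> \<one>) \<otimes> e i \<oplus> x" using e_diag[OF i a] by blast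
  have xc: "x \<in> carrier A" using cx J_carrier by blast
  have c: "c \<noteq> 0"
  proof
    assume "c = 0"
    then have "?u = x" using cx(2) ei xc by (simp add: scalar_zero)
    then show False using u cx(1) by simp
  qed
  let ?k = "(1 / c) \<odot> \<one>"
  note k = scalar_closed[of "1 / c"] scalar_closed[of c]
  define y where "y = ?k \<otimes> x"
  have y: "y \<in> J 1" "y \<in> carrier A" using J_left[OF cx(1) k(1)] J_carrier by (auto simp: y_def)
  \<comment> \<open>Normalized so that the coefficient of e_i becomes 1.\<close>
  define w where "w = ?k \<otimes> ?u"
  have "?k \<otimes> ((c \<odot> \<one>) \<otimes> e i) = e i"
    using c ei k by (simp add: m_assoc[symmetric] scalar_mult[symmetric] scalar_one)
  then have wy: "w = e i \<oplus> y"
    unfolding w_def cx(2) using k ei xc by (simp add: r_distr y_def)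
  have wc: "w \<in> carrier A" using k uc by (simp add: w_def)
  have "?u \<otimes> e i = ?u" using ei a by (simp add: m_assoc)
  then have we: "w \<otimes> e i = w" using k uc ei by (simp add: w_def m_assoc)
  \<comment> \<open>A geometric series in recursive form: if z = b w - e_i is the error of b, then b
    - z has the error - z y, which lies one power of the radical deeper.\<close>
  have "\<exists>b\<in>carrier A. b \<otimes> w \<oplus> \<ominus> e i \<in> J (Suc r)" for r
  proof (induction r)
    case 0
    have "\<one> \<otimes> w \<oplus> \<ominus> e i = y"
      unfolding wy using ei y by (simp add: ag_ac[OF is_abelian_group] ag_simps[OF is_abelian_group] ag_cancel_mid[OF is_abelian_group])
    then show ?case using y by (intro bexI[of _ \<one>]) auto
  next
    case (Suc r)
    then obtain b where b: "b \<in> carrier A" "b \<otimes> w \<oplus> \<ominus> e i \<in> J (Suc r)" by blast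
    define z where "z = b \<otimes> w \<oplus> \<ominus> e i"
    have z: "z \<in> J (Suc r)" "z \<in> carrier A" using b J_carrier by (auto simp: z_def)
    have ze: "z \<otimes> e i = z"
      unfolding z_def using b(1) wc ei we by (simp add: l_distr m_assoc l_minus)
    have zw: "z \<otimes> w = z \<oplus> z \<otimes> y" unfolding wy using z ei y ze by (simp add: r_distr)
    have "(b \<oplus> \<ominus> z) \<otimes> w \<oplus> \<ominus> e i = (b \<otimes> w \<oplus> \<ominus> e i) \<oplus> \<ominus> (z \<otimes> w)"
      using b(1) wc ei z by (simp add: l_distr l_minus a_ac)
    also have "\<dots> = z \<oplus> \<ominus> (z \<otimes> w)" by (simp add: z_def)
    also have "\<dots> = \<ominus> (z \<otimes> y)"
      using zw z y by (simp add: minus_add ag_simps[OF is_abelian_group])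
    finally show ?case
      using b(1) z J_neg[OF J_mult[OF z(1) y(1)]] by (intro bexI[of _ "b \<oplus> \<ominus> z"]) auto
  qed
  then obtain b where b: "b \<in> carrier A" "b \<otimes> w \<oplus> \<ominus> e i = \<zero>"
    using J_nil by (metis singletonD)
  have bw: "b \<otimes> w = e i"
    by (rule ag_diff_zero[OF is_abelian_group]) (use b wc ei in auto)
  show ?thesis
  proof (intro bexI conjI)
    have "e i \<otimes> b \<otimes> ?k \<otimes> ?u = e i \<otimes> (b \<otimes> w)"
      using ei b k a by (simp add: w_def m_assoc)
    then show "e i \<otimes> b \<otimes> ?k \<otimes> ?u = e i" using bw ei by simp
    show "e i \<otimes> (e i \<otimes> b \<otimes> ?k) = e i \<otimes> b \<otimes> ?k"
      using ei b k by (simp add: m_assoc[symmetric])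
    show "e i \<otimes> b \<otimes> ?k \<in> carrier A" using ei b k by simp
  qed
qed

lemma J_finsum: "(\<And>i. i \<in> S \<Longrightarrow> f i \<in> J r) \<Longrightarrow> finite S \<Longrightarrow> (\<Oplus>i\<in>S. f i) \<in> J r"
proof (induction S rule: infinite_finite_induct)
  case (insert s S)
  then have "(\<Oplus>i\<in>insert s S. f i) = f s \<oplus> (\<Oplus>i\<in>S. f i)"
    by (intro finsum_insert) (auto dest: J_carrier)
  then show ?case using insert by (auto intro: J_add)
qed (auto simp: J_zero)

lemma J_of_span:
  assumes "x \<in> mspan C R G" "C \<subseteq> carrier A" "G \<subseteq> J r"
  shows "x \<in> J r"
  using assms(1) by induction (use assms(2,3) in \<open>auto intro: J_zero J_add J_right\<close>)

text \<open>A Nakayama argument. With M a summand of A^n, every m is the sum of the q(1_j) i(m)_j,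
  so l(m) is the sum of the l(q(1_j)) i(m)_j. If all functionals take values in \<open>J 1\<close>,
  iteration pushes these values into every power of the radical; hence functionals vanish, in
  particular the coordinates of i(m).\<close>

lemma projective_eq_zero:
  assumes "fg_projective A M" and J: "\<And>l m. \<lbrakk>l \<in> mod_hom A M R; m \<in> carrier M\<rbrakk> \<Longrightarrow> l m \<in> J 1"
  shows "carrier M = {\<zero>\<^bsub>M\<^esub>}"
proof -
  obtain n i q where M: "right_module A M" and i: "i \<in> mod_hom A M (dsum_mod {..<n::nat} (\<lambda>_. R))"
    and q: "q \<in> mod_hom A (dsum_mod {..<n} (\<lambda>_. R)) M" and qi: "\<forall>x\<in>carrier M. q (i x) = x"
    using assms(1) unfolding fg_projective_def Let_def by blast
  let ?F = "dsum_mod {..<n} (\<lambda>_. R)"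
  have F: "right_module A ?F" by (intro right_module_dsum right_module_R ring_A)
  have ic: "i m \<in> carrier ?F" if "m \<in> carrier M" for m using mod_hom_closed[OF i that] .
  have pi: "(\<lambda>m. i m j) \<in> mod_hom A M R" if "j \<in> {..<n}" for j
    by (rule mod_hom_comp[of "\<lambda>x. x j", OF mod_hom_proj[OF that] i])
  have 1: "\<one> \<in> carrier R" by (simp only: carrier_R one_closed)
  have "l m \<in> J (Suc r)" if "l \<in> mod_hom A M R" "m \<in> carrier M" for r l m
    using that
  proof (induction r arbitrary: l m)
    case (Suc r)
    have lq: "(\<lambda>x. l (q x)) \<in> mod_hom A ?F R" by (rule mod_hom_comp[OF Suc.prems(1) q])
    have "l (q (dsum_inj {..<n} (\<lambda>_. R) j (i m j))) \<in> J (Suc (Suc r))" if j: "j \<in> {..<n}" for j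
    proof -
      have ij: "dsum_inj {..<n} (\<lambda>_. R) j \<in> mod_hom A R ?F"
        by (rule mod_hom_dsum_inj) (use right_module_R j in auto)
      have h: "(\<lambda>x. l (q (dsum_inj {..<n} (\<lambda>_. R) j x))) \<in> mod_hom A R R"
        by (rule mod_hom_comp[OF lq ij])
      have xj: "i m j \<in> J 1" by (rule J[OF pi[OF j] Suc.prems(2)])
      have "l (q (dsum_inj {..<n} (\<lambda>_. R) j (i m j \<odot>\<^bsub>R\<^esub> \<one>)))
          = i m j \<odot>\<^bsub>R\<^esub> l (q (dsum_inj {..<n} (\<lambda>_. R) j \<one>))"
        by (rule mod_hom_act[OF h J_carrier[OF xj] 1])
      moreover have "l (q (dsum_inj {..<n} (\<lambda>_. R) j \<one>)) \<in> J (Suc r)"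
        by (rule Suc.IH[OF Suc.prems(1)]) (intro mod_hom_closed[OF q] mod_hom_closed[OF ij] 1)
      ultimately show ?thesis using J_mult xj J_carrier[OF xj] by simp
    qed
    moreover have "l (q (i m)) \<in> mspan {} R ((\<lambda>x. l (q x)) ` (\<lambda>j. dsum_inj {..<n} (\<lambda>_. R) j (i m j)) ` {..<n})"
    proof (rule mspan_hom[OF dsum_elem_span lq F right_module_R])
      show "(\<lambda>j. dsum_inj {..<n} (\<lambda>_. R) j (i m j)) ` {..<n} \<subseteq> carrier ?F"
      proof (intro subsetI, elim imageE, clarify)
        fix j assume j: "j < n"
        show "dsum_inj {..<n} (\<lambda>_. R) j (i m j) \<in> carrier ?F"
          by (rule mod_hom_closed[OF mod_hom_dsum_inj])
            (use j right_module_R mod_hom_closed[OF pi Suc.prems(2)] in auto)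
      qed
    qed (use ic[OF Suc.prems(2)] right_module_R in \<open>auto intro: mspan.base\<close>)
    ultimately have "l (q (i m)) \<in> J (Suc (Suc r))"
      by (intro J_of_span) auto
    then show ?case using qi Suc.prems(2) by simp
  qed (use J in simp)
  then have z: "l m = \<zero>" if "l \<in> mod_hom A M R" "m \<in> carrier M" for l m
    using J_nil that by blast
  have "m = \<zero>\<^bsub>M\<^esub>" if m: "m \<in> carrier M" for m
  proof -
    have "i m = \<zero>\<^bsub>?F\<^esub>"
    proof
      fix j
      show "i m j = \<zero>\<^bsub>?F\<^esub> j"
        using z[OF pi m] ic[OF m] by (cases "j \<in> {..<n}") (auto simp: PiE_iff extensional_def)
    qed
    then have "m = q \<zero>\<^bsub>?F\<^esub>" using qi m by metis
    then show ?thesis using mod_hom_zero[OF q right_module_ag[OF F] right_module_ag[OF M]] by simp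
  qed
  then show ?thesis using ag_closed(2)[OF right_module_ag[OF M]] by blast
qed

text \<open>By \<open>projective_eq_zero\<close> some functional has a value a outside the radical
  at a generator g with g e_v = g. From a = a e_v and \<open>e_off_diag\<close>, the part e_v a e_v
  is outside the radical too. Then \<open>left_inverse\<close> corrects the functional to one that
  sends g to e_v, and it is split by x |-> g x.\<close>

lemma split_off_generator:
  assumes M: "fg_projective A M" "carrier M \<noteq> {\<zero>\<^bsub>M\<^esub>}"
    and G: "\<And>g v. (g, v) \<in> G \<Longrightarrow> v \<in> V \<and> g \<in> carrier M \<and> e v \<odot>\<^bsub>M\<^esub> g = g"
    and gen: "carrier M \<subseteq> mspan (carrier A) M (fst ` G)"
  shows "\<exists>(g, v)\<in>G. \<exists>l\<in>mod_hom A M (P v). \<exists>s\<in>mod_hom A (P v) M.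
    (\<forall>x\<in>carrier (P v). l (s x) = x) \<and> s (l g) = g"
proof -
  have rM: "right_module A M" using M by (simp add: fg_projective_def)
  obtain l0 m where l0: "l0 \<in> mod_hom A M R" "m \<in> carrier M" "l0 m \<notin> J 1"
    using projective_eq_zero[OF M(1)] M(2) by blast
  have "\<exists>(g, v)\<in>G. l0 g \<notin> J 1"
  proof (rule ccontr)
    assume "\<not> ?thesis"
    then have "l0 ` fst ` G \<subseteq> J 1" by auto
    moreover have "l0 m \<in> mspan (carrier A) R (l0 ` fst ` G)"
      by (rule mspan_hom[where G = "fst ` G", OF _ l0(1) rM right_module_R])
        (use gen l0 G in \<open>auto intro: mspan.base\<close>)
    ultimately show False using J_of_span l0(3) by blast
  qed
  then obtain g v where gv: "(g, v) \<in> G" "l0 g \<notin> J 1" by blast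
  note g = G[OF gv(1)]
  define a where "a = l0 g"
  have v: "v \<in> V" and ac: "a \<in> carrier A"
    using g mod_hom_closed[OF l0(1)] unfolding a_def carrier_R by auto
  have "l0 (e v \<odot>\<^bsub>M\<^esub> g) = e v \<odot>\<^bsub>R\<^esub> l0 g" using mod_hom_act[OF l0(1) e_closed[OF v]] g by blast
  then have ae: "a \<otimes> e v = a" using g by (simp add: a_def)
  have "e v \<otimes> a \<otimes> e v \<notin> J 1"
  proof
    assume "e v \<otimes> a \<otimes> e v \<in> J 1"
    then have "e i \<otimes> a \<in> J 1" if "i \<in> V" for i
      using e_off_diag[OF that v _ ac] e_closed[OF v] e_closed[OF that] ac ae
      by (cases "i = v") (auto simp: m_assoc)
    then have "(\<Oplus>i\<in>V. e i \<otimes> a) \<in> J 1" by (intro J_finsum V_finite)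
    also have "(\<Oplus>i\<in>V. e i \<otimes> a) = (\<Oplus>i\<in>V. e i) \<otimes> a"
      using finsum_ldistr[OF V_finite ac, of e] e_closed by auto
    finally show False using gv(2) ac by (simp add: e_sum a_def)
  qed
  from left_inverse[OF v ac this] obtain b where
    b: "b \<in> carrier A" "b \<otimes> (e v \<otimes> a \<otimes> e v) = e v" "e v \<otimes> b = b" by blast
  note ev = e_closed[OF v] e_idem[OF v]
  define l where "l m = b \<otimes> e v \<otimes> l0 m" for m
  define s where "s x = x \<odot>\<^bsub>M\<^esub> g" for x
  have l0c: "l0 x \<in> carrier A" if "x \<in> carrier M" for x
    using mod_hom_closed[OF l0(1) that] unfolding carrier_R .
  have lg: "l g = e v" using b ev ac ae by (simp add: l_def a_def[symmetric] m_assoc)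
  have l: "l \<in> mod_hom A M (P v)"
  proof (rule mod_homI)
    fix x assume x: "x \<in> carrier M"
    show "l x \<in> carrier (P v)" unfolding P_elem[OF v] using x b ev l0c by (simp add: l_def m_assoc[symmetric])
    show "l (c \<odot>\<^bsub>M\<^esub> x) = c \<odot>\<^bsub>P v\<^esub> l x" if "c \<in> carrier A" for c
      using mod_hom_act[OF l0(1) that x] that x b ev l0c by (simp add: l_def m_assoc)
    show "l (x \<oplus>\<^bsub>M\<^esub> y) = l x \<oplus>\<^bsub>P v\<^esub> l y" if "y \<in> carrier M" for y
      using mod_hom_add[OF l0(1) x that] that x b ev l0c by (simp add: l_def r_distr)
  qed
  have s: "s \<in> mod_hom A (P v) M"
    by (rule mod_homI)
      (use g in \<open>auto simp: s_def P_elem[OF v] right_module_act[OF rM] simp del: right_ideal_mod_simps(1)\<close>)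
  have "l (s x) = x" if "x \<in> carrier (P v)" for x
    using mod_hom_act[OF l, of x g] that g lg by (simp add: P_elem[OF v] s_def del: right_ideal_mod_simps(1))
  moreover have "s (l g) = g" using g by (simp add: lg s_def)
  ultimately show ?thesis using gv(1) l s by blast
qed

text \<open>Induction on the number of generators takes the place of Krull-Schmidt: a summand P_v
  with generator g is split off, and the projection to the complement kills g, so the images of the
  other generators suffice there. The pairs (g, v) record the vertex of a generator. W restricts the
  vertices, because the lemma is also applied when only the P_i with i \<noteq> k are known to be
  generated.\<close>

lemma Gen_of_generators:
  fixes M :: "('r, 'm) module"
  assumes T: "projective_complex A T" and W: "W \<subseteq> V" "\<And>v. v \<in> W \<Longrightarrow> Gen T (stalk (P v))"
    and "finite G" "fg_projective A M" "fd_module A M"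
    and "\<And>g v. (g, v) \<in> G \<Longrightarrow> v \<in> W \<and> g \<in> carrier M \<and> e v \<odot>\<^bsub>M\<^esub> g = g"
    and "carrier M \<subseteq> mspan (carrier A) M (fst ` G)"
  shows "Gen T (stalk M)"
  using assms(4-)
proof (induction "card G" arbitrary: G M rule: less_induct)
  case less
  have rM: "right_module A M" using less.prems(2) by (simp add: fg_projective_def)
  show ?case
  proof (cases "carrier M = {\<zero>\<^bsub>M\<^esub>}")
    case True
    show ?thesis by (rule Gen_trivial[OF T module_complex_stalk[OF rM]]) (use True in auto)
  next
    case False
    have "\<exists>(g, v)\<in>G. \<exists>l\<in>mod_hom A M (P v). \<exists>s\<in>mod_hom A (P v) M.
        (\<forall>x\<in>carrier (P v). l (s x) = x) \<and> s (l g) = g"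
      by (rule split_off_generator[OF less.prems(2) False _ less.prems(5)]) (use less.prems(4) W in blast)
    then obtain g v l s where gv: "(g, v) \<in> G" and l: "l \<in> mod_hom A M (P v)" and s: "s \<in> mod_hom A (P v) M"
      and ls: "\<And>x. x \<in> carrier (P v) \<Longrightarrow> l (s x) = x" and sg: "s (l g) = g"
      by blast
    have v: "v \<in> W" "v \<in> V" and g: "g \<in> carrier M" using less.prems(4)[OF gv] W by auto
    note rP = right_module_P[OF v(2)]
    define K where "K = M\<lparr>carrier := {x \<in> carrier M. l x = \<zero>\<^bsub>P v\<^esub>}\<rparr>"
    define p where "p x = x \<oplus>\<^bsub>M\<^esub> \<ominus>\<^bsub>M\<^esub> s (l x)" for x
    have rK: "right_module A K" and p: "p \<in> mod_hom A M K" and pK: "p ` carrier M = carrier K"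
      using right_module_retract_kernel[OF rM rP s l ls] by (simp_all add: K_def p_def[abs_def])
    have Kc: "x \<in> carrier K \<longleftrightarrow> x \<in> carrier M \<and> l x = \<zero>" for x by (simp add: K_def)
    have i: "(\<lambda>x. x) \<in> mod_hom A K M" by (rule mod_homI) (simp_all add: K_def)
    note ag = right_module_ag[OF rM] right_module_ag[OF rP]
    have s0: "s \<zero> = \<zero>\<^bsub>M\<^esub>" using mod_hom_zero[OF s ag(2,1)] by simp
    have pi: "p x = x" if "x \<in> carrier K" for x
      using that s0 by (simp add: Kc p_def ag_simps[OF ag(1)])
    have fdK: "fd_module A K" by (rule fd_surj[OF less.prems(3) rK p]) (simp add: pK)
    have fgK: "fg_projective A K"
      by (rule fg_projective_retract[OF less.prems(2,3) rK i p pi])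
    define G' where "G' = (\<lambda>(h, w). (p h, w)) ` (G - {(g, v)})"
    have "Gen T (stalk K)"
    proof (rule less.hyps[OF _ _ fgK fdK])
      show "card G' < card G"
        unfolding G'_def using less.prems(1) gv
        by (meson card_Diff1_less card_image_le finite_Diff le_less_trans)
      show "finite G'" unfolding G'_def using less.prems(1) by simp
      show "w \<in> W \<and> h \<in> carrier K \<and> e w \<odot>\<^bsub>K\<^esub> h = h" if "(h, w) \<in> G'" for h w
      proof -
        from that have "\<exists>y\<in>G - {(g, v)}. (h, w) = (case y of (h, w) \<Rightarrow> (p h, w))"
          unfolding G'_def image_iff .
        then obtain y where "y \<in> G - {(g, v)}" "(h, w) = (case y of (h, w) \<Rightarrow> (p h, w))" by blast
        then obtain h' where h': "(h', w) \<in> G" "h = p h'" by (cases y) auto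
        note * = less.prems(4)[OF h'(1)]
        then have "e w \<in> carrier A" using W e_closed by blast
        then show ?thesis using * h'(2) mod_hom_act[OF p, of "e w" h'] mod_hom_closed[OF p, of h'] by auto
      qed
      show "carrier K \<subseteq> mspan (carrier A) K (fst ` G')"
      proof
        fix x assume x: "x \<in> carrier K"
        have "p x \<in> mspan (carrier A) K (fst ` G')"
        proof (rule mspan_hom[OF _ p rM rK])
          show "x \<in> mspan (carrier A) M (fst ` G)" using x less.prems(5) Kc by blast
          show "fst ` G \<subseteq> carrier M" using less.prems(4) by auto
          show "p ` fst ` G \<subseteq> mspan (carrier A) K (fst ` G')"
          proof (intro subsetI, elim imageE, clarify)
            fix h w assume hw: "(h, w) \<in> G"
            show "p (fst (h, w)) \<in> mspan (carrier A) K (fst ` G')"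
            proof (cases "(h, w) = (g, v)")
              case True
              then have "p h = \<zero>\<^bsub>K\<^esub>" using sg g by (simp add: p_def ag_simps[OF ag(1)] K_def)
              then show ?thesis by (simp add: mspan.zero)
            next
              case False
              then show ?thesis using hw by (force intro: mspan.base simp: G'_def image_iff)
            qed
          qed
        qed simp
        then show "x \<in> mspan (carrier A) K (fst ` G')" using pi[OF x] by simp
      qed
    qed
    then show ?thesis
    proof (rule Gen_stalk_sum[OF W(2)[OF v(1)] _ less.prems(3) rP rK l p s i])
      note t = ag_simps[OF ag(1)] ag_simps[OF ag(2)] mod_hom_closed[OF l] mod_hom_closed[OF s]
        mod_hom_add[OF l] ls
      show "s (l x) \<oplus>\<^bsub>M\<^esub> p x = x" if "x \<in> carrier M" for x
        using that by (simp add: p_def t ag_ac[OF ag(1)] ag_cancel_mid[OF ag(1)] del: right_ideal_mod_simps)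
      fix x y assume x: "x \<in> carrier (P v)" and y: "y \<in> carrier K"
      have y': "y \<in> carrier M" "l y = \<zero>\<^bsub>P v\<^esub>" using y by (simp_all add: Kc)
      show lx: "l (s x \<oplus>\<^bsub>M\<^esub> y) = x" using x y' by (simp add: t del: right_ideal_mod_simps)
      show "p (s x \<oplus>\<^bsub>M\<^esub> y) = y"
        using x y' unfolding p_def lx by (simp add: t ag_ac[OF ag(1)] ag_cancel_mid[OF ag(1)] del: right_ideal_mod_simps)
    qed
  qed
qed

text \<open>The idempotents add up to 1, so each element b of a spanning set is the sum of the b
  e_v, and these live at single vertices.\<close>

lemma fd_generators:
  assumes "fd_module A M"
  shows "\<exists>G. finite G \<and> (\<forall>(g, v)\<in>G. v \<in> V \<and> g \<in> carrier M \<and> e v \<odot>\<^bsub>M\<^esub> g = g) \<and>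
    carrier M \<subseteq> mspan (carrier A) M (fst ` G)"
proof -
  obtain B where M: "right_module A M" and B: "finite B" "B \<subseteq> carrier M" "carrier M \<subseteq> mspan scalars M B"
    using assms by (auto simp: fd_module_iff)
  note act = right_module_act[OF M]
  define G where "G = (\<lambda>(b, v). (e v \<odot>\<^bsub>M\<^esub> b, v)) ` (B \<times> V)"
  have "b \<in> mspan (carrier A) M (fst ` G)" if b: "b \<in> B" for b
  proof -
    have bM: "b \<in> carrier M" using b B by blast
    have "(\<Oplus>v\<in>S. e v) \<odot>\<^bsub>M\<^esub> b \<in> mspan (carrier A) M (fst ` G)" if "finite S" "S \<subseteq> V" for S
      using that
    proof (induction S rule: finite_induct)
      case empty
      then show ?case using bM by (simp add: act mspan.zero)
    next
      case (insert s S)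
      then have ec: "e \<in> S \<rightarrow> carrier A" "e s \<in> carrier A" using e_closed by auto
      have "(\<Oplus>v\<in>insert s S. e v) \<odot>\<^bsub>M\<^esub> b = e s \<odot>\<^bsub>M\<^esub> b \<oplus>\<^bsub>M\<^esub> (\<Oplus>v\<in>S. e v) \<odot>\<^bsub>M\<^esub> b"
        using insert ec bM by (simp add: act)
      moreover have "e s \<odot>\<^bsub>M\<^esub> b \<in> fst ` G" using b insert.prems by (force simp: G_def)
      ultimately show ?case using insert by (auto intro: mspan.add mspan.base)
    qed
    from this[OF V_finite order_refl] show ?thesis using bM by (simp add: e_sum act)
  qed
  then have "carrier M \<subseteq> mspan (carrier A) M (fst ` G)"
    using B(3) mspan_trans[of _ scalars M B "carrier A" "fst ` G"] scalars_carrier by blast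
  moreover have "v \<in> V \<and> g \<in> carrier M \<and> e v \<odot>\<^bsub>M\<^esub> g = g" if "(g, v) \<in> G" for g v
    using that B(2) e_closed e_idem act(4)[symmetric] act(1) by (auto simp: G_def)
  moreover have "finite G" using B(1) V_finite by (simp add: G_def)
  ultimately show ?thesis by blast
qed

text \<open>A perfect complex is replaced by a complex of projectives, this by the stalks of its
  terms, and these by the P_v.\<close>

theorem perfect_generated:
  assumes T: "projective_complex A T" and W: "\<And>v. v \<in> V \<Longrightarrow> Gen T (stalk (P v))"
    and X: "perfect_complex A X"
  shows "generated A T X"
proof -
  obtain Q :: "('k, 'r) small_cpx" where Q: "projective_complex A Q" "Db_isomorphic A X Q" and bX: "bounded_complex A X"
    using X by (auto simp: perfect_complex_def)
  have "Gen T (stalk M)" if M: "fg_projective A M" "fd_module A M" for M :: "('k, 'r) small_module"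
  proof -
    obtain G where "finite G" "\<forall>(g, v)\<in>G. v \<in> V \<and> g \<in> carrier M \<and> e v \<odot>\<^bsub>M\<^esub> g = g"
      "carrier M \<subseteq> mspan (carrier A) M (fst ` G)"
      using fd_generators[OF M(2)] by blast
    then show ?thesis by (intro Gen_of_generators[OF T order_refl W _ M, of G]) auto
  qed
  then have "Gen T Q" by (rule Gen_of_stalks[OF T _ Q(1)])
  then have "generated A T Q" by (rule Gen_generated_self)
  then show ?thesis by (rule generated.iso[OF _ bX Db_isomorphic_sym[OF Q(2)]])
qed

end

section \<open>Bound quiver algebras\<close>

locale bound_quiver = fin_digraph Q for Q :: "('v, 'a) pre_digraph" +
  fixes I :: "(('v, 'a) qpath \<Rightarrow> 'k::field) set"
  assumes admissible: "admissible_ideal Q I"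
begin

abbreviation KQ :: "('k, ('v, 'a) qpath \<Rightarrow> 'k) module" where "KQ \<equiv> path_algebra Q"

abbreviation A :: "('k, (('v, 'a) qpath \<Rightarrow> 'k) set) module" where "A \<equiv> quiver_algebra Q I"

lemma ideal_I: "ideal I KQ"
  using admissible by (simp add: admissible_ideal_def)

sublocale KQ: ideal I KQ by (rule ideal_I)

lemma KQ_simps:
  "(f \<otimes>\<^bsub>KQ\<^esub> g) (v, p) = (\<Sum>n\<le>length p. f (v, take n p) * g (awlast v (take n p), drop n p))"
  "\<one>\<^bsub>KQ\<^esub> = (\<lambda>p. if p \<in> verts Q \<times> {[]} then 1 else 0)"
  "\<zero>\<^bsub>KQ\<^esub> = (\<lambda>p. 0)"
  "f \<oplus>\<^bsub>KQ\<^esub> g = (\<lambda>p. f p + g p)"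
  "c \<odot>\<^bsub>KQ\<^esub> f = (\<lambda>p. c * f p)"
  by (simp_all add: path_algebra_def)

lemma carrier_KQ: "f \<in> carrier KQ \<longleftrightarrow> finite {p. f p \<noteq> 0} \<and> {p. f p \<noteq> 0} \<subseteq> qpaths Q"
  by (simp add: path_algebra_def)

lemma qpaths_iff: "(u, p) \<in> qpaths Q \<longleftrightarrow> awalk u p (awlast u p)"
proof
  assume "(u, p) \<in> qpaths Q"
  then obtain v where v: "awalk u p v" by (auto simp: qpaths_def)
  moreover from this have "awlast u p = v" by simp
  ultimately show "awalk u p (awlast u p)" by simp
next
  assume "awalk u p (awlast u p)"
  then show "(u, p) \<in> qpaths Q" unfolding qpaths_def by blast
qed

lemma path_fun_carrier: "p \<in> qpaths Q \<Longrightarrow> path_fun p \<in> carrier KQ"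
  by (auto simp: carrier_KQ path_fun_def)

lemma KQ_finsum:
  "\<lbrakk>finite S; \<And>s. s \<in> S \<Longrightarrow> F s \<in> carrier KQ\<rbrakk> \<Longrightarrow> (\<Oplus>\<^bsub>KQ\<^esub>s\<in>S. F s) p = (\<Sum>s\<in>S. F s p)"
proof (induction S rule: finite_induct)
  case (insert s S)
  then have "(\<Oplus>\<^bsub>KQ\<^esub>s\<in>insert s S. F s) = F s \<oplus>\<^bsub>KQ\<^esub> (\<Oplus>\<^bsub>KQ\<^esub>s\<in>S. F s)"
    by (intro KQ.finsum_insert) auto
  then show ?case using insert by (simp add: KQ_simps)
qed (simp add: KQ_simps)

subsection \<open>Products with vertices and arrows\<close>

text \<open>Combinations of trivial paths: the idempotents of the vertices and the scalars c . 1 are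
  both of this form, so one product formula on each side covers both.\<close>

definition vertex_fun :: "('v \<Rightarrow> 'k) \<Rightarrow> ('v, 'a) qpath \<Rightarrow> 'k" where
  "vertex_fun h = (\<lambda>(v, p). if p = [] \<and> v \<in> verts Q then h v else 0)"

lemma vertex_fun_carrier: "vertex_fun h \<in> carrier KQ"
proof -
  have "{p. vertex_fun h p \<noteq> 0} \<subseteq> verts Q \<times> {[]}" by (auto simp: vertex_fun_def split: if_splits)
  moreover have "verts Q \<times> {[]} \<subseteq> qpaths Q" by (auto simp: qpaths_iff awalk_Nil_iff)
  moreover have "finite (verts Q \<times> {[] :: 'a list})" by simp
  ultimately show ?thesis
    unfolding carrier_KQ by (metis finite_subset subset_trans)
qed

lemma vertex_fun_left:
  "(vertex_fun h \<otimes>\<^bsub>KQ\<^esub> f) (v, p) = (if v \<in> verts Q then h v * f (v, p) else 0)"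
proof -
  have "(vertex_fun h \<otimes>\<^bsub>KQ\<^esub> f) (v, p) =
      (\<Sum>n\<le>length p. if n = 0 then (if v \<in> verts Q then h v * f (v, p) else 0) else 0)"
    unfolding KQ_simps by (intro sum.cong) (auto simp: vertex_fun_def)
  then show ?thesis by simp
qed

lemma vertex_fun_right:
  "(f \<otimes>\<^bsub>KQ\<^esub> vertex_fun h) (v, p) = (if awlast v p \<in> verts Q then f (v, p) * h (awlast v p) else 0)"
proof -
  have "(f \<otimes>\<^bsub>KQ\<^esub> vertex_fun h) (v, p) =
      (\<Sum>n\<le>length p. if n = length p then (if awlast v p \<in> verts Q then f (v, p) * h (awlast v p) else 0) else 0)"
    unfolding KQ_simps by (intro sum.cong) (auto simp: vertex_fun_def)
  then show ?thesis by simp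
qed

lemma path_fun_vertex: "i \<in> verts Q \<Longrightarrow> path_fun (i, []) = vertex_fun (\<lambda>v. if v = i then 1 else 0)"
  by (auto simp: path_fun_def vertex_fun_def fun_eq_iff)

lemma smult_one: "c \<odot>\<^bsub>KQ\<^esub> \<one>\<^bsub>KQ\<^esub> = vertex_fun (\<lambda>_. c)"
  by (auto simp: vertex_fun_def fun_eq_iff KQ_simps)

lemma carrier_KQ_verts:
  assumes "f \<in> carrier KQ" "f (v, p) \<noteq> 0"
  shows "v \<in> verts Q" "awlast v p \<in> verts Q" "awalk v p (awlast v p)"
proof -
  show w: "awalk v p (awlast v p)" using assms by (auto simp: carrier_KQ qpaths_iff)
  show "v \<in> verts Q" "awlast v p \<in> verts Q"
    using awalk_hd_in_verts[OF w] awalk_last_in_verts[OF w] by auto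
qed

lemma smult_one_left: "f \<in> carrier KQ \<Longrightarrow> (c \<odot>\<^bsub>KQ\<^esub> \<one>\<^bsub>KQ\<^esub>) \<otimes>\<^bsub>KQ\<^esub> f = c \<odot>\<^bsub>KQ\<^esub> f"
  unfolding smult_one
  by (rule ext, clarify, subst vertex_fun_left) (use carrier_KQ_verts in \<open>auto simp: KQ_simps\<close>)

lemma smult_one_right: "f \<in> carrier KQ \<Longrightarrow> f \<otimes>\<^bsub>KQ\<^esub> (c \<odot>\<^bsub>KQ\<^esub> \<one>\<^bsub>KQ\<^esub>) = c \<odot>\<^bsub>KQ\<^esub> f"
  unfolding smult_one
  by (rule ext, clarify, subst vertex_fun_right) (use carrier_KQ_verts in \<open>auto simp: KQ_simps\<close>)

lemma smult_carrier: "f \<in> carrier KQ \<Longrightarrow> c \<odot>\<^bsub>KQ\<^esub> f \<in> carrier KQ"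
  using smult_one_left[of f c] KQ.m_closed[of "c \<odot>\<^bsub>KQ\<^esub> \<one>\<^bsub>KQ\<^esub>" f] vertex_fun_carrier
  unfolding smult_one by metis

definition arrow_fun :: "'a \<Rightarrow> ('v, 'a) qpath \<Rightarrow> 'k" where
  "arrow_fun \<alpha> = path_fun (tail Q \<alpha>, [\<alpha>])"

lemma arrow_fun_carrier: "\<alpha> \<in> arcs Q \<Longrightarrow> arrow_fun \<alpha> \<in> carrier KQ"
  unfolding arrow_fun_def
  by (rule path_fun_carrier) (simp add: qpaths_iff awalk_Cons_iff awalk_Nil_iff)

lemma arrow_fun_right:
  "(f \<otimes>\<^bsub>KQ\<^esub> arrow_fun \<alpha>) (v, p) =
    (if p \<noteq> [] \<and> last p = \<alpha> \<and> awlast v (butlast p) = tail Q \<alpha> then f (v, butlast p) else 0)"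
proof (cases p rule: rev_cases)
  case Nil
  then show ?thesis by (simp add: arrow_fun_def path_fun_def KQ_simps)
next
  case (snoc q \<beta>)
  \<comment> \<open>Only the cut just before the last arrow contributes to the sum.\<close>
  have d: "drop n (q @ [\<beta>]) = [\<alpha>] \<longleftrightarrow> n = length q \<and> \<beta> = \<alpha>" for n
    by (cases "n < length q"; cases "n = length q") (auto simp: drop_eq_Nil dest: arg_cong[where f = length])
  have t: "take (length q) (q @ [\<beta>]) = q" by simp
  have "(f \<otimes>\<^bsub>KQ\<^esub> arrow_fun \<alpha>) (v, p) = (\<Sum>n\<le>length p. if n = length q then
      (if \<beta> = \<alpha> \<and> awlast v q = tail Q \<alpha> then f (v, q) else 0) else 0)"
    unfolding KQ_simps
    by (intro sum.cong) (auto simp: arrow_fun_def path_fun_def snoc d t simp del: drop_append take_append)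
  then show ?thesis by (simp add: snoc sum.delta del: sum.atMost_Suc)
qed

lemma arrow_fun_left:
  "(arrow_fun \<beta> \<otimes>\<^bsub>KQ\<^esub> f) (v, p) =
    (if p \<noteq> [] \<and> hd p = \<beta> \<and> v = tail Q \<beta> then f (head Q \<beta>, tl p) else 0)"
proof (cases p)
  case Nil
  then show ?thesis by (simp add: arrow_fun_def path_fun_def KQ_simps)
next
  case (Cons \<alpha> q)
  have d: "take n (\<alpha> # q) = [\<beta>] \<longleftrightarrow> n = 1 \<and> \<beta> = \<alpha>" if "n \<le> length p" for n
    using that Cons by (cases n; cases q; cases "n - 1") auto
  have "(arrow_fun \<beta> \<otimes>\<^bsub>KQ\<^esub> f) (v, p) = (\<Sum>n\<le>length p. if n = 1 then
      (if \<beta> = \<alpha> \<and> v = tail Q \<beta> then f (head Q \<beta>, q) else 0) else 0)"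
    unfolding KQ_simps by (intro sum.cong) (auto simp: arrow_fun_def path_fun_def Cons d[unfolded Cons])
  then show ?thesis by (simp add: Cons sum.delta del: sum.atMost_Suc)
qed

text \<open>Every nontrivial path ends with an arrow: \<open>y \<alpha>\<close> collects the paths
  of x that end with \<alpha>, with this arrow removed.\<close>

lemma KQ_factor_right:
  assumes x: "x \<in> carrier KQ" and x0: "\<And>v. x (v, []) = 0"
  shows "\<exists>y. (\<forall>\<alpha>\<in>arcs Q. y \<alpha> \<in> carrier KQ) \<and> x = (\<Oplus>\<^bsub>KQ\<^esub>\<alpha>\<in>arcs Q. y \<alpha> \<otimes>\<^bsub>KQ\<^esub> arrow_fun \<alpha>)"
proof -
  define y where "y \<alpha> = (\<lambda>(v, p). x (v, p @ [\<alpha>]))" for \<alpha>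
  have y: "y \<alpha> \<in> carrier KQ" for \<alpha>
  proof -
    have "{p. y \<alpha> p \<noteq> 0} \<subseteq> (\<lambda>(v, p). (v, butlast p)) ` {p. x p \<noteq> 0}"
      by (force simp: y_def image_iff)
    then have "finite {p. y \<alpha> p \<noteq> 0}" using x finite_subset unfolding carrier_KQ by blast
    moreover have "{p. y \<alpha> p \<noteq> 0} \<subseteq> qpaths Q"
    proof clarify
      fix v p assume "y \<alpha> (v, p) \<noteq> 0"
      then have "awalk v (p @ [\<alpha>]) (awlast v (p @ [\<alpha>]))"
        by (intro carrier_KQ_verts(3)[OF x]) (simp add: y_def)
      then show "(v, p) \<in> qpaths Q" by (simp add: qpaths_iff)
    qed
    ultimately show ?thesis by (simp add: carrier_KQ)
  qed
  have "x (v, p) = (\<Sum>\<alpha>\<in>arcs Q. (y \<alpha> \<otimes>\<^bsub>KQ\<^esub> arrow_fun \<alpha>) (v, p))" for v p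
  proof (cases p rule: rev_cases)
    case Nil
    then show ?thesis unfolding arrow_fun_right by (simp add: x0)
  next
    case (snoc q \<beta>)
    have "(\<Sum>\<alpha>\<in>arcs Q. (y \<alpha> \<otimes>\<^bsub>KQ\<^esub> arrow_fun \<alpha>) (v, p))
      = (\<Sum>\<alpha>\<in>arcs Q. if \<alpha> = \<beta> then (if awlast v q = tail Q \<beta> then x (v, p) else 0) else 0)"
      unfolding arrow_fun_right by (intro sum.cong) (auto simp: snoc y_def)
    also have "\<dots> = (if \<beta> \<in> arcs Q \<and> awlast v q = tail Q \<beta> then x (v, p) else 0)"
      using finite_arcs by (simp add: sum.delta)
    also have "\<dots> = x (v, p)"
      using carrier_KQ_verts(3)[OF x, of v p] by (auto simp: snoc awalk_Cons_iff)
    finally show ?thesis by simp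
  qed
  then have xy: "x = (\<Oplus>\<^bsub>KQ\<^esub>\<alpha>\<in>arcs Q. y \<alpha> \<otimes>\<^bsub>KQ\<^esub> arrow_fun \<alpha>)"
    using KQ_finsum[OF finite_arcs, of "\<lambda>\<alpha>. y \<alpha> \<otimes>\<^bsub>KQ\<^esub> arrow_fun \<alpha>"] y arrow_fun_carrier
    by auto
  show ?thesis by (rule exI[of _ y], rule conjI, use y in blast, rule xy)
qed

lemma KQ_factor_left:
  assumes x: "x \<in> carrier KQ" and x0: "\<And>v. x (v, []) = 0"
  shows "\<exists>y. (\<forall>\<beta>\<in>arcs Q. y \<beta> \<in> carrier KQ) \<and> x = (\<Oplus>\<^bsub>KQ\<^esub>\<beta>\<in>arcs Q. arrow_fun \<beta> \<otimes>\<^bsub>KQ\<^esub> y \<beta>)"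
proof -
  \<comment> \<open>A path carries its start vertex, which moves to the head of \<beta> when \<beta>
    is removed in front; the guard makes all other entries zero, so that \<open>y \<beta>\<close>
    lies in the path algebra.\<close>
  define y where "y \<beta> = (\<lambda>(u, p). if u = head Q \<beta> then x (tail Q \<beta>, \<beta> # p) else 0)" for \<beta>
  have y: "y \<beta> \<in> carrier KQ" for \<beta>
  proof -
    have "{p. y \<beta> p \<noteq> 0} \<subseteq> (\<lambda>(v, p). (head Q \<beta>, tl p)) ` {p. x p \<noteq> 0}"
      by (force simp: y_def image_iff split: if_splits)
    then have "finite {p. y \<beta> p \<noteq> 0}" using x finite_subset unfolding carrier_KQ by blast
    moreover have "{p. y \<beta> p \<noteq> 0} \<subseteq> qpaths Q"
    proof clarify
      fix v p assume "y \<beta> (v, p) \<noteq> 0"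
      then have v: "v = head Q \<beta>" "x (tail Q \<beta>, \<beta> # p) \<noteq> 0" by (auto simp: y_def split: if_splits)
      from carrier_KQ_verts(3)[OF x v(2)] show "(v, p) \<in> qpaths Q"
        by (simp add: qpaths_iff awalk_Cons_iff v(1))
    qed
    ultimately show ?thesis by (simp add: carrier_KQ)
  qed
  have "x (v, p) = (\<Sum>\<beta>\<in>arcs Q. (arrow_fun \<beta> \<otimes>\<^bsub>KQ\<^esub> y \<beta>) (v, p))" for v p
  proof (cases p)
    case Nil
    then show ?thesis unfolding arrow_fun_left by (simp add: x0)
  next
    case (Cons \<alpha> q)
    have "(\<Sum>\<beta>\<in>arcs Q. (arrow_fun \<beta> \<otimes>\<^bsub>KQ\<^esub> y \<beta>) (v, p))
      = (\<Sum>\<beta>\<in>arcs Q. if \<beta> = \<alpha> then (if v = tail Q \<alpha> then x (v, p) else 0) else 0)"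
      unfolding arrow_fun_left by (intro sum.cong) (auto simp: Cons y_def)
    also have "\<dots> = (if \<alpha> \<in> arcs Q \<and> v = tail Q \<alpha> then x (v, p) else 0)"
      using finite_arcs by (simp add: sum.delta)
    also have "\<dots> = x (v, p)"
      using carrier_KQ_verts(3)[OF x, of v p] by (auto simp: Cons awalk_Cons_iff)
    finally show ?thesis by simp
  qed
  then have xy: "x = (\<Oplus>\<^bsub>KQ\<^esub>\<beta>\<in>arcs Q. arrow_fun \<beta> \<otimes>\<^bsub>KQ\<^esub> y \<beta>)"
    using KQ_finsum[OF finite_arcs, of "\<lambda>\<beta>. arrow_fun \<beta> \<otimes>\<^bsub>KQ\<^esub> y \<beta>"] y arrow_fun_carrier
    by auto
  show ?thesis by (rule exI[of _ y], rule conjI, use y in blast, rule xy)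
qed

subsection \<open>The quotient algebra\<close>

definition cls :: "(('v, 'a) qpath \<Rightarrow> 'k) \<Rightarrow> (('v, 'a) qpath \<Rightarrow> 'k) set" where
  "cls f = I +>\<^bsub>KQ\<^esub> f"

lemma A_simps:
  "carrier A = carrier (KQ Quot I)" "x \<otimes>\<^bsub>A\<^esub> y = x \<otimes>\<^bsub>KQ Quot I\<^esub> y" "\<one>\<^bsub>A\<^esub> = \<one>\<^bsub>KQ Quot I\<^esub>"
  "\<zero>\<^bsub>A\<^esub> = \<zero>\<^bsub>KQ Quot I\<^esub>" "x \<oplus>\<^bsub>A\<^esub> y = x \<oplus>\<^bsub>KQ Quot I\<^esub> y"
  "c \<odot>\<^bsub>A\<^esub> X = I <+>\<^bsub>KQ\<^esub> (\<lambda>f. c \<odot>\<^bsub>KQ\<^esub> f) ` X"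
  by (simp_all add: quiver_algebra_def ring.defs module.defs)

text \<open>The record of A carries scalars and so differs in type from the quotient ring; the
  axioms are transferred through \<open>A_simps\<close>.\<close>

lemma ring_A: "ring A"
proof -
  interpret q: ring "KQ Quot I" by (rule KQ.quotient_is_ring)
  show ?thesis
  proof (rule ringI)
    show "abelian_group A"
    proof (rule abelian_groupI)
      fix x assume "x \<in> carrier A"
      then show "\<exists>y\<in>carrier A. y \<oplus>\<^bsub>A\<^esub> x = \<zero>\<^bsub>A\<^esub>"
        unfolding A_simps by (intro bexI[of _ "\<ominus>\<^bsub>KQ Quot I\<^esub> x"]) (auto simp: q.l_neg)
    qed (unfold A_simps, auto simp: q.a_ac)
    show "Group.monoid A"
      by (rule monoidI) (unfold A_simps, auto simp: q.m_assoc)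
  qed (unfold A_simps, auto simp: q.l_distr q.r_distr)
qed

sublocale A: ring A by (rule ring_A)

lemma carrier_A: "carrier A = cls ` carrier KQ"
  by (auto simp: A_simps FactRing_def A_RCOSETS_def' cls_def)

lemma cls_carrier: "f \<in> carrier KQ \<Longrightarrow> cls f \<in> carrier A"
  by (simp add: carrier_A)

lemma cls_hom: "cls \<in> ring_hom KQ (KQ Quot I)"
  using KQ.rcos_ring_hom by (simp add: cls_def[abs_def])

lemma cls_add: "\<lbrakk>f \<in> carrier KQ; g \<in> carrier KQ\<rbrakk> \<Longrightarrow> cls (f \<oplus>\<^bsub>KQ\<^esub> g) = cls f \<oplus>\<^bsub>A\<^esub> cls g"
  using ring_hom_add[OF cls_hom] by (simp add: A_simps)

lemma cls_mult: "\<lbrakk>f \<in> carrier KQ; g \<in> carrier KQ\<rbrakk> \<Longrightarrow> cls (f \<otimes>\<^bsub>KQ\<^esub> g) = cls f \<otimes>\<^bsub>A\<^esub> cls g"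
  using ring_hom_mult[OF cls_hom] by (simp add: A_simps)

lemma cls_one: "cls \<one>\<^bsub>KQ\<^esub> = \<one>\<^bsub>A\<^esub>"
  using ring_hom_one[OF cls_hom] by (simp add: A_simps)

lemma A_zero: "\<zero>\<^bsub>A\<^esub> = I"
  by (simp add: A_simps FactRing_def)

lemma cls_zero_iff: "f \<in> carrier KQ \<Longrightarrow> cls f = \<zero>\<^bsub>A\<^esub> \<longleftrightarrow> f \<in> I"
  unfolding A_zero cls_def
  using KQ.a_coset_join1[OF _ _ KQ.additive_subgroup_axioms[THEN additive_subgroup.a_subgroup]]
    KQ.a_coset_join2[OF _ KQ.additive_subgroup_axioms[THEN additive_subgroup.a_subgroup]]
    KQ.a_subset by blast

lemma cls_finsum:
  "\<lbrakk>finite S; \<And>s. s \<in> S \<Longrightarrow> F s \<in> carrier KQ\<rbrakk> \<Longrightarrow> cls (\<Oplus>\<^bsub>KQ\<^esub>s\<in>S. F s) = (\<Oplus>\<^bsub>A\<^esub>s\<in>S. cls (F s))"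
proof (induction S rule: finite_induct)
  case empty
  have "cls \<zero>\<^bsub>KQ\<^esub> = \<zero>\<^bsub>A\<^esub>" using cls_zero_iff[OF KQ.zero_closed] KQ.additive_subgroup_axioms
    by (simp add: additive_subgroup.zero_closed)
  then show ?case by simp
next
  case (insert s S)
  then have *: "F s \<in> carrier KQ" "F \<in> S \<rightarrow> carrier KQ" by auto
  then have "cls (\<Oplus>\<^bsub>KQ\<^esub>s\<in>insert s S. F s) = cls (F s) \<oplus>\<^bsub>A\<^esub> cls (\<Oplus>\<^bsub>KQ\<^esub>s\<in>S. F s)"
    using insert by (subst KQ.finsum_insert) (auto simp: cls_add)
  also have "\<dots> = (\<Oplus>\<^bsub>A\<^esub>s\<in>insert s S. cls (F s))"
    using insert * by (subst A.finsum_insert) (auto simp: cls_carrier)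
  finally show ?case .
qed

text \<open>Multiples of elements of I lie in I, being products with c . 1; hence the set I + c (I +
  f) of the definition is the coset of c f.\<close>

lemma A_smult: 
  assumes f: "f \<in> carrier KQ"
  shows "c \<odot>\<^bsub>A\<^esub> cls f = cls (c \<odot>\<^bsub>KQ\<^esub> f)"
proof -
  have sub: "c \<odot>\<^bsub>KQ\<^esub> g \<in> I" if "g \<in> I" for g
  proof -
    have "g \<in> carrier KQ" using that KQ.a_subset by blast
    then show ?thesis
      using KQ.I_l_closed[OF that, of "c \<odot>\<^bsub>KQ\<^esub> \<one>\<^bsub>KQ\<^esub>"] smult_carrier[OF KQ.one_closed] smult_one_left
      by metis
  qed
  have add: "c \<odot>\<^bsub>KQ\<^esub> (g \<oplus>\<^bsub>KQ\<^esub> f) = c \<odot>\<^bsub>KQ\<^esub> g \<oplus>\<^bsub>KQ\<^esub> c \<odot>\<^bsub>KQ\<^esub> f" for g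
    by (simp add: distrib_left KQ_simps)
  have c: "c \<odot>\<^bsub>KQ\<^esub> f \<in> carrier KQ" by (rule smult_carrier[OF f])
  have into: "\<exists>h\<in>I. h' \<oplus>\<^bsub>KQ\<^esub> c \<odot>\<^bsub>KQ\<^esub> (g \<oplus>\<^bsub>KQ\<^esub> f) = h \<oplus>\<^bsub>KQ\<^esub> c \<odot>\<^bsub>KQ\<^esub> f" if "h' \<in> I" "g \<in> I" for h' g
    using that sub[OF that(2)] KQ.a_subset c KQ.a_assoc[of h' "c \<odot>\<^bsub>KQ\<^esub> g" "c \<odot>\<^bsub>KQ\<^esub> f"] unfolding add
    by (intro bexI[of _ "h' \<oplus>\<^bsub>KQ\<^esub> c \<odot>\<^bsub>KQ\<^esub> g"])
      (auto simp del: KQ_simps intro: additive_subgroup.a_closed[OF KQ.additive_subgroup_axioms])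
  have onto: "\<exists>h'\<in>I. \<exists>g\<in>I. h \<oplus>\<^bsub>KQ\<^esub> c \<odot>\<^bsub>KQ\<^esub> f = h' \<oplus>\<^bsub>KQ\<^esub> c \<odot>\<^bsub>KQ\<^esub> (g \<oplus>\<^bsub>KQ\<^esub> f)" if "h \<in> I" for h
    using that f by (intro bexI[of _ h] bexI[of _ "\<zero>\<^bsub>KQ\<^esub>"])
      (auto intro: additive_subgroup.zero_closed[OF KQ.additive_subgroup_axioms])
  show ?thesis
    unfolding A_simps cls_def
  proof (intro equalityI subsetI)
    fix z assume "z \<in> I <+>\<^bsub>KQ\<^esub> (\<lambda>f. c \<odot>\<^bsub>KQ\<^esub> f) ` (I +>\<^bsub>KQ\<^esub> f)"
    then obtain h' g where "h' \<in> I" "g \<in> I" "z = h' \<oplus>\<^bsub>KQ\<^esub> c \<odot>\<^bsub>KQ\<^esub> (g \<oplus>\<^bsub>KQ\<^esub> f)"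
      unfolding set_add_def' a_r_coset_def' by blast
    then show "z \<in> I +>\<^bsub>KQ\<^esub> (c \<odot>\<^bsub>KQ\<^esub> f)"
      using into[of h' g] unfolding a_r_coset_def' by blast
  next
    fix z assume "z \<in> I +>\<^bsub>KQ\<^esub> (c \<odot>\<^bsub>KQ\<^esub> f)"
    then obtain h where "h \<in> I" "z = h \<oplus>\<^bsub>KQ\<^esub> c \<odot>\<^bsub>KQ\<^esub> f" unfolding a_r_coset_def' by blast
    then show "z \<in> I <+>\<^bsub>KQ\<^esub> (\<lambda>f. c \<odot>\<^bsub>KQ\<^esub> f) ` (I +>\<^bsub>KQ\<^esub> f)"
      using onto[of h] unfolding set_add_def' a_r_coset_def' by blast
  qed
qed

lemma A_scalar: "c \<odot>\<^bsub>A\<^esub> \<one>\<^bsub>A\<^esub> = cls (c \<odot>\<^bsub>KQ\<^esub> \<one>\<^bsub>KQ\<^esub>)"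
  unfolding cls_one[symmetric] by (rule A_smult) simp

lemma kalgebra_A: "kalgebra A"
proof (rule kalgebra.intro[OF ring_A kalgebra_axioms.intro])
  have c: "c \<odot>\<^bsub>KQ\<^esub> \<one>\<^bsub>KQ\<^esub> \<in> carrier KQ" for c by (rule smult_carrier[OF KQ.one_closed])
  show "c \<odot>\<^bsub>A\<^esub> \<one>\<^bsub>A\<^esub> \<in> carrier A" for c unfolding A_scalar by (rule cls_carrier[OF c])
  show "(c + d) \<odot>\<^bsub>A\<^esub> \<one>\<^bsub>A\<^esub> = c \<odot>\<^bsub>A\<^esub> \<one>\<^bsub>A\<^esub> \<oplus>\<^bsub>A\<^esub> d \<odot>\<^bsub>A\<^esub> \<one>\<^bsub>A\<^esub>" for c d
    unfolding A_scalar cls_add[OF c c, symmetric] by (simp add: KQ_simps distrib_right)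
  show "(c * d) \<odot>\<^bsub>A\<^esub> \<one>\<^bsub>A\<^esub> = (c \<odot>\<^bsub>A\<^esub> \<one>\<^bsub>A\<^esub>) \<otimes>\<^bsub>A\<^esub> (d \<odot>\<^bsub>A\<^esub> \<one>\<^bsub>A\<^esub>)" for c d
    unfolding A_scalar cls_mult[OF c c, symmetric] smult_one_left[OF c] by (simp add: KQ_simps mult.assoc)
  show "1 \<odot>\<^bsub>A\<^esub> \<one>\<^bsub>A\<^esub> = \<one>\<^bsub>A\<^esub>"
    unfolding A_scalar by (subst cls_one[symmetric]) (simp add: KQ_simps)
qed

subsection \<open>The radical filtration\<close>

definition ve :: "'v \<Rightarrow> (('v, 'a) qpath \<Rightarrow> 'k) set" where
  "ve i = path_class Q I (i, [])"

definition J :: "nat \<Rightarrow> (('v, 'a) qpath \<Rightarrow> 'k) set set" where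
  "J r = cls ` arrow_ideal_power Q r"

lemma ve_cls: "i \<in> verts Q \<Longrightarrow> ve i = cls (vertex_fun (\<lambda>v. if v = i then 1 else 0))"
  unfolding ve_def path_class_def cls_def by (simp add: path_fun_vertex)

lemma arrow_ideal_power_carrier: "f \<in> arrow_ideal_power Q r \<Longrightarrow> f \<in> carrier KQ"
  by (simp add: arrow_ideal_power_def)

text \<open>A nonzero coefficient at a path needs a cut with nonzero coefficients at both pieces,
  and the lengths of the pieces add up.\<close>

lemma arrow_ideal_power_mult:
  assumes f: "f \<in> arrow_ideal_power Q r" and g: "g \<in> arrow_ideal_power Q s"
  shows "f \<otimes>\<^bsub>KQ\<^esub> g \<in> arrow_ideal_power Q (r + s)"
  unfolding arrow_ideal_power_def
proof (intro CollectI conjI allI impI)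
  show "f \<otimes>\<^bsub>KQ\<^esub> g \<in> carrier KQ" using f g arrow_ideal_power_carrier by (intro KQ.m_closed)
  fix p assume p: "(f \<otimes>\<^bsub>KQ\<^esub> g) p \<noteq> 0"
  obtain v q where vq: "p = (v, q)" by (cases p)
  obtain n where n: "n \<le> length q" "f (v, take n q) \<noteq> 0" "g (awlast v (take n q), drop n q) \<noteq> 0"
    using p unfolding vq KQ_simps by (metis (no_types, lifting) atMost_iff mult_zero_left mult_zero_right sum.neutral)
  have "r \<le> length (take n q)" "s \<le> length (drop n q)"
    using f g n(2,3) unfolding arrow_ideal_power_def by force+
  then show "r + s \<le> length (snd p)" using n(1) by (simp add: vq)
qed

lemma arrow_ideal_power_0: "arrow_ideal_power Q 0 = carrier KQ"
  by (auto simp: arrow_ideal_power_def)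

lemma nil_degree: "\<exists>m. arrow_ideal_power Q (Suc m) \<subseteq> I"
proof -
  obtain m where "m \<ge> 2" "arrow_ideal_power Q m \<subseteq> I"
    using admissible unfolding admissible_ideal_def by blast
  then show ?thesis by (cases m) auto
qed

lemma zero_in_arrow_ideal_power: "\<zero>\<^bsub>KQ\<^esub> \<in> arrow_ideal_power Q r"
  unfolding arrow_ideal_power_def using KQ.zero_closed by (simp add: KQ_simps(3))

lemma cls_zero: "cls \<zero>\<^bsub>KQ\<^esub> = \<zero>\<^bsub>A\<^esub>"
  using cls_zero_iff[OF KQ.zero_closed] additive_subgroup.zero_closed[OF KQ.additive_subgroup_axioms]
  by simp

text \<open>Long paths vanish in A, so the classes of the paths of length at most m span; there are
  finitely many of these because Q is finite.\<close>

lemma fd_regular_A: "fd_module A (right_ideal_mod A \<one>\<^bsub>A\<^esub>)"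
proof -
  interpret kalgebra A by (rule kalgebra_A)
  let ?R = "right_ideal_mod A \<one>\<^bsub>A\<^esub>"
  have cR: "carrier ?R = carrier A" by auto
  obtain m where m: "arrow_ideal_power Q (Suc m) \<subseteq> I" using nil_degree by blast
  define S where "S = {p \<in> qpaths Q. length (snd p) \<le> m}"
  have "S \<subseteq> verts Q \<times> {p. set p \<subseteq> arcs Q \<and> length p \<le> m}"
    by (auto simp: S_def qpaths_iff awalk_def)
  then have S: "finite S"
    by (rule finite_subset) (intro finite_cartesian_product finite_verts finite_lists_length_le finite_arcs)
  have Sq: "S \<subseteq> qpaths Q" by (auto simp: S_def)
  let ?B = "(\<lambda>p. cls (path_fun p)) ` S"
  have short: "cls f \<in> mspan scalars ?R ?B" if "finite U" "U \<subseteq> S" "{p. f p \<noteq> 0} \<subseteq> U" for f U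
    using that
  proof (induction U arbitrary: f rule: finite_induct)
    case empty
    then have "f = \<zero>\<^bsub>KQ\<^esub>" by (auto simp: fun_eq_iff KQ_simps)
    then show ?case using mspan.zero[of ?R] by (simp add: cls_zero)
  next
    case (insert u U)
    let ?g = "f(u := 0)"
    have g: "?g \<in> carrier KQ"
      unfolding carrier_KQ using insert.prems insert.hyps(1) Sq by (auto intro: finite_subset[of _ U])
    have u: "path_fun u \<in> carrier KQ" using insert.prems Sq by (intro path_fun_carrier) auto
    have "f = ?g \<oplus>\<^bsub>KQ\<^esub> f u \<odot>\<^bsub>KQ\<^esub> path_fun u"
      by (auto simp: fun_eq_iff path_fun_def KQ_simps)
    then have "cls f = cls ?g \<oplus>\<^bsub>A\<^esub> cls (f u \<odot>\<^bsub>KQ\<^esub> path_fun u)"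
      using cls_add[OF g smult_carrier[OF u]] by metis
    also have "cls (f u \<odot>\<^bsub>KQ\<^esub> path_fun u) = cls (path_fun u) \<otimes>\<^bsub>A\<^esub> (f u \<odot>\<^bsub>A\<^esub> \<one>\<^bsub>A\<^esub>)"
      unfolding A_scalar smult_one_right[OF u, symmetric]
      by (rule cls_mult[OF u smult_carrier[OF KQ.one_closed]])
    finally have eq: "cls f = cls ?g \<oplus>\<^bsub>?R\<^esub> (f u \<odot>\<^bsub>A\<^esub> \<one>\<^bsub>A\<^esub>) \<odot>\<^bsub>?R\<^esub> cls (path_fun u)"
      by (simp del: fun_upd_apply add: fun_upd_def)
    have "cls ?g \<in> mspan scalars ?R ?B" using insert.prems by (intro insert.IH) auto
    moreover have "(f u \<odot>\<^bsub>A\<^esub> \<one>\<^bsub>A\<^esub>) \<odot>\<^bsub>?R\<^esub> cls (path_fun u) \<in> mspan scalars ?R ?B"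
      using insert.prems by (intro mspan.act mspan.base) auto
    ultimately show ?case unfolding eq by (rule mspan.add)
  qed
  have "a \<in> mspan scalars ?R ?B" if a: "a \<in> carrier A" for a
  proof -
    obtain f where f: "f \<in> carrier KQ" "a = cls f" using a carrier_A by blast
    \<comment> \<open>f is split by path length: g is a combination of short paths, and h lies in
      I.\<close>
    define g where "g p = (if length (snd p) \<le> m then f p else 0)" for p
    define h where "h p = (if length (snd p) \<le> m then 0 else f p)" for p
    have gS: "{p. g p \<noteq> 0} \<subseteq> S" using f(1) by (auto simp: g_def S_def carrier_KQ)
    then have g: "g \<in> carrier KQ" using S Sq finite_subset unfolding carrier_KQ by blast
    have "{p. h p \<noteq> 0} \<subseteq> {p. f p \<noteq> 0}" by (auto simp: h_def)
    then have "h \<in> carrier KQ" using f(1) finite_subset unfolding carrier_KQ by blast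
    then have "h \<in> arrow_ideal_power Q (Suc m)" by (auto simp: arrow_ideal_power_def h_def split: if_splits)
    then have h: "h \<in> I" "h \<in> carrier KQ" using m arrow_ideal_power_carrier by auto
    have "f = g \<oplus>\<^bsub>KQ\<^esub> h" by (auto simp: fun_eq_iff g_def h_def KQ_simps)
    then have "cls f = cls g" using cls_add[OF g h(2)] cls_zero_iff[OF h(2)] h(1) cls_carrier[OF g] by simp
    then show ?thesis using short[OF S order_refl gS] f(2) by simp
  qed
  then have "carrier ?R \<subseteq> mspan scalars ?R ?B" unfolding cR by blast
  moreover have "?B \<subseteq> carrier ?R" unfolding cR using Sq path_fun_carrier cls_carrier by blast
  moreover have "finite ?B" using S by simp
  ultimately show ?thesis using right_module_regular[OF ring_A] by (intro fd_moduleI)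
qed

lemma ve_carrier: "i \<in> verts Q \<Longrightarrow> ve i \<in> carrier A"
  by (simp add: ve_cls cls_carrier vertex_fun_carrier)

lemma ve_mult: "\<lbrakk>i \<in> verts Q; j \<in> verts Q\<rbrakk> \<Longrightarrow> ve i \<otimes>\<^bsub>A\<^esub> ve j = (if i = j then ve i else \<zero>\<^bsub>A\<^esub>)"
proof -
  assume ij: "i \<in> verts Q" "j \<in> verts Q"
  let ?d = "\<lambda>i. vertex_fun (\<lambda>v. if v = i then 1 else 0)"
  have "?d i \<otimes>\<^bsub>KQ\<^esub> ?d j = (if i = j then ?d i else \<zero>\<^bsub>KQ\<^esub>)"
    by (rule ext, clarify, subst vertex_fun_left) (auto simp: vertex_fun_def KQ_simps)
  then show ?thesis
    using cls_mult[OF vertex_fun_carrier vertex_fun_carrier, of "\<lambda>v. if v = i then 1 else 0" "\<lambda>v. if v = j then 1 else 0"]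
    by (auto simp: ve_cls ij cls_zero simp del: KQ_simps split: if_splits)
qed

lemma ve_sum: "(\<Oplus>\<^bsub>A\<^esub>i\<in>verts Q. ve i) = \<one>\<^bsub>A\<^esub>"
proof -
  let ?d = "\<lambda>i. vertex_fun (\<lambda>v. if v = i then 1 else 0)"
  have "(\<Oplus>\<^bsub>KQ\<^esub>i\<in>verts Q. ?d i) p = \<one>\<^bsub>KQ\<^esub> p" for p
    using finite_verts
    by (subst KQ_finsum[OF finite_verts vertex_fun_carrier], cases p)
      (auto simp: vertex_fun_def sum.delta KQ_simps)
  then have "cls \<one>\<^bsub>KQ\<^esub> = cls (\<Oplus>\<^bsub>KQ\<^esub>i\<in>verts Q. ?d i)" by (metis ext)
  also have "\<dots> = (\<Oplus>\<^bsub>A\<^esub>i\<in>verts Q. cls (?d i))"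
    by (rule cls_finsum[OF finite_verts vertex_fun_carrier])
  also have "\<dots> = (\<Oplus>\<^bsub>A\<^esub>i\<in>verts Q. ve i)"
    by (rule A.finsum_cong') (auto simp: ve_cls cls_carrier vertex_fun_carrier)
  finally show ?thesis by (simp add: cls_one)
qed

text \<open>Reduces the claims about e_i A e_j to the observation that a trivial path runs from i to
  j only if i = j.\<close>

lemma sandwich:
  assumes i: "i \<in> verts Q" and j: "j \<in> verts Q" and f: "f \<in> carrier KQ"
  defines "g \<equiv> \<lambda>(v, p). if v = i \<and> awlast v p = j then f (v, p) else 0"
  shows "ve i \<otimes>\<^bsub>A\<^esub> cls f \<otimes>\<^bsub>A\<^esub> ve j = cls g" "g \<in> carrier KQ"
proof -
  let ?d = "\<lambda>i. vertex_fun (\<lambda>v. if v = i then 1 else 0)"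
  note d = vertex_fun_carrier[of "\<lambda>v. if v = i then 1 else 0"] vertex_fun_carrier[of "\<lambda>v. if v = j then 1 else 0"]
  have g: "g = ?d i \<otimes>\<^bsub>KQ\<^esub> f \<otimes>\<^bsub>KQ\<^esub> ?d j"
    by (rule ext, clarify, subst vertex_fun_right, subst vertex_fun_left) (use i j in \<open>auto simp: g_def\<close>)
  show "g \<in> carrier KQ" unfolding g by (intro KQ.m_closed d f)
  show "ve i \<otimes>\<^bsub>A\<^esub> cls f \<otimes>\<^bsub>A\<^esub> ve j = cls g"
    unfolding g ve_cls[OF i] ve_cls[OF j] cls_mult[OF KQ.m_closed[OF d(1) f] d(2)] cls_mult[OF d(1) f] ..
qed

text \<open>Admissibility provides nilpotency, as I contains a power of the arrow ideal, and keeps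
  the idempotents out of the radical, as the elements of I have no coefficients at paths of length
  below 2.\<close>

sublocale basic_algebra A "verts Q" ve J
proof (intro basic_algebra.intro kalgebra_A basic_algebra_axioms.intro)
  show "finite (verts Q)" by simp
  show "ve i \<in> carrier A" if "i \<in> verts Q" for i by (rule ve_carrier[OF that])
  show "ve i \<otimes>\<^bsub>A\<^esub> ve i = ve i" if "i \<in> verts Q" for i using ve_mult[OF that that] by simp
  show "(\<Oplus>\<^bsub>A\<^esub>i\<in>verts Q. ve i) = \<one>\<^bsub>A\<^esub>" by (rule ve_sum)
  show "J r \<subseteq> carrier A" for r unfolding J_def using arrow_ideal_power_carrier cls_carrier by blast
  show "\<zero>\<^bsub>A\<^esub> \<in> J r" for r unfolding J_def cls_zero[symmetric] by (intro imageI zero_in_arrow_ideal_power)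
  show "x \<oplus>\<^bsub>A\<^esub> y \<in> J r" if hyp: "x \<in> J r" "y \<in> J r" for x y r
  proof -
    obtain f g where fg: "f \<in> arrow_ideal_power Q r" "g \<in> arrow_ideal_power Q r" "x = cls f" "y = cls g"
      using hyp by (auto simp: J_def)
    note c = arrow_ideal_power_carrier[OF fg(1)] arrow_ideal_power_carrier[OF fg(2)]
    have "f \<oplus>\<^bsub>KQ\<^esub> g \<in> arrow_ideal_power Q r"
      using KQ.a_closed[OF c] fg(1,2) unfolding arrow_ideal_power_def
      by (auto simp: KQ_simps) (metis add.right_neutral)
    then show ?thesis using cls_add[OF c] fg unfolding J_def by (metis imageI)
  qed
  show "x \<otimes>\<^bsub>A\<^esub> a \<in> J r" if hyp: "x \<in> J r" "a \<in> carrier A" for x a r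
  proof -
    obtain f g where fg: "f \<in> arrow_ideal_power Q r" "g \<in> carrier KQ" "x = cls f" "a = cls g"
      using hyp by (auto simp: J_def carrier_A)
    then have "f \<otimes>\<^bsub>KQ\<^esub> g \<in> arrow_ideal_power Q r"
      using arrow_ideal_power_mult[of f r g 0] by (simp add: arrow_ideal_power_0)
    then show ?thesis using cls_mult[OF arrow_ideal_power_carrier[OF fg(1)] fg(2)] fg(3,4) unfolding J_def by (metis imageI)
  qed
  show "a \<otimes>\<^bsub>A\<^esub> x \<in> J r" if hyp: "x \<in> J r" "a \<in> carrier A" for x a r
  proof -
    obtain f g where fg: "f \<in> arrow_ideal_power Q r" "g \<in> carrier KQ" "x = cls f" "a = cls g"
      using hyp by (auto simp: J_def carrier_A)
    then have "g \<otimes>\<^bsub>KQ\<^esub> f \<in> arrow_ideal_power Q r"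
      using arrow_ideal_power_mult[of g 0 f r] by (simp add: arrow_ideal_power_0)
    then show ?thesis using cls_mult[OF fg(2) arrow_ideal_power_carrier[OF fg(1)]] fg(3,4) unfolding J_def by (metis imageI)
  qed
  show "x \<otimes>\<^bsub>A\<^esub> y \<in> J (Suc r)" if hyp: "x \<in> J r" "y \<in> J 1" for x y r
  proof -
    obtain f g where fg: "f \<in> arrow_ideal_power Q r" "g \<in> arrow_ideal_power Q 1" "x = cls f" "y = cls g"
      using hyp by (auto simp: J_def)
    then have "f \<otimes>\<^bsub>KQ\<^esub> g \<in> arrow_ideal_power Q (Suc r)"
      using arrow_ideal_power_mult[of f r g 1] by simp
    then show ?thesis
      using cls_mult[OF fg(1,2)[THEN arrow_ideal_power_carrier]] fg(3,4) unfolding J_def by (metis imageI)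
  qed
  show "\<exists>m. J (Suc m) = {\<zero>\<^bsub>A\<^esub>}"
  proof -
    obtain m where m: "arrow_ideal_power Q (Suc m) \<subseteq> I" using nil_degree by blast
    have "cls f = \<zero>\<^bsub>A\<^esub>" if "f \<in> arrow_ideal_power Q (Suc m)" for f
      using cls_zero_iff[OF arrow_ideal_power_carrier[OF that]] m that by blast
    then show ?thesis
      unfolding J_def using zero_in_arrow_ideal_power by (intro exI[of _ m]) blast
  qed
  show "ve i \<notin> J 1" if i: "i \<in> verts Q" for i
  proof
    assume "ve i \<in> J 1"
    then obtain f where f: "f \<in> arrow_ideal_power Q 1" "ve i = cls f" by (auto simp: J_def)
    let ?d = "vertex_fun (\<lambda>v. if v = i then 1 else 0)"
    note c = arrow_ideal_power_carrier[OF f(1)] vertex_fun_carrier[of "\<lambda>v. if v = i then 1 else 0"]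
    have "?d \<in> I +>\<^bsub>KQ\<^esub> f"
      using f(2) ve_cls[OF i] KQ.a_rcos_self[OF c(2)] unfolding cls_def by metis
    then obtain h where h: "h \<in> I" "?d = h \<oplus>\<^bsub>KQ\<^esub> f"
      unfolding a_r_coset_def' by blast
    \<comment> \<open>Neither h nor f has a coefficient at the trivial path at i, whereas the
      idempotent has.\<close>
    have "h \<in> arrow_ideal_power Q 2" using h(1) admissible unfolding admissible_ideal_def by blast
    then have "h (i, []) = 0" "f (i, []) = 0"
      using f(1) unfolding arrow_ideal_power_def by force+
    then have "?d (i, []) = 0" by (simp add: h(2) KQ_simps)
    then show False using i by (simp add: vertex_fun_def)
  qed
  show "ve i \<otimes>\<^bsub>A\<^esub> a \<otimes>\<^bsub>A\<^esub> ve j \<in> J 1"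
    if ij: "i \<in> verts Q" "j \<in> verts Q" "i \<noteq> j" and a: "a \<in> carrier A" for i j a
  proof -
    from a have "a \<in> cls ` carrier KQ" by (simp only: carrier_A)
    then obtain f where f: "f \<in> carrier KQ" "a = cls f" by (elim imageE)
    note s = sandwich[OF ij(1,2) f(1)]
    show ?thesis
      unfolding f(2) s(1) J_def
    proof (rule imageI)
      \<comment> \<open>A path from i to j with i \<noteq> j contains an arrow.\<close>
      show "(\<lambda>(v, p). if v = i \<and> awlast v p = j then f (v, p) else 0) \<in> arrow_ideal_power Q 1"
        unfolding arrow_ideal_power_def
        using s(2) ij(3) by (auto split: if_splits simp: Suc_le_eq)
    qed
  qed
  show "\<exists>c. \<exists>x\<in>J 1. ve i \<otimes>\<^bsub>A\<^esub> a \<otimes>\<^bsub>A\<^esub> ve i = (c \<odot>\<^bsub>A\<^esub> \<one>\<^bsub>A\<^esub>) \<otimes>\<^bsub>A\<^esub> ve i \<oplus>\<^bsub>A\<^esub> x"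
    if i: "i \<in> verts Q" and a: "a \<in> carrier A" for i a
  proof -
    from a have "a \<in> cls ` carrier KQ" by (simp only: carrier_A)
    then obtain f where f: "f \<in> carrier KQ" "a = cls f" by (elim imageE)
    note s = sandwich[OF i i f(1)]
    let ?g = "\<lambda>(v, p). if v = i \<and> awlast v p = i then f (v, p) else 0"
    let ?d = "vertex_fun (\<lambda>v. if v = i then 1 else 0)"
    note d = vertex_fun_carrier[of "\<lambda>v. if v = i then 1 else 0"]
    \<comment> \<open>The scalar of the claim is the coefficient of f at the trivial path at i; y is
      the remainder.\<close>
    define y where "y = (\<lambda>p. if snd p = [] then 0 else ?g p)"
    have "{p. y p \<noteq> 0} \<subseteq> {p. ?g p \<noteq> 0}" by (auto simp: y_def)
    then have yc: "y \<in> carrier KQ" using s(2) finite_subset unfolding carrier_KQ by blast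
    then have y: "y \<in> arrow_ideal_power Q 1"
      by (auto simp: arrow_ideal_power_def y_def Suc_le_eq)
    have "?g = f (i, []) \<odot>\<^bsub>KQ\<^esub> ?d \<oplus>\<^bsub>KQ\<^esub> y"
      using i by (auto simp: fun_eq_iff y_def vertex_fun_def KQ_simps)
    then have "cls ?g = cls (f (i, []) \<odot>\<^bsub>KQ\<^esub> ?d) \<oplus>\<^bsub>A\<^esub> cls y"
      using cls_add[OF smult_carrier[OF d] yc] by metis
    also have "cls (f (i, []) \<odot>\<^bsub>KQ\<^esub> ?d) = (f (i, []) \<odot>\<^bsub>A\<^esub> \<one>\<^bsub>A\<^esub>) \<otimes>\<^bsub>A\<^esub> ve i"
      unfolding A_scalar ve_cls[OF i] smult_one_left[OF d, symmetric]
      by (rule cls_mult[OF smult_carrier[OF KQ.one_closed] d])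
    finally show ?thesis
      unfolding f(2) s(1) using y unfolding J_def by blast
  qed
  show "fd_module A (right_ideal_mod A \<one>\<^bsub>A\<^esub>)" by (rule fd_regular_A)
qed

subsection \<open>Factoring through arrows\<close>

abbreviation ar :: "'a \<Rightarrow> (('v, 'a) qpath \<Rightarrow> 'k) set" where
  "ar \<equiv> arrow_class Q I"

lemma ar_cls: "ar \<alpha> = cls (arrow_fun \<alpha>)"
  by (simp add: arrow_class_def path_class_def cls_def arrow_fun_def)

lemma ar_carrier: "\<alpha> \<in> arcs Q \<Longrightarrow> ar \<alpha> \<in> carrier A"
  by (simp add: ar_cls cls_carrier arrow_fun_carrier)

lemma ar_J: "\<alpha> \<in> arcs Q \<Longrightarrow> ar \<alpha> \<in> J 1"
  unfolding ar_cls J_def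
  by (rule imageI, simp only: arrow_ideal_power_def mem_Collect_eq)
    (simp add: arrow_fun_carrier, simp add: arrow_fun_def path_fun_def split: if_splits)

lemma ar_tail: "\<alpha> \<in> arcs Q \<Longrightarrow> ve (tail Q \<alpha>) \<otimes>\<^bsub>A\<^esub> ar \<alpha> = ar \<alpha>"
proof -
  assume \<alpha>: "\<alpha> \<in> arcs Q"
  have "vertex_fun (\<lambda>v. if v = tail Q \<alpha> then 1 else 0) \<otimes>\<^bsub>KQ\<^esub> arrow_fun \<alpha> = arrow_fun \<alpha>"
    by (rule ext, clarify, subst vertex_fun_left) (use \<alpha> in \<open>auto simp: arrow_fun_def path_fun_def\<close>)
  then show ?thesis
    using cls_mult[OF vertex_fun_carrier arrow_fun_carrier[OF \<alpha>], of "\<lambda>v. if v = tail Q \<alpha> then 1 else 0"] \<alpha>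
    by (simp add: ve_cls ar_cls)
qed

lemma ar_head: "\<alpha> \<in> arcs Q \<Longrightarrow> ar \<alpha> \<otimes>\<^bsub>A\<^esub> ve (head Q \<alpha>) = ar \<alpha>"
proof -
  assume \<alpha>: "\<alpha> \<in> arcs Q"
  have "arrow_fun \<alpha> \<otimes>\<^bsub>KQ\<^esub> vertex_fun (\<lambda>v. if v = head Q \<alpha> then 1 else 0) = arrow_fun \<alpha>"
    by (rule ext, clarify, subst vertex_fun_right) (use \<alpha> in \<open>auto simp: arrow_fun_def path_fun_def\<close>)
  then show ?thesis
    using cls_mult[OF arrow_fun_carrier[OF \<alpha>] vertex_fun_carrier, of "\<lambda>v. if v = head Q \<alpha> then 1 else 0"] \<alpha>
    by (simp add: ve_cls ar_cls)
qed

text \<open>Such an x lies in the radical by \<open>e_off_diag\<close>, so it lifts to an f without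
  trivial paths, to which \<open>KQ_factor_right\<close> applies. Multiplication by e_i and e_k then
  puts the cofactors into e_i A and discards the arrows that do not end at k.\<close>

lemma factor_through_arrows_into:
  assumes i: "i \<in> verts Q" and k: "k \<in> verts Q" and ik: "i \<noteq> k"
    and x: "x \<in> carrier A" "ve i \<otimes>\<^bsub>A\<^esub> x = x" "x \<otimes>\<^bsub>A\<^esub> ve k = x"
  shows "\<exists>y. (\<forall>\<alpha>. \<alpha> \<in> arcs Q \<and> head Q \<alpha> = k \<longrightarrow> y \<alpha> \<in> carrier A \<and> ve i \<otimes>\<^bsub>A\<^esub> y \<alpha> = y \<alpha>) \<and>
    x = (\<Oplus>\<^bsub>A\<^esub>\<alpha>\<in>{\<alpha> \<in> arcs Q. head Q \<alpha> = k}. y \<alpha> \<otimes>\<^bsub>A\<^esub> ar \<alpha>)"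
proof -
  note vi = ve_carrier[OF i] ve_mult[OF i i] and vk = ve_carrier[OF k]
  have "x = ve i \<otimes>\<^bsub>A\<^esub> x \<otimes>\<^bsub>A\<^esub> ve k" using x by simp
  then have "x \<in> J 1" using e_off_diag[OF i k ik x(1)] by simp
  then obtain f where f: "f \<in> arrow_ideal_power Q 1" "x = cls f" by (auto simp: J_def)
  then have "f \<in> carrier KQ" "f (v, []) = 0" for v by (force simp: arrow_ideal_power_def)+
  from KQ_factor_right[OF this] obtain g where g: "\<forall>\<alpha>\<in>arcs Q. g \<alpha> \<in> carrier KQ"
    "f = (\<Oplus>\<^bsub>KQ\<^esub>\<alpha>\<in>arcs Q. g \<alpha> \<otimes>\<^bsub>KQ\<^esub> arrow_fun \<alpha>)" by blast
  have "x = (\<Oplus>\<^bsub>A\<^esub>\<alpha>\<in>arcs Q. cls (g \<alpha> \<otimes>\<^bsub>KQ\<^esub> arrow_fun \<alpha>))"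
    unfolding f(2) g(2) using g(1) arrow_fun_carrier by (intro cls_finsum finite_arcs KQ.m_closed) auto
  also have "\<dots> = (\<Oplus>\<^bsub>A\<^esub>\<alpha>\<in>arcs Q. cls (g \<alpha>) \<otimes>\<^bsub>A\<^esub> ar \<alpha>)"
    using g(1) arrow_fun_carrier
    by (intro A.finsum_cong') (auto simp: cls_mult ar_cls cls_carrier)
  finally have xs: "x = (\<Oplus>\<^bsub>A\<^esub>\<alpha>\<in>arcs Q. cls (g \<alpha>) \<otimes>\<^bsub>A\<^esub> ar \<alpha>)" .
  have gc: "cls (g \<alpha>) \<in> carrier A" if "\<alpha> \<in> arcs Q" for \<alpha> using g(1) that cls_carrier by blast
  define y where "y \<alpha> = ve i \<otimes>\<^bsub>A\<^esub> cls (g \<alpha>)" for \<alpha>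
  have yc: "y \<alpha> \<in> carrier A" "ve i \<otimes>\<^bsub>A\<^esub> y \<alpha> = y \<alpha>" if "\<alpha> \<in> arcs Q" for \<alpha>
    using gc[OF that] vi by (simp_all add: y_def A.m_assoc[symmetric])
  have "x = ve i \<otimes>\<^bsub>A\<^esub> (\<Oplus>\<^bsub>A\<^esub>\<alpha>\<in>arcs Q. cls (g \<alpha>) \<otimes>\<^bsub>A\<^esub> ar \<alpha>) \<otimes>\<^bsub>A\<^esub> ve k" using x xs by simp
  also have "\<dots> = (\<Oplus>\<^bsub>A\<^esub>\<alpha>\<in>arcs Q. ve i \<otimes>\<^bsub>A\<^esub> (cls (g \<alpha>) \<otimes>\<^bsub>A\<^esub> ar \<alpha>) \<otimes>\<^bsub>A\<^esub> ve k)"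
    using gc ar_carrier vi(1) vk
    by (subst A.finsum_rdistr, simp_all add: Pi_iff) (subst A.finsum_ldistr, simp_all add: Pi_iff)
  also have "\<dots> = (\<Oplus>\<^bsub>A\<^esub>\<alpha>\<in>arcs Q. if head Q \<alpha> = k then y \<alpha> \<otimes>\<^bsub>A\<^esub> ar \<alpha> else \<zero>\<^bsub>A\<^esub>)"
  proof (rule A.finsum_cong')
    fix \<alpha> assume \<alpha>: "\<alpha> \<in> arcs Q"
    note c = gc[OF \<alpha>] ar_carrier[OF \<alpha>] vi(1) vk
    have h: "head Q \<alpha> \<in> verts Q" using \<alpha> by simp
    have "ar \<alpha> \<otimes>\<^bsub>A\<^esub> ve k = ar \<alpha> \<otimes>\<^bsub>A\<^esub> (ve (head Q \<alpha>) \<otimes>\<^bsub>A\<^esub> ve k)"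
      using A.m_assoc[OF c(2) ve_carrier[OF h] vk] ar_head[OF \<alpha>] by simp
    also have "\<dots> = (if head Q \<alpha> = k then ar \<alpha> else \<zero>\<^bsub>A\<^esub>)"
      using ve_mult[OF h k] ar_head[OF \<alpha>] c(2) by auto
    finally have "ar \<alpha> \<otimes>\<^bsub>A\<^esub> ve k = (if head Q \<alpha> = k then ar \<alpha> else \<zero>\<^bsub>A\<^esub>)" .
    then show "ve i \<otimes>\<^bsub>A\<^esub> (cls (g \<alpha>) \<otimes>\<^bsub>A\<^esub> ar \<alpha>) \<otimes>\<^bsub>A\<^esub> ve k = (if head Q \<alpha> = k then y \<alpha> \<otimes>\<^bsub>A\<^esub> ar \<alpha> else \<zero>\<^bsub>A\<^esub>)"
      using c by (simp add: y_def A.m_assoc)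
  qed (use yc ar_carrier in auto)
  also have "\<dots> = (\<Oplus>\<^bsub>A\<^esub>\<alpha>\<in>{\<alpha> \<in> arcs Q. head Q \<alpha> = k}. if head Q \<alpha> = k then y \<alpha> \<otimes>\<^bsub>A\<^esub> ar \<alpha> else \<zero>\<^bsub>A\<^esub>)"
    using yc ar_carrier by (intro A.add.finprod_mono_neutral_cong_right) auto
  also have "\<dots> = (\<Oplus>\<^bsub>A\<^esub>\<alpha>\<in>{\<alpha> \<in> arcs Q. head Q \<alpha> = k}. y \<alpha> \<otimes>\<^bsub>A\<^esub> ar \<alpha>)"
    using yc ar_carrier by (intro A.finsum_cong') auto
  finally show ?thesis using yc by blast
qed

text \<open>The mirror image, with \<open>KQ_factor_left\<close>: multiplication by e_k from the
  left selects the arrows that start at k.\<close>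

lemma factor_through_arrows_from:
  assumes i: "i \<in> verts Q" and k: "k \<in> verts Q" and ik: "k \<noteq> i"
    and x: "x \<in> carrier A" "ve k \<otimes>\<^bsub>A\<^esub> x = x" "x \<otimes>\<^bsub>A\<^esub> ve i = x"
  shows "\<exists>y. (\<forall>\<beta>. \<beta> \<in> arcs Q \<and> tail Q \<beta> = k \<longrightarrow> y \<beta> \<in> carrier A) \<and>
    x = (\<Oplus>\<^bsub>A\<^esub>\<beta>\<in>{\<beta> \<in> arcs Q. tail Q \<beta> = k}. ar \<beta> \<otimes>\<^bsub>A\<^esub> y \<beta>)"
proof -
  note vk = ve_carrier[OF k]
  have "x = ve k \<otimes>\<^bsub>A\<^esub> x \<otimes>\<^bsub>A\<^esub> ve i" using x by simp
  then have "x \<in> J 1" using e_off_diag[OF k i ik x(1)] by simp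
  then obtain f where f: "f \<in> arrow_ideal_power Q 1" "x = cls f" by (auto simp: J_def)
  then have "f \<in> carrier KQ" "f (v, []) = 0" for v by (force simp: arrow_ideal_power_def)+
  from KQ_factor_left[OF this] obtain g where g: "\<forall>\<beta>\<in>arcs Q. g \<beta> \<in> carrier KQ"
    "f = (\<Oplus>\<^bsub>KQ\<^esub>\<beta>\<in>arcs Q. arrow_fun \<beta> \<otimes>\<^bsub>KQ\<^esub> g \<beta>)" by blast
  have "x = (\<Oplus>\<^bsub>A\<^esub>\<beta>\<in>arcs Q. cls (arrow_fun \<beta> \<otimes>\<^bsub>KQ\<^esub> g \<beta>))"
    unfolding f(2) g(2) using g(1) arrow_fun_carrier by (intro cls_finsum finite_arcs KQ.m_closed) auto
  also have "\<dots> = (\<Oplus>\<^bsub>A\<^esub>\<beta>\<in>arcs Q. ar \<beta> \<otimes>\<^bsub>A\<^esub> cls (g \<beta>))"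
    using g(1) arrow_fun_carrier
    by (intro A.finsum_cong') (auto simp: cls_mult ar_cls cls_carrier)
  finally have xs: "x = (\<Oplus>\<^bsub>A\<^esub>\<beta>\<in>arcs Q. ar \<beta> \<otimes>\<^bsub>A\<^esub> cls (g \<beta>))" .
  have gc: "cls (g \<beta>) \<in> carrier A" if "\<beta> \<in> arcs Q" for \<beta> using g(1) that cls_carrier by blast
  have "x = ve k \<otimes>\<^bsub>A\<^esub> (\<Oplus>\<^bsub>A\<^esub>\<beta>\<in>arcs Q. ar \<beta> \<otimes>\<^bsub>A\<^esub> cls (g \<beta>))" using x xs by simp
  also have "\<dots> = (\<Oplus>\<^bsub>A\<^esub>\<beta>\<in>arcs Q. ve k \<otimes>\<^bsub>A\<^esub> (ar \<beta> \<otimes>\<^bsub>A\<^esub> cls (g \<beta>)))"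
    using gc ar_carrier vk by (subst A.finsum_rdistr) (simp_all add: Pi_iff)
  also have "\<dots> = (\<Oplus>\<^bsub>A\<^esub>\<beta>\<in>arcs Q. if tail Q \<beta> = k then ar \<beta> \<otimes>\<^bsub>A\<^esub> cls (g \<beta>) else \<zero>\<^bsub>A\<^esub>)"
  proof (rule A.finsum_cong')
    fix \<beta> assume \<beta>: "\<beta> \<in> arcs Q"
    note c = gc[OF \<beta>] ar_carrier[OF \<beta>] vk
    have h: "tail Q \<beta> \<in> verts Q" using \<beta> by simp
    have "ve k \<otimes>\<^bsub>A\<^esub> ar \<beta> = (ve k \<otimes>\<^bsub>A\<^esub> ve (tail Q \<beta>)) \<otimes>\<^bsub>A\<^esub> ar \<beta>"
      using A.m_assoc[OF vk ve_carrier[OF h] c(2)] ar_tail[OF \<beta>] by simp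
    also have "\<dots> = (if tail Q \<beta> = k then ar \<beta> else \<zero>\<^bsub>A\<^esub>)"
      using ve_mult[OF k h] ar_tail[OF \<beta>] c(2) by auto
    finally have "ve k \<otimes>\<^bsub>A\<^esub> ar \<beta> = (if tail Q \<beta> = k then ar \<beta> else \<zero>\<^bsub>A\<^esub>)" .
    then show "ve k \<otimes>\<^bsub>A\<^esub> (ar \<beta> \<otimes>\<^bsub>A\<^esub> cls (g \<beta>)) = (if tail Q \<beta> = k then ar \<beta> \<otimes>\<^bsub>A\<^esub> cls (g \<beta>) else \<zero>\<^bsub>A\<^esub>)"
      using c by (simp add: A.m_assoc[symmetric])
  qed (use gc ar_carrier in auto)
  also have "\<dots> = (\<Oplus>\<^bsub>A\<^esub>\<beta>\<in>{\<beta> \<in> arcs Q. tail Q \<beta> = k}. if tail Q \<beta> = k then ar \<beta> \<otimes>\<^bsub>A\<^esub> cls (g \<beta>) else \<zero>\<^bsub>A\<^esub>)"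
    using gc ar_carrier by (intro A.add.finprod_mono_neutral_cong_right) auto
  also have "\<dots> = (\<Oplus>\<^bsub>A\<^esub>\<beta>\<in>{\<beta> \<in> arcs Q. tail Q \<beta> = k}. ar \<beta> \<otimes>\<^bsub>A\<^esub> cls (g \<beta>))"
    using gc ar_carrier by (intro A.finsum_cong') auto
  finally show ?thesis using gc by (intro exI[of _ "\<lambda>\<beta>. cls (g \<beta>)"]) auto
qed

end

section \<open>Complexes with two terms\<close>

context kalgebra
begin

text \<open>X and V meet in degree c alone, and homotopies have no room: there they would start from
  X in degree c + 1 or end in V in degree c - 1. So Hom consists of the maps X_c -> V_c that are
  compatible with the differentials.\<close>

lemma Db_hom_vanishes_corner:
  assumes X: "projective_complex A X" and V: "bounded_complex A V"
    and X0: "\<And>n. n > c \<Longrightarrow> carrier (obj X n) = {\<zero>\<^bsub>obj X n\<^esub>}"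
    and V0: "\<And>n. n < c \<Longrightarrow> carrier (obj V n) = {\<zero>\<^bsub>obj V n\<^esub>}"
  shows "Db_hom_vanishes A X V \<longleftrightarrow>
    (\<forall>\<phi>\<in>mod_hom A (obj X c) (obj V c).
      (\<forall>x\<in>carrier (obj X c). diff V c (\<phi> x) = \<zero>\<^bsub>obj V (c + 1)\<^esub>) \<and>
      (\<forall>x\<in>carrier (obj X (c - 1)). \<phi> (diff X (c - 1) x) = \<zero>\<^bsub>obj V c\<^esub>) \<longrightarrow>
      (\<forall>x\<in>carrier (obj X c). \<phi> x = \<zero>\<^bsub>obj V c\<^esub>))" (is "_ \<longleftrightarrow> ?R")
proof -
  note mX = proj_module_complex[OF X] and mV = bounded_complex_module_complex[OF V]
  note s = diff_simps[OF mX] diff_simps[OF mV] ag_simps module_complex_ag[OF mX] module_complex_ag[OF mV]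
  show ?thesis
    unfolding Db_hom_vanishes_iff[OF X V]
  proof
    assume v: "\<forall>g. chain_map A X V g \<longrightarrow> homotopic A X V g (\<lambda>n x. \<zero>\<^bsub>obj V n\<^esub>)"
    show ?R
    proof (intro ballI impI, elim conjE)
      fix \<phi> x assume \<phi>: "\<phi> \<in> mod_hom A (obj X c) (obj V c)"
        and d\<phi>: "\<forall>x\<in>carrier (obj X c). diff V c (\<phi> x) = \<zero>\<^bsub>obj V (c + 1)\<^esub>"
        and \<phi>d: "\<forall>x\<in>carrier (obj X (c - 1)). \<phi> (diff X (c - 1) x) = \<zero>\<^bsub>obj V c\<^esub>"
        and x: "x \<in> carrier (obj X c)"
      let ?g = "\<lambda>n. if n = c then \<phi> else (\<lambda>x. \<zero>\<^bsub>obj V n\<^esub>)"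
      have "chain_map A X V ?g"
      proof (rule chain_mapI)
        show "graded_hom A X V 0 ?g"
          using \<phi> by (auto simp: graded_hom_def intro: mod_hom_zero_map module_complex_rm[OF mV])
        show "?g (n + 1) (diff X n y) = diff V n (?g n y)" if y: "y \<in> carrier (obj X n)" for n y
        proof (cases "n = c - 1")
          case True
          then show ?thesis using \<phi>d y s(8)[of n] by simp
        next
          case False
          then show ?thesis using d\<phi> y s(8)[of n] by auto
        qed
      qed
      then have "homotopic A X V ?g (\<lambda>n x. \<zero>\<^bsub>obj V n\<^esub>)" using v by blast
      from homotopicD[OF this] obtain h where h: "graded_hom A X V (- 1) h"
        and hx: "\<And>n x. x \<in> carrier (obj X n) \<Longrightarrow> ?g n x =
          \<zero>\<^bsub>obj V n\<^esub> \<oplus>\<^bsub>obj V n\<^esub> (diff V (n - 1) (h n x) \<oplus>\<^bsub>obj V n\<^esub> h (n + 1) (diff X n x))" by blast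
      note hs = graded_hom_simps[OF h mX mV]
      have "h c x \<in> carrier (obj V (c - 1))" using hs(1)[OF x] by simp
      then have "h c x = \<zero>\<^bsub>obj V (c - 1)\<^esub>" using V0[of "c - 1"] by simp
      moreover have "diff X c x \<in> carrier (obj X (c + 1))" using x by (simp add: s)
      then have "diff X c x = \<zero>\<^bsub>obj X (c + 1)\<^esub>" using X0[of "c + 1"] by simp
      ultimately show "\<phi> x = \<zero>\<^bsub>obj V c\<^esub>"
        using hx[OF x] s(8)[of "c - 1"] hs(3)[of "c + 1"] by (simp add: s)
    qed
  next
    assume r: ?R
    show "\<forall>g. chain_map A X V g \<longrightarrow> homotopic A X V g (\<lambda>n x. \<zero>\<^bsub>obj V n\<^esub>)"
    proof (intro allI impI)
      fix g assume g: "chain_map A X V g"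
      note gs = chain_map_simps[OF g mX mV]
      have "g c x = \<zero>\<^bsub>obj V c\<^esub>" if x: "x \<in> carrier (obj X c)" for x
      proof -
        have "\<forall>x\<in>carrier (obj X c). diff V c (g c x) = \<zero>\<^bsub>obj V (c + 1)\<^esub>"
        proof
          fix x assume x: "x \<in> carrier (obj X c)"
          then have "diff X c x \<in> carrier (obj X (c + 1))" by (simp add: s)
          then have "diff X c x = \<zero>\<^bsub>obj X (c + 1)\<^esub>" using X0[of "c + 1"] by simp
          then show "diff V c (g c x) = \<zero>\<^bsub>obj V (c + 1)\<^esub>"
            using gs(5)[OF x refl] gs(3)[of "c + 1"] by simp
        qed
        moreover have "\<forall>x\<in>carrier (obj X (c - 1)). g c (diff X (c - 1) x) = \<zero>\<^bsub>obj V c\<^esub>"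
        proof
          fix x assume x: "x \<in> carrier (obj X (c - 1))"
          have "g (c - 1) x = \<zero>\<^bsub>obj V (c - 1)\<^esub>" using gs(1)[OF x] V0[of "c - 1"] by simp
          then show "g c (diff X (c - 1) x) = \<zero>\<^bsub>obj V c\<^esub>"
            using gs(5)[OF x, of c] s(8)[of "c - 1"] by simp
        qed
        ultimately show ?thesis using r chain_map_hom[OF g, of c] x by blast
      qed
      moreover have "g n x = \<zero>\<^bsub>obj V n\<^esub>" if "x \<in> carrier (obj X n)" "n \<noteq> c" for n x
      proof (cases "n < c")
        case True
        then show ?thesis using gs(1)[OF that(1)] V0 by simp
      next
        case False
        then show ?thesis using that X0[of n] gs(3)[of n] by simp
      qed
      ultimately show "homotopic A X V g (\<lambda>n x. \<zero>\<^bsub>obj V n\<^esub>)"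
        by (intro homotopic_eq[OF chain_map_zero[OF mX mV] mX mV]) metis
    qed
  qed
qed

lemma Db_hom_vanishes_disjoint:
  assumes X: "projective_complex A X" and V: "bounded_complex A V"
    and XV: "\<And>n. carrier (obj X n) = {\<zero>\<^bsub>obj X n\<^esub>} \<or> carrier (obj V n) = {\<zero>\<^bsub>obj V n\<^esub>}"
  shows "Db_hom_vanishes A X V"
proof -
  note mX = proj_module_complex[OF X] and mV = bounded_complex_module_complex[OF V]
  show ?thesis
    unfolding Db_hom_vanishes_iff[OF X V]
  proof (intro allI impI homotopic_eq[OF chain_map_zero[OF mX mV] mX mV])
    fix g n x assume g: "chain_map A X V g" and x: "x \<in> carrier (obj X n)"
    note gs = chain_map_simps[OF g mX mV]
    show "g n x = \<zero>\<^bsub>obj V n\<^esub>" using XV[of n] gs(1,3) x by (metis singletonD)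
  qed
qed

context
  fixes X :: "('r, 'm) cpx" and d :: int
  assumes X: "projective_complex A X"
    and X0: "\<And>n. \<lbrakk>n \<noteq> d; n \<noteq> d + 1\<rbrakk> \<Longrightarrow> carrier (obj X n) = {\<zero>\<^bsub>obj X n\<^esub>}"
begin

text \<open>A chain map X -> X[1] has at most one nonzero component, X_d -> X_(d+1), and
  \<open>H\<close> is what contracts it.\<close>

lemma Db_hom_vanishes_shift_1:
  assumes H: "\<And>\<phi>. \<phi> \<in> mod_hom A (obj X d) (obj X (d + 1)) \<Longrightarrow>
    \<exists>u\<in>mod_hom A (obj X d) (obj X d). \<exists>w\<in>mod_hom A (obj X (d + 1)) (obj X (d + 1)).
      \<forall>x\<in>carrier (obj X d). \<phi> x = diff X d (u x) \<oplus>\<^bsub>obj X (d + 1)\<^esub> w (diff X d x)"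
  shows "Db_hom_vanishes A X (shift 1 X)"
proof -
  note mX = proj_module_complex[OF X]
  note bS = bounded_complex_shift[OF projective_complex_bounded[OF X], of 1]
  note mS = bounded_complex_module_complex[OF bS]
  note s = diff_simps[OF mX] ag_simps module_complex_ag[OF mX]
  show ?thesis
    unfolding Db_hom_vanishes_iff[OF X bS]
  proof (intro allI impI)
    fix g assume g: "chain_map A X (shift 1 X) g"
    note gs = chain_map_simps[OF g mX mS]
    have "g d \<in> mod_hom A (obj X d) (obj X (d + 1))" using chain_map_hom[OF g, of d] by simp
    from H[OF this] obtain u w where u: "u \<in> mod_hom A (obj X d) (obj X d)"
      and w: "w \<in> mod_hom A (obj X (d + 1)) (obj X (d + 1))"
      and uw: "\<forall>x\<in>carrier (obj X d). g d x = diff X d (u x) \<oplus>\<^bsub>obj X (d + 1)\<^esub> w (diff X d x)" by blast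
    \<comment> \<open>The differential of X[1] carries a sign, which - u compensates.\<close>
    let ?h = "\<lambda>n. if n = d then (\<lambda>x. \<ominus>\<^bsub>obj X d\<^esub> u x) else if n = d + 1 then w else (\<lambda>x. \<zero>\<^bsub>obj X n\<^esub>)"
    have h: "?h n \<in> mod_hom A (obj X n) (obj X n)" for n
      using mod_hom_uminus[OF u module_complex_rm[OF mX]] w
      by (auto intro: mod_hom_zero_map module_complex_rm[OF mX])
    show "homotopic A X (shift 1 X) g (\<lambda>n x. \<zero>\<^bsub>obj (shift 1 X) n\<^esub>)"
    proof (rule homotopicI)
      show "graded_hom A X (shift 1 X) (- 1) ?h" using h by (simp add: graded_hom_def)
      fix n x assume x: "x \<in> carrier (obj X n)"
      note hx = mod_hom_simps[OF h]
      let ?r = "\<zero>\<^bsub>obj X (n + 1)\<^esub> \<oplus>\<^bsub>obj X (n + 1)\<^esub>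
          (\<ominus>\<^bsub>obj X (n + 1)\<^esub> diff X n (?h n x) \<oplus>\<^bsub>obj X (n + 1)\<^esub> ?h (n + 1) (diff X n x))"
      have "g n x = ?r"
      proof (cases "n = d")
        case True
        have "u x \<in> carrier (obj X d)" "w (diff X d x) \<in> carrier (obj X (d + 1))"
          using x True mod_hom_closed[OF u] mod_hom_closed[OF w] by (simp_all add: s)
        then show ?thesis using x True uw by (simp add: s)
      next
        case False
        have c: "g n x \<in> carrier (obj X (n + 1))" using gs(1)[OF x] by simp
        have r: "?r \<in> carrier (obj X (n + 1))"
          by (intro s hx(1) x) simp_all
        show ?thesis
        proof (cases "n = d - 1")
          case True
          then have "x = \<zero>\<^bsub>obj X n\<^esub>" using x X0[of n] by simp
          moreover have "?h n \<zero>\<^bsub>obj X n\<^esub> = \<zero>\<^bsub>obj X n\<^esub>"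
            "?h (n + 1) \<zero>\<^bsub>obj X (n + 1)\<^esub> = \<zero>\<^bsub>obj X (n + 1)\<^esub>"
            by (intro hx(4) module_complex_ag[OF mX])+
          ultimately show ?thesis using gs(3)[of n] by (simp only: s) (simp add: s)
        next
          case nd: False
          then have "carrier (obj X (n + 1)) = {\<zero>\<^bsub>obj X (n + 1)\<^esub>}" using False X0[of "n + 1"] by simp
          then show ?thesis using c r by (metis singletonD)
        qed
      qed
      then show "g n x = \<zero>\<^bsub>obj (shift 1 X) n\<^esub> \<oplus>\<^bsub>obj (shift 1 X) n\<^esub>
          (diff (shift 1 X) (n - 1) (?h n x) \<oplus>\<^bsub>obj (shift 1 X) n\<^esub> ?h (n + 1) (diff X n x))"
        by simp
    qed
  qed
qed

text \<open>For |r| \<ge> 2 the supports of X and X[r] are disjoint, and r = 1 is settled by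
  \<open>H\<close>. For r = -1 the two complexes meet in degree d + 1 alone, where
  \<open>Db_hom_vanishes_corner\<close> applies.\<close>

lemma Db_hom_vanishes_shift_iff:
  assumes H: "\<And>\<phi>. \<phi> \<in> mod_hom A (obj X d) (obj X (d + 1)) \<Longrightarrow>
    \<exists>u\<in>mod_hom A (obj X d) (obj X d). \<exists>w\<in>mod_hom A (obj X (d + 1)) (obj X (d + 1)).
      \<forall>x\<in>carrier (obj X d). \<phi> x = diff X d (u x) \<oplus>\<^bsub>obj X (d + 1)\<^esub> w (diff X d x)"
  shows "(\<forall>r. r \<noteq> 0 \<longrightarrow> Db_hom_vanishes A X (shift r X)) \<longleftrightarrow>
    (\<forall>\<phi>\<in>mod_hom A (obj X (d + 1)) (obj X d).
      (\<forall>x\<in>carrier (obj X (d + 1)). diff X d (\<phi> x) = \<zero>\<^bsub>obj X (d + 1)\<^esub>) \<and>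
      (\<forall>x\<in>carrier (obj X d). \<phi> (diff X d x) = \<zero>\<^bsub>obj X d\<^esub>) \<longrightarrow>
      (\<forall>x\<in>carrier (obj X (d + 1)). \<phi> x = \<zero>\<^bsub>obj X d\<^esub>))" (is "_ \<longleftrightarrow> ?R")
proof -
  note mX = proj_module_complex[OF X]
  note bS = bounded_complex_shift[OF projective_complex_bounded[OF X]]
  note s = diff_simps[OF mX] ag_simps module_complex_ag[OF mX]
  have neg: "\<ominus>\<^bsub>obj X (d + 1)\<^esub> diff X d y = \<zero>\<^bsub>obj X (d + 1)\<^esub> \<longleftrightarrow> diff X d y = \<zero>\<^bsub>obj X (d + 1)\<^esub>"
    if "y \<in> carrier (obj X d)" for y
    using that s(1)[OF that refl] by (metis s(16,17) module_complex_ag[OF mX])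
  have m1: "Db_hom_vanishes A X (shift (- 1) X) \<longleftrightarrow> ?R"
  proof -
    have c: "carrier (obj X n) = {\<zero>\<^bsub>obj X n\<^esub>}" if "n > d + 1" for n
      using X0[of n] that by simp
    have c': "carrier (obj (shift (- 1) X) n) = {\<zero>\<^bsub>obj (shift (- 1) X) n\<^esub>}" if "n < d + 1" for n
      using X0[of "n - 1"] that by simp
    have k: "obj (shift (- 1) X) (d + 1) = obj X d" by simp
    have i: "d + 1 - 1 = d" "d + 1 + 1 + (- 1) = d + 1" "d + 1 + (- 1) = d" by simp_all
    have body: "((\<forall>x\<in>carrier (obj X (d + 1)). diff (shift (- 1) X) (d + 1) (\<phi> x) = \<zero>\<^bsub>obj (shift (- 1) X) (d + 1 + 1)\<^esub>) \<and>
          (\<forall>x\<in>carrier (obj X (d + 1 - 1)). \<phi> (diff X (d + 1 - 1) x) = \<zero>\<^bsub>obj X d\<^esub>) \<longrightarrow>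
          (\<forall>x\<in>carrier (obj X (d + 1)). \<phi> x = \<zero>\<^bsub>obj X d\<^esub>)) \<longleftrightarrow>
        ((\<forall>x\<in>carrier (obj X (d + 1)). diff X d (\<phi> x) = \<zero>\<^bsub>obj X (d + 1)\<^esub>) \<and>
          (\<forall>x\<in>carrier (obj X d). \<phi> (diff X d x) = \<zero>\<^bsub>obj X d\<^esub>) \<longrightarrow>
          (\<forall>x\<in>carrier (obj X (d + 1)). \<phi> x = \<zero>\<^bsub>obj X d\<^esub>))"
      if \<phi>: "\<phi> \<in> mod_hom A (obj X (d + 1)) (obj X d)" for \<phi>
      unfolding shift_simps i using neg[OF mod_hom_closed[OF \<phi>]] by simp
    show ?thesis
    proof (rule trans[OF Db_hom_vanishes_corner[where c = "d + 1", OF X bS]], unfold k)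
      show "carrier (obj X n) = {\<zero>\<^bsub>obj X n\<^esub>}" if "n > d + 1" for n by (rule c[OF that])
      show "carrier (obj (shift (- 1) X) n) = {\<zero>\<^bsub>obj (shift (- 1) X) n\<^esub>}" if "n < d + 1" for n
        by (rule c'[OF that])
    qed (rule ball_cong[OF refl], rule body)
  qed
  have "Db_hom_vanishes A X (shift r X)" if "r \<noteq> 0" "r \<noteq> 1" "r \<noteq> - 1" for r
  proof (rule Db_hom_vanishes_disjoint[OF X bS])
    fix n
    show "carrier (obj X n) = {\<zero>\<^bsub>obj X n\<^esub>} \<or> carrier (obj (shift r X) n) = {\<zero>\<^bsub>obj (shift r X) n\<^esub>}"
      using X0[of n] X0[of "n + r"] that by fastforce
  qed
  moreover have "Db_hom_vanishes A X (shift 1 X)" by (rule Db_hom_vanishes_shift_1) (rule H)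
  ultimately have "Db_hom_vanishes A X (shift r X)" if "r \<noteq> 0" "r \<noteq> - 1" for r
    using that by (cases "r = 1") simp_all
  then show ?thesis unfolding m1[symmetric] by (metis zero_neq_neg_one)
qed

end

text \<open>Chain maps are conjugated by the isomorphisms. This carries self-orthogonality over to a
  small copy of a tilting complex.\<close>

lemma Db_hom_vanishes_iso:
  assumes X: "projective_complex A X" and X': "projective_complex A X'" and V: "bounded_complex A V"
    and V': "bounded_complex A V'" and i: "cpx_iso A X X' \<phi> \<psi>" and j: "cpx_iso A V V' \<phi>' \<psi>'"
    and v: "Db_hom_vanishes A X V"
  shows "Db_hom_vanishes A X' V'"
  unfolding Db_hom_vanishes_iff[OF X' V']
proof (intro allI impI)
  note mX = proj_module_complex[OF X] and mX' = proj_module_complex[OF X']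
  note mV = bounded_complex_module_complex[OF V] and mV' = bounded_complex_module_complex[OF V']
  have i': "chain_map A X X' \<phi>" "chain_map A X' X \<psi>" "\<And>n x. x \<in> carrier (obj X' n) \<Longrightarrow> \<phi> n (\<psi> n x) = x"
    and j': "chain_map A V V' \<phi>'" "chain_map A V' V \<psi>'" "\<And>n x. x \<in> carrier (obj V' n) \<Longrightarrow> \<phi>' n (\<psi>' n x) = x"
    using i j by (auto simp: cpx_iso_def)
  fix g assume g: "chain_map A X' V' g"
  let ?g = "comp_maps \<psi>' (comp_maps g \<phi>)"
  have "chain_map A X V ?g" by (intro chain_map_comp[OF j'(2)] chain_map_comp[OF g] i')
  then have "homotopic A X V ?g (\<lambda>n x. \<zero>\<^bsub>obj V n\<^esub>)" using v Db_hom_vanishes_iff[OF X V] by blast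
  from homotopic_comp_left[OF mX mV mV' j'(1) chain_map_zero[OF mX mV] this]
  have "homotopic A X V' (comp_maps \<phi>' ?g) (comp_maps \<phi>' (\<lambda>n x. \<zero>\<^bsub>obj V n\<^esub>))" .
  from homotopic_comp_right[OF mX' mX mV' i'(2) chain_map_comp[OF j'(1) chain_map_zero[OF mX mV]] this]
  have "homotopic A X' V' (comp_maps (comp_maps \<phi>' ?g) \<psi>)
    (comp_maps (comp_maps \<phi>' (\<lambda>n x. \<zero>\<^bsub>obj V n\<^esub>)) \<psi>)" .
  also have "?this \<longleftrightarrow> homotopic A X' V' g (\<lambda>n x. \<zero>\<^bsub>obj V' n\<^esub>)"
  proof (rule homotopic_congs)
    fix n x assume x: "x \<in> carrier (obj X' n)"
    show "comp_maps (comp_maps \<phi>' ?g) \<psi> n x = g n x"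
      using i'(3)[OF x] j'(3) chain_map_simps(1)[OF g mX' mV' x] by (simp add: comp_maps_def)
    show "comp_maps (comp_maps \<phi>' (\<lambda>n x. \<zero>\<^bsub>obj V n\<^esub>)) \<psi> n x = \<zero>\<^bsub>obj V' n\<^esub>"
      using chain_map_simps(3)[OF j'(1) mV mV'] by (simp add: comp_maps_def)
  qed
  finally show "homotopic A X' V' g (\<lambda>n x. \<zero>\<^bsub>obj V' n\<^esub>)" .
qed

subsection \<open>Retracts\<close>

definition retract :: "('r, 'm) cpx \<Rightarrow> ('r, 't) cpx \<Rightarrow> bool" where
  "retract X T \<longleftrightarrow> (\<exists>i p. chain_map A X T i \<and> chain_map A T X p \<and>
     (\<forall>n. \<forall>x\<in>carrier (obj X n). p n (i n x) = x))"

lemma retractI: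
  "\<lbrakk>chain_map A X T i; chain_map A T X p; \<And>n x. x \<in> carrier (obj X n) \<Longrightarrow> p n (i n x) = x\<rbrakk> \<Longrightarrow> retract X T"
  unfolding retract_def by (intro exI[of _ i] exI[of _ p]) blast

lemma retract_trans:
  assumes "retract X Y" "retract Y Z" "module_complex A X" "module_complex A Y"
  shows "retract X Z"
proof -
  obtain i p where i: "chain_map A X Y i" and p: "chain_map A Y X p"
    and pi: "\<forall>n. \<forall>x\<in>carrier (obj X n). p n (i n x) = x"
    using assms(1) unfolding retract_def by (elim exE conjE)
  obtain i' p' where i': "chain_map A Y Z i'" and p': "chain_map A Z Y p'"
    and pi': "\<forall>n. \<forall>x\<in>carrier (obj Y n). p' n (i' n x) = x"
    using assms(2) unfolding retract_def by (elim exE conjE)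
  show ?thesis
  proof (rule retractI[OF chain_map_comp[OF i' i] chain_map_comp[OF p p']])
    fix n x assume x: "x \<in> carrier (obj X n)"
    show "comp_maps p p' n (comp_maps i' i n x) = x"
      using pi pi' x chain_map_simps(1)[OF i assms(3,4) x] by (simp add: comp_maps_def)
  qed
qed

lemma retract_iso: "cpx_iso A X T f g \<Longrightarrow> retract X T"
  unfolding cpx_iso_def by (elim conjE, rule retractI) auto

lemma Gen_of_retract:
  assumes "projective_complex A T" "projective_complex A X" "retract X T"
  shows "Gen T X"
  using assms(3) unfolding retract_def
  by (elim exE conjE) (rule Gen_retract[OF assms(1,2)], auto)

lemma retract_pair:
  assumes X: "module_complex A X" and Y: "module_complex A Y"
  shows "retract X (pair_cpx X Y)" "retract Y (pair_cpx X Y)"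
proof -
  note s = diff_simps[OF X] diff_simps[OF Y] module_complex_ag[OF X] module_complex_ag[OF Y]
  note z = mod_hom_zero_map[OF module_complex_rm[OF X]] mod_hom_zero_map[OF module_complex_rm[OF Y]]
  show "retract X (pair_cpx X Y)"
  proof (rule retractI)
    show "chain_map A X (pair_cpx X Y) (\<lambda>n x. (x, \<zero>\<^bsub>obj Y n\<^esub>))"
      by (rule chain_mapI) (use z in \<open>auto simp: graded_hom_def s intro!: mod_hom_into_pair mod_hom_id\<close>)
    show "chain_map A (pair_cpx X Y) X (\<lambda>n. fst)"
      by (rule chain_mapI) (auto simp: graded_hom_def mod_hom_fst)
  qed simp
  show "retract Y (pair_cpx X Y)"
  proof (rule retractI)
    show "chain_map A Y (pair_cpx X Y) (\<lambda>n y. (\<zero>\<^bsub>obj X n\<^esub>, y))"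
      by (rule chain_mapI) (use z in \<open>auto simp: graded_hom_def s intro!: mod_hom_into_pair mod_hom_id\<close>)
    show "chain_map A (pair_cpx X Y) Y (\<lambda>n. snd)"
      by (rule chain_mapI) (auto simp: graded_hom_def mod_hom_snd)
  qed simp
qed

section \<open>Finite direct sums and two-term complexes of projectives\<close>

lemma dsum_cpx_simps [simp]:
  "obj (dsum_cpx J X) n = dsum_mod J (\<lambda>j. obj (X j) n)"
  "diff (dsum_cpx J X) n x = (\<lambda>j\<in>J. diff (X j) n (x j))"
  by (simp_all add: dsum_cpx_def)

lemma projective_complex_dsum:
  assumes J: "finite J" and X: "\<And>j. j \<in> J \<Longrightarrow> projective_complex A (X j)"
  shows "projective_complex A (dsum_cpx J X)"
proof -
  have b: "bounded_complex A (X j)" and m: "module_complex A (X j)" if "j \<in> J" for j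
    using X[OF that] by (simp_all add: projective_complex_bounded proj_module_complex)
  have fd: "fd_module A (obj (X j) n)" and pr: "fg_projective A (obj (X j) n)" if "j \<in> J" for j n
    using X[OF that] b[OF that] by (simp_all add: projective_complex_def bounded_complex_iff)
  have "\<forall>j\<in>J. \<exists>N. \<forall>n. \<bar>n\<bar> > N \<longrightarrow> carrier (obj (X j) n) = {\<zero>\<^bsub>obj (X j) n\<^esub>}"
    using b by (simp add: bounded_complex_iff)
  then obtain N where N: "\<forall>j\<in>J. \<forall>n. \<bar>n\<bar> > N j \<longrightarrow> carrier (obj (X j) n) = {\<zero>\<^bsub>obj (X j) n\<^esub>}"
    by (elim bchoice[elim_format] exE)
  \<comment> \<open>A common bound exists because J is finite; the element 0 keeps the maximum
    defined when J is empty.\<close>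
  have triv: "carrier (obj (dsum_cpx J X) n) = {\<zero>\<^bsub>obj (dsum_cpx J X) n\<^esub>}" if n: "\<bar>n\<bar> > Max (insert 0 (N ` J))" for n
  proof -
    have "\<bar>n\<bar> > N j" if "j \<in> J" for j using n J that by simp
    then have "carrier (obj (dsum_cpx J X) n) = (\<Pi>\<^sub>E j\<in>J. {\<zero>\<^bsub>obj (X j) n\<^esub>})"
      using N by (auto intro!: PiE_cong)
    then show ?thesis by (simp add: PiE_singleton[of "restrict _ J" J, symmetric] cong: PiE_cong)
  qed
  have rm: "right_module A (obj (dsum_cpx J X) n)" for n
    using m by (simp add: right_module_dsum[OF ring_A] module_complex_rm)
  have "module_complex A (dsum_cpx J X)"
    unfolding module_complex_def
  proof (intro conjI allI ballI rm)
    fix n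
    have "(\<lambda>x. \<lambda>j\<in>J. diff (X j) n (x j)) \<in> mod_hom A (dsum_mod J (\<lambda>j. obj (X j) n)) (dsum_mod J (\<lambda>j. obj (X j) (n + 1)))"
      by (rule mod_hom_into_dsum) (rule mod_hom_comp[where g = "diff (X _) n"], auto intro: diff_hom m mod_hom_proj)
    then show "diff (dsum_cpx J X) n \<in> mod_hom A (obj (dsum_cpx J X) n) (obj (dsum_cpx J X) (n + 1))"
      by (simp add: dsum_cpx_def)
    fix x assume x: "x \<in> carrier (obj (dsum_cpx J X) n)"
    have "diff (X j) (n + 1) (diff (X j) n (x j)) = \<zero>\<^bsub>obj (X j) (n + 1 + 1)\<^esub>" if "j \<in> J" for j
      using x that diff_diff[OF m[OF that] _ refl] by (auto simp: PiE_mem)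
    then show "diff (dsum_cpx J X) (n + 1) (diff (dsum_cpx J X) n x) = \<zero>\<^bsub>obj (dsum_cpx J X) (n + 1 + 1)\<^esub>"
      by (auto simp: fun_eq_iff restrict_def)
  qed
  moreover have "fd_module A (obj (dsum_cpx J X) n)" for n
    unfolding dsum_cpx_simps by (rule fd_dsum[OF J fd])
  moreover have "\<exists>N. \<forall>n. \<bar>n\<bar> > N \<longrightarrow> carrier (obj (dsum_cpx J X) n) = {\<zero>\<^bsub>obj (dsum_cpx J X) n\<^esub>}"
    by (rule exI[of _ "Max (insert 0 (N ` J))"]) (use triv in blast)
  moreover have "fg_projective A (obj (dsum_cpx J X) n)" for n
    unfolding dsum_cpx_simps by (rule fg_projective_dsum[OF J pr fd])
  ultimately show ?thesis by (simp only: projective_complex_def bounded_complex_iff) simp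
qed

lemma retract_dsum:
  assumes m: "\<And>j. j \<in> J \<Longrightarrow> module_complex A (X j)" and j: "j \<in> J"
  shows "retract (X j) (dsum_cpx J X)"
proof (rule retractI)
  let ?i = "\<lambda>n. dsum_inj J (\<lambda>j. obj (X j) n) j"
  show "chain_map A (X j) (dsum_cpx J X) ?i"
  proof (rule chain_mapI)
    have "?i n \<in> mod_hom A (obj (X j) n) (dsum_mod J (\<lambda>j. obj (X j) n))" for n
      by (rule mod_hom_dsum_inj[OF _ j]) (rule module_complex_rm[OF m])
    then show "graded_hom A (X j) (dsum_cpx J X) 0 ?i" by (simp add: graded_hom_def)
    show "?i (n + 1) (diff (X j) n x) = diff (dsum_cpx J X) n (?i n x)" for n x
      using diff_simps(3)[OF m] by (auto simp: dsum_inj_def fun_eq_iff restrict_def)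
  qed
  show "chain_map A (dsum_cpx J X) (X j) (\<lambda>n x. x j)"
    by (rule chain_mapI) (use j mod_hom_proj[OF j, of A "\<lambda>j. obj (X j) _"] in \<open>auto simp: graded_hom_def\<close>)
qed (simp add: dsum_inj_def j)

lemma two_term_simps [simp]:
  "obj (two_term d M N f) n = (if n = d then M else if n = d + 1 then N else zero_sub N)"
  "diff (two_term d M N f) n x = (if n = d then f x else \<zero>\<^bsub>obj (two_term d M N f) (n + 1)\<^esub>)"
  by (simp_all add: two_term_def Let_def)

lemma projective_complex_two_term:
  assumes M: "fd_module A M" "fg_projective A M" and N: "fd_module A N" "fg_projective A N"
    and f: "f \<in> mod_hom A M N"
  shows "projective_complex A (two_term d M N f)"
proof -
  let ?X = "two_term d M N f"
  have rm: "right_module A M" "right_module A N" using M N by (simp_all add: fd_module_def)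
  have z: "right_module A (zero_sub N)" by (rule right_module_zero_sub[OF rm(2)])
  have rmX: "right_module A (obj ?X n)" for n using rm z by simp
  have "module_complex A ?X"
    unfolding module_complex_def
  proof (intro conjI allI ballI rmX)
    fix n
    show "diff ?X n \<in> mod_hom A (obj ?X n) (obj ?X (n + 1))"
    proof (cases "n = d")
      case True
      then have "diff ?X n = f" by (auto simp: fun_eq_iff)
      then show ?thesis using True f by simp
    next
      case False
      then have "diff ?X n = (\<lambda>x. \<zero>\<^bsub>obj ?X (n + 1)\<^esub>)" by (auto simp: fun_eq_iff)
      then show ?thesis using mod_hom_zero_map[OF rmX] by metis
    qed
    show "diff ?X (n + 1) (diff ?X n x) = \<zero>\<^bsub>obj ?X (n + 1 + 1)\<^esub>" if "x \<in> carrier (obj ?X n)" for x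
      using mod_hom_zero[OF f rm[THEN right_module_ag]] by simp
  qed
  moreover have "fd_module A (obj ?X n)" "fg_projective A (obj ?X n)" for n
    using M N fd_trivial[OF z] fg_projective_trivial[OF z] by simp_all
  moreover have "\<exists>B. \<forall>n. \<bar>n\<bar> > B \<longrightarrow> carrier (obj ?X n) = {\<zero>\<^bsub>obj ?X n\<^esub>}"
    by (rule exI[of _ "\<bar>d\<bar> + 1"]) auto
  ultimately show ?thesis by (simp only: projective_complex_def bounded_complex_iff) simp
qed

end

section \<open>Self-orthogonality of mutated sums\<close>

lemma dsum_inj_apply: "i \<in> J \<Longrightarrow> dsum_inj J M j y i = (if i = j then y else \<zero>\<^bsub>M i\<^esub>)"
  by (simp add: dsum_inj_def)

text \<open>
  In the application \<open>M\<close> is the projective at the mutated vertex, \<open>J\<close> is the set of the other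
  vertices, and \<open>S\<close> is the set of the arrows that end (or start) at the mutated vertex.
\<close>

locale mutation = kalgebra A for A :: "('k::field, 'r) module" (structure) +
  fixes J :: "'j set" and P :: "'j \<Rightarrow> ('r, 'p) module" and S :: "'s set" and t :: "'s \<Rightarrow> 'j"
    and M :: "('r, 's \<Rightarrow> 'p) module"
  assumes J: "finite J" and S: "finite S" and t: "s \<in> S \<Longrightarrow> t s \<in> J"
    and P: "j \<in> J \<Longrightarrow> fd_module A (P j)" "j \<in> J \<Longrightarrow> fg_projective A (P j)"
    and M: "fd_module A M" "fg_projective A M"
begin

abbreviation "N \<equiv> dsum_mod S (\<lambda>s. P (t s))"
abbreviation "B \<equiv> dsum_mod J P"
text \<open>The term of D outside degree 0: a zero module, but written as a sum of zero submodules,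
  with the same zero as B.\<close>

abbreviation "Z \<equiv> dsum_mod J (\<lambda>j. zero_sub (P j))"
abbreviation "D \<equiv> dsum_cpx J (\<lambda>j. stalk (P j))"

lemma right_modules:
  "j \<in> J \<Longrightarrow> right_module A (P j)" "right_module A M" "right_module A N" "right_module A B" "right_module A Z"
proof -
  show P': "right_module A (P j)" if "j \<in> J" for j using P(1)[OF that] by (simp add: fd_module_def)
  show "right_module A M" using M(1) by (simp add: fd_module_def)
  show "right_module A N" by (rule right_module_dsum[OF ring_A P'[OF t]])
  show "right_module A B" by (rule right_module_dsum[OF ring_A P'])
  show "right_module A Z" by (rule right_module_dsum[OF ring_A right_module_zero_sub[OF P']])
qed

lemmas ags = right_modules[THEN right_module_ag]

lemma projective_N: "fd_module A N" "fg_projective A N"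
  by (rule fd_dsum[OF S P(1)[OF t]], assumption)
    (rule fg_projective_dsum[OF S P(2)[OF t] P(1)[OF t]])

lemma projective_D: "projective_complex A D"
  by (rule projective_complex_dsum[OF J projective_complex_stalk[OF P]])

lemma carrier_Z: "carrier Z = {\<zero>\<^bsub>Z\<^esub>}"
  by (simp add: PiE_singleton[of "restrict _ J" J, symmetric] cong: PiE_cong)

lemma Z_eq: "z \<in> carrier Z \<Longrightarrow> z = \<zero>\<^bsub>Z\<^esub>"
  using carrier_Z by simp

lemma zero_B: "\<zero>\<^bsub>B\<^esub> = \<zero>\<^bsub>Z\<^esub>"
  by simp

lemma obj_D: "obj D n = (if n = 0 then B else Z)"
  by simp

lemma diff_D: "diff D n x = \<zero>\<^bsub>Z\<^esub>"
  by simp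

text \<open>The degree-0 term of both mutated complexes is N + B, a sum of projectives P_j, so maps
  out of it are compared summand by summand.\<close>

lemma sum_ext:
  assumes h: "h \<in> mod_hom A (pair_mod N B) L" and h': "h' \<in> mod_hom A (pair_mod N B) L"
    and L: "right_module A L"
    and 1: "\<And>s y. \<lbrakk>s \<in> S; y \<in> carrier (P (t s))\<rbrakk> \<Longrightarrow>
      h (dsum_inj S (\<lambda>s. P (t s)) s y, \<zero>\<^bsub>B\<^esub>) = h' (dsum_inj S (\<lambda>s. P (t s)) s y, \<zero>\<^bsub>B\<^esub>)"
    and 2: "\<And>j y. \<lbrakk>j \<in> J; y \<in> carrier (P j)\<rbrakk> \<Longrightarrow>
      h (\<zero>\<^bsub>N\<^esub>, dsum_inj J P j y) = h' (\<zero>\<^bsub>N\<^esub>, dsum_inj J P j y)"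
    and x: "x \<in> carrier (pair_mod N B)"
  shows "h x = h' x"
proof -
  let ?G = "\<Union>s\<in>S. dsum_inj S (\<lambda>s. P (t s)) s ` carrier (P (t s))"
  let ?H = "\<Union>j\<in>J. dsum_inj J P j ` carrier (P j)"
  let ?U = "(\<lambda>x. (x, \<zero>\<^bsub>B\<^esub>)) ` ?G \<union> (\<lambda>y. (\<zero>\<^bsub>N\<^esub>, y)) ` ?H"
  note rN = right_modules(1)[OF t]
  have G: "?G \<subseteq> carrier N"
  proof (intro UN_least image_subsetI)
    fix s y assume "s \<in> S" and y: "y \<in> carrier (P (t s))"
    then have "dsum_inj S (\<lambda>s. P (t s)) s \<in> mod_hom A (P (t s)) N" by (intro mod_hom_dsum_inj rN)
    then show "dsum_inj S (\<lambda>s. P (t s)) s y \<in> carrier N" by (rule mod_hom_closed[OF _ y])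
  qed
  have H: "?H \<subseteq> carrier B"
  proof (intro UN_least image_subsetI)
    fix j y assume "j \<in> J" and y: "y \<in> carrier (P j)"
    then have "dsum_inj J P j \<in> mod_hom A (P j) B" by (intro mod_hom_dsum_inj right_modules)
    then show "dsum_inj J P j y \<in> carrier B" by (rule mod_hom_closed[OF _ y])
  qed
  have sN: "carrier N \<subseteq> mspan (carrier A) N ?G" by (rule dsum_span_self[OF S ring_A rN order_refl])
  have sB: "carrier B \<subseteq> mspan (carrier A) B ?H" by (rule dsum_span_self[OF J ring_A right_modules(1) order_refl])
  have span: "x \<in> mspan (carrier A) (pair_mod N B) ?U"
    by (rule subsetD[OF pair_span[OF right_modules(3,4) order_refl sN sB G H] x])
  have U: "?U \<subseteq> carrier (pair_mod N B)"
  proof -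
    have "\<zero>\<^bsub>N\<^esub> \<in> carrier N" "\<zero>\<^bsub>B\<^esub> \<in> carrier B" by (rule ag_closed(2)[OF ags(3)], rule ag_closed(2)[OF ags(4)])
    then show ?thesis using G H unfolding pair_mod_simps by (intro Un_least image_subsetI SigmaI) (assumption | erule subsetD)+
  qed
  show ?thesis
  proof (rule mod_hom_eq_on_span[OF span h h' right_module_pair[OF right_modules(3,4)] L order_refl U])
    fix y assume "y \<in> ?U"
    then show "h y = h' y"
    proof (elim UnE imageE UN_E)
      fix n s z assume "y = (n, \<zero>\<^bsub>B\<^esub>)" "s \<in> S" "n = dsum_inj S (\<lambda>s. P (t s)) s z" "z \<in> carrier (P (t s))"
      then show ?thesis using 1[of s z] by (simp only:)
    next
      fix b j z assume "y = (\<zero>\<^bsub>N\<^esub>, b)" "j \<in> J" "b = dsum_inj J P j z" "z \<in> carrier (P j)"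
      then show ?thesis using 2[of j z] by (simp only:)
    qed
  qed
qed

lemma inj_N: "s \<in> S \<Longrightarrow> (\<lambda>y. (dsum_inj S (\<lambda>s. P (t s)) s y, \<zero>\<^bsub>B\<^esub>)) \<in> mod_hom A (P (t s)) (pair_mod N B)"
  by (rule mod_hom_into_pair[OF mod_hom_dsum_inj mod_hom_zero_map]) (use right_modules t in auto)

lemma inj_B: "j \<in> J \<Longrightarrow> (\<lambda>y. (\<zero>\<^bsub>N\<^esub>, dsum_inj J P j y)) \<in> mod_hom A (P j) (pair_mod N B)"
  by (rule mod_hom_into_pair[OF mod_hom_zero_map mod_hom_dsum_inj]) (use right_modules in auto)

context
  fixes f
  assumes f: "f \<in> mod_hom A M N"
begin

lemma projective_minus: "projective_complex A (pair_cpx (two_term (- 1) M N f) D)"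
  by (rule projective_complex_pair[OF projective_complex_two_term[OF M projective_N f] projective_D])

text \<open>T has the term M + 0 in degree -1 and N + B in degree 0. For r = 1, a map M -> N + B is
  a family of maps M -> P_j, each of which factors through f by \<open>factor\<close>. For r = -1, a
  map N + B -> M with values in the kernel of f is a family of such maps P_j -> M.\<close>

lemma self_orthogonal_minus_iff:
  assumes factor: "\<And>j \<psi>. \<lbrakk>j \<in> J; \<psi> \<in> mod_hom A M (P j)\<rbrakk> \<Longrightarrow>
    \<exists>w\<in>mod_hom A N (P j). \<forall>x\<in>carrier M. w (f x) = \<psi> x"
  shows "(\<forall>r. r \<noteq> 0 \<longrightarrow> Db_hom_vanishes A (pair_cpx (two_term (- 1) M N f) D)
      (shift r (pair_cpx (two_term (- 1) M N f) D))) \<longleftrightarrow>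
    (\<forall>j\<in>J. \<forall>\<psi>\<in>mod_hom A (P j) M. (\<forall>x\<in>carrier (P j). f (\<psi> x) = \<zero>\<^bsub>N\<^esub>) \<longrightarrow>
      (\<forall>x\<in>carrier (P j). \<psi> x = \<zero>\<^bsub>M\<^esub>))" (is "_ \<longleftrightarrow> ?R")
proof -
  define T where "T = pair_cpx (two_term (- 1) M N f) D"
  have T: "projective_complex A T" unfolding T_def by (rule projective_minus)
  have o: "obj T (- 1) = pair_mod M Z" "obj T (- 1 + 1) = pair_mod N B"
    unfolding T_def pair_cpx_simps obj_D by simp_all
  have d: "diff T (- 1) x = (f (fst x), \<zero>\<^bsub>Z\<^esub>)" for x
    by (cases x) (simp only: T_def pair_cpx_simps diff_D, simp)
  have T0: "carrier (obj T n) = {\<zero>\<^bsub>obj T n\<^esub>}" if "n \<noteq> - 1" "n \<noteq> - 1 + 1" for n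
    using that unfolding T_def pair_cpx_simps obj_D pair_mod_simps by (simp add: carrier_Z del: dsum_mod_simps)
  note z = mod_hom_zero[OF f ags(2,3)]
  have "(\<forall>r. r \<noteq> 0 \<longrightarrow> Db_hom_vanishes A T (shift r T)) \<longleftrightarrow> ?R"
  proof (rule trans[OF Db_hom_vanishes_shift_iff[where d = "- 1", OF T T0]], unfold o d)
    fix \<phi> assume \<phi>: "\<phi> \<in> mod_hom A (pair_mod M Z) (pair_mod N B)"
    define \<psi> where "\<psi> x = \<phi> (x, \<zero>\<^bsub>Z\<^esub>)" for x
    have \<psi>: "\<psi> \<in> mod_hom A M (pair_mod N B)"
      unfolding \<psi>_def by (rule mod_hom_comp[OF \<phi> mod_hom_into_pair[OF mod_hom_id mod_hom_zero_map[OF right_modules(5)]]])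
    have "\<exists>w\<in>mod_hom A N (P (t s)). \<forall>x\<in>carrier M. w (f x) = fst (\<psi> x) s" if s: "s \<in> S" for s
      by (rule factor[OF t[OF s]], rule mod_hom_comp[OF mod_hom_proj[OF s] mod_hom_comp[OF mod_hom_fst \<psi>]])
    then obtain w1 where w1: "\<forall>s\<in>S. w1 s \<in> mod_hom A N (P (t s)) \<and> (\<forall>x\<in>carrier M. w1 s (f x) = fst (\<psi> x) s)"
      by metis
    have "\<exists>w\<in>mod_hom A N (P j). \<forall>x\<in>carrier M. w (f x) = snd (\<psi> x) j" if j: "j \<in> J" for j
      by (rule factor[OF j], rule mod_hom_comp[OF mod_hom_proj[OF j] mod_hom_comp[OF mod_hom_snd \<psi>]])
    then obtain w2 where w2: "\<forall>j\<in>J. w2 j \<in> mod_hom A N (P j) \<and> (\<forall>x\<in>carrier M. w2 j (f x) = snd (\<psi> x) j)"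
      by metis
    let ?w = "\<lambda>x. (\<lambda>s\<in>S. w1 s (fst x), \<lambda>j\<in>J. w2 j (fst x))"
    have w: "?w \<in> mod_hom A (pair_mod N B) (pair_mod N B)"
      using w1 w2 by (intro mod_hom_into_pair mod_hom_into_dsum mod_hom_comp[OF _ mod_hom_fst]) simp_all
    \<comment> \<open>The factorization through f already accounts for the whole map, so this half
      of the homotopy is zero.\<close>
    let ?u = "\<lambda>x. \<zero>\<^bsub>pair_mod M Z\<^esub>"
    have u: "?u \<in> mod_hom A (pair_mod M Z) (pair_mod M Z)"
      by (rule mod_hom_zero_map[OF right_module_pair[OF right_modules(2,5)]])
    have "\<phi> x = (f (fst (?u x)), \<zero>\<^bsub>Z\<^esub>) \<oplus>\<^bsub>pair_mod N B\<^esub> ?w (f (fst x), \<zero>\<^bsub>Z\<^esub>)"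
      if x: "x \<in> carrier (pair_mod M Z)" for x
    proof -
      have x': "fst x \<in> carrier M" "x = (fst x, \<zero>\<^bsub>Z\<^esub>)" using x Z_eq by (auto simp del: dsum_mod_simps)
      have c: "fst (\<psi> (fst x)) \<in> carrier N" "snd (\<psi> (fst x)) \<in> carrier B"
        using mod_hom_closed[OF \<psi> x'(1)] by (auto simp del: dsum_mod_simps)
      have "(\<lambda>s\<in>S. w1 s (f (fst x))) = fst (\<psi> (fst x))"
        by (rule extensionalityI[where A = S]) (use c w1 x'(1) in \<open>simp_all add: PiE_def\<close>)
      moreover have "(\<lambda>j\<in>J. w2 j (f (fst x))) = snd (\<psi> (fst x))"
        by (rule extensionalityI[where A = J]) (use c w2 x'(1) in \<open>simp_all add: PiE_def\<close>)
      ultimately have "?w (f (fst x), \<zero>\<^bsub>Z\<^esub>) = \<psi> (fst x)" by (simp add: prod_eq_iff)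
      moreover have "\<phi> x = \<psi> (fst x)" unfolding \<psi>_def using x'(2) by simp
      moreover have "(\<zero>\<^bsub>N\<^esub>, \<zero>\<^bsub>B\<^esub>) \<oplus>\<^bsub>pair_mod N B\<^esub> \<psi> (fst x) = \<psi> (fst x)"
        using ag_zero(1)[OF right_module_ag[OF right_module_pair[OF right_modules(3,4)]] mod_hom_closed[OF \<psi> x'(1)]]
        unfolding pair_mod_simps .
      ultimately show ?thesis unfolding zero_B[symmetric] by (simp only: z fst_conv pair_mod_simps(2))
    qed
    then show "\<exists>u\<in>mod_hom A (pair_mod M Z) (pair_mod M Z). \<exists>w\<in>mod_hom A (pair_mod N B) (pair_mod N B).
        \<forall>x\<in>carrier (pair_mod M Z). \<phi> x = (f (fst (u x)), \<zero>\<^bsub>Z\<^esub>) \<oplus>\<^bsub>pair_mod N B\<^esub> w (f (fst x), \<zero>\<^bsub>Z\<^esub>)"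
      by (rule bexI[OF bexI[OF ballI w] u])
  next
    show "(\<forall>\<phi>\<in>mod_hom A (pair_mod N B) (pair_mod M Z).
        (\<forall>x\<in>carrier (pair_mod N B). (f (fst (\<phi> x)), \<zero>\<^bsub>Z\<^esub>) = \<zero>\<^bsub>pair_mod N B\<^esub>) \<and>
        (\<forall>x\<in>carrier (pair_mod M Z). \<phi> (f (fst x), \<zero>\<^bsub>Z\<^esub>) = \<zero>\<^bsub>pair_mod M Z\<^esub>) \<longrightarrow>
        (\<forall>x\<in>carrier (pair_mod N B). \<phi> x = \<zero>\<^bsub>pair_mod M Z\<^esub>)) \<longleftrightarrow> ?R" (is "?L \<longleftrightarrow> ?R")
    proof
      assume L: ?L
      show ?R
      proof (intro ballI impI)
        fix j \<psi> x assume j: "j \<in> J" and \<psi>: "\<psi> \<in> mod_hom A (P j) M"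
          and f\<psi>: "\<forall>x\<in>carrier (P j). f (\<psi> x) = \<zero>\<^bsub>N\<^esub>" and x: "x \<in> carrier (P j)"
        \<comment> \<open>Placed on the B-summand: the differential of T maps into N, so the
          composite with it vanishes.\<close>
        let ?\<phi> = "\<lambda>x. (\<psi> (snd x j), \<zero>\<^bsub>Z\<^esub>)"
        have \<phi>: "?\<phi> \<in> mod_hom A (pair_mod N B) (pair_mod M Z)"
        proof (rule mod_hom_into_pair[OF _ mod_hom_zero_map[OF right_modules(5)]], rule mod_hom_comp[OF \<psi>])
          show "(\<lambda>x. snd x j) \<in> mod_hom A (pair_mod N B) (P j)"
            by (rule mod_hom_comp[OF mod_hom_proj[OF j] mod_hom_snd])
        qed
        have "snd x j \<in> carrier (P j)" if "x \<in> carrier (pair_mod N B)" for x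
          using that j by (auto simp: PiE_mem)
        then have c1: "\<forall>x\<in>carrier (pair_mod N B). (f (fst (?\<phi> x)), \<zero>\<^bsub>Z\<^esub>) = \<zero>\<^bsub>pair_mod N B\<^esub>"
          using f\<psi> unfolding pair_mod_simps zero_B by simp
        have c2: "\<forall>x\<in>carrier (pair_mod M Z). ?\<phi> (f (fst x), \<zero>\<^bsub>Z\<^esub>) = \<zero>\<^bsub>pair_mod M Z\<^esub>"
          using mod_hom_zero[OF \<psi> ags(1)[OF j] ags(2)] j by simp
        have "\<forall>x\<in>carrier (pair_mod N B). ?\<phi> x = \<zero>\<^bsub>pair_mod M Z\<^esub>"
          by (rule mp[OF bspec[OF L \<phi>] conjI[OF c1 c2]])
        from bspec[OF this mod_hom_closed[OF inj_B[OF j] x]] show "\<psi> x = \<zero>\<^bsub>M\<^esub>"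
          using j by (simp add: dsum_inj_apply)
      qed
    next
      assume R: ?R
      show ?L
      proof (intro ballI impI, elim conjE)
        fix \<phi> x assume \<phi>: "\<phi> \<in> mod_hom A (pair_mod N B) (pair_mod M Z)"
          and d\<phi>: "\<forall>x\<in>carrier (pair_mod N B). (f (fst (\<phi> x)), \<zero>\<^bsub>Z\<^esub>) = \<zero>\<^bsub>pair_mod N B\<^esub>"
          and x: "x \<in> carrier (pair_mod N B)"
        have r: "right_module A (pair_mod M Z)" by (rule right_module_pair[OF right_modules(2,5)])
        have *: "\<phi> (g y) = \<zero>\<^bsub>pair_mod M Z\<^esub>"
          if j: "j \<in> J" and g: "g \<in> mod_hom A (P j) (pair_mod N B)" and y: "y \<in> carrier (P j)" for j g y
        proof -
          have h: "(\<lambda>y. fst (\<phi> (g y))) \<in> mod_hom A (P j) M" by (rule mod_hom_comp[OF mod_hom_fst mod_hom_comp[OF \<phi> g]])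
          have z: "\<forall>y\<in>carrier (P j). f (fst (\<phi> (g y))) = \<zero>\<^bsub>N\<^esub>"
          proof
            fix y assume "y \<in> carrier (P j)"
            from bspec[OF d\<phi> mod_hom_closed[OF g this]] show "f (fst (\<phi> (g y))) = \<zero>\<^bsub>N\<^esub>"
              unfolding pair_mod_simps prod.inject by (rule conjunct1)
          qed
          have "fst (\<phi> (g y)) = \<zero>\<^bsub>M\<^esub>" by (rule bspec[OF mp[OF bspec[OF bspec[OF R j] h] z] y])
          moreover have "snd (\<phi> (g y)) = \<zero>\<^bsub>Z\<^esub>"
            using mod_hom_closed[OF \<phi> mod_hom_closed[OF g y]] unfolding pair_mod_simps(1) by (intro Z_eq) auto
          ultimately show ?thesis unfolding pair_mod_simps by (simp add: prod_eq_iff del: dsum_mod_simps)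
        qed
        show "\<phi> x = \<zero>\<^bsub>pair_mod M Z\<^esub>"
          by (rule sum_ext[OF \<phi> mod_hom_zero_map[OF r] r _ _ x])
            (rule *[OF t inj_N], assumption+, rule *[OF _ inj_B], assumption+)
      qed
    qed
  qed
  then show ?thesis unfolding T_def .
qed

end

context
  fixes g
  assumes g: "g \<in> mod_hom A N M"
begin

lemma projective_plus: "projective_complex A (pair_cpx (two_term 0 N M g) D)"
  by (rule projective_complex_pair[OF projective_complex_two_term[OF projective_N M g] projective_D])

text \<open>Now N + B is the source, in degree 0, and M + 0 sits in degree 1. The roles are
  exchanged: \<open>factor\<close> lifts the components P_j -> M through g, and
  \<open>dsum_copair\<close> assembles the lifts.\<close>

lemma self_orthogonal_plus_iff:
  assumes factor: "\<And>j \<psi>. \<lbrakk>j \<in> J; \<psi> \<in> mod_hom A (P j) M\<rbrakk> \<Longrightarrow>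
    \<exists>u\<in>mod_hom A (P j) N. \<forall>x\<in>carrier (P j). g (u x) = \<psi> x"
  shows "(\<forall>r. r \<noteq> 0 \<longrightarrow> Db_hom_vanishes A (pair_cpx (two_term 0 N M g) D)
      (shift r (pair_cpx (two_term 0 N M g) D))) \<longleftrightarrow>
    (\<forall>j\<in>J. \<forall>\<psi>\<in>mod_hom A M (P j). (\<forall>x\<in>carrier N. \<psi> (g x) = \<zero>\<^bsub>P j\<^esub>) \<longrightarrow>
      (\<forall>x\<in>carrier M. \<psi> x = \<zero>\<^bsub>P j\<^esub>))" (is "_ \<longleftrightarrow> ?R")
proof -
  define T where "T = pair_cpx (two_term 0 N M g) D"
  have T: "projective_complex A T" unfolding T_def by (rule projective_plus)
  have o: "obj T 0 = pair_mod N B" "obj T (0 + 1) = pair_mod M Z"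
    unfolding T_def pair_cpx_simps obj_D by simp_all
  have d: "diff T 0 x = (g (fst x), \<zero>\<^bsub>Z\<^esub>)" for x
    by (cases x) (simp only: T_def pair_cpx_simps diff_D, simp)
  have T0: "carrier (obj T n) = {\<zero>\<^bsub>obj T n\<^esub>}" if "n \<noteq> 0" "n \<noteq> 0 + 1" for n
    using that unfolding T_def pair_cpx_simps obj_D pair_mod_simps by (simp add: carrier_Z del: dsum_mod_simps)
  note rT = right_module_pair[OF right_modules(3,4)] right_module_pair[OF right_modules(2,5)]
  note z = mod_hom_zero[OF g ags(3,2)]
  have "(\<forall>r. r \<noteq> 0 \<longrightarrow> Db_hom_vanishes A T (shift r T)) \<longleftrightarrow> ?R"
  proof (rule trans[OF Db_hom_vanishes_shift_iff[where d = 0, OF T T0]], unfold o d)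
    fix \<phi> assume \<phi>: "\<phi> \<in> mod_hom A (pair_mod N B) (pair_mod M Z)"
    have "\<exists>u\<in>mod_hom A (P (t s)) N. \<forall>y\<in>carrier (P (t s)). g (u y) = fst (\<phi> (dsum_inj S (\<lambda>s. P (t s)) s y, \<zero>\<^bsub>B\<^esub>))"
      if s: "s \<in> S" for s
      by (rule factor[OF t[OF s]], rule mod_hom_comp[OF mod_hom_fst mod_hom_comp[OF \<phi> inj_N[OF s]]])
    then obtain u1 where u1: "\<forall>s\<in>S. u1 s \<in> mod_hom A (P (t s)) N \<and>
        (\<forall>y\<in>carrier (P (t s)). g (u1 s y) = fst (\<phi> (dsum_inj S (\<lambda>s. P (t s)) s y, \<zero>\<^bsub>B\<^esub>)))" by metis
    have "\<exists>u\<in>mod_hom A (P j) N. \<forall>y\<in>carrier (P j). g (u y) = fst (\<phi> (\<zero>\<^bsub>N\<^esub>, dsum_inj J P j y))" if j: "j \<in> J" for j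
      by (rule factor[OF j], rule mod_hom_comp[OF mod_hom_fst mod_hom_comp[OF \<phi> inj_B[OF j]]])
    then obtain u2 where u2: "\<forall>j\<in>J. u2 j \<in> mod_hom A (P j) N \<and>
        (\<forall>y\<in>carrier (P j). g (u2 j y) = fst (\<phi> (\<zero>\<^bsub>N\<^esub>, dsum_inj J P j y)))" by metis
    have "\<exists>v\<in>mod_hom A N N. \<forall>s\<in>S. \<forall>y\<in>carrier (P (t s)). v (dsum_inj S (\<lambda>s. P (t s)) s y) = u1 s y"
      using u1 by (intro dsum_copair[OF S ring_A right_modules(1)[OF t] right_modules(3)]) auto
    then obtain v1 where v1: "v1 \<in> mod_hom A N N"
      "\<forall>s\<in>S. \<forall>y\<in>carrier (P (t s)). v1 (dsum_inj S (\<lambda>s. P (t s)) s y) = u1 s y" by blast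
    have "\<exists>v\<in>mod_hom A B N. \<forall>j\<in>J. \<forall>y\<in>carrier (P j). v (dsum_inj J P j y) = u2 j y"
      using u2 by (intro dsum_copair[OF J ring_A right_modules(1,3)]) auto
    then obtain v2 where v2: "v2 \<in> mod_hom A B N" "\<forall>j\<in>J. \<forall>y\<in>carrier (P j). v2 (dsum_inj J P j y) = u2 j y" by blast
    let ?v = "\<lambda>x. v1 (fst x) \<oplus>\<^bsub>N\<^esub> v2 (snd x)"
    have v: "?v \<in> mod_hom A (pair_mod N B) N" by (rule mod_hom_from_pair[OF v1(1) v2(1) right_modules(3)])
    let ?u = "\<lambda>x. (?v x, \<zero>\<^bsub>B\<^esub>)"
    have u: "?u \<in> mod_hom A (pair_mod N B) (pair_mod N B)"
      by (rule mod_hom_into_pair[OF v mod_hom_zero_map[OF right_modules(4)]])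
    have gv: "(\<lambda>x. (g (?v x), \<zero>\<^bsub>Z\<^esub>)) \<in> mod_hom A (pair_mod N B) (pair_mod M Z)"
      by (rule mod_hom_into_pair[OF mod_hom_comp[OF g v] mod_hom_zero_map[OF right_modules(5)]])
    have sndZ: "snd (\<phi> x) = \<zero>\<^bsub>Z\<^esub>" if "x \<in> carrier (pair_mod N B)" for x
      using mod_hom_closed[OF \<phi> that] unfolding pair_mod_simps(1) by (intro Z_eq) auto
    have eq: "(g (?v x), \<zero>\<^bsub>Z\<^esub>) = \<phi> x" if x: "x \<in> carrier (pair_mod N B)" for x
    proof (rule sum_ext[OF gv \<phi> rT(2) _ _ x])
      fix s y assume s: "s \<in> S" and y: "y \<in> carrier (P (t s))"
      let ?i = "dsum_inj S (\<lambda>s. P (t s)) s y"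
      have u: "u1 s \<in> mod_hom A (P (t s)) N" "g (u1 s y) = fst (\<phi> (?i, \<zero>\<^bsub>B\<^esub>))" using u1 s y by blast+
      have v: "v1 ?i = u1 s y" using v1(2) s y by blast
      have e: "v1 ?i \<oplus>\<^bsub>N\<^esub> v2 \<zero>\<^bsub>B\<^esub> = u1 s y"
        unfolding v mod_hom_zero[OF v2(1) ags(4,3)] by (rule ag_zero(2)[OF ags(3) mod_hom_closed[OF u(1) y]])
      show "(g (?v (?i, \<zero>\<^bsub>B\<^esub>)), \<zero>\<^bsub>Z\<^esub>) = \<phi> (?i, \<zero>\<^bsub>B\<^esub>)"
        by (rule prod_eqI) (simp_all only: fst_conv snd_conv e u sndZ[OF mod_hom_closed[OF inj_N[OF s] y]])
    next
      fix j y assume j: "j \<in> J" and y: "y \<in> carrier (P j)"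
      let ?i = "dsum_inj J P j y"
      have u: "u2 j \<in> mod_hom A (P j) N" "g (u2 j y) = fst (\<phi> (\<zero>\<^bsub>N\<^esub>, ?i))" using u2 j y by blast+
      have v: "v2 ?i = u2 j y" using v2(2) j y by blast
      have e: "v1 \<zero>\<^bsub>N\<^esub> \<oplus>\<^bsub>N\<^esub> v2 ?i = u2 j y"
        unfolding v mod_hom_zero[OF v1(1) ags(3,3)] by (rule ag_zero(1)[OF ags(3) mod_hom_closed[OF u(1) y]])
      show "(g (?v (\<zero>\<^bsub>N\<^esub>, ?i)), \<zero>\<^bsub>Z\<^esub>) = \<phi> (\<zero>\<^bsub>N\<^esub>, ?i)"
        by (rule prod_eqI) (simp_all only: fst_conv snd_conv e u sndZ[OF mod_hom_closed[OF inj_B[OF j] y]])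
    qed
    have "\<phi> x = (g (fst (?u x)), \<zero>\<^bsub>Z\<^esub>) \<oplus>\<^bsub>pair_mod M Z\<^esub> \<zero>\<^bsub>pair_mod M Z\<^esub>"
      if x: "x \<in> carrier (pair_mod N B)" for x
      using eq[OF x] ag_zero(2)[OF right_module_ag[OF rT(2)] mod_hom_closed[OF \<phi> x]] by (simp only: fst_conv)
    then show "\<exists>u\<in>mod_hom A (pair_mod N B) (pair_mod N B). \<exists>w\<in>mod_hom A (pair_mod M Z) (pair_mod M Z).
        \<forall>x\<in>carrier (pair_mod N B). \<phi> x = (g (fst (u x)), \<zero>\<^bsub>Z\<^esub>) \<oplus>\<^bsub>pair_mod M Z\<^esub> w (g (fst x), \<zero>\<^bsub>Z\<^esub>)"
      by (rule bexI[OF bexI[OF ballI mod_hom_zero_map[OF rT(2)]] u])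
  next
    show "(\<forall>\<phi>\<in>mod_hom A (pair_mod M Z) (pair_mod N B).
        (\<forall>x\<in>carrier (pair_mod M Z). (g (fst (\<phi> x)), \<zero>\<^bsub>Z\<^esub>) = \<zero>\<^bsub>pair_mod M Z\<^esub>) \<and>
        (\<forall>x\<in>carrier (pair_mod N B). \<phi> (g (fst x), \<zero>\<^bsub>Z\<^esub>) = \<zero>\<^bsub>pair_mod N B\<^esub>) \<longrightarrow>
        (\<forall>x\<in>carrier (pair_mod M Z). \<phi> x = \<zero>\<^bsub>pair_mod N B\<^esub>)) \<longleftrightarrow> ?R" (is "?L \<longleftrightarrow> ?R")
    proof
      assume L: ?L
      show ?R
      proof (intro ballI impI)
        fix j \<psi> x assume j: "j \<in> J" and \<psi>: "\<psi> \<in> mod_hom A M (P j)"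
          and \<psi>g: "\<forall>x\<in>carrier N. \<psi> (g x) = \<zero>\<^bsub>P j\<^esub>" and x: "x \<in> carrier M"
        \<comment> \<open>Placed in the B-summand, on which the differential of T vanishes.\<close>
        let ?\<phi> = "\<lambda>x. (\<zero>\<^bsub>N\<^esub>, dsum_inj J P j (\<psi> (fst x)))"
        have \<phi>: "?\<phi> \<in> mod_hom A (pair_mod M Z) (pair_mod N B)"
          by (rule mod_hom_comp[OF inj_B[OF j] mod_hom_comp[OF \<psi> mod_hom_fst]])
        have c1: "\<forall>x\<in>carrier (pair_mod M Z). (g (fst (?\<phi> x)), \<zero>\<^bsub>Z\<^esub>) = \<zero>\<^bsub>pair_mod M Z\<^esub>"
          using z by (simp only: fst_conv pair_mod_simps) simp
        have c2: "\<forall>x\<in>carrier (pair_mod N B). ?\<phi> (g (fst x), \<zero>\<^bsub>Z\<^esub>) = \<zero>\<^bsub>pair_mod N B\<^esub>"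
          using \<psi>g mod_hom_zero[OF inj_B[OF j] ags(1)[OF j] right_module_ag[OF rT(1)]]
          by (simp only: fst_conv pair_mod_simps SigmaE) auto
        have "\<forall>x\<in>carrier (pair_mod M Z). ?\<phi> x = \<zero>\<^bsub>pair_mod N B\<^esub>"
          by (rule mp[OF bspec[OF L \<phi>] conjI[OF c1 c2]])
        moreover have "(x, \<zero>\<^bsub>Z\<^esub>) \<in> carrier (pair_mod M Z)" using x carrier_Z by (simp del: dsum_mod_simps)
        ultimately have "dsum_inj J P j (\<psi> x) = \<zero>\<^bsub>B\<^esub>" by (auto simp del: dsum_mod_simps)
        from fun_cong[OF this, of j] show "\<psi> x = \<zero>\<^bsub>P j\<^esub>" using j by (simp add: dsum_inj_apply)
      qed
    next
      assume R: ?R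
      show ?L
      proof (intro ballI impI, elim conjE)
        fix \<phi> x assume \<phi>: "\<phi> \<in> mod_hom A (pair_mod M Z) (pair_mod N B)"
          and \<phi>d: "\<forall>x\<in>carrier (pair_mod N B). \<phi> (g (fst x), \<zero>\<^bsub>Z\<^esub>) = \<zero>\<^bsub>pair_mod N B\<^esub>"
          and x: "x \<in> carrier (pair_mod M Z)"
        have x': "fst x \<in> carrier M" "x = (fst x, \<zero>\<^bsub>Z\<^esub>)" using x Z_eq by (auto simp del: dsum_mod_simps)
        note i = mod_hom_comp[OF \<phi> mod_hom_into_pair[OF mod_hom_id mod_hom_zero_map[OF right_modules(5)]]]
        have *: "h (\<phi> x) = \<zero>\<^bsub>P j\<^esub>" if j: "j \<in> J" and h: "h \<in> mod_hom A (pair_mod N B) (P j)" for j h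
        proof -
          have c1: "(\<lambda>m. h (\<phi> (m, \<zero>\<^bsub>Z\<^esub>))) \<in> mod_hom A M (P j)" by (rule mod_hom_comp[OF h i])
          have c2: "\<forall>n\<in>carrier N. h (\<phi> (g n, \<zero>\<^bsub>Z\<^esub>)) = \<zero>\<^bsub>P j\<^esub>"
          proof
            fix n assume n: "n \<in> carrier N"
            have "(n, \<zero>\<^bsub>B\<^esub>) \<in> carrier (pair_mod N B)" using n ag_closed(2)[OF ags(4)] unfolding pair_mod_simps by blast
            from bspec[OF \<phi>d this] show "h (\<phi> (g n, \<zero>\<^bsub>Z\<^esub>)) = \<zero>\<^bsub>P j\<^esub>"
              using mod_hom_zero[OF h right_module_ag[OF rT(1)] ags(1)[OF j]] by (simp only: fst_conv)
          qed
          have "h (\<phi> (fst x, \<zero>\<^bsub>Z\<^esub>)) = \<zero>\<^bsub>P j\<^esub>"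
            by (rule bspec[OF mp[OF bspec[OF bspec[OF R j] c1] c2] x'(1)])
          then show ?thesis using x'(2) by simp
        qed
        have "fst (\<phi> x) s = \<zero>\<^bsub>P (t s)\<^esub>" if s: "s \<in> S" for s
          by (rule *[OF t[OF s] mod_hom_comp[OF mod_hom_proj[OF s] mod_hom_fst]])
        moreover have "snd (\<phi> x) j = \<zero>\<^bsub>P j\<^esub>" if j: "j \<in> J" for j
          by (rule *[OF j mod_hom_comp[OF mod_hom_proj[OF j] mod_hom_snd]])
        moreover have "fst (\<phi> x) \<in> extensional S" "snd (\<phi> x) \<in> extensional J"
          using mod_hom_closed[OF \<phi> x] by (auto simp: PiE_def)
        ultimately show "\<phi> x = \<zero>\<^bsub>pair_mod N B\<^esub>"
          by (auto simp: prod_eq_iff fun_eq_iff restrict_def extensional_def)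
      qed
    qed
  qed
  then show ?thesis unfolding T_def .
qed

end

end

section \<open>Stalks, truncation triangles, and Hom between stalks and two-term complexes\<close>

context kalgebra
begin

text \<open>The negative of an element depends on the carrier of the record, so it has to be
  computed in \<open>zero_sub M\<close> separately.\<close>

lemma neg_zero_stalk:
  assumes "right_module A M"
  shows "\<ominus>\<^bsub>M\<^esub> \<zero>\<^bsub>M\<^esub> = \<zero>\<^bsub>M\<^esub>" "\<ominus>\<^bsub>zero_sub M\<^esub> \<zero>\<^bsub>M\<^esub> = \<zero>\<^bsub>M\<^esub>"
  using ag_neg(7)[OF right_module_ag[OF assms]] ag_neg(7)[OF right_module_ag[OF right_module_zero_sub[OF assms]]]
  by simp_all

lemma cpx_iso_stalk:
  assumes M: "right_module A M" and M': "right_module A M'" and h: "h \<in> mod_hom A M M'"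
    and g: "\<And>y. y \<in> carrier M' \<Longrightarrow> g y \<in> carrier M \<and> h (g y) = y"
    and gh: "\<And>x. x \<in> carrier M \<Longrightarrow> g (h x) = x"
  shows "cpx_iso A (stalk M) (stalk M') (\<lambda>n. h) (\<lambda>n. g)"
proof (rule cpx_isoI[OF module_complex_stalk[OF M]])
  note z = mod_hom_zero[OF h right_module_ag[OF M] right_module_ag[OF M']]
  note z' = ag_closed(2)[OF right_module_ag[OF M]]
  show "chain_map A (stalk M) (stalk M') (\<lambda>n. h)"
  proof (rule chain_mapI)
    have "h \<in> mod_hom A (zero_sub M) (zero_sub M')"
      by (rule mod_homI) (use z h z' mod_hom_add[OF h] mod_hom_act[OF h] right_module_act(6)[OF M] right_module_act(6)[OF M']
        ag_zero(1)[OF right_module_ag[OF M]] ag_zero(1)[OF right_module_ag[OF M']] ag_closed(2)[OF right_module_ag[OF M']] in auto)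
    then show "graded_hom A (stalk M) (stalk M') 0 (\<lambda>n. h)" using h by (simp add: graded_hom_def)
  qed (simp add: z)
  have gz: "g \<zero>\<^bsub>M'\<^esub> = \<zero>\<^bsub>M\<^esub>" using gh[OF z'] by (simp add: z)
  show "g y \<in> carrier (obj (stalk M) n) \<and> h (g y) = y" if "y \<in> carrier (obj (stalk M') n)" for n y
    using that g gz z by (simp split: if_splits)
  show "g (h x) = x" if "x \<in> carrier (obj (stalk M) n)" for n x
    using that gh z' by (simp split: if_splits)
qed

lemma Gen_stalk_iso:
  assumes G: "Gen T (stalk M)" and M: "right_module A M" and M': "fd_module A M'" and h: "h \<in> mod_hom A M M'"
    and "\<And>y. y \<in> carrier M' \<Longrightarrow> g y \<in> carrier M \<and> h (g y) = y" "\<And>x. x \<in> carrier M \<Longrightarrow> g (h x) = x"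
  shows "Gen T (stalk M')"
proof -
  have "right_module A M'" using M' by (simp add: fd_module_def)
  then have "cpx_iso A (stalk M) (stalk M') (\<lambda>n. h) (\<lambda>n. g)"
    using assms by (intro cpx_iso_stalk)
  then show ?thesis by (rule Gen_iso[OF G bounded_complex_stalk[OF M']])
qed

lemma shift_stalk_diff:
  assumes "right_module A M"
  shows "diff (shift r (stalk M)) n x = \<zero>\<^bsub>M\<^esub>"
  by (simp add: neg_zero_stalk[OF assms])

lemma shift_zero_diff:
  assumes M: "right_module A M"
  shows "diff (shift r (shift r' (stalk M))) n x = \<zero>\<^bsub>M\<^esub>"
  unfolding shift_simps(2)[of r] shift_stalk_diff[OF M] by (simp add: neg_zero_stalk[OF M])

lemma Gen_unshift_stalk:
  assumes G: "Gen T (shift r (stalk M))" and M: "fd_module A M"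
  shows "Gen T (stalk M)"
proof -
  have rM: "right_module A M" using M by (simp add: fd_module_def)
  let ?Y = "shift (- r) (shift r (stalk M))"
  have m: "module_complex A ?Y" by (intro module_complex_shift module_complex_stalk rM)
  have o: "obj ?Y n = obj (stalk M) n" for n by simp
  have "cpx_iso A ?Y (stalk M) (\<lambda>n x. x) (\<lambda>n x. x)"
  proof (rule cpx_isoI[OF m])
    show "chain_map A ?Y (stalk M) (\<lambda>n x. x)"
    proof (rule chain_mapI)
      show "graded_hom A ?Y (stalk M) 0 (\<lambda>n x. x)"
        unfolding graded_hom_def o add_0_right by (intro allI mod_hom_id)
      show "diff ?Y n x = diff (stalk M) n x" for n x
        unfolding shift_zero_diff[OF rM] by simp
    qed
  qed (simp_all only: o)
  then show ?thesis by (rule Gen_iso[OF Gen_shift[OF G] bounded_complex_stalk[OF M]])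
qed

text \<open>The brutal truncation of a two-term complex gives a short exact sequence of complexes.\<close>

context
  fixes d :: int and M N :: "('r, 'm) module" and f
  assumes M: "fd_module A M" "fg_projective A M" and N: "fd_module A N" "fg_projective A N"
    and f: "f \<in> mod_hom A M N"
begin

lemma
  shows Gen_two_term_source: "\<lbrakk>Gen T (stalk N); Gen T (two_term d M N f)\<rbrakk> \<Longrightarrow> Gen T (stalk M)"
    and Gen_two_term_target: "\<lbrakk>Gen T (two_term d M N f); Gen T (stalk M)\<rbrakk> \<Longrightarrow> Gen T (stalk N)"
proof -
  let ?Y = "shift (- (d + 1)) (stalk N)" and ?E = "two_term d M N f" and ?Z = "shift (- d) (stalk M)"
  have rM: "right_module A M" and rN: "right_module A N" using M N by (simp_all add: fd_module_def)
  note ag = right_module_ag[OF rM] right_module_ag[OF rN]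
  note pY = projective_complex_shift[OF projective_complex_stalk[OF N], of "- (d + 1)"]
  note pE = projective_complex_two_term[OF M N f, of d]
  note pZ = projective_complex_shift[OF projective_complex_stalk[OF M], of "- d"]
  \<comment> \<open>Inclusion of the term in degree d + 1 and projection to the term in degree
    d.\<close>
  let ?i = "\<lambda>n x. if n = d then \<zero>\<^bsub>M\<^esub> else x" and ?p = "\<lambda>n x. if n = d then x else \<zero>\<^bsub>M\<^esub>"
  have oY: "obj ?Y n = (if n = d + 1 then N else zero_sub N)" for n by simp
  have oZ: "obj ?Z n = (if n = d then M else zero_sub M)" for n by simp
  note z = mod_hom_zero[OF f ag]
  have i: "chain_map A ?Y ?E ?i"
  proof (rule chain_mapI)
    have "?i n \<in> mod_hom A (obj ?Y n) (obj ?E n)" for n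
      unfolding oY using mod_hom_id[of A N] mod_hom_id[of A "zero_sub N"] mod_hom_zero_map[OF rM, of "zero_sub N"]
      by simp
    then show "graded_hom A ?Y ?E 0 ?i" by (simp add: graded_hom_def)
    show "?i (n + 1) (diff ?Y n x) = diff ?E n (?i n x)" if "x \<in> carrier (obj ?Y n)" for n x
      unfolding shift_stalk_diff[OF rN] by (simp add: z)
  qed
  have p: "chain_map A ?E ?Z ?p"
  proof (rule chain_mapI)
    have "?p n \<in> mod_hom A (obj ?E n) (obj ?Z n)" for n
      unfolding oZ using mod_hom_id[of A M] mod_hom_zero_map[OF right_module_zero_sub[OF rM], of N]
        mod_hom_zero_map[OF right_module_zero_sub[OF rM], of "zero_sub N"] by simp
    then show "graded_hom A ?E ?Z 0 ?p" by (simp add: graded_hom_def)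
    show "?p (n + 1) (diff ?E n x) = diff ?Z n (?p n x)" if "x \<in> carrier (obj ?E n)" for n x
      unfolding shift_stalk_diff[OF rM] by simp
  qed
  have inj: "y = \<zero>\<^bsub>obj ?Y n\<^esub>" if "y \<in> carrier (obj ?Y n)" "?i n y = \<zero>\<^bsub>obj ?E n\<^esub>" for n y
    using that unfolding oY by (simp split: if_splits)
  have surj: "\<exists>e\<in>carrier (obj ?E n). z = ?p n e" if "z \<in> carrier (obj ?Z n)" for n z
  proof (cases "n = d")
    case True
    then show ?thesis using that unfolding oZ by auto
  next
    case False
    then show ?thesis using that ag_closed(2)[OF ag(2)] unfolding oZ by auto
  qed
  have exact: "?p n e = \<zero>\<^bsub>obj ?Z n\<^esub> \<longleftrightarrow> (\<exists>y\<in>carrier (obj ?Y n). e = ?i n y)" if "e \<in> carrier (obj ?E n)" for n e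
    using that ag_closed(2)[OF ag(2)] unfolding oY oZ by (auto split: if_splits)
  show "Gen T (stalk M)" if "Gen T (stalk N)" "Gen T ?E"
    by (rule Gen_unshift_stalk[OF Gen_ses_right[OF pY pE pZ i p inj surj exact Gen_shift[OF that(1)] that(2)] M(1)])
  show "Gen T (stalk N)" if "Gen T ?E" "Gen T (stalk M)"
  proof -
    have "Gen T (shift 1 ?Y)" by (rule Gen_ses_left[OF pY pE pZ i p inj surj exact that(1) Gen_shift[OF that(2)]])
    \<comment> \<open>The shifts by - (d + 1), 1, - 1 and d + 1 cancel, and the identity compares
      the result with the stalk of N.\<close>
    then have "Gen T (shift (- 1) (shift 1 ?Y))" by (rule Gen_shift)
    then have G: "Gen T (shift (d + 1) (shift (- 1) (shift 1 ?Y)))" by (rule Gen_shift)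
    let ?X = "shift (d + 1) (shift (- 1) (shift 1 ?Y))"
    have o: "obj ?X n = obj (stalk N) n" for n by (simp add: algebra_simps)
    have "diff ?X n x = \<zero>\<^bsub>N\<^esub>" for n x
      unfolding shift_simps(2)[of "d + 1"] shift_simps(2)[of "- 1"] shift_simps(2)[of 1] shift_stalk_diff[OF rN]
      by (simp add: neg_zero_stalk[OF rN])
    note dX = this
    have "cpx_iso A ?X (stalk N) (\<lambda>n x. x) (\<lambda>n x. x)"
    proof (rule cpx_isoI[OF proj_module_complex[OF Gen_projective[OF G]]])
      show "chain_map A ?X (stalk N) (\<lambda>n x. x)"
      proof (rule chain_mapI)
        show "graded_hom A ?X (stalk N) 0 (\<lambda>n x. x)"
          unfolding graded_hom_def o add_0_right by (intro allI mod_hom_id)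
        show "diff ?X n x = diff (stalk N) n x" for n x unfolding dX by simp
      qed
    qed (simp_all only: o)
    then show ?thesis by (rule Gen_iso[OF G bounded_complex_stalk[OF N(1)]])
  qed
qed

end

text \<open>After the shift by -1 the complex has M in degree 0, where X sits, so
  \<open>Db_hom_vanishes_corner\<close> leaves the maps from X to the kernel of f. The sign of the
  shifted differential does not affect the kernel.\<close>

lemma stalk_two_term_vanishes_iff:
  assumes X: "fd_module A X" "fg_projective A X" and E: "projective_complex A (two_term (- 1) M N f)"
    and f: "f \<in> mod_hom A M N" and N: "right_module A N"
  shows "Db_hom_vanishes A (stalk X) (shift (- 1) (two_term (- 1) M N f)) \<longleftrightarrow>
    (\<forall>\<psi>\<in>mod_hom A X M. (\<forall>x\<in>carrier X. f (\<psi> x) = \<zero>\<^bsub>N\<^esub>) \<longrightarrow> (\<forall>x\<in>carrier X. \<psi> x = \<zero>\<^bsub>M\<^esub>))"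
proof -
  let ?V = "shift (- 1) (two_term (- 1) M N f)"
  have o: "obj (stalk X) 0 = X" "obj ?V 0 = M" "obj ?V (0 + 1) = N" by simp_all
  have x: "carrier (obj (stalk X) (0 - 1)) = {\<zero>\<^bsub>X\<^esub>}" by simp
  have d: "diff ?V 0 y = \<ominus>\<^bsub>N\<^esub> f y" "diff (stalk X) (0 - 1) x = \<zero>\<^bsub>X\<^esub>" for x y by simp_all
  note mE = proj_module_complex[OF E]
  have M: "right_module A M" using module_complex_rm[OF mE, of "- 1"] by simp
  have rX: "right_module A X" using X by (simp add: fd_module_def)
  note ag = right_module_ag[OF rX] right_module_ag[OF M] right_module_ag[OF N]
  have neg: "\<ominus>\<^bsub>N\<^esub> f y = \<zero>\<^bsub>N\<^esub> \<longleftrightarrow> f y = \<zero>\<^bsub>N\<^esub>" if "y \<in> carrier M" for y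
    using mod_hom_closed[OF f that] ag_neg(6,7)[OF ag(3)] by metis
  show ?thesis
  proof (rule trans[OF Db_hom_vanishes_corner[where c = 0, OF projective_complex_stalk[OF X]
      bounded_complex_shift[OF projective_complex_bounded[OF E]]]], unfold o d x)
    show "carrier (obj (stalk X) n) = {\<zero>\<^bsub>obj (stalk X) n\<^esub>}" if "n > 0" for n using that by simp
    show "carrier (obj ?V n) = {\<zero>\<^bsub>obj ?V n\<^esub>}" if "n < 0" for n using that by simp
  next
    show "(\<forall>\<psi>\<in>mod_hom A X M. (\<forall>x\<in>carrier X. \<ominus>\<^bsub>N\<^esub> f (\<psi> x) = \<zero>\<^bsub>N\<^esub>) \<and> (\<forall>x\<in>{\<zero>\<^bsub>X\<^esub>}. \<psi> \<zero>\<^bsub>X\<^esub> = \<zero>\<^bsub>M\<^esub>) \<longrightarrow>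
        (\<forall>x\<in>carrier X. \<psi> x = \<zero>\<^bsub>M\<^esub>)) \<longleftrightarrow>
      (\<forall>\<psi>\<in>mod_hom A X M. (\<forall>x\<in>carrier X. f (\<psi> x) = \<zero>\<^bsub>N\<^esub>) \<longrightarrow> (\<forall>x\<in>carrier X. \<psi> x = \<zero>\<^bsub>M\<^esub>))"
      by (rule ball_cong[OF refl]) (simp add: neg mod_hom_closed mod_hom_zero[OF _ ag(1,2)])
  qed
qed

text \<open>The corner is again degree 0, now with M as the source: what remains are the maps from
  the cokernel of g to X.\<close>

lemma two_term_stalk_vanishes_iff:
  assumes X: "fd_module A X" and E: "projective_complex A (two_term 0 N M g)"
    and g: "g \<in> mod_hom A N M" and M: "right_module A M"
  shows "Db_hom_vanishes A (shift 1 (two_term 0 N M g)) (stalk X) \<longleftrightarrow>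
    (\<forall>\<psi>\<in>mod_hom A M X. (\<forall>x\<in>carrier N. \<psi> (g x) = \<zero>\<^bsub>X\<^esub>) \<longrightarrow> (\<forall>x\<in>carrier M. \<psi> x = \<zero>\<^bsub>X\<^esub>))"
proof -
  let ?V = "shift 1 (two_term 0 N M g)"
  have o: "obj (stalk X) 0 = X" "obj ?V 0 = M" "obj ?V (0 - 1) = N" by simp_all
  have x: "\<zero>\<^bsub>obj (stalk X) (0 + 1)\<^esub> = \<zero>\<^bsub>X\<^esub>" by simp
  have d: "diff ?V (0 - 1) y = \<ominus>\<^bsub>M\<^esub> g y" "diff (stalk X) 0 x = \<zero>\<^bsub>X\<^esub>" for x y by simp_all
  have rX: "right_module A X" using X by (simp add: fd_module_def)
  note ag = right_module_ag[OF M] right_module_ag[OF rX]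
  have neg: "\<ominus>\<^bsub>X\<^esub> y = \<zero>\<^bsub>X\<^esub> \<longleftrightarrow> y = \<zero>\<^bsub>X\<^esub>" if "y \<in> carrier X" for y
    using that ag_neg(6,7)[OF ag(2)] by metis
  show ?thesis
  proof (rule trans[OF Db_hom_vanishes_corner[where c = 0, OF projective_complex_shift[OF E]
      bounded_complex_stalk[OF X]]], unfold o d x)
    show "carrier (obj ?V n) = {\<zero>\<^bsub>obj ?V n\<^esub>}" if "n > 0" for n using that by simp
    show "carrier (obj (stalk X) n) = {\<zero>\<^bsub>obj (stalk X) n\<^esub>}" if "n < 0" for n using that by simp
  next
    show "(\<forall>\<psi>\<in>mod_hom A M X. (\<forall>x\<in>carrier M. \<zero>\<^bsub>X\<^esub> = \<zero>\<^bsub>X\<^esub>) \<and> (\<forall>x\<in>carrier N. \<psi> (\<ominus>\<^bsub>M\<^esub> g x) = \<zero>\<^bsub>X\<^esub>) \<longrightarrow>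
        (\<forall>x\<in>carrier M. \<psi> x = \<zero>\<^bsub>X\<^esub>)) \<longleftrightarrow>
      (\<forall>\<psi>\<in>mod_hom A M X. (\<forall>x\<in>carrier N. \<psi> (g x) = \<zero>\<^bsub>X\<^esub>) \<longrightarrow> (\<forall>x\<in>carrier M. \<psi> x = \<zero>\<^bsub>X\<^esub>))"
    proof (rule ball_cong[OF refl])
      fix \<psi> assume \<psi>: "\<psi> \<in> mod_hom A M X"
      have "\<psi> (\<ominus>\<^bsub>M\<^esub> g x) = \<zero>\<^bsub>X\<^esub> \<longleftrightarrow> \<psi> (g x) = \<zero>\<^bsub>X\<^esub>" if "x \<in> carrier N" for x
        unfolding mod_hom_neg[OF \<psi> ag mod_hom_closed[OF g that]]
        by (rule neg[OF mod_hom_closed[OF \<psi> mod_hom_closed[OF g that]]])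
      then show "((\<forall>x\<in>carrier M. \<zero>\<^bsub>X\<^esub> = \<zero>\<^bsub>X\<^esub>) \<and> (\<forall>x\<in>carrier N. \<psi> (\<ominus>\<^bsub>M\<^esub> g x) = \<zero>\<^bsub>X\<^esub>) \<longrightarrow>
        (\<forall>x\<in>carrier M. \<psi> x = \<zero>\<^bsub>X\<^esub>)) \<longleftrightarrow>
        ((\<forall>x\<in>carrier N. \<psi> (g x) = \<zero>\<^bsub>X\<^esub>) \<longrightarrow> (\<forall>x\<in>carrier M. \<psi> x = \<zero>\<^bsub>X\<^esub>))" by simp
    qed
  qed
qed

text \<open>
  The cokernel is realized on representatives of the cosets, so that it has the carrier type of the
  complex.
\<close>

lemma quasi_iso_cokernel:
  fixes X :: "('r, 'm) cpx"
  assumes X: "bounded_complex A X"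
    and X0: "\<And>n. \<lbrakk>n \<noteq> - 1; n \<noteq> 0\<rbrakk> \<Longrightarrow> carrier (obj X n) = {\<zero>\<^bsub>obj X n\<^esub>}"
    and inj: "\<And>x. \<lbrakk>x \<in> carrier (obj X (- 1)); diff X (- 1) x = \<zero>\<^bsub>obj X 0\<^esub>\<rbrakk> \<Longrightarrow> x = \<zero>\<^bsub>obj X (- 1)\<^esub>"
  shows "\<exists>(M :: ('r, 'm) module) q. fd_module A M \<and> quasi_iso A X (stalk M) q"
proof -
  note mX = bounded_complex_module_complex[OF X]
  let ?O = "obj X 0" and ?C = "coboundaries X 0"
  note rO = module_complex_rm[OF mX, of 0]
  note agO = right_module_ag[OF rO]
  note ag = ag_closed[OF agO] ag_neg[OF agO] ag_zero[OF agO]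
  note s = diff_simps[OF mX]
  have C: "additive_subgroup ?C ?O" by (rule additive_subgroup_coboundaries[OF mX])
  note Cc = additive_subgroup.a_closed[OF C] additive_subgroup.zero_closed[OF C]
  have Csub: "c \<in> carrier ?O" if "c \<in> ?C" for c using additive_subgroup.a_subset[OF C] that by blast
  have Cact: "a \<odot>\<^bsub>?O\<^esub> c \<in> ?C" if c: "c \<in> ?C" and a: "a \<in> carrier A" for a c
  proof -
    obtain x where x: "x \<in> carrier (obj X (- 1))" "c = diff X (- 1) x" using c by (auto simp: coboundaries_def)
    have dh: "diff X (- 1) \<in> mod_hom A (obj X (- 1)) ?O" by (rule diff_hom[OF mX]) simp
    have "a \<odot>\<^bsub>?O\<^esub> c = diff X (- 1) (a \<odot>\<^bsub>obj X (- 1)\<^esub> x)" using mod_hom_act[OF dh a x(1)] x(2) by simp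
    moreover have "a \<odot>\<^bsub>obj X (- 1)\<^esub> x \<in> carrier (obj X (- 1))"
      by (rule right_module_act(1)[OF module_complex_rm[OF mX] a x(1)])
    ultimately show ?thesis by (auto simp: coboundaries_def)
  qed
  have Cneg: "\<ominus>\<^bsub>?O\<^esub> c \<in> ?C" if c: "c \<in> ?C" for c
  proof -
    obtain x where x: "x \<in> carrier (obj X (- 1))" "c = diff X (- 1) x" using c by (auto simp: coboundaries_def)
    have "\<ominus>\<^bsub>?O\<^esub> c = diff X (- 1) (\<ominus>\<^bsub>obj X (- 1)\<^esub> x)" using s(4)[OF x(1)] x(2) by simp
    moreover have "\<ominus>\<^bsub>obj X (- 1)\<^esub> x \<in> carrier (obj X (- 1))"
      by (rule ag_closed(3)[OF module_complex_ag[OF mX] x(1)])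
    ultimately show ?thesis by (auto simp: coboundaries_def)
  qed
  \<comment> \<open>A chosen element of the coset, dependent on the coset alone; hence
    \<open>rep x = rep y\<close> iff the cosets agree, and \<open>image_mod rep\<close> is the
    cokernel.\<close>
  define rep where "rep x = (SOME y. y \<in> ?C +>\<^bsub>?O\<^esub> x)" for x
  have coset: "?C +>\<^bsub>?O\<^esub> x = ?C +>\<^bsub>?O\<^esub> y \<longleftrightarrow> x \<oplus>\<^bsub>?O\<^esub> \<ominus>\<^bsub>?O\<^esub> y \<in> ?C" if "x \<in> carrier ?O" "y \<in> carrier ?O" for x y
    by (rule coset_eq_iff[OF agO C that])
  have repC: "\<exists>c\<in>?C. rep x = c \<oplus>\<^bsub>?O\<^esub> x" if x: "x \<in> carrier ?O" for x
  proof -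
    have "\<zero>\<^bsub>?O\<^esub> \<oplus>\<^bsub>?O\<^esub> x \<in> ?C +>\<^bsub>?O\<^esub> x" using Cc(2) unfolding a_r_coset_def' by blast
    then have "rep x \<in> ?C +>\<^bsub>?O\<^esub> x" unfolding rep_def by (rule someI)
    then show ?thesis unfolding a_r_coset_def' by blast
  qed
  have rep_eq: "rep x = rep y \<longleftrightarrow> x \<oplus>\<^bsub>?O\<^esub> \<ominus>\<^bsub>?O\<^esub> y \<in> ?C" if x: "x \<in> carrier ?O" and y: "y \<in> carrier ?O" for x y
  proof
    assume e: "rep x = rep y"
    obtain c d where c: "c \<in> ?C" "rep x = c \<oplus>\<^bsub>?O\<^esub> x" and d: "d \<in> ?C" "rep y = d \<oplus>\<^bsub>?O\<^esub> y"
      using repC[OF x] repC[OF y] by blast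
    note cd = Csub[OF c(1)] Csub[OF d(1)]
    have "x = \<ominus>\<^bsub>?O\<^esub> c \<oplus>\<^bsub>?O\<^esub> (d \<oplus>\<^bsub>?O\<^esub> y)" using e c d x y cd ag by (metis ag_neg(4)[OF agO])
    then have "x \<oplus>\<^bsub>?O\<^esub> \<ominus>\<^bsub>?O\<^esub> y = (\<ominus>\<^bsub>?O\<^esub> c \<oplus>\<^bsub>?O\<^esub> (d \<oplus>\<^bsub>?O\<^esub> y)) \<oplus>\<^bsub>?O\<^esub> \<ominus>\<^bsub>?O\<^esub> y" by simp
    also have "\<dots> = \<ominus>\<^bsub>?O\<^esub> c \<oplus>\<^bsub>?O\<^esub> d" using cd y by (simp add: ag_ac(1)[OF agO] ag)
    also have "\<dots> \<in> ?C" using Cneg[OF c(1)] d(1) by (intro Cc)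
    finally show "x \<oplus>\<^bsub>?O\<^esub> \<ominus>\<^bsub>?O\<^esub> y \<in> ?C" .
  next
    assume "x \<oplus>\<^bsub>?O\<^esub> \<ominus>\<^bsub>?O\<^esub> y \<in> ?C"
    then show "rep x = rep y" unfolding rep_def using coset[OF x y] by simp
  qed
  let ?M = "image_mod rep ?O"
  have add: "rep (x \<oplus>\<^bsub>?O\<^esub> y) = rep (x' \<oplus>\<^bsub>?O\<^esub> y')"
    if c: "x \<in> carrier ?O" "x' \<in> carrier ?O" "y \<in> carrier ?O" "y' \<in> carrier ?O" and e: "rep x = rep x'" "rep y = rep y'"
    for x x' y y'
  proof -
    have "(x \<oplus>\<^bsub>?O\<^esub> \<ominus>\<^bsub>?O\<^esub> x') \<oplus>\<^bsub>?O\<^esub> (y \<oplus>\<^bsub>?O\<^esub> \<ominus>\<^bsub>?O\<^esub> y') \<in> ?C"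
      by (rule Cc(1)) (use e rep_eq c in simp_all)
    also have "(x \<oplus>\<^bsub>?O\<^esub> \<ominus>\<^bsub>?O\<^esub> x') \<oplus>\<^bsub>?O\<^esub> (y \<oplus>\<^bsub>?O\<^esub> \<ominus>\<^bsub>?O\<^esub> y') = (x \<oplus>\<^bsub>?O\<^esub> y) \<oplus>\<^bsub>?O\<^esub> \<ominus>\<^bsub>?O\<^esub> (x' \<oplus>\<^bsub>?O\<^esub> y')"
      using c by (simp add: ag ag_ac[OF agO])
    finally show ?thesis using rep_eq c ag by simp
  qed
  have act: "rep (a \<odot>\<^bsub>?O\<^esub> x) = rep (a \<odot>\<^bsub>?O\<^esub> x')"
    if a: "a \<in> carrier A" and c: "x \<in> carrier ?O" "x' \<in> carrier ?O" and e: "rep x = rep x'" for a x x'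
  proof -
    have "a \<odot>\<^bsub>?O\<^esub> (x \<oplus>\<^bsub>?O\<^esub> \<ominus>\<^bsub>?O\<^esub> x') \<in> ?C" using Cact a e rep_eq c by simp
    then show ?thesis using rep_eq right_module_act[OF rO] a c ag by simp
  qed
  have rM: "right_module A ?M" by (rule right_module_image_mod[OF rO add act])
  have h: "rep \<in> mod_hom A ?O ?M" by (rule mod_hom_image_mod[OF rO add act])
  have fd: "fd_module A ?M" by (rule fd_surj[OF _ rM h]) (use X in \<open>simp_all add: bounded_complex_iff\<close>)
  have rep0: "rep x = \<zero>\<^bsub>?M\<^esub> \<longleftrightarrow> x \<in> ?C" if x: "x \<in> carrier ?O" for x
    using mod_hom_zero[OF h agO right_module_ag[OF rM]] rep_eq[OF x ag(2)] x ag by simp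
  let ?q = "\<lambda>n. if n = 0 then rep else (\<lambda>x. \<zero>\<^bsub>?M\<^esub>)"
  note mS = module_complex_stalk[OF rM]
  have d0: "diff X 0 x = \<zero>\<^bsub>obj X 1\<^esub>" if "x \<in> carrier ?O" for x
    using s(1)[OF that, of 1] X0[of 1] by simp
  have dC: "diff X (- 1) x \<in> ?C" if "x \<in> carrier (obj X (- 1))" for x
    using that by (auto simp: coboundaries_def)
  have q: "chain_map A X (stalk ?M) ?q"
  proof (rule chain_mapI)
    have "?q n \<in> mod_hom A (obj X n) (obj (stalk ?M) n)" for n
      using h mod_hom_zero_map[OF right_module_zero_sub[OF rM], of "obj X n"] by simp
    then show "graded_hom A X (stalk ?M) 0 ?q" by (simp add: graded_hom_def)
    show "?q (n + 1) (diff X n x) = diff (stalk ?M) n (?q n x)" if x: "x \<in> carrier (obj X n)" for n x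
    proof (cases "n = - 1")
      case True
      then show ?thesis using dC[of x] x rep0 Csub by simp
    qed simp
  qed
  have "quasi_iso A X (stalk ?M) ?q"
  proof (rule quasi_isoI[OF mX mS q])
    fix n z assume z: "z \<in> cocycles X n" and b: "?q n z \<in> coboundaries (stalk ?M) n"
    have zc: "z \<in> carrier (obj X n)" "diff X n z = \<zero>\<^bsub>obj X (n + 1)\<^esub>" using z by (auto simp: cocycles_def)
    have bz: "coboundaries (stalk ?M) n \<subseteq> {\<zero>\<^bsub>?M\<^esub>}" by (auto simp: coboundaries_def)
    show "z \<in> coboundaries X n"
    proof (cases "n = 0")
      case True
      then show ?thesis using b bz zc rep0 by auto
    next
      case False
      have "z = \<zero>\<^bsub>obj X n\<^esub>"
      proof (cases "n = - 1")
        case True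
        then show ?thesis using inj[of z] zc by simp
      qed (use X0[of n] False zc in simp)
      then show ?thesis using additive_subgroup.zero_closed[OF additive_subgroup_coboundaries[OF mX]] by simp
    qed
  next
    fix n y assume y: "y \<in> cocycles (stalk ?M) n"
    have b: "\<zero>\<^bsub>obj (stalk ?M) n\<^esub> \<in> coboundaries (stalk ?M) n"
      by (rule additive_subgroup.zero_closed[OF additive_subgroup_coboundaries[OF mS]])
    have "\<exists>z\<in>cocycles X n. y = ?q n z"
    proof (cases "n = 0")
      case True
      then obtain z where "z \<in> carrier ?O" "y = rep z" using y by (auto simp: cocycles_def)
      then show ?thesis using True d0 by (auto simp: cocycles_def)
    next
      case False
      then have "y = \<zero>\<^bsub>?M\<^esub>" using y by (simp add: cocycles_def)
      moreover have "\<zero>\<^bsub>obj X n\<^esub> \<in> cocycles X n"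
        using s(3)[of n] ag_closed(2)[OF module_complex_ag[OF mX]] by (simp add: cocycles_def)
      ultimately show ?thesis using False by auto
    qed
    then obtain z where z: "z \<in> cocycles X n" "y = ?q n z" by blast
    have "y \<in> carrier (obj (stalk ?M) n)" using y by (simp add: cocycles_def)
    then have "y = \<zero>\<^bsub>obj (stalk ?M) n\<^esub> \<oplus>\<^bsub>obj (stalk ?M) n\<^esub> ?q n z"
      using ag_zero(1)[OF module_complex_ag[OF mS]] z(2) by metis
    then show "\<exists>z\<in>cocycles X n. \<exists>b\<in>coboundaries (stalk ?M) n. y = b \<oplus>\<^bsub>obj (stalk ?M) n\<^esub> ?q n z"
      using z(1) b by blast
  qed
  then show ?thesis using fd by blast
qed

end

section \<open>Mutation at a vertex\<close>

text \<open>Membership in \<open>P v\<close> is from here on read off from \<open>P_elem\<close>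
  instead of from the image of a multiplication.\<close>

declare right_ideal_mod_simps(1) [simp del]

locale mutation_vertex = bound_quiver Q I for Q :: "('v, 'a) pre_digraph"
    and I :: "(('v, 'a) qpath \<Rightarrow> 'k::field) set" +
  fixes k :: 'v
  assumes k: "k \<in> verts Q" and no_loop: "\<lbrakk>\<alpha> \<in> arcs Q; tail Q \<alpha> = k\<rbrakk> \<Longrightarrow> head Q \<alpha> \<noteq> k"
begin

abbreviation "Sin \<equiv> Some ` {\<alpha> \<in> arcs Q. head Q \<alpha> = k}"
abbreviation "Sout \<equiv> Some ` {\<beta> \<in> arcs Q. tail Q \<beta> = k}"
abbreviation "Pk \<equiv> dsum_mod {None :: 'a option} (\<lambda>_. P k)"
text \<open>The identification of P_k with its one-term sum \<open>Pk\<close>; the inverse is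
  evaluation at \<open>None\<close>.\<close>

abbreviation "kap x \<equiv> (\<lambda>_\<in>{None :: 'a option}. x)"

lemma P_projective:
  assumes "v \<in> verts Q"
  shows "fd_module A (P v)" "fg_projective A (P v)"
proof -
  have e: "ve v \<otimes>\<^bsub>A\<^esub> ve v = ve v" using ve_mult[OF assms assms] by simp
  show "fd_module A (P v)" by (rule fd_right_ideal[OF fd_regular ve_carrier[OF assms]])
  show "fg_projective A (P v)" by (rule fg_projective_right_ideal[OF fd_regular ve_carrier[OF assms] e])
qed

lemma Pk_projective: "fd_module A Pk" "fg_projective A Pk"
  by (rule fd_dsum, simp, rule P_projective[OF k]) (rule fg_projective_dsum, simp, rule P_projective[OF k], rule P_projective[OF k])

lemma finite_arrows: "finite Sin" "finite Sout"
  using finite_arcs by simp_all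

text \<open>As there is no loop at k, the arrows that end at k start at other vertices. The
  instances \<open>into\<close> and \<open>out\<close> share the index set and the projectives, so
  B, Z and D are the same terms in both.\<close>

sublocale into: mutation A "verts Q - {k}" P Sin "\<lambda>s. tail Q (the s)" Pk
proof unfold_locales
  show "tail Q (the s) \<in> verts Q - {k}" if "s \<in> Sin" for s
  proof -
    obtain \<alpha> where "s = Some \<alpha>" "\<alpha> \<in> arcs Q" "head Q \<alpha> = k" using \<open>s \<in> Sin\<close> by blast
    then show ?thesis using no_loop[of \<alpha>] by auto
  qed
qed (use P_projective Pk_projective finite_arrows in auto)

sublocale out: mutation A "verts Q - {k}" P Sout "\<lambda>s. head Q (the s)" Pk
proof unfold_locales
  show "head Q (the s) \<in> verts Q - {k}" if "s \<in> Sout" for s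
    using that no_loop by auto
qed (use P_projective Pk_projective finite_arrows in auto)

lemma left_mult_hom:
  assumes i: "i \<in> verts Q" and v: "v \<in> verts Q" and a: "a \<in> carrier A" "ve i \<otimes>\<^bsub>A\<^esub> a = a"
  shows "(\<lambda>x. a \<otimes>\<^bsub>A\<^esub> x) \<in> mod_hom A (P v) (P i)"
proof (rule mod_homI)
  fix x assume "x \<in> carrier (P v)"
  then have x: "x \<in> carrier A" by (simp add: P_elem[OF v])
  show "a \<otimes>\<^bsub>A\<^esub> x \<in> carrier (P i)"
    using x a ve_carrier[OF i] by (simp add: P_elem[OF i] A.m_assoc[symmetric])
  show "a \<otimes>\<^bsub>A\<^esub> (b \<odot>\<^bsub>P v\<^esub> x) = b \<odot>\<^bsub>P i\<^esub> (a \<otimes>\<^bsub>A\<^esub> x)" if "b \<in> carrier A" for b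
    using x a that by (simp add: A.m_assoc)
  show "a \<otimes>\<^bsub>A\<^esub> (x \<oplus>\<^bsub>P v\<^esub> y) = a \<otimes>\<^bsub>A\<^esub> x \<oplus>\<^bsub>P i\<^esub> a \<otimes>\<^bsub>A\<^esub> y" if "y \<in> carrier (P v)" for y
    using x a that by (simp add: P_elem[OF v] A.r_distr)
qed

lemma finsum_hom:
  assumes "finite S" and L: "right_module A L" and v: "v \<in> verts Q"
    and h: "\<And>s. s \<in> S \<Longrightarrow> h s \<in> mod_hom A L (P v)"
  shows "(\<lambda>x. \<Oplus>\<^bsub>A\<^esub>s\<in>S. h s x) \<in> mod_hom A L (P v)"
  using assms(1) h
proof (induction S rule: finite_induct)
  case empty
  show ?case using mod_hom_zero_map[OF right_module_P[OF v], of L] by simp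
next
  case (insert s S)
  have "(\<lambda>x. h s x \<oplus>\<^bsub>P v\<^esub> (\<Oplus>\<^bsub>A\<^esub>s\<in>S. h s x)) \<in> mod_hom A L (P v)"
    using insert by (intro mod_hom_plus right_module_P[OF v]) auto
  then show ?case
  proof (rule mod_hom_cong[OF _ L])
    fix x assume x: "x \<in> carrier L"
    have "h t x \<in> carrier A" if "t \<in> insert s S" for t
      using mod_hom_closed[OF insert.prems[OF that] x] by (simp add: P_elem[OF v])
    then show "(\<Oplus>\<^bsub>A\<^esub>s\<in>insert s S. h s x) = h s x \<oplus>\<^bsub>P v\<^esub> (\<Oplus>\<^bsub>A\<^esub>s\<in>S. h s x)"
      using insert.hyps by (simp add: Pi_iff)
  qed
qed

lemma kap_hom: "kap \<in> mod_hom A (P k) Pk"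
  by (rule mod_hom_into_dsum, rule mod_hom_id)

lemma at_None_hom: "(\<lambda>x. x None) \<in> mod_hom A Pk (P k)"
  by (rule mod_hom_proj) simp

lemma Pk_eq: "x \<in> carrier Pk \<Longrightarrow> x = kap (x None)"
  by (auto simp: fun_eq_iff PiE_def extensional_def)

lemma ve_in_P: "v \<in> verts Q \<Longrightarrow> ve v \<in> carrier (P v)"
  by (simp add: P_elem ve_carrier ve_mult)

section \<open>The maps f and g, and the four complexes in terms of them\<close>

lemma arrow_mult_hom:
  assumes "s \<in> Sin"
  shows "(\<lambda>x. ar (the s) \<otimes>\<^bsub>A\<^esub> x) \<in> mod_hom A (P k) (P (tail Q (the s)))"
  using assms k ar_carrier ar_tail by (intro left_mult_hom) auto

lemma arrow_mult_hom':
  assumes "s \<in> Sout"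
  shows "(\<lambda>x. ar (the s) \<otimes>\<^bsub>A\<^esub> x) \<in> mod_hom A (P (head Q (the s))) (P k)"
  using assms k ar_carrier ar_tail by (intro left_mult_hom) auto

definition fL :: "('a option \<Rightarrow> (('v, 'a) qpath \<Rightarrow> 'k) set) \<Rightarrow> 'a option \<Rightarrow> (('v, 'a) qpath \<Rightarrow> 'k) set" where
  "fL = (\<lambda>x. \<lambda>s\<in>Sin. ar (the s) \<otimes>\<^bsub>A\<^esub> x None)"

definition gR :: "('a option \<Rightarrow> (('v, 'a) qpath \<Rightarrow> 'k) set) \<Rightarrow> 'a option \<Rightarrow> (('v, 'a) qpath \<Rightarrow> 'k) set" where
  "gR = (\<lambda>x. kap (\<Oplus>\<^bsub>A\<^esub>s\<in>Sout. ar (the s) \<otimes>\<^bsub>A\<^esub> x s))"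

lemma fL_hom: "fL \<in> mod_hom A Pk into.N"
  unfolding fL_def
  by (rule mod_hom_into_dsum, rule mod_hom_comp[OF arrow_mult_hom at_None_hom])

lemma gR_hom: "gR \<in> mod_hom A out.N Pk"
  unfolding gR_def
proof (rule mod_hom_into_dsum, rule finsum_hom[OF finite_arrows(2) out.right_modules(3) k])
  fix s assume s: "s \<in> Sout"
  have "(\<lambda>x. x s) \<in> mod_hom A out.N (P (head Q (the s)))" by (rule mod_hom_proj[OF s])
  then show "(\<lambda>x. ar (the s) \<otimes>\<^bsub>A\<^esub> x s) \<in> mod_hom A out.N (P k)" by (rule mod_hom_comp[OF arrow_mult_hom'[OF s]])
qed

lemma L_complex_eq: "L_complex Q I k = two_term (- 1) Pk into.N fL"
  by (simp add: L_complex_def Let_def proj_at_def ve_def fL_def)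

lemma R_complex_eq: "R_complex Q I k = two_term 0 out.N Pk gR"
  by (simp add: R_complex_def Let_def proj_at_def ve_def gR_def)

lemma T_minus_eq: "T_minus Q I k = pair_cpx (two_term (- 1) Pk into.N fL) into.D"
  unfolding T_minus_def L_complex_eq by (simp add: proj_at_def ve_def)

lemma T_plus_eq: "T_plus Q I k = pair_cpx (two_term 0 out.N Pk gR) into.D"
  unfolding T_plus_def R_complex_eq by (simp add: proj_at_def ve_def)

text \<open>The map f is a left approximation: \<psi> is left multiplication by a = \<psi>(e_k), an
  element of e_j A e_k. Since a is a sum of products y_\<alpha> \<alpha>, the map \<psi> is the sum
  of the components of f followed by left multiplication by the y_\<alpha>.\<close>

lemma factor_into:
  assumes j: "j \<in> verts Q - {k}" and \<psi>: "\<psi> \<in> mod_hom A Pk (P j)"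
  shows "\<exists>w\<in>mod_hom A into.N (P j). \<forall>x\<in>carrier Pk. w (fL x) = \<psi> x"
proof -
  have jv: "j \<in> verts Q" and jk: "j \<noteq> k" using j by auto
  have e: "kap (ve k) \<in> carrier Pk" by (rule mod_hom_closed[OF kap_hom ve_in_P[OF k]])
  define a where "a = \<psi> (kap (ve k))"
  have a: "a \<in> carrier A" "ve j \<otimes>\<^bsub>A\<^esub> a = a"
    using mod_hom_closed[OF \<psi> e] by (simp_all add: P_elem[OF jv] a_def)
  have xk: "x None \<in> carrier A" "ve k \<otimes>\<^bsub>A\<^esub> x None = x None" if "x \<in> carrier Pk" for x
    using mod_hom_closed[OF at_None_hom that] by (simp_all add: P_elem[OF k])
  have \<psi>x: "\<psi> x = a \<otimes>\<^bsub>A\<^esub> x None" if x: "x \<in> carrier Pk" for x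
  proof -
    have "x None \<odot>\<^bsub>Pk\<^esub> kap (ve k) = kap (x None)" using xk(2)[OF x] by (simp cong: restrict_cong)
    then have "x = x None \<odot>\<^bsub>Pk\<^esub> kap (ve k)" using Pk_eq[OF x] by metis
    then have "\<psi> x = x None \<odot>\<^bsub>P j\<^esub> a" using mod_hom_act[OF \<psi> xk(1)[OF x] e] unfolding a_def by metis
    then show ?thesis by simp
  qed
  have "a \<otimes>\<^bsub>A\<^esub> ve k = a" using \<psi>x[OF e] unfolding a_def[symmetric] by simp
  from factor_through_arrows_into[OF jv k jk a this] obtain y
    where y: "\<And>\<alpha>. \<lbrakk>\<alpha> \<in> arcs Q; head Q \<alpha> = k\<rbrakk> \<Longrightarrow> y \<alpha> \<in> carrier A \<and> ve j \<otimes>\<^bsub>A\<^esub> y \<alpha> = y \<alpha>"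
      and ay: "a = (\<Oplus>\<^bsub>A\<^esub>\<alpha>\<in>{\<alpha> \<in> arcs Q. head Q \<alpha> = k}. y \<alpha> \<otimes>\<^bsub>A\<^esub> ar \<alpha>)" by blast
  let ?w = "\<lambda>z. \<Oplus>\<^bsub>A\<^esub>s\<in>Sin. y (the s) \<otimes>\<^bsub>A\<^esub> z s"
  have "?w \<in> mod_hom A into.N (P j)"
  proof (rule finsum_hom[OF finite_arrows(1) into.right_modules(3) jv])
    fix s assume s: "s \<in> Sin"
    have "(\<lambda>x. y (the s) \<otimes>\<^bsub>A\<^esub> x) \<in> mod_hom A (P (tail Q (the s))) (P j)"
      using s y by (intro left_mult_hom jv) auto
    moreover have "(\<lambda>x. x s) \<in> mod_hom A into.N (P (tail Q (the s)))" by (rule mod_hom_proj[OF s])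
    ultimately show "(\<lambda>x. y (the s) \<otimes>\<^bsub>A\<^esub> x s) \<in> mod_hom A into.N (P j)" by (rule mod_hom_comp)
  qed
  moreover have "?w (fL x) = \<psi> x" if x: "x \<in> carrier Pk" for x
  proof -
    note x0 = xk(1)[OF x]
    have c: "y (the s) \<in> carrier A" "ar (the s) \<in> carrier A" if "s \<in> Sin" for s using that y ar_carrier by auto
    have "?w (fL x) = (\<Oplus>\<^bsub>A\<^esub>s\<in>Sin. (y (the s) \<otimes>\<^bsub>A\<^esub> ar (the s)) \<otimes>\<^bsub>A\<^esub> x None)"
      using c x0 by (intro A.finsum_cong') (simp_all add: fL_def A.m_assoc Pi_iff)
    also have "\<dots> = (\<Oplus>\<^bsub>A\<^esub>s\<in>Sin. y (the s) \<otimes>\<^bsub>A\<^esub> ar (the s)) \<otimes>\<^bsub>A\<^esub> x None"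
      using c x0 finite_arrows by (intro A.finsum_ldistr[symmetric]) (simp_all add: Pi_iff)
    also have "(\<Oplus>\<^bsub>A\<^esub>s\<in>Sin. y (the s) \<otimes>\<^bsub>A\<^esub> ar (the s)) = a"
      unfolding ay using c by (subst A.finsum_reindex) (auto simp: Pi_iff)
    finally show ?thesis using \<psi>x[OF x] by simp
  qed
  ultimately show ?thesis by (intro bexI[of _ ?w] ballI)
qed

text \<open>The map g is a right approximation: \<psi> is left multiplication by b = \<psi>(e_j), an
  element of e_k A e_j, and b is a sum of products \<beta> y_\<beta>.\<close>

lemma factor_out:
  assumes j: "j \<in> verts Q - {k}" and \<psi>: "\<psi> \<in> mod_hom A (P j) Pk"
  shows "\<exists>u\<in>mod_hom A (P j) out.N. \<forall>x\<in>carrier (P j). gR (u x) = \<psi> x"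
proof -
  have jv: "j \<in> verts Q" and kj: "k \<noteq> j" using j by auto
  note \<psi>0 = mod_hom_comp[OF at_None_hom \<psi>]
  define b where "b = \<psi> (ve j) None"
  have b: "b \<in> carrier A" "ve k \<otimes>\<^bsub>A\<^esub> b = b"
    using mod_hom_closed[OF \<psi>0 ve_in_P[OF jv]] by (simp_all add: P_elem[OF k] b_def)
  have \<psi>x: "\<psi> x None = b \<otimes>\<^bsub>A\<^esub> x" if "x \<in> carrier (P j)" for x
  proof -
    have x: "x \<in> carrier A" "ve j \<otimes>\<^bsub>A\<^esub> x = x" using that by (simp_all add: P_elem[OF jv])
    show ?thesis using mod_hom_act[OF \<psi>0 x(1) ve_in_P[OF jv]] x(2) by (simp add: b_def)
  qed
  have "b \<otimes>\<^bsub>A\<^esub> ve j = b" using \<psi>x[OF ve_in_P[OF jv]] by (simp add: b_def)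
  from factor_through_arrows_from[OF jv k kj b this] obtain y
    where y: "\<And>\<beta>. \<lbrakk>\<beta> \<in> arcs Q; tail Q \<beta> = k\<rbrakk> \<Longrightarrow> y \<beta> \<in> carrier A"
      and bty: "b = (\<Oplus>\<^bsub>A\<^esub>\<beta>\<in>{\<beta> \<in> arcs Q. tail Q \<beta> = k}. ar \<beta> \<otimes>\<^bsub>A\<^esub> y \<beta>)" by blast
  \<comment> \<open>The idempotent at the head of the arrow puts the cofactor into the projective at
    that vertex; in the product it is absorbed by the arrow.\<close>
  let ?y = "\<lambda>s. ve (head Q (the s)) \<otimes>\<^bsub>A\<^esub> y (the s)"
  let ?u = "\<lambda>x. \<lambda>s\<in>Sout. ?y s \<otimes>\<^bsub>A\<^esub> x"
  have h: "head Q (the s) \<in> verts Q" "y (the s) \<in> carrier A" "ar (the s) \<in> carrier A" "ve (head Q (the s)) \<in> carrier A"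
    if "s \<in> Sout" for s using that y ar_carrier by (auto intro: ve_carrier)
  have u: "?u \<in> mod_hom A (P j) out.N"
    by (rule mod_hom_into_dsum, rule left_mult_hom[OF h(1) jv])
      (use h ve_mult in \<open>simp_all add: A.m_assoc[symmetric]\<close>)
  have "gR (?u x) = \<psi> x" if x: "x \<in> carrier (P j)" for x
  proof -
    have x0: "x \<in> carrier A" using x by (simp add: P_elem[OF jv])
    have t: "ar (the s) \<otimes>\<^bsub>A\<^esub> (?y s \<otimes>\<^bsub>A\<^esub> x) = (ar (the s) \<otimes>\<^bsub>A\<^esub> y (the s)) \<otimes>\<^bsub>A\<^esub> x" if s: "s \<in> Sout" for s
    proof -
      have "ar (the s) \<otimes>\<^bsub>A\<^esub> (?y s \<otimes>\<^bsub>A\<^esub> x) = (ar (the s) \<otimes>\<^bsub>A\<^esub> ve (head Q (the s))) \<otimes>\<^bsub>A\<^esub> (y (the s) \<otimes>\<^bsub>A\<^esub> x)"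
        using h[OF s] x0 by (simp add: A.m_assoc)
      also have "ar (the s) \<otimes>\<^bsub>A\<^esub> ve (head Q (the s)) = ar (the s)" using s ar_head by auto
      finally show ?thesis using h[OF s] x0 by (simp add: A.m_assoc)
    qed
    have "(\<Oplus>\<^bsub>A\<^esub>s\<in>Sout. ar (the s) \<otimes>\<^bsub>A\<^esub> ?u x s) = (\<Oplus>\<^bsub>A\<^esub>s\<in>Sout. (ar (the s) \<otimes>\<^bsub>A\<^esub> y (the s)) \<otimes>\<^bsub>A\<^esub> x)"
      using h x0 t by (intro A.finsum_cong') (simp_all add: Pi_iff)
    also have "\<dots> = (\<Oplus>\<^bsub>A\<^esub>s\<in>Sout. ar (the s) \<otimes>\<^bsub>A\<^esub> y (the s)) \<otimes>\<^bsub>A\<^esub> x"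
      using h x0 finite_arrows by (intro A.finsum_ldistr[symmetric]) (simp_all add: Pi_iff)
    also have "(\<Oplus>\<^bsub>A\<^esub>s\<in>Sout. ar (the s) \<otimes>\<^bsub>A\<^esub> y (the s)) = b"
      unfolding bty using h by (subst A.finsum_reindex) (auto simp: Pi_iff)
    finally have "gR (?u x) = kap (\<psi> x None)" using \<psi>x[OF x] unfolding gR_def by simp
    then show ?thesis using Pk_eq[OF mod_hom_closed[OF \<psi> x]] by simp
  qed
  then show ?thesis by (intro bexI[of _ ?u] ballI u)
qed

text \<open>Left multiplication by an element x of the kernel maps every P_i into the kernel, so x
  e_i = 0 for all i, and these elements add up to x.\<close>

lemma fL_injective:
  assumes v: "\<And>i. i \<in> verts Q \<Longrightarrow> \<forall>\<psi>\<in>mod_hom A (P i) Pk. (\<forall>x\<in>carrier (P i). fL (\<psi> x) = \<zero>\<^bsub>into.N\<^esub>) \<longrightarrow>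
      (\<forall>x\<in>carrier (P i). \<psi> x = \<zero>\<^bsub>Pk\<^esub>)"
    and x: "x \<in> carrier Pk" "fL x = \<zero>\<^bsub>into.N\<^esub>"
  shows "x = \<zero>\<^bsub>Pk\<^esub>"
proof -
  have x0: "x None \<in> carrier A" "ve k \<otimes>\<^bsub>A\<^esub> x None = x None"
    using mod_hom_closed[OF at_None_hom x(1)] by (simp_all add: P_elem[OF k])
  have ax: "ar (the s) \<otimes>\<^bsub>A\<^esub> x None = \<zero>\<^bsub>A\<^esub>" if "s \<in> Sin" for s
    using fun_cong[OF x(2), of s] that by (simp add: fL_def)
  have "x None \<otimes>\<^bsub>A\<^esub> ve i = \<zero>\<^bsub>A\<^esub>" if i: "i \<in> verts Q" for i
  proof -
    let ?\<psi> = "\<lambda>z. kap (x None \<otimes>\<^bsub>A\<^esub> z)"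
    have \<psi>: "?\<psi> \<in> mod_hom A (P i) Pk" by (rule mod_hom_comp[OF kap_hom left_mult_hom[OF k i x0]])
    have "\<forall>z\<in>carrier (P i). fL (?\<psi> z) = \<zero>\<^bsub>into.N\<^esub>"
    proof
      fix z assume "z \<in> carrier (P i)"
      then have z: "z \<in> carrier A" by (simp add: P_elem[OF i])
      have "ar (the s) \<otimes>\<^bsub>A\<^esub> (x None \<otimes>\<^bsub>A\<^esub> z) = \<zero>\<^bsub>A\<^esub>" if s: "s \<in> Sin" for s
      proof -
        have "ar (the s) \<in> carrier A" using s ar_carrier by auto
        then show ?thesis using ax[OF s] x0(1) z by (simp add: A.m_assoc[symmetric])
      qed
      then show "fL (?\<psi> z) = \<zero>\<^bsub>into.N\<^esub>" by (simp add: fL_def cong: restrict_cong)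
    qed
    from bspec[OF mp[OF bspec[OF v[OF i] \<psi>] this] ve_in_P[OF i]]
    have "kap (x None \<otimes>\<^bsub>A\<^esub> ve i) = \<zero>\<^bsub>Pk\<^esub>" .
    from fun_cong[OF this, of None] show ?thesis by simp
  qed
  then have "(\<Oplus>\<^bsub>A\<^esub>i\<in>verts Q. x None \<otimes>\<^bsub>A\<^esub> ve i) = \<zero>\<^bsub>A\<^esub>" by (intro A.add.finprod_one_eqI) auto
  moreover have "x None = x None \<otimes>\<^bsub>A\<^esub> (\<Oplus>\<^bsub>A\<^esub>i\<in>verts Q. ve i)" using x0(1) by (simp add: ve_sum)
  ultimately have "x None = \<zero>\<^bsub>A\<^esub>"
    using x0(1) ve_carrier by (simp add: A.finsum_rdistr Pi_iff)
  then show ?thesis using Pk_eq[OF x(1)] by simp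
qed

subsection \<open>Generation\<close>

lemma Gen_other:
  assumes T: "projective_complex A T" and r: "retract into.D T" and v: "v \<in> verts Q - {k}"
  shows "Gen T (stalk (P v))"
proof -
  have p: "projective_complex A (stalk (P i))" if "i \<in> verts Q" for i
    by (rule projective_complex_stalk[OF P_projective[OF that]])
  have "retract (stalk (P v)) into.D"
    by (rule retract_dsum[where X = "\<lambda>i. stalk (P i)", OF _ v]) (use p proj_module_complex in blast)
  then have "retract (stalk (P v)) T"
    by (rule retract_trans[OF _ r proj_module_complex[OF p] proj_module_complex[OF into.projective_D]]) (use v in auto)
  then show ?thesis by (intro Gen_of_retract[OF T p]) (use v in auto)
qed

text \<open>An instance of \<open>Gen_of_generators\<close>: each summand contributes its idempotent
  as a generator.\<close>

lemma Gen_stalk_dsum: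
  assumes T: "projective_complex A T" and S: "finite S"
    and t: "\<And>s. s \<in> S \<Longrightarrow> t s \<in> verts Q \<and> Gen T (stalk (P (t s)))"
  shows "Gen T (stalk (dsum_mod S (\<lambda>s. P (t s))))"
proof -
  let ?N = "dsum_mod S (\<lambda>s. P (t s))" and ?i = "dsum_inj S (\<lambda>s. P (t s))"
  have rP: "right_module A (P (t s))" if "s \<in> S" for s using t[OF that] right_module_P by blast
  have i: "?i s \<in> mod_hom A (P (t s)) ?N" if "s \<in> S" for s by (rule mod_hom_dsum_inj[OF rP that])
  have e: "ve (t s) \<in> carrier (P (t s))" if "s \<in> S" for s using t[OF that] ve_in_P by blast
  show ?thesis
  proof (rule Gen_of_generators[OF T, of "t ` S" "(\<lambda>s. (?i s (ve (t s)), t s)) ` S"])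
    show "t ` S \<subseteq> verts Q" using t by blast
    show "Gen T (stalk (P v))" if "v \<in> t ` S" for v using that t by blast
    show "finite ((\<lambda>s. (?i s (ve (t s)), t s)) ` S)" using S by simp
    show "fg_projective A ?N" "fd_module A ?N"
      by (rule fg_projective_dsum[OF S], use t P_projective in blast, use t P_projective in blast)
        (rule fd_dsum[OF S], use t P_projective in blast)
    show "v \<in> t ` S \<and> g \<in> carrier ?N \<and> ve v \<odot>\<^bsub>?N\<^esub> g = g"
      if gv: "(g, v) \<in> (\<lambda>s. (?i s (ve (t s)), t s)) ` S" for g v
    proof -
      obtain s where s: "s \<in> S" "g = ?i s (ve (t s))" "v = t s" using gv by (auto simp del: dsum_mod_simps)
      have tv: "t s \<in> verts Q" using t s by blast
      have "ve (t s) \<odot>\<^bsub>P (t s)\<^esub> ve (t s) = ve (t s)" using tv by (simp add: ve_mult)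
      then show ?thesis
        using s mod_hom_closed[OF i[OF s(1)] e[OF s(1)]] mod_hom_act[OF i[OF s(1)] ve_carrier[OF tv] e[OF s(1)]]
        by (metis imageI)
    qed
    have "carrier ?N \<subseteq> mspan (carrier A) ?N (\<Union>s\<in>S. ?i s ` {ve (t s)})"
    proof (rule dsum_span[OF S ring_A rP order_refl])
      fix s assume s: "s \<in> S"
      then have tv: "t s \<in> verts Q" using t by blast
      show "{ve (t s)} \<subseteq> carrier (P (t s))" using e[OF s] by simp
      show "carrier (P (t s)) \<subseteq> mspan (carrier A) (P (t s)) {ve (t s)}"
      proof
        fix x assume "x \<in> carrier (P (t s))"
        then have x: "x \<in> carrier A" "x = x \<odot>\<^bsub>P (t s)\<^esub> ve (t s)" by (simp_all add: P_elem[OF tv])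
        have "x \<odot>\<^bsub>P (t s)\<^esub> ve (t s) \<in> mspan (carrier A) (P (t s)) {ve (t s)}"
          by (rule mspan.act[OF x(1)]) (rule mspan.base, simp)
        then show "x \<in> mspan (carrier A) (P (t s)) {ve (t s)}" using x(2) by simp
      qed
    qed
    moreover have "(\<Union>s\<in>S. ?i s ` {ve (t s)}) = fst ` (\<lambda>s. (?i s (ve (t s)), t s)) ` S" by force
    ultimately show "carrier ?N \<subseteq> mspan (carrier A) ?N (fst ` (\<lambda>s. (?i s (ve (t s)), t s)) ` S)" by metis
  qed
qed

lemma Gen_Pk:
  assumes "Gen T (stalk Pk)"
  shows "Gen T (stalk (P k))"
proof (rule Gen_stalk_iso[OF assms into.right_modules(2) P_projective(1)[OF k] at_None_hom])
  show "kap y \<in> carrier Pk \<and> kap y None = y" if "y \<in> carrier (P k)" for y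
    using mod_hom_closed[OF kap_hom that] by simp
  show "kap (x None) = x" if "x \<in> carrier Pk" for x using Pk_eq[OF that] by simp
qed

text \<open>T is any isomorphic copy, since the result is needed for the complex itself and for its
  small copy. L and the P_j with j \<noteq> k are retracts of T, N is a sum of such P_j, and the
  truncation of L then yields P_k.\<close>

lemma Gen_minus:
  assumes T: "projective_complex A T" and i: "cpx_iso A (T_minus Q I k) T \<phi> \<psi>" and v: "v \<in> verts Q"
  shows "Gen T (stalk (P v))"
proof -
  let ?L = "two_term (- 1) Pk into.N fL"
  note pL = projective_complex_two_term[OF Pk_projective into.projective_N fL_hom, of "- 1"]
  note m = proj_module_complex[OF pL] proj_module_complex[OF into.projective_D]
    proj_module_complex[OF into.projective_minus[OF fL_hom]]
  note r = retract_iso[OF i, unfolded T_minus_eq]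
  have L: "Gen T ?L" by (rule Gen_of_retract[OF T pL retract_trans[OF retract_pair(1)[OF m(1,2)] r m(1,3)]])
  have other: "Gen T (stalk (P j))" if "j \<in> verts Q - {k}" for j
    by (rule Gen_other[OF T retract_trans[OF retract_pair(2)[OF m(1,2)] r m(2,3)] that])
  have N: "Gen T (stalk into.N)"
    by (rule Gen_stalk_dsum[OF T finite_arrows(1)]) (use into.t other in blast)
  have "Gen T (stalk (P k))"
    by (rule Gen_Pk[OF Gen_two_term_source[OF Pk_projective into.projective_N fL_hom N L]])
  then show ?thesis using other v by (cases "v = k") simp_all
qed

text \<open>As for \<open>Gen_minus\<close>, except that \<open>Pk\<close> is now the target of the
  two-term complex.\<close>

lemma Gen_plus:
  assumes T: "projective_complex A T" and i: "cpx_iso A (T_plus Q I k) T \<phi> \<psi>" and v: "v \<in> verts Q"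
  shows "Gen T (stalk (P v))"
proof -
  let ?R = "two_term 0 out.N Pk gR"
  note pR = projective_complex_two_term[OF out.projective_N Pk_projective gR_hom, of 0]
  note m = proj_module_complex[OF pR] proj_module_complex[OF into.projective_D]
    proj_module_complex[OF out.projective_plus[OF gR_hom]]
  note r = retract_iso[OF i, unfolded T_plus_eq]
  have R: "Gen T ?R" by (rule Gen_of_retract[OF T pR retract_trans[OF retract_pair(1)[OF m(1,2)] r m(1,3)]])
  have other: "Gen T (stalk (P j))" if "j \<in> verts Q - {k}" for j
    by (rule Gen_other[OF T retract_trans[OF retract_pair(2)[OF m(1,2)] r m(2,3)] that])
  have N: "Gen T (stalk out.N)"
    by (rule Gen_stalk_dsum[OF T finite_arrows(2)]) (use out.t other in blast)
  have "Gen T (stalk (P k))"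
    by (rule Gen_Pk[OF Gen_two_term_target[OF out.projective_N Pk_projective gR_hom R N]])
  then show ?thesis using other v by (cases "v = k") simp_all
qed

subsection \<open>The four assertions\<close>

text \<open>Hom(P_i, ker f) = 0, where ker f is the cohomology of L_k in degree -1.\<close>

abbreviation "kernel_orthogonal i \<equiv> \<forall>\<psi>\<in>mod_hom A (P i) Pk.
  (\<forall>x\<in>carrier (P i). fL (\<psi> x) = \<zero>\<^bsub>into.N\<^esub>) \<longrightarrow> (\<forall>x\<in>carrier (P i). \<psi> x = \<zero>\<^bsub>Pk\<^esub>)"

text \<open>Hom(coker g, P_i) = 0, where coker g is the cohomology of R_k in degree 1.\<close>

abbreviation "cokernel_orthogonal i \<equiv> \<forall>\<psi>\<in>mod_hom A Pk (P i).
  (\<forall>x\<in>carrier out.N. \<psi> (gR x) = \<zero>\<^bsub>P i\<^esub>) \<longrightarrow> (\<forall>x\<in>carrier Pk. \<psi> x = \<zero>\<^bsub>P i\<^esub>)"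

lemma vanishes_L_iff:
  assumes i: "i \<in> verts Q"
  shows "Db_hom_vanishes A (stalk (proj_at Q I i)) (shift (- 1) (L_complex Q I k)) \<longleftrightarrow> kernel_orthogonal i"
  unfolding L_complex_eq proj_at_def ve_def[symmetric]
  by (rule stalk_two_term_vanishes_iff[OF P_projective[OF i]
    projective_complex_two_term[OF Pk_projective into.projective_N fL_hom] fL_hom into.right_modules(3)])

lemma vanishes_R_iff:
  assumes i: "i \<in> verts Q"
  shows "Db_hom_vanishes A (shift 1 (R_complex Q I k)) (stalk (proj_at Q I i)) \<longleftrightarrow> cokernel_orthogonal i"
  unfolding R_complex_eq proj_at_def ve_def[symmetric]
  by (rule two_term_stalk_vanishes_iff[OF P_projective(1)[OF i]
    projective_complex_two_term[OF out.projective_N Pk_projective gR_hom] gR_hom out.right_modules(2)])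

lemma projective_T_minus: "projective_complex A (T_minus Q I k)"
  unfolding T_minus_eq by (rule into.projective_minus[OF fL_hom])

lemma projective_T_plus: "projective_complex A (T_plus Q I k)"
  unfolding T_plus_eq by (rule out.projective_plus[OF gR_hom])

lemma cpx_iso_id: "cpx_iso A X X (\<lambda>n x. x) (\<lambda>n x. x)"
  by (simp add: cpx_iso_def chain_map_id)

text \<open>Projectivity of the terms and generation hold in any case, so being tilting comes down
  to self-orthogonality.\<close>

lemma tilting_minus_iff:
  "tilting_complex A (T_minus Q I k) \<longleftrightarrow> (\<forall>i\<in>verts Q - {k}. kernel_orthogonal i)"
proof -
  have gen: "\<forall>X. perfect_complex A X \<longrightarrow> generated A (T_minus Q I k) X"
    using perfect_generated[OF projective_T_minus Gen_minus[OF projective_T_minus cpx_iso_id]] by blast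
  have orth: "(\<forall>r. r \<noteq> 0 \<longrightarrow> Db_hom_vanishes A (T_minus Q I k) (shift r (T_minus Q I k))) \<longleftrightarrow>
      (\<forall>i\<in>verts Q - {k}. kernel_orthogonal i)"
    unfolding T_minus_eq by (rule into.self_orthogonal_minus_iff[OF fL_hom factor_into])
  show ?thesis
    unfolding tilting_complex_def orth
    by (rule iffI, elim conjE, assumption, intro conjI projective_T_minus gen)
qed

lemma tilting_plus_iff:
  "tilting_complex A (T_plus Q I k) \<longleftrightarrow> (\<forall>i\<in>verts Q - {k}. cokernel_orthogonal i)"
proof -
  have gen: "\<forall>X. perfect_complex A X \<longrightarrow> generated A (T_plus Q I k) X"
    using perfect_generated[OF projective_T_plus Gen_plus[OF projective_T_plus cpx_iso_id]] by blast
  have orth: "(\<forall>r. r \<noteq> 0 \<longrightarrow> Db_hom_vanishes A (T_plus Q I k) (shift r (T_plus Q I k))) \<longleftrightarrow>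
      (\<forall>i\<in>verts Q - {k}. cokernel_orthogonal i)"
    unfolding T_plus_eq by (rule out.self_orthogonal_plus_iff[OF gR_hom factor_out])
  show ?thesis
    unfolding tilting_complex_def orth
    by (rule iffI, elim conjE, assumption, intro conjI projective_T_plus gen)
qed

text \<open>A stalk has no cohomology outside degree 0, and \<open>Db_isomorphic_acyclic\<close>
  carries this over to T.\<close>

lemma iso_to_module_acyclic:
  assumes T: "bounded_complex A T" and i: "iso_to_tilting_module A T" and n: "n \<noteq> 0"
  shows "cocycles T n \<subseteq> coboundaries T n"
proof -
  obtain M :: "('k, (('v, 'a) qpath \<Rightarrow> 'k) set) small_module" where M: "fd_module A M" "Db_isomorphic A T (stalk M)"
    using i unfolding iso_to_tilting_module_def tilting_module_def by blast
  have m: "module_complex A (stalk M)" using M(1) by (intro module_complex_stalk) (simp add: fd_module_def)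
  have "cocycles (stalk M) n \<subseteq> {\<zero>\<^bsub>obj (stalk M) n\<^esub>}" using n by (auto simp: cocycles_def)
  then have "cocycles (stalk M) n \<subseteq> coboundaries (stalk M) n"
    using additive_subgroup.zero_closed[OF additive_subgroup_coboundaries[OF m], of n] by auto
  then show ?thesis by (rule Db_isomorphic_acyclic[OF T bounded_complex_stalk[OF M(1)] M(2)])
qed

text \<open>The values of a map from P_i to the kernel of f are cocycles of degree -1, hence
  coboundaries; but the term in degree -2 is zero.\<close>

lemma minus_module_only_if:
  assumes "iso_to_tilting_module A (T_minus Q I k)" and i: "i \<in> verts Q"
  shows "kernel_orthogonal i"
proof (intro ballI impI)
  let ?T = "T_minus Q I k"
  fix \<psi> x assume \<psi>: "\<psi> \<in> mod_hom A (P i) Pk" and f\<psi>: "\<forall>x\<in>carrier (P i). fL (\<psi> x) = \<zero>\<^bsub>into.N\<^esub>"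
    and x: "x \<in> carrier (P i)"
  have o: "obj ?T (- 1) = pair_mod Pk into.Z" "obj ?T (- 1 + 1) = pair_mod into.N into.B"
    unfolding T_minus_eq pair_cpx_simps into.obj_D by simp_all
  have d: "diff ?T (- 1) (y, z) = (fL y, \<zero>\<^bsub>into.Z\<^esub>)" "diff ?T (- 1 - 1) (y, z) = (\<zero>\<^bsub>Pk\<^esub>, \<zero>\<^bsub>into.Z\<^esub>)" for y z
    by (simp_all only: T_minus_eq pair_cpx_simps into.diff_D) simp_all
  have "(\<psi> x, \<zero>\<^bsub>into.Z\<^esub>) \<in> cocycles ?T (- 1)"
    unfolding cocycles_def mem_Collect_eq o pair_mod_simps d(1)
    using f\<psi> x mod_hom_closed[OF \<psi> x] into.carrier_Z by (simp del: dsum_mod_simps(1))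
  then have "(\<psi> x, \<zero>\<^bsub>into.Z\<^esub>) \<in> coboundaries ?T (- 1)"
    using iso_to_module_acyclic[OF projective_complex_bounded[OF projective_T_minus] assms(1), of "- 1"] by auto
  then obtain w where "(\<psi> x, \<zero>\<^bsub>into.Z\<^esub>) = diff ?T (- 1 - 1) w" unfolding coboundaries_def by blast
  then show "\<psi> x = \<zero>\<^bsub>Pk\<^esub>" by (cases w) (simp only: d(2) prod.inject)
qed

lemma cpx_iso_shift:
  assumes i: "cpx_iso A X Y f g" and X: "module_complex A X" and Y: "module_complex A Y"
  shows "cpx_iso A (shift r X) (shift r Y) (\<lambda>n. f (n + r)) (\<lambda>n. g (n + r))"
  using i chain_map_shift[OF _ X Y] chain_map_shift[OF _ Y X] unfolding cpx_iso_def by simp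

text \<open>By \<open>fL_injective\<close> the cohomology sits in degree 0, so
  \<open>quasi_iso_cokernel\<close> yields the module. A \<open>tilting_module\<close> asks for a
  tilting complex over the small type, so a small copy T' is taken first and the tilting property is
  carried over to it.\<close>

lemma minus_module_if:
  assumes c: "\<And>i. i \<in> verts Q \<Longrightarrow> kernel_orthogonal i"
  shows "iso_to_tilting_module A (T_minus Q I k)"
proof -
  let ?T = "T_minus Q I k"
  note pT = projective_T_minus
  note bT = projective_complex_bounded[OF pT] and mT = proj_module_complex[OF pT]
  have tT: "tilting_complex A ?T" unfolding tilting_minus_iff using c by blast
  obtain T' :: "('k, (('v, 'a) qpath \<Rightarrow> 'k) set) small_cpx" and \<phi> \<psi>
    where bT': "bounded_complex A T'" and i': "cpx_iso A T' ?T \<phi> \<psi>" using small_copy[OF bT] by blast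
  note i = cpx_iso_sym[OF i']
  note pT' = projective_complex_iso[OF pT bT' i]
  note mT' = proj_module_complex[OF pT']
  have ch: "chain_map A T' ?T \<phi>" "chain_map A ?T T' \<psi>"
    and inv: "\<And>n x. x \<in> carrier (obj T' n) \<Longrightarrow> \<psi> n (\<phi> n x) = x" using i' by (auto simp: cpx_iso_def)
  note s = chain_map_simps[OF ch(1) mT' mT] chain_map_simps[OF ch(2) mT mT']
  have "Db_hom_vanishes A T' (shift r T')" if r: "r \<noteq> 0" for r
  proof (rule Db_hom_vanishes_iso[OF pT pT' _ _ i cpx_iso_shift[OF i mT mT']])
    show "bounded_complex A (shift r ?T)" "bounded_complex A (shift r T')"
      by (rule bounded_complex_shift[OF bT], rule bounded_complex_shift[OF bT'])
    show "Db_hom_vanishes A ?T (shift r ?T)" using tT r unfolding tilting_complex_def by blast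
  qed
  moreover have "\<forall>X. perfect_complex A X \<longrightarrow> generated A T' X"
    using perfect_generated[OF pT' Gen_minus[OF pT' i]] by blast
  ultimately have tT': "tilting_complex A T'" using pT' unfolding tilting_complex_def by blast
  \<comment> \<open>Injectivity of the comparison map allows vanishing in T' to be checked in the
    original complex.\<close>
  have zero: "x = \<zero>\<^bsub>obj T' n\<^esub>" if "x \<in> carrier (obj T' n)" "\<phi> n x = \<zero>\<^bsub>obj ?T n\<^esub>" for n x
    using inv[OF that(1)] s(8)[of n] that(2) by simp
  have o: "obj ?T (- 1) = pair_mod Pk into.Z" "obj ?T 0 = pair_mod into.N into.B"
    unfolding T_minus_eq pair_cpx_simps into.obj_D by simp_all
  have d: "diff ?T (- 1) (y, z) = (fL y, \<zero>\<^bsub>into.Z\<^esub>)" for y z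
    by (simp only: T_minus_eq pair_cpx_simps into.diff_D) simp
  have "\<exists>(M :: ('k, (('v, 'a) qpath \<Rightarrow> 'k) set) small_module) q. fd_module A M \<and> quasi_iso A T' (stalk M) q"
  proof (rule quasi_iso_cokernel[OF bT'])
    fix n :: int assume n: "n \<noteq> - 1" "n \<noteq> 0"
    have T0: "carrier (obj ?T n) = {\<zero>\<^bsub>obj ?T n\<^esub>}"
      using n unfolding T_minus_eq pair_cpx_simps into.obj_D pair_mod_simps
      by (simp add: into.carrier_Z del: dsum_mod_simps)
    have "x = \<zero>\<^bsub>obj T' n\<^esub>" if x: "x \<in> carrier (obj T' n)" for x
      by (rule zero[OF x]) (use s(1)[OF x] T0 in simp)
    then show "carrier (obj T' n) = {\<zero>\<^bsub>obj T' n\<^esub>}"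
      using ag_closed(2)[OF module_complex_ag[OF mT']] by blast
  next
    fix x assume x: "x \<in> carrier (obj T' (- 1))" and dx: "diff T' (- 1) x = \<zero>\<^bsub>obj T' 0\<^esub>"
    have \<phi>x: "\<phi> (- 1) x \<in> carrier (pair_mod Pk into.Z)" using s(1)[OF x] o by simp
    obtain y z where yz: "\<phi> (- 1) x = (y, z)" by (cases "\<phi> (- 1) x")
    have y: "y \<in> carrier Pk" and z: "z = \<zero>\<^bsub>into.Z\<^esub>"
      using \<phi>x unfolding yz pair_mod_simps by (blast, intro into.Z_eq, blast)
    have "diff ?T (- 1) (\<phi> (- 1) x) = \<zero>\<^bsub>obj ?T 0\<^esub>"
      using s(5)[OF x, of 0] dx s(3)[of 0] by simp
    then have fy: "fL y = \<zero>\<^bsub>into.N\<^esub>" unfolding yz d o pair_mod_simps prod.inject by (rule conjunct1)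
    have "y = \<zero>\<^bsub>Pk\<^esub>" by (rule fL_injective[OF c y fy])
    then show "x = \<zero>\<^bsub>obj T' (- 1)\<^esub>" by (intro zero[OF x]) (simp only: yz z o pair_mod_simps)
  qed
  then obtain M :: "('k, (('v, 'a) qpath \<Rightarrow> 'k) set) small_module" and q
    where M: "fd_module A M" and q: "quasi_iso A T' (stalk M) q" by blast
  note bS = bounded_complex_stalk[OF M]
  note mS = bounded_complex_module_complex[OF bS]
  have "Db_isomorphic A (stalk M) T'" by (rule Db_isomorphic_sym[OF Db_isomorphic_quasi_iso[OF pT' bS q]])
  then have "tilting_module A M" unfolding tilting_module_def using M tT' by blast
  moreover have "Db_isomorphic A ?T (stalk M)"
    by (rule Db_isomorphic_quasi_iso[OF pT bS quasi_iso_comp[OF mT mT' mS cpx_iso_quasi_iso[OF mT mT' i] q]])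
  ultimately show ?thesis unfolding iso_to_tilting_module_def by blast
qed

text \<open>
  The top of $P_k$ survives in $H^1(T^+_k)$: the image of $g$ lies in the radical.
\<close>

lemma plus_not_module: "\<not> iso_to_tilting_module A (T_plus Q I k)"
proof
  assume i: "iso_to_tilting_module A (T_plus Q I k)"
  let ?T = "T_plus Q I k"
  have o: "obj ?T 1 = pair_mod Pk into.Z" "obj ?T (1 + 1) = pair_mod (zero_sub Pk) into.Z"
    "obj ?T (1 - 1) = pair_mod out.N into.B"
    unfolding T_plus_eq pair_cpx_simps into.obj_D by simp_all
  have d: "diff ?T 1 (y, z) = (\<zero>\<^bsub>Pk\<^esub>, \<zero>\<^bsub>into.Z\<^esub>)" "diff ?T (1 - 1) (y, z) = (gR y, \<zero>\<^bsub>into.Z\<^esub>)" for y z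
    by (simp_all only: T_plus_eq pair_cpx_simps into.diff_D) simp_all
  \<comment> \<open>The term in degree 1 consists of cocycles, and the idempotent at k is the one
    whose class is nonzero.\<close>
  have "kap (ve k) \<in> carrier Pk" by (rule mod_hom_closed[OF kap_hom ve_in_P[OF k]])
  then have "(kap (ve k), \<zero>\<^bsub>into.Z\<^esub>) \<in> cocycles ?T 1"
    unfolding cocycles_def mem_Collect_eq o pair_mod_simps d(1) zero_sub_simps
    using into.carrier_Z by (simp del: dsum_mod_simps(1))
  then have "(kap (ve k), \<zero>\<^bsub>into.Z\<^esub>) \<in> coboundaries ?T 1"
    using iso_to_module_acyclic[OF projective_complex_bounded[OF projective_T_plus] i, of 1] by auto
  then obtain n b where n: "n \<in> carrier out.N" and "(kap (ve k), \<zero>\<^bsub>into.Z\<^esub>) = diff ?T (1 - 1) (n, b)"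
    unfolding coboundaries_def o pair_mod_simps by blast
  then have "kap (ve k) = gR n" by (simp only: d(2) prod.inject)
  from fun_cong[OF this, of None] have "ve k = (\<Oplus>\<^bsub>A\<^esub>s\<in>Sout. ar (the s) \<otimes>\<^bsub>A\<^esub> n s)" by (simp add: gR_def)
  also have "\<dots> \<in> J 1"
  proof (rule J_finsum[OF _ finite_arrows(2)])
    fix s assume s: "s \<in> Sout"
    then have h: "head Q (the s) \<in> verts Q" and a: "the s \<in> arcs Q" by auto
    have "n s \<in> carrier (P (head Q (the s)))" using n s by (auto simp: PiE_mem)
    then have "n s \<in> carrier A" by (simp add: P_elem[OF h])
    then show "ar (the s) \<otimes>\<^bsub>A\<^esub> n s \<in> J 1" by (rule J_right[OF ar_J[OF a]])
  qed
  finally show False using e_notin_J[OF k] by blast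
qed

end

theorem proposition2p1:
  fixes Q :: "('v, 'a) pre_digraph"
    and I :: "(('v, 'a) qpath \<Rightarrow> 'k::field) set"
    and k :: 'v
  assumes "fin_digraph Q"
    and "admissible_ideal Q I"
    and "k \<in> verts Q"
    and "\<not> (\<exists>\<alpha>\<in>arcs Q. tail Q \<alpha> = k \<and> head Q \<alpha> = k)"
  shows
    "(tilting_complex (quiver_algebra Q I) (T_minus Q I k) \<longleftrightarrow>
          (\<forall>i\<in>verts Q. i \<noteq> k \<longrightarrow>
             Db_hom_vanishes (quiver_algebra Q I) (stalk (proj_at Q I i)) (shift (- 1) (L_complex Q I k)))) \<and>
     (iso_to_tilting_module (quiver_algebra Q I) (T_minus Q I k) \<longleftrightarrow>
          (\<forall>i\<in>verts Q.
             Db_hom_vanishes (quiver_algebra Q I) (stalk (proj_at Q I i)) (shift (- 1) (L_complex Q I k)))) \<and>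
     (tilting_complex (quiver_algebra Q I) (T_plus Q I k) \<longleftrightarrow>
          (\<forall>i\<in>verts Q. i \<noteq> k \<longrightarrow>
             Db_hom_vanishes (quiver_algebra Q I) (shift 1 (R_complex Q I k)) (stalk (proj_at Q I i)))) \<and>
     (\<not> iso_to_tilting_module (quiver_algebra Q I) (T_plus Q I k))"
proof -
  interpret fin_digraph Q by (rule assms(1))
  interpret mutation_vertex Q I k
    by unfold_locales (use assms in auto)
  have eq: "(\<forall>i\<in>verts Q - {k}. C i) \<longleftrightarrow> (\<forall>i\<in>verts Q. i \<noteq> k \<longrightarrow> C i)" for C by blast
  show ?thesis
  proof (intro conjI)
    show "tilting_complex A (T_minus Q I k) \<longleftrightarrow> (\<forall>i\<in>verts Q. i \<noteq> k \<longrightarrow>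
        Db_hom_vanishes A (stalk (proj_at Q I i)) (shift (- 1) (L_complex Q I k)))"
      unfolding tilting_minus_iff eq by (rule ball_cong[OF refl]) (simp only: vanishes_L_iff)
    show "iso_to_tilting_module A (T_minus Q I k) \<longleftrightarrow> (\<forall>i\<in>verts Q.
        Db_hom_vanishes A (stalk (proj_at Q I i)) (shift (- 1) (L_complex Q I k)))"
    proof
      assume "iso_to_tilting_module A (T_minus Q I k)"
      then show "\<forall>i\<in>verts Q. Db_hom_vanishes A (stalk (proj_at Q I i)) (shift (- 1) (L_complex Q I k))"
        using vanishes_L_iff minus_module_only_if by blast
    next
      assume v: "\<forall>i\<in>verts Q. Db_hom_vanishes A (stalk (proj_at Q I i)) (shift (- 1) (L_complex Q I k))"
      have "kernel_orthogonal i" if "i \<in> verts Q" for i using v vanishes_L_iff that by blast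
      then show "iso_to_tilting_module A (T_minus Q I k)" by (rule minus_module_if)
    qed
    show "tilting_complex A (T_plus Q I k) \<longleftrightarrow> (\<forall>i\<in>verts Q. i \<noteq> k \<longrightarrow>
        Db_hom_vanishes A (shift 1 (R_complex Q I k)) (stalk (proj_at Q I i)))"
      unfolding tilting_plus_iff eq by (rule ball_cong[OF refl]) (simp only: vanishes_R_iff)
    show "\<not> iso_to_tilting_module A (T_plus Q I k)" by (rule plus_not_module)
  qed
qed

end
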